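(* Let $\mathbf{k}$ be an algebraically closed field of characteristic $0$, let $\mathrm{Alg}_2^{fd}$ be the fully dualisable part of the Morita bicategory of finite-dimensional $\mathbf{k}$-algebras, and let $(-)^\circ:(\mathrm{Alg}_2^{fd})^{co}\to \mathrm{Alg}_2^{fd}$, $\mathfrak{y}$ and $\zeta$ be the bifunctor, the pseudonatural adjoint equivalence and the invertible modification described in the context (so that $A^\circ=A^{op}$, $({}_AM_B)^\circ={}_{A^{op}}\mathrm{hom}_B(M,B)_{B^{op}}$, $f^\circ=f^*$). Then the bifunctor $(-)^\circ$ together with $\mathfrak{y}$ and $\zeta$ defines a weak duality involution on $\mathrm{Alg}_2^{fd}$.
   Context: **The Morita bicategory.** $\mathrm{Alg}_2$ is the bicategory whose objects are finite-dimensional (unital, associative) $\mathbf{k}$-algebras, whose 1-morphisms $A\to B$ are finite-dimensional $(A,B)$-bimodules ${}_AM_B$, and whose 2-morphisms are bimodule maps. The composite of ${}_AM_B$ and ${}_BN_C$ is $N\circ M:={}_A(M\otimes_BN)_C$; horizontal composition of 2-morphisms is $g\bullet^h f=f\otimes_B g$, vertical composition is composition of maps; the identity 1-morphism $1_A$ is ${}_AA_A$; associators and unitors are the canonical isomorphisms of tensor products. With respect to the tensor product over $\mathbf{k}$, $\mathrm{Alg}_2$ is a symmetric monoidal bicategory. $\mathrm{Alg}_2^{fd}$ denotes its maximal fully dualisable sub-bicategory (all objects have duals, all 1-morphisms have left and right adjoints); it is the full sub-bicategory on the semisimple finite-dimensional algebras. In it all 1-morphisms are projective as left and as right modules. **Conventions.**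 $\mathrm{hom}_B(M,N)$ denotes right $B$-module maps. For ${}_AM_B$, ${}_CN_B$ it is a $(C,A)$-bimodule via $(cf)(x)=c f(x)$, $(fa)(x)=f(ax)$. $A^{op}$ is the opposite algebra. A left (right) $A$-module is tacitly regarded as a right (left) $A^{op}$-module, and an $(A,B)$-bimodule as a $(B^{op},A^{op})$-bimodule. **$\mathcal A^{co}$.** For a bicategory $\mathcal A$, $\mathcal A^{co}$ has the same objects and 1-morphisms, with 2-morphisms reversed. A pseudofunctor $F:\mathcal A\to\mathcal B$ induces $F^{co}:\mathcal A^{co}\to\mathcal B^{co}$. **Weak duality involution.** A weak duality involution on a bicategory $\mathcal A$ consists of 1. a pseudofunctor $(-)^\circ:\mathcal A^{co}\to\mathcal A$; 2. a pseudonatural adjoint equivalence $\mathfrak y: 1_{\mathcal A}\Rightarrow (-)^\circ\circ((-)^\circ)^{co}$, with components $\mathfrak y_x:x\to x^{\circ\circ}$ and, for each $M:x\to y$, invertible 2-morphisms $\mathfrak y_M:\mathfrak y_y\circ M\Rightarrow M^{\circ\circ}\circ\mathfrak y_x$; 3. an invertible modification $\zeta$ with components $\zeta_x:\mathfrak y_{x^\circ}\xrightarrow{\simeq}(\mathfrak y_x)^\circ$, such that for every object $x$ the following two 2-morphisms $\mathfrak y_{x^{\circ\circ}}\circ\mathfrak y_x\Rightarrow(\mathfrak y_{x^\circ})^\circ\circ\mathfrak y_x$ are equal: the whiskering of $\zeta_{x^\circ}:\mathfrak y_{x^{\circ\circ}}\Rightarrow(\mathfrak y_{x^\circ})^\circ$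 with $\mathfrak y_x$; and the vertical composite $$\mathfrak y_{x^{\circ\circ}}\circ\mathfrak y_x\xRightarrow{\ \mathfrak y_{(\mathfrak y_x)}\ }(\mathfrak y_x)^{\circ\circ}\circ\mathfrak y_x\xRightarrow{\ (\zeta_x)^\circ\ \text{whiskered with } \mathfrak y_x\ }(\mathfrak y_{x^\circ})^\circ\circ\mathfrak y_x .$$ **The data on $\mathrm{Alg}_2^{fd}$.** *The bifunctor $(-)^\circ$.* $A^\circ:=A^{op}$. $({}_AM_B)^\circ:={}_{A^{op}}\mathrm{hom}_B(M,B)_{B^{op}}$ (the $(B,A)$-bimodule $\mathrm{hom}_B(M,B)$ viewed as an $(A^{op},B^{op})$-bimodule). $f^\circ:=f^*$ is precomposition with $f$. The coherence isomorphism $(M\otimes_BN)^\circ\Rightarrow M^\circ\otimes_{B^{op}}N^\circ$ for ${}_AM_B,{}_BN_C$ is the composite $$\mathrm{hom}_C(M\otimes_BN,C)\simeq\mathrm{hom}_B(M,\mathrm{hom}_C(N,C))\simeq\mathrm{hom}_C(N,C)\otimes_B\mathrm{hom}_B(M,B)\simeq M^\circ\otimes_{B^{op}}N^\circ$$ of the canonical isomorphisms (hom-tensor adjunction, the projective evaluation isomorphism, and the flip); its inverse is $g\otimes h\mapsto(m\otimes n\mapsto h(g(m)n))$. The coherence isomorphism $1_A^\circ=\mathrm{hom}_A(A,A)\Rightarrow A^{op}=1_{A^\circ}$ is $f\mapsto f(1)$. *The transformation $\mathfrak y$.* $\mathfrak y_A:={}_AA_A:A\to A^{\circ\circ}=A$.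 For ${}_AM_B$, $\mathfrak y_M$ is the composite of canonical isomorphisms $$M\otimes_BB\simeq M\xrightarrow{\psi_M}M^{\circ\circ}\simeq A\otimes_AM^{\circ\circ},$$ where $M^{\circ\circ}=\mathrm{hom}_{B^{op}}(\mathrm{hom}_B(M,B),B^{op})$ and $\psi_M(p)(g)=g(p)$. A pseudonatural transformation whose 1-cell components are equivalences and whose 2-cell components are invertible is completed to a pseudonatural adjoint equivalence. *The modification $\zeta$.* $\zeta_A:\mathfrak y_{A^\circ}=A^{op}\to\mathrm{hom}_A(A,A)=(\mathfrak y_A)^\circ$ is the inverse of $f\mapsto f(1)$, i.e. $\zeta_A(x)=(a\mapsto xa)$ with product taken in $A$. *)

theory Defs
  imports "HOL-Algebra.Algebra"
begin

section \<open>Bicategories\<close>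

record ('o, 'm, 'c) bicat =
  Obj :: "'o set"
  Arr :: "'m set"
  Cell :: "'c set"
  src :: "'m \<Rightarrow> 'o"
  trg :: "'m \<Rightarrow> 'o"
  vdom :: "'c \<Rightarrow> 'm"
  vcod :: "'c \<Rightarrow> 'm"
  id1 :: "'o \<Rightarrow> 'm"
  comp1 :: "'m \<Rightarrow> 'm \<Rightarrow> 'm" (infixr \<open>\<circledcirc>\<index>\<close> 75)
  id2 :: "'m \<Rightarrow> 'c"
  vcomp :: "'c \<Rightarrow> 'c \<Rightarrow> 'c" (infixr \<open>\<bullet>\<index>\<close> 65)
  hcomp :: "'c \<Rightarrow> 'c \<Rightarrow> 'c" (infixr \<open>\<star>\<index>\<close> 70)
  assoc :: "'m \<Rightarrow> 'm \<Rightarrow> 'm \<Rightarrow> 'c"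
  lunit :: "'m \<Rightarrow> 'c"
  runit :: "'m \<Rightarrow> 'c"

definition Hom :: "('o, 'm, 'c) bicat \<Rightarrow> 'o \<Rightarrow> 'o \<Rightarrow> 'm set" where
  "Hom B x y = {f \<in> Arr B. src B f = x \<and> trg B f = y}"

definition Cells :: "('o, 'm, 'c) bicat \<Rightarrow> 'm \<Rightarrow> 'm \<Rightarrow> 'c set" where
  "Cells B f g = {\<sigma> \<in> Cell B. vdom B \<sigma> = f \<and> vcod B \<sigma> = g}"

definition inverse2 :: "('o, 'm, 'c) bicat \<Rightarrow> 'c \<Rightarrow> 'c \<Rightarrow> bool" where
  "inverse2 B \<sigma> \<tau> \<longleftrightarrow>
     \<tau> \<in> Cells B (vcod B \<sigma>) (vdom B \<sigma>) \<and>
     \<tau> \<bullet>\<^bsub>B\<^esub> \<sigma> = id2 B (vdom B \<sigma>) \<and> \<sigma> \<bullet>\<^bsub>B\<^esub> \<tau> = id2 B (vcod B \<sigma>)"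

definition Isos :: "('o, 'm, 'c) bicat \<Rightarrow> 'm \<Rightarrow> 'm \<Rightarrow> 'c set" where
  "Isos B f g = {\<sigma> \<in> Cells B f g. \<exists>\<tau>. inverse2 B \<sigma> \<tau>}"

definition inv2 :: "('o, 'm, 'c) bicat \<Rightarrow> 'c \<Rightarrow> 'c" where
  "inv2 B \<sigma> = (THE \<tau>. inverse2 B \<sigma> \<tau>)"

text \<open>
  Composites are written in the order of maps: \<open>g \<circledcirc> f\<close> is first \<open>f\<close>, then \<open>g\<close>.
  The structure cells are \<open>assoc h g f : (h \<circledcirc> g) \<circledcirc> f \<Rightarrow> h \<circledcirc> (g \<circledcirc> f)\<close>,
  \<open>lunit f : 1 \<circledcirc> f \<Rightarrow> f\<close> and \<open>runit f : f \<circledcirc> 1 \<Rightarrow> f\<close>.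
\<close>

locale bicategory =
  fixes B :: "('o, 'm, 'c) bicat" (structure)
  assumes src_obj: "f \<in> Arr B \<Longrightarrow> src B f \<in> Obj B"
    and trg_obj: "f \<in> Arr B \<Longrightarrow> trg B f \<in> Obj B"
    and cell_boundary: "\<sigma> \<in> Cell B \<Longrightarrow>
      vdom B \<sigma> \<in> Arr B \<and> vcod B \<sigma> \<in> Hom B (src B (vdom B \<sigma>)) (trg B (vdom B \<sigma>))"
    and id1_hom: "x \<in> Obj B \<Longrightarrow> id1 B x \<in> Hom B x x"
    and comp1_hom: "\<lbrakk>f \<in> Hom B x y; g \<in> Hom B y z\<rbrakk> \<Longrightarrow> g \<circledcirc> f \<in> Hom B x z"
    and id2_cell: "f \<in> Arr B \<Longrightarrow> id2 B f \<in> Cells B f f"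
    and vcomp_cell: "\<lbrakk>\<sigma> \<in> Cells B f g; \<tau> \<in> Cells B g h\<rbrakk> \<Longrightarrow> \<tau> \<bullet> \<sigma> \<in> Cells B f h"
    and vcomp_assoc: "\<lbrakk>\<sigma> \<in> Cells B f g; \<tau> \<in> Cells B g h; \<upsilon> \<in> Cells B h k\<rbrakk> \<Longrightarrow>
      (\<upsilon> \<bullet> \<tau>) \<bullet> \<sigma> = \<upsilon> \<bullet> (\<tau> \<bullet> \<sigma>)"
    and vcomp_id_right: "\<sigma> \<in> Cells B f g \<Longrightarrow> \<sigma> \<bullet> id2 B f = \<sigma>"
    and vcomp_id_left: "\<sigma> \<in> Cells B f g \<Longrightarrow> id2 B g \<bullet> \<sigma> = \<sigma>"
    and hcomp_cell: "\<lbrakk>\<sigma> \<in> Cells B f f'; \<tau> \<in> Cells B g g'; trg B f = src B g\<rbrakk> \<Longrightarrow>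
      \<tau> \<star> \<sigma> \<in> Cells B (g \<circledcirc> f) (g' \<circledcirc> f')"
    and hcomp_id: "\<lbrakk>f \<in> Hom B x y; g \<in> Hom B y z\<rbrakk> \<Longrightarrow> id2 B g \<star> id2 B f = id2 B (g \<circledcirc> f)"
    and interchange:
      "\<lbrakk>\<sigma> \<in> Cells B f f'; \<sigma>' \<in> Cells B f' f''; \<tau> \<in> Cells B g g'; \<tau>' \<in> Cells B g' g'';
        trg B f = src B g\<rbrakk> \<Longrightarrow> (\<tau>' \<bullet> \<tau>) \<star> (\<sigma>' \<bullet> \<sigma>) = (\<tau>' \<star> \<sigma>') \<bullet> (\<tau> \<star> \<sigma>)"
    and assoc_iso: "\<lbrakk>f \<in> Hom B w x; g \<in> Hom B x y; h \<in> Hom B y z\<rbrakk> \<Longrightarrow>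
      assoc B h g f \<in> Isos B ((h \<circledcirc> g) \<circledcirc> f) (h \<circledcirc> (g \<circledcirc> f))"
    and assoc_natural:
      "\<lbrakk>\<sigma> \<in> Cells B f f'; \<tau> \<in> Cells B g g'; \<upsilon> \<in> Cells B h h';
        trg B f = src B g; trg B g = src B h\<rbrakk> \<Longrightarrow>
        assoc B h' g' f' \<bullet> ((\<upsilon> \<star> \<tau>) \<star> \<sigma>) = (\<upsilon> \<star> (\<tau> \<star> \<sigma>)) \<bullet> assoc B h g f"
    and lunit_iso: "f \<in> Hom B x y \<Longrightarrow> lunit B f \<in> Isos B (id1 B y \<circledcirc> f) f"
    and lunit_natural: "\<lbrakk>\<sigma> \<in> Cells B f f'; f \<in> Hom B x y\<rbrakk> \<Longrightarrow>
      lunit B f' \<bullet> (id2 B (id1 B y) \<star> \<sigma>) = \<sigma> \<bullet> lunit B f"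
    and runit_iso: "f \<in> Hom B x y \<Longrightarrow> runit B f \<in> Isos B (f \<circledcirc> id1 B x) f"
    and runit_natural: "\<lbrakk>\<sigma> \<in> Cells B f f'; f \<in> Hom B x y\<rbrakk> \<Longrightarrow>
      runit B f' \<bullet> (\<sigma> \<star> id2 B (id1 B x)) = \<sigma> \<bullet> runit B f"
    and pentagon:
      "\<lbrakk>f \<in> Hom B v w; g \<in> Hom B w x; h \<in> Hom B x y; k \<in> Hom B y z\<rbrakk> \<Longrightarrow>
        (id2 B k \<star> assoc B h g f) \<bullet> assoc B k (h \<circledcirc> g) f \<bullet> (assoc B k h g \<star> id2 B f)
          = assoc B k h (g \<circledcirc> f) \<bullet> assoc B (k \<circledcirc> h) g f"
    and triangle: "\<lbrakk>f \<in> Hom B x y; g \<in> Hom B y z\<rbrakk> \<Longrightarrow>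
      (id2 B g \<star> lunit B f) \<bullet> assoc B g (id1 B y) f = runit B g \<star> id2 B f"

definition co :: "('o, 'm, 'c) bicat \<Rightarrow> ('o, 'm, 'c) bicat" where
  "co B = B\<lparr>vdom := vcod B, vcod := vdom B,
     vcomp := (\<lambda>\<tau> \<sigma>. \<sigma> \<bullet>\<^bsub>B\<^esub> \<tau>),
     assoc := (\<lambda>h g f. inv2 B (assoc B h g f)),
     lunit := (\<lambda>f. inv2 B (lunit B f)),
     runit := (\<lambda>f. inv2 B (runit B f))\<rparr>"

definition full_subbicat :: "('o, 'm, 'c) bicat \<Rightarrow> 'o set \<Rightarrow> ('o, 'm, 'c) bicat" where
  "full_subbicat B S = B\<lparr>Obj := Obj B \<inter> S,
     Arr := {f \<in> Arr B. src B f \<in> S \<and> trg B f \<in> S},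
     Cell := {\<sigma> \<in> Cell B. src B (vdom B \<sigma>) \<in> S \<and> trg B (vdom B \<sigma>) \<in> S}\<rparr>"


section \<open>Pseudofunctors\<close>

text \<open>
  The invertible structure cells are oriented as
  \<open>pf_comp F g f : F (g \<circledcirc> f) \<Rightarrow> F g \<circledcirc> F f\<close> and \<open>pf_unit F x : F 1 \<Rightarrow> 1\<close>.
\<close>

record ('o, 'm, 'c, 'p, 'n, 'd) psfun =
  pf_obj :: "'o \<Rightarrow> 'p"
  pf_arr :: "'m \<Rightarrow> 'n"
  pf_cell :: "'c \<Rightarrow> 'd"
  pf_comp :: "'m \<Rightarrow> 'm \<Rightarrow> 'd"
  pf_unit :: "'o \<Rightarrow> 'd"

locale pseudofunctor = A: bicategory A + B: bicategory B
  for A :: "('o, 'm, 'c) bicat" and B :: "('p, 'n, 'd) bicat"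
    and F :: "('o, 'm, 'c, 'p, 'n, 'd) psfun" +
  assumes obj: "x \<in> Obj A \<Longrightarrow> pf_obj F x \<in> Obj B"
    and arr: "f \<in> Hom A x y \<Longrightarrow> pf_arr F f \<in> Hom B (pf_obj F x) (pf_obj F y)"
    and cell: "\<sigma> \<in> Cells A f g \<Longrightarrow> pf_cell F \<sigma> \<in> Cells B (pf_arr F f) (pf_arr F g)"
    and cell_id: "f \<in> Arr A \<Longrightarrow> pf_cell F (id2 A f) = id2 B (pf_arr F f)"
    and cell_vcomp: "\<lbrakk>\<sigma> \<in> Cells A f g; \<tau> \<in> Cells A g h\<rbrakk> \<Longrightarrow>
      pf_cell F (\<tau> \<bullet>\<^bsub>A\<^esub> \<sigma>) = pf_cell F \<tau> \<bullet>\<^bsub>B\<^esub> pf_cell F \<sigma>"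
    and comp_iso: "\<lbrakk>f \<in> Hom A x y; g \<in> Hom A y z\<rbrakk> \<Longrightarrow>
      pf_comp F g f \<in> Isos B (pf_arr F (g \<circledcirc>\<^bsub>A\<^esub> f)) (pf_arr F g \<circledcirc>\<^bsub>B\<^esub> pf_arr F f)"
    and comp_natural:
      "\<lbrakk>\<sigma> \<in> Cells A f f'; \<tau> \<in> Cells A g g'; trg A f = src A g\<rbrakk> \<Longrightarrow>
        pf_comp F g' f' \<bullet>\<^bsub>B\<^esub> pf_cell F (\<tau> \<star>\<^bsub>A\<^esub> \<sigma>)
          = (pf_cell F \<tau> \<star>\<^bsub>B\<^esub> pf_cell F \<sigma>) \<bullet>\<^bsub>B\<^esub> pf_comp F g f"
    and unit_iso: "x \<in> Obj A \<Longrightarrow>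
      pf_unit F x \<in> Isos B (pf_arr F (id1 A x)) (id1 B (pf_obj F x))"
    and assoc_coherence:
      "\<lbrakk>f \<in> Hom A w x; g \<in> Hom A x y; h \<in> Hom A y z\<rbrakk> \<Longrightarrow>
        assoc B (pf_arr F h) (pf_arr F g) (pf_arr F f)
          \<bullet>\<^bsub>B\<^esub> (pf_comp F h g \<star>\<^bsub>B\<^esub> id2 B (pf_arr F f)) \<bullet>\<^bsub>B\<^esub> pf_comp F (h \<circledcirc>\<^bsub>A\<^esub> g) f
        = (id2 B (pf_arr F h) \<star>\<^bsub>B\<^esub> pf_comp F g f)
          \<bullet>\<^bsub>B\<^esub> pf_comp F h (g \<circledcirc>\<^bsub>A\<^esub> f) \<bullet>\<^bsub>B\<^esub> pf_cell F (assoc A h g f)"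
    and lunit_coherence: "f \<in> Hom A x y \<Longrightarrow>
      lunit B (pf_arr F f) \<bullet>\<^bsub>B\<^esub> (pf_unit F y \<star>\<^bsub>B\<^esub> id2 B (pf_arr F f))
        \<bullet>\<^bsub>B\<^esub> pf_comp F (id1 A y) f = pf_cell F (lunit A f)"
    and runit_coherence: "f \<in> Hom A x y \<Longrightarrow>
      runit B (pf_arr F f) \<bullet>\<^bsub>B\<^esub> (id2 B (pf_arr F f) \<star>\<^bsub>B\<^esub> pf_unit F x)
        \<bullet>\<^bsub>B\<^esub> pf_comp F f (id1 A x) = pf_cell F (runit A f)"

definition pf_Id :: "('o, 'm, 'c) bicat \<Rightarrow> ('o, 'm, 'c, 'o, 'm, 'c) psfun" where
  "pf_Id A = \<lparr>pf_obj = (\<lambda>x. x), pf_arr = (\<lambda>f. f), pf_cell = (\<lambda>\<sigma>. \<sigma>),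
     pf_comp = (\<lambda>g f. id2 A (g \<circledcirc>\<^bsub>A\<^esub> f)), pf_unit = (\<lambda>x. id2 A (id1 A x))\<rparr>"

text \<open>\<open>pf_Comp C G F\<close> is \<open>G \<circ> F\<close>, where \<open>C\<close> is the codomain of \<open>G\<close>.\<close>

definition pf_Comp ::
  "('q, 'l, 'e) bicat \<Rightarrow> ('p, 'n, 'd, 'q, 'l, 'e) psfun \<Rightarrow> ('o, 'm, 'c, 'p, 'n, 'd) psfun
    \<Rightarrow> ('o, 'm, 'c, 'q, 'l, 'e) psfun" where
  "pf_Comp C G F = \<lparr>
     pf_obj = (\<lambda>x. pf_obj G (pf_obj F x)),
     pf_arr = (\<lambda>f. pf_arr G (pf_arr F f)),
     pf_cell = (\<lambda>\<sigma>. pf_cell G (pf_cell F \<sigma>)),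
     pf_comp = (\<lambda>g f. pf_comp G (pf_arr F g) (pf_arr F f) \<bullet>\<^bsub>C\<^esub> pf_cell G (pf_comp F g f)),
     pf_unit = (\<lambda>x. pf_unit G (pf_obj F x) \<bullet>\<^bsub>C\<^esub> pf_cell G (pf_unit F x))\<rparr>"

text \<open>
  For \<open>F : A \<rightarrow> B\<close>, \<open>pf_co B F\<close> is \<open>F\<^sup>c\<^sup>o : co A \<rightarrow> co B\<close>; the structure cells are inverted
  because their direction is reversed in \<open>co B\<close>.
\<close>

definition pf_co :: "('p, 'n, 'd) bicat \<Rightarrow> ('o, 'm, 'c, 'p, 'n, 'd) psfun
    \<Rightarrow> ('o, 'm, 'c, 'p, 'n, 'd) psfun" where
  "pf_co B F = F\<lparr>pf_comp := (\<lambda>g f. inv2 B (pf_comp F g f)),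
     pf_unit := (\<lambda>x. inv2 B (pf_unit F x))\<rparr>"


section \<open>Pseudonatural transformations and modifications\<close>

text \<open>
  For \<open>\<alpha> : F \<Rightarrow> G\<close> the components are \<open>\<alpha>\<^sub>x : F x \<rightarrow> G x\<close> and, for \<open>f : x \<rightarrow> y\<close>,
  the invertible cells \<open>\<alpha>\<^sub>f : \<alpha>\<^sub>y \<circledcirc> F f \<Rightarrow> G f \<circledcirc> \<alpha>\<^sub>x\<close>.
\<close>

record ('o, 'm, 'n, 'd) pstrans =
  pt_obj :: "'o \<Rightarrow> 'n"
  pt_arr :: "'m \<Rightarrow> 'd"

locale pseudonatural =
  fixes A :: "('o, 'm, 'c) bicat" and B :: "('p, 'n, 'd) bicat"
    and F G :: "('o, 'm, 'c, 'p, 'n, 'd) psfun"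
    and \<alpha> :: "('o, 'm, 'n, 'd) pstrans"
  assumes obj: "x \<in> Obj A \<Longrightarrow> pt_obj \<alpha> x \<in> Hom B (pf_obj F x) (pf_obj G x)"
    and arr: "f \<in> Hom A x y \<Longrightarrow>
      pt_arr \<alpha> f \<in> Isos B (pt_obj \<alpha> y \<circledcirc>\<^bsub>B\<^esub> pf_arr F f) (pf_arr G f \<circledcirc>\<^bsub>B\<^esub> pt_obj \<alpha> x)"
    and natural: "\<lbrakk>\<sigma> \<in> Cells A f f'; f \<in> Hom A x y\<rbrakk> \<Longrightarrow>
      (pf_cell G \<sigma> \<star>\<^bsub>B\<^esub> id2 B (pt_obj \<alpha> x)) \<bullet>\<^bsub>B\<^esub> pt_arr \<alpha> f
        = pt_arr \<alpha> f' \<bullet>\<^bsub>B\<^esub> (id2 B (pt_obj \<alpha> y) \<star>\<^bsub>B\<^esub> pf_cell F \<sigma>)"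
    and comp_coherence: "\<lbrakk>f \<in> Hom A x y; g \<in> Hom A y z\<rbrakk> \<Longrightarrow>
      (pf_comp G g f \<star>\<^bsub>B\<^esub> id2 B (pt_obj \<alpha> x)) \<bullet>\<^bsub>B\<^esub> pt_arr \<alpha> (g \<circledcirc>\<^bsub>A\<^esub> f)
        = inv2 B (assoc B (pf_arr G g) (pf_arr G f) (pt_obj \<alpha> x))
          \<bullet>\<^bsub>B\<^esub> (id2 B (pf_arr G g) \<star>\<^bsub>B\<^esub> pt_arr \<alpha> f)
          \<bullet>\<^bsub>B\<^esub> assoc B (pf_arr G g) (pt_obj \<alpha> y) (pf_arr F f)
          \<bullet>\<^bsub>B\<^esub> (pt_arr \<alpha> g \<star>\<^bsub>B\<^esub> id2 B (pf_arr F f))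
          \<bullet>\<^bsub>B\<^esub> inv2 B (assoc B (pt_obj \<alpha> z) (pf_arr F g) (pf_arr F f))
          \<bullet>\<^bsub>B\<^esub> (id2 B (pt_obj \<alpha> z) \<star>\<^bsub>B\<^esub> pf_comp F g f)"
    and unit_coherence: "x \<in> Obj A \<Longrightarrow>
      (pf_unit G x \<star>\<^bsub>B\<^esub> id2 B (pt_obj \<alpha> x)) \<bullet>\<^bsub>B\<^esub> pt_arr \<alpha> (id1 A x)
        = inv2 B (lunit B (pt_obj \<alpha> x)) \<bullet>\<^bsub>B\<^esub> runit B (pt_obj \<alpha> x)
          \<bullet>\<^bsub>B\<^esub> (id2 B (pt_obj \<alpha> x) \<star>\<^bsub>B\<^esub> pf_unit F x)"

definition pt_Id :: "('p, 'n, 'd) bicat \<Rightarrow> ('o, 'm, 'c, 'p, 'n, 'd) psfun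
    \<Rightarrow> ('o, 'm, 'n, 'd) pstrans" where
  "pt_Id B F = \<lparr>pt_obj = (\<lambda>x. id1 B (pf_obj F x)),
     pt_arr = (\<lambda>f. inv2 B (runit B (pf_arr F f)) \<bullet>\<^bsub>B\<^esub> lunit B (pf_arr F f))\<rparr>"

text \<open>\<open>pt_Comp A B F G H \<beta> \<alpha>\<close> is the vertical composite of \<open>\<alpha> : F \<Rightarrow> G\<close> and \<open>\<beta> : G \<Rightarrow> H\<close>.\<close>

definition pt_Comp ::
  "('o, 'm, 'c) bicat \<Rightarrow> ('p, 'n, 'd) bicat
    \<Rightarrow> ('o, 'm, 'c, 'p, 'n, 'd) psfun \<Rightarrow> ('o, 'm, 'c, 'p, 'n, 'd) psfun
    \<Rightarrow> ('o, 'm, 'c, 'p, 'n, 'd) psfun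
    \<Rightarrow> ('o, 'm, 'n, 'd) pstrans \<Rightarrow> ('o, 'm, 'n, 'd) pstrans \<Rightarrow> ('o, 'm, 'n, 'd) pstrans" where
  "pt_Comp A B F G H \<beta> \<alpha> = \<lparr>
     pt_obj = (\<lambda>x. pt_obj \<beta> x \<circledcirc>\<^bsub>B\<^esub> pt_obj \<alpha> x),
     pt_arr = (\<lambda>f. let x = src A f; y = trg A f in
       assoc B (pf_arr H f) (pt_obj \<beta> x) (pt_obj \<alpha> x)
       \<bullet>\<^bsub>B\<^esub> (pt_arr \<beta> f \<star>\<^bsub>B\<^esub> id2 B (pt_obj \<alpha> x))
       \<bullet>\<^bsub>B\<^esub> inv2 B (assoc B (pt_obj \<beta> y) (pf_arr G f) (pt_obj \<alpha> x))
       \<bullet>\<^bsub>B\<^esub> (id2 B (pt_obj \<beta> y) \<star>\<^bsub>B\<^esub> pt_arr \<alpha> f)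
       \<bullet>\<^bsub>B\<^esub> assoc B (pt_obj \<beta> y) (pt_obj \<alpha> y) (pf_arr F f))\<rparr>"

text \<open>
  Whiskering: for \<open>F : A \<rightarrow> B\<close> and \<open>\<alpha> : G \<Rightarrow> H\<close> between pseudofunctors out of \<open>B\<close>,
  \<open>pt_pre \<alpha> F\<close> is \<open>\<alpha>F\<close>; for \<open>\<alpha> : F \<Rightarrow> G\<close> between pseudofunctors \<open>A \<rightarrow> B\<close> and \<open>H : B \<rightarrow> C\<close>,
  \<open>pt_post A C H F G \<alpha>\<close> is \<open>H\<alpha>\<close>.
\<close>

definition pt_pre :: "('p, 'n, 'l, 'e) pstrans \<Rightarrow> ('o, 'm, 'c, 'p, 'n, 'd) psfun
    \<Rightarrow> ('o, 'm, 'l, 'e) pstrans" where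
  "pt_pre \<alpha> F = \<lparr>pt_obj = (\<lambda>x. pt_obj \<alpha> (pf_obj F x)), pt_arr = (\<lambda>f. pt_arr \<alpha> (pf_arr F f))\<rparr>"

definition pt_post ::
  "('o, 'm, 'c) bicat \<Rightarrow> ('q, 'l, 'e) bicat \<Rightarrow> ('p, 'n, 'd, 'q, 'l, 'e) psfun
    \<Rightarrow> ('o, 'm, 'c, 'p, 'n, 'd) psfun \<Rightarrow> ('o, 'm, 'c, 'p, 'n, 'd) psfun
    \<Rightarrow> ('o, 'm, 'n, 'd) pstrans \<Rightarrow> ('o, 'm, 'l, 'e) pstrans" where
  "pt_post A C H F G \<alpha> = \<lparr>
     pt_obj = (\<lambda>x. pf_arr H (pt_obj \<alpha> x)),
     pt_arr = (\<lambda>f.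
       pf_comp H (pf_arr G f) (pt_obj \<alpha> (src A f))
       \<bullet>\<^bsub>C\<^esub> pf_cell H (pt_arr \<alpha> f)
       \<bullet>\<^bsub>C\<^esub> inv2 C (pf_comp H (pt_obj \<alpha> (trg A f)) (pf_arr F f)))\<rparr>"

text \<open>
  For \<open>\<alpha> : F \<Rightarrow> G\<close> into \<open>B\<close>, \<open>pt_co B \<alpha> : F\<^sup>c\<^sup>o \<Rightarrow> G\<^sup>c\<^sup>o\<close> has the same 1-cells; its 2-cells, read in
  \<open>co B\<close>, again go from \<open>\<alpha>\<^sub>y \<circledcirc> F f\<close> to \<open>G f \<circledcirc> \<alpha>\<^sub>x\<close> and are therefore the inverses in \<open>B\<close>.
\<close>

definition pt_co :: "('p, 'n, 'd) bicat \<Rightarrow> ('o, 'm, 'n, 'd) pstrans \<Rightarrow> ('o, 'm, 'n, 'd) pstrans"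
  where "pt_co B \<alpha> = \<alpha>\<lparr>pt_arr := (\<lambda>f. inv2 B (pt_arr \<alpha> f))\<rparr>"

locale invertible_modification =
  fixes A :: "('o, 'm, 'c) bicat" and B :: "('p, 'n, 'd) bicat"
    and F G :: "('o, 'm, 'c, 'p, 'n, 'd) psfun"
    and \<alpha> \<beta> :: "('o, 'm, 'n, 'd) pstrans"
    and \<mu> :: "'o \<Rightarrow> 'd"
  assumes component: "x \<in> Obj A \<Longrightarrow> \<mu> x \<in> Isos B (pt_obj \<alpha> x) (pt_obj \<beta> x)"
    and modification: "f \<in> Hom A x y \<Longrightarrow>
      (id2 B (pf_arr G f) \<star>\<^bsub>B\<^esub> \<mu> x) \<bullet>\<^bsub>B\<^esub> pt_arr \<alpha> f
        = pt_arr \<beta> f \<bullet>\<^bsub>B\<^esub> (\<mu> y \<star>\<^bsub>B\<^esub> id2 B (pf_arr F f))"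

text \<open>
  An adjoint equivalence in the bicategory of pseudofunctors \<open>A \<rightarrow> B\<close>:
  \<open>\<alpha> : F \<Rightarrow> G\<close> with right adjoint \<open>\<beta> : G \<Rightarrow> F\<close>, invertible unit \<open>\<eta> : 1 \<rightarrow> \<beta>\<alpha>\<close> and invertible
  counit \<open>\<epsilon> : \<alpha>\<beta> \<rightarrow> 1\<close>; the triangle identities between modifications are componentwise.
\<close>

locale pseudonatural_adjoint_equivalence =
  fixes A :: "('o, 'm, 'c) bicat" and B :: "('p, 'n, 'd) bicat"
    and F G :: "('o, 'm, 'c, 'p, 'n, 'd) psfun"
    and \<alpha> \<beta> :: "('o, 'm, 'n, 'd) pstrans"
    and \<eta> \<epsilon> :: "'o \<Rightarrow> 'd"
  assumes forward: "pseudonatural A B F G \<alpha>"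
    and backward: "pseudonatural A B G F \<beta>"
    and unit: "invertible_modification A B F F (pt_Id B F) (pt_Comp A B F G F \<beta> \<alpha>) \<eta>"
    and counit: "invertible_modification A B G G (pt_Comp A B G F G \<alpha> \<beta>) (pt_Id B G) \<epsilon>"
    and triangle_forward: "x \<in> Obj A \<Longrightarrow>
      lunit B (pt_obj \<alpha> x) \<bullet>\<^bsub>B\<^esub> (\<epsilon> x \<star>\<^bsub>B\<^esub> id2 B (pt_obj \<alpha> x))
        \<bullet>\<^bsub>B\<^esub> inv2 B (assoc B (pt_obj \<alpha> x) (pt_obj \<beta> x) (pt_obj \<alpha> x))
        \<bullet>\<^bsub>B\<^esub> (id2 B (pt_obj \<alpha> x) \<star>\<^bsub>B\<^esub> \<eta> x)
      = runit B (pt_obj \<alpha> x)"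
    and triangle_backward: "x \<in> Obj A \<Longrightarrow>
      runit B (pt_obj \<beta> x) \<bullet>\<^bsub>B\<^esub> (id2 B (pt_obj \<beta> x) \<star>\<^bsub>B\<^esub> \<epsilon> x)
        \<bullet>\<^bsub>B\<^esub> assoc B (pt_obj \<beta> x) (pt_obj \<alpha> x) (pt_obj \<beta> x)
        \<bullet>\<^bsub>B\<^esub> (\<eta> x \<star>\<^bsub>B\<^esub> id2 B (pt_obj \<beta> x))
      = lunit B (pt_obj \<beta> x)"


section \<open>Weak duality involutions\<close>

text \<open>
  \<open>D\<close> is \<open>(-)\<degree>\<close>, the adjoint equivalence is \<open>(y, y', \<eta>, \<epsilon>)\<close> with underlying transformation \<open>y\<close>.
  The modification \<open>\<zeta>\<close> goes from \<open>yD\<close> to \<open>Dy\<^sup>c\<^sup>o\<close>, both being transformations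
  \<open>D \<Rightarrow> D \<circ> D\<^sup>c\<^sup>o \<circ> D\<close> of pseudofunctors \<open>co A \<rightarrow> A\<close>.
\<close>

locale weak_duality_involution =
  fixes A :: "('o, 'm, 'c) bicat" (structure)
    and D :: "('o, 'm, 'c, 'o, 'm, 'c) psfun"
    and y y' :: "('o, 'm, 'm, 'c) pstrans"
    and \<eta> \<epsilon> \<zeta> :: "'o \<Rightarrow> 'c"
  assumes bicategory: "bicategory A"
    and pseudofunctor: "pseudofunctor (co A) A D"
    and adjoint_equivalence:
      "pseudonatural_adjoint_equivalence A A (pf_Id A) (pf_Comp A D (pf_co A D)) y y' \<eta> \<epsilon>"
    and modification:
      "invertible_modification (co A) A D (pf_Comp A (pf_Comp A D (pf_co A D)) D)
         (pt_pre y D)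
         (pt_post (co A) A D (pf_Id (co A)) (pf_Comp (co A) (pf_co A D) D) (pt_co A y))
         \<zeta>"
    and coherence: "x \<in> Obj A \<Longrightarrow>
      \<zeta> (pf_obj D x) \<star> id2 A (pt_obj y x)
        = (pf_cell D (\<zeta> x) \<star> id2 A (pt_obj y x)) \<bullet> pt_arr y (pt_obj y x)"


section \<open>Finite-dimensional algebras and bimodules\<close>

text \<open>
  A \<open>\<^bold>k\<close>-algebra is a \<^typ>\<open>('k, 'u) module\<close> record carrying a (not necessarily commutative) ring
  structure. All carriers are subsets of one type \<open>'u\<close>; a type that contains a copy of
  \<open>\<^bold>k\<close> contains, up to isomorphism, all finite-dimensional algebras and bimodules when \<open>\<^bold>k\<close> is infinite.
\<close>

definition fin_dim :: "'k ring \<Rightarrow> ('k, 'u, 'x) module_scheme \<Rightarrow> bool" where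
  "fin_dim K M \<longleftrightarrow> (\<exists>S. finite S \<and> S \<subseteq> carrier M \<and>
     carrier M = {\<Oplus>\<^bsub>M\<^esub>s\<in>S. c s \<odot>\<^bsub>M\<^esub> s |c. c \<in> S \<rightarrow> carrier K})"

locale fd_algebra = module K A + ring A
  for K :: "'k ring" and A :: "('k, 'u) module" (structure) +
  assumes smult_mult_left: "\<lbrakk>c \<in> carrier K; a \<in> carrier A; b \<in> carrier A\<rbrakk> \<Longrightarrow>
      (c \<odot> a) \<otimes> b = c \<odot> (a \<otimes> b)"
    and smult_mult_right: "\<lbrakk>c \<in> carrier K; a \<in> carrier A; b \<in> carrier A\<rbrakk> \<Longrightarrow>
      a \<otimes> (c \<odot> b) = c \<odot> (a \<otimes> b)"
    and finite_dimensional: "fin_dim K A"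

definition op :: "('k, 'u) module \<Rightarrow> ('k, 'u) module" where
  "op A = A\<lparr>monoid.mult := (\<lambda>a b. b \<otimes>\<^bsub>A\<^esub> a)\<rparr>"

definition left_ideal :: "('k, 'u) module \<Rightarrow> 'u set \<Rightarrow> bool" where
  "left_ideal A I \<longleftrightarrow> additive_subgroup I A \<and> (\<forall>a\<in>carrier A. \<forall>x\<in>I. a \<otimes>\<^bsub>A\<^esub> x \<in> I)"

text \<open>Semisimplicity of the regular left module: every submodule is a direct summand.\<close>

definition semisimple :: "('k, 'u) module \<Rightarrow> bool" where
  "semisimple A \<longleftrightarrow> (\<forall>I. left_ideal A I \<longrightarrow>
     (\<exists>J. left_ideal A J \<and> I \<inter> J = {\<zero>\<^bsub>A\<^esub>} \<and> I <+>\<^bsub>A\<^esub> J = carrier A))"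

text \<open>
  A bimodule records the two algebras that act on it. The fields \<^const>\<open>monoid.mult\<close> and \<^const>\<open>monoid.one\<close>
  inherited from \<^typ>\<open>('k, 'u) module\<close> are ignored.
\<close>

record ('k, 'u) bimodule = "('k, 'u) module" +
  lalg :: "('k, 'u) module"
  ralg :: "('k, 'u) module"
  lact :: "'u \<Rightarrow> 'u \<Rightarrow> 'u"
  ract :: "'u \<Rightarrow> 'u \<Rightarrow> 'u"

locale fd_bimodule =
  module K M + left: fd_algebra K "lalg M" + right: fd_algebra K "ralg M"
  for K :: "'k ring" and M :: "('k, 'u) bimodule" (structure) +
  assumes finite_dimensional: "fin_dim K M"
    and lact_closed: "\<lbrakk>a \<in> carrier (lalg M); m \<in> carrier M\<rbrakk> \<Longrightarrow> lact M a m \<in> carrier M"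
    and lact_add_left: "\<lbrakk>a \<in> carrier (lalg M); a' \<in> carrier (lalg M); m \<in> carrier M\<rbrakk> \<Longrightarrow>
      lact M (a \<oplus>\<^bsub>lalg M\<^esub> a') m = lact M a m \<oplus> lact M a' m"
    and lact_add_right: "\<lbrakk>a \<in> carrier (lalg M); m \<in> carrier M; m' \<in> carrier M\<rbrakk> \<Longrightarrow>
      lact M a (m \<oplus> m') = lact M a m \<oplus> lact M a m'"
    and lact_mult: "\<lbrakk>a \<in> carrier (lalg M); a' \<in> carrier (lalg M); m \<in> carrier M\<rbrakk> \<Longrightarrow>
      lact M (a \<otimes>\<^bsub>lalg M\<^esub> a') m = lact M a (lact M a' m)"
    and lact_one: "m \<in> carrier M \<Longrightarrow> lact M \<one>\<^bsub>lalg M\<^esub> m = m"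
    and lact_smult: "\<lbrakk>c \<in> carrier K; a \<in> carrier (lalg M); m \<in> carrier M\<rbrakk> \<Longrightarrow>
      lact M (c \<odot>\<^bsub>lalg M\<^esub> a) m = c \<odot> lact M a m"
    and ract_closed: "\<lbrakk>m \<in> carrier M; b \<in> carrier (ralg M)\<rbrakk> \<Longrightarrow> ract M m b \<in> carrier M"
    and ract_add_left: "\<lbrakk>m \<in> carrier M; m' \<in> carrier M; b \<in> carrier (ralg M)\<rbrakk> \<Longrightarrow>
      ract M (m \<oplus> m') b = ract M m b \<oplus> ract M m' b"
    and ract_add_right: "\<lbrakk>m \<in> carrier M; b \<in> carrier (ralg M); b' \<in> carrier (ralg M)\<rbrakk> \<Longrightarrow>
      ract M m (b \<oplus>\<^bsub>ralg M\<^esub> b') = ract M m b \<oplus> ract M m b'"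
    and ract_mult: "\<lbrakk>m \<in> carrier M; b \<in> carrier (ralg M); b' \<in> carrier (ralg M)\<rbrakk> \<Longrightarrow>
      ract M m (b \<otimes>\<^bsub>ralg M\<^esub> b') = ract M (ract M m b) b'"
    and ract_one: "m \<in> carrier M \<Longrightarrow> ract M m \<one>\<^bsub>ralg M\<^esub> = m"
    and ract_smult: "\<lbrakk>c \<in> carrier K; m \<in> carrier M; b \<in> carrier (ralg M)\<rbrakk> \<Longrightarrow>
      ract M m (c \<odot>\<^bsub>ralg M\<^esub> b) = c \<odot> ract M m b"
    and lact_ract: "\<lbrakk>a \<in> carrier (lalg M); m \<in> carrier M; b \<in> carrier (ralg M)\<rbrakk> \<Longrightarrow>
      ract M (lact M a m) b = lact M a (ract M m b)"

text \<open>An \<open>(A, B)\<close>-bimodule viewed as a \<open>(B\<^sup>o\<^sup>p, A\<^sup>o\<^sup>p)\<close>-bimodule.\<close>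

definition op_bimodule :: "('k, 'u) bimodule \<Rightarrow> ('k, 'u) bimodule" where
  "op_bimodule M = M\<lparr>lalg := op (ralg M), ralg := op (lalg M),
     lact := (\<lambda>b m. ract M m b), ract := (\<lambda>m a. lact M a m)\<rparr>"

definition regular :: "('k, 'u) module \<Rightarrow> ('k, 'u) bimodule" where
  "regular A = \<lparr>carrier = carrier A, monoid.mult = monoid.mult A, monoid.one = \<one>\<^bsub>A\<^esub>, ring.zero = \<zero>\<^bsub>A\<^esub>, ring.add = ring.add A,
     smult = smult A, lalg = A, ralg = A, lact = monoid.mult A, ract = monoid.mult A\<rparr>"

record ('k, 'u) bimod_map =
  bdom :: "('k, 'u) bimodule"
  bcod :: "('k, 'u) bimodule"
  bmap :: "'u \<Rightarrow> 'u"

text \<open>Bimodule maps are extensional; \<open>\<^bold>k\<close>-linearity follows from linearity over the algebras.\<close>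

locale bimodule_map =
  dom: fd_bimodule K "bdom f" + cod: fd_bimodule K "bcod f"
  for K :: "'k ring" and f :: "('k, 'u) bimod_map" +
  assumes lalg_eq: "lalg (bcod f) = lalg (bdom f)"
    and ralg_eq: "ralg (bcod f) = ralg (bdom f)"
    and extensional: "bmap f \<in> extensional (carrier (bdom f))"
    and additive: "bmap f \<in> hom (add_monoid (bdom f)) (add_monoid (bcod f))"
    and left_linear: "\<lbrakk>a \<in> carrier (lalg (bdom f)); m \<in> carrier (bdom f)\<rbrakk> \<Longrightarrow>
      bmap f (lact (bdom f) a m) = lact (bcod f) a (bmap f m)"
    and right_linear: "\<lbrakk>m \<in> carrier (bdom f); b \<in> carrier (ralg (bdom f))\<rbrakk> \<Longrightarrow>
      bmap f (ract (bdom f) m b) = ract (bcod f) (bmap f m) b"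


section \<open>Tensor products and Hom modules\<close>

text \<open>
  Cosets of a free abelian group and sets of linear maps do not literally live in \<open>'u\<close>.
  They are moved there along a chosen injection; such an injection exists for the sets used below whenever \<open>'u\<close> is infinite (otherwise the value is meaningless).
\<close>

definition encode :: "'x set \<Rightarrow> 'x \<Rightarrow> 'u" where
  "encode S = (SOME e. inj_on e S)"

definition decode :: "'x set \<Rightarrow> 'u \<Rightarrow> 'x" where
  "decode S = inv_into S (encode S)"

definition tensor_free :: "('k, 'u) bimodule \<Rightarrow> ('k, 'u) bimodule \<Rightarrow> ('u \<times> 'u \<Rightarrow>\<^sub>0 int) monoid" where
  "tensor_free M N = free_Abelian_group (carrier M \<times> carrier N)"

definition tensor_rel :: "('k, 'u) bimodule \<Rightarrow> ('k, 'u) bimodule \<Rightarrow> ('u \<times> 'u \<Rightarrow>\<^sub>0 int) set" where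
  "tensor_rel M N = generate (tensor_free M N)
    ({frag_of (m \<oplus>\<^bsub>M\<^esub> m', n) - frag_of (m, n) - frag_of (m', n) |m m' n.
        m \<in> carrier M \<and> m' \<in> carrier M \<and> n \<in> carrier N} \<union>
     {frag_of (m, n \<oplus>\<^bsub>N\<^esub> n') - frag_of (m, n) - frag_of (m, n') |m n n'.
        m \<in> carrier M \<and> n \<in> carrier N \<and> n' \<in> carrier N} \<union>
     {frag_of (ract M m b, n) - frag_of (m, lact N b n) |m b n.
        m \<in> carrier M \<and> b \<in> carrier (ralg M) \<and> n \<in> carrier N})"

definition tensor_quot :: "('k, 'u) bimodule \<Rightarrow> ('k, 'u) bimodule
    \<Rightarrow> ('u \<times> 'u \<Rightarrow>\<^sub>0 int) set monoid" where
  "tensor_quot M N = tensor_free M N Mod tensor_rel M N"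

definition tensor_group :: "('k, 'u) bimodule \<Rightarrow> ('k, 'u) bimodule \<Rightarrow> 'u monoid" where
  "tensor_group M N = (let Q = tensor_quot M N; e = encode (carrier Q); d = decode (carrier Q) in
     \<lparr>carrier = e ` carrier Q, monoid.mult = (\<lambda>s t. e (d s \<otimes>\<^bsub>Q\<^esub> d t)), monoid.one = e \<one>\<^bsub>Q\<^esub>\<rparr>)"

definition pure_tensor :: "('k, 'u) bimodule \<Rightarrow> ('k, 'u) bimodule \<Rightarrow> 'u \<Rightarrow> 'u \<Rightarrow> 'u" where
  "pure_tensor M N m n = encode (carrier (tensor_quot M N))
     (tensor_rel M N #>\<^bsub>tensor_free M N\<^esub> frag_of (m, n))"

text \<open>The additive map \<open>M \<otimes> N \<rightarrow> G\<close> with \<open>m \<otimes> n \<mapsto> \<beta> m n\<close>, for a balanced biadditive map \<open>\<beta>\<close>.\<close>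

definition tensor_lift ::
  "('k, 'u) bimodule \<Rightarrow> ('k, 'u) bimodule \<Rightarrow> ('u, 'x) monoid_scheme \<Rightarrow> ('u \<Rightarrow> 'u \<Rightarrow> 'u) \<Rightarrow> 'u \<Rightarrow> 'u" where
  "tensor_lift M N G \<beta> = (THE h. h \<in> hom (tensor_group M N) G \<and>
     h \<in> extensional (carrier (tensor_group M N)) \<and>
     (\<forall>m\<in>carrier M. \<forall>n\<in>carrier N. h (pure_tensor M N m n) = \<beta> m n))"

text \<open>\<open>tensor M N\<close> is \<open>\<^sub>AM \<otimes>\<^sub>B N\<^sub>C\<close>, where \<open>B\<close> is the right algebra of \<open>M\<close> and the left algebra of \<open>N\<close>.\<close>

definition tensor :: "('k, 'u) bimodule \<Rightarrow> ('k, 'u) bimodule \<Rightarrow> ('k, 'u) bimodule" where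
  "tensor M N = (let T = tensor_group M N in
     \<lparr>carrier = carrier T, monoid.mult = undefined, monoid.one = undefined, ring.zero = \<one>\<^bsub>T\<^esub>, ring.add = monoid.mult T,
      smult = (\<lambda>c. tensor_lift M N T (\<lambda>m n. pure_tensor M N (c \<odot>\<^bsub>M\<^esub> m) n)),
      lalg = lalg M, ralg = ralg N,
      lact = (\<lambda>a. tensor_lift M N T (\<lambda>m n. pure_tensor M N (lact M a m) n)),
      ract = (\<lambda>t c. tensor_lift M N T (\<lambda>m n. pure_tensor M N m (ract N n c)) t)\<rparr>)"

definition tensor_map :: "('k, 'u) bimod_map \<Rightarrow> ('k, 'u) bimod_map \<Rightarrow> ('k, 'u) bimod_map" where
  "tensor_map f g = \<lparr>bdom = tensor (bdom f) (bdom g), bcod = tensor (bcod f) (bcod g),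
     bmap = tensor_lift (bdom f) (bdom g) (tensor_group (bcod f) (bcod g))
       (\<lambda>m n. pure_tensor (bcod f) (bcod g) (bmap f m) (bmap g n))\<rparr>"

text \<open>
  The set of right \<open>B\<close>-module maps between \<open>\<^sub>AM\<^sub>B\<close> and \<open>\<^sub>CN\<^sub>B\<close>, and the \<open>(C, A)\<close>-bimodule they form.
  \<open>rhom_code\<close> turns a linear map into an element of this bimodule, \<open>rhom_fun\<close> turns it back.
\<close>

definition rhom_set :: "('k, 'u) bimodule \<Rightarrow> ('k, 'u) bimodule \<Rightarrow> ('u \<Rightarrow> 'u) set" where
  "rhom_set M N = {h. h \<in> hom (add_monoid M) (add_monoid N) \<and> h \<in> extensional (carrier M) \<and>
     (\<forall>m\<in>carrier M. \<forall>b\<in>carrier (ralg M). h (ract M m b) = ract N (h m) b)}"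

definition rhom_code :: "('k, 'u) bimodule \<Rightarrow> ('k, 'u) bimodule \<Rightarrow> ('u \<Rightarrow> 'u) \<Rightarrow> 'u" where
  "rhom_code M N = encode (rhom_set M N)"

definition rhom_fun :: "('k, 'u) bimodule \<Rightarrow> ('k, 'u) bimodule \<Rightarrow> 'u \<Rightarrow> 'u \<Rightarrow> 'u" where
  "rhom_fun M N = decode (rhom_set M N)"

definition rhom :: "('k, 'u) bimodule \<Rightarrow> ('k, 'u) bimodule \<Rightarrow> ('k, 'u) bimodule" where
  "rhom M N = (let code = rhom_code M N; ev = rhom_fun M N in
     \<lparr>carrier = code ` rhom_set M N, monoid.mult = undefined, monoid.one = undefined,
      ring.zero = code (\<lambda>m\<in>carrier M. \<zero>\<^bsub>N\<^esub>),
      ring.add = (\<lambda>g h. code (\<lambda>m\<in>carrier M. ev g m \<oplus>\<^bsub>N\<^esub> ev h m)),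
      smult = (\<lambda>c h. code (\<lambda>m\<in>carrier M. c \<odot>\<^bsub>N\<^esub> ev h m)),
      lalg = lalg N, ralg = lalg M,
      lact = (\<lambda>c h. code (\<lambda>m\<in>carrier M. lact N c (ev h m))),
      ract = (\<lambda>h a. code (\<lambda>m\<in>carrier M. ev h (lact M a m)))\<rparr>)"


section \<open>The Morita bicategory\<close>

definition Alg2 :: "'k ring \<Rightarrow> (('k, 'u) module, ('k, 'u) bimodule, ('k, 'u) bimod_map) bicat" where
  "Alg2 K = \<lparr>
     Obj = {A. fd_algebra K A},
     Arr = {M. fd_bimodule K M},
     Cell = {f. bimodule_map K f},
     src = lalg,
     trg = ralg,
     vdom = bdom,
     vcod = bcod,
     id1 = regular,
     comp1 = (\<lambda>N M. tensor M N),
     id2 = (\<lambda>M. \<lparr>bdom = M, bcod = M, bmap = (\<lambda>m\<in>carrier M. m)\<rparr>),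
     vcomp = (\<lambda>g f. \<lparr>bdom = bdom f, bcod = bcod g,
       bmap = compose (carrier (bdom f)) (bmap g) (bmap f)\<rparr>),
     hcomp = (\<lambda>g f. tensor_map f g),
     assoc = (\<lambda>P N M. \<lparr>bdom = tensor M (tensor N P), bcod = tensor (tensor M N) P,
       bmap = tensor_lift M (tensor N P) (tensor_group (tensor M N) P)
         (\<lambda>m. tensor_lift N P (tensor_group (tensor M N) P)
           (\<lambda>n p. pure_tensor (tensor M N) P (pure_tensor M N m n) p))\<rparr>),
     lunit = (\<lambda>M. \<lparr>bdom = tensor M (regular (ralg M)), bcod = M,
       bmap = tensor_lift M (regular (ralg M)) (add_monoid M) (ract M)\<rparr>),
     runit = (\<lambda>M. \<lparr>bdom = tensor (regular (lalg M)) M, bcod = M,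
       bmap = tensor_lift (regular (lalg M)) M (add_monoid M) (lact M)\<rparr>)\<rparr>"

text \<open>The fully dualisable part is the full sub-bicategory on the semisimple algebras.\<close>

definition Alg2_fd :: "'k ring \<Rightarrow> (('k, 'u) module, ('k, 'u) bimodule, ('k, 'u) bimod_map) bicat"
  where "Alg2_fd K = full_subbicat (Alg2 K) {A. semisimple A}"


section \<open>The duality data\<close>

definition dual :: "('k, 'u) bimodule \<Rightarrow> ('k, 'u) bimodule" where
  "dual M = op_bimodule (rhom M (regular (ralg M)))"

abbreviation dual_code :: "('k, 'u) bimodule \<Rightarrow> ('u \<Rightarrow> 'u) \<Rightarrow> 'u" where
  "dual_code M \<equiv> rhom_code M (regular (ralg M))"

abbreviation dual_fun :: "('k, 'u) bimodule \<Rightarrow> 'u \<Rightarrow> 'u \<Rightarrow> 'u" where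
  "dual_fun M \<equiv> rhom_fun M (regular (ralg M))"

definition dual_map :: "('k, 'u) bimod_map \<Rightarrow> ('k, 'u) bimod_map" where
  "dual_map f = \<lparr>bdom = dual (bcod f), bcod = dual (bdom f),
     bmap = (\<lambda>g\<in>carrier (dual (bcod f)).
       dual_code (bdom f) (\<lambda>m\<in>carrier (bdom f). dual_fun (bcod f) g (bmap f m)))\<rparr>"

text \<open>The map \<open>g \<otimes> h \<mapsto> (m \<otimes> n \<mapsto> h (g(m) n))\<close>, inverse to the coherence isomorphism \<open>(M \<otimes>\<^sub>B N)\<degree> \<Rightarrow> M\<degree> \<otimes> N\<degree>\<close>.\<close>

definition dual_comp_inv :: "('k, 'u) bimodule \<Rightarrow> ('k, 'u) bimodule \<Rightarrow> ('k, 'u) bimod_map" where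
  "dual_comp_inv M N = \<lparr>bdom = tensor (dual M) (dual N), bcod = dual (tensor M N),
     bmap = tensor_lift (dual M) (dual N) (add_monoid (dual (tensor M N)))
       (\<lambda>g h. dual_code (tensor M N)
         (tensor_lift M N (add_monoid (ralg N))
           (\<lambda>m n. dual_fun N h (lact N (dual_fun M g m) n))))\<rparr>"

definition dual_unit :: "('k, 'u) module \<Rightarrow> ('k, 'u) bimod_map" where
  "dual_unit A = \<lparr>bdom = dual (regular A), bcod = regular (op A),
     bmap = (\<lambda>h\<in>carrier (dual (regular A)). dual_fun (regular A) h \<one>\<^bsub>A\<^esub>)\<rparr>"

definition duality :: "'k ring \<Rightarrow>
    (('k, 'u) module, ('k, 'u) bimodule, ('k, 'u) bimod_map,
     ('k, 'u) module, ('k, 'u) bimodule, ('k, 'u) bimod_map) psfun" where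
  "duality K = \<lparr>pf_obj = op, pf_arr = dual, pf_cell = dual_map,
     pf_comp = (\<lambda>N M. inv2 (Alg2_fd K) (dual_comp_inv M N)),
     pf_unit = dual_unit\<rparr>"

text \<open>\<open>\<psi>\<^sub>M : M \<rightarrow> M\<degree>\<degree>\<close>, \<open>\<psi>\<^sub>M(p)(g) = g(p)\<close>.\<close>

definition psi :: "('k, 'u) bimodule \<Rightarrow> ('k, 'u) bimod_map" where
  "psi M = \<lparr>bdom = M, bcod = dual (dual M),
     bmap = (\<lambda>p\<in>carrier M. dual_code (dual M) (\<lambda>g\<in>carrier (dual M). dual_fun M g p))\<rparr>"

definition dual_y :: "'k ring \<Rightarrow>
    (('k, 'u) module, ('k, 'u) bimodule, ('k, 'u) bimodule, ('k, 'u) bimod_map) pstrans" where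
  "dual_y K = \<lparr>pt_obj = regular,
     pt_arr = (\<lambda>M. inv2 (Alg2_fd K) (runit (Alg2_fd K) (dual (dual M)))
       \<bullet>\<^bsub>Alg2_fd K\<^esub> psi M \<bullet>\<^bsub>Alg2_fd K\<^esub> lunit (Alg2_fd K) M)\<rparr>"

definition dual_zeta :: "('k, 'u) module \<Rightarrow> ('k, 'u) bimod_map" where
  "dual_zeta A = \<lparr>bdom = regular (op A), bcod = dual (regular A),
     bmap = (\<lambda>x\<in>carrier A. dual_code (regular A) (\<lambda>a\<in>carrier A. x \<otimes>\<^bsub>A\<^esub> a))\<rparr>"

end

theory Submission
  imports Defs
begin

text \<open>
  Every cell of the Morita bicategory is an additive map out of an iterated tensor product, hence
  determined by its values on pure tensors, and a map into a dual is determined by its values as a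
  functional. All coherence laws thus become identities such as
  \<open>h (g(m) n) = (g(m) h)(n)\<close> between elements.

  Invertibility of \<open>\<psi>\<^sub>M\<close> and of \<open>M\<degree> \<otimes> N\<degree> \<rightarrow> (M \<otimes> N)\<degree>\<close> uses a dual basis \<open>m = \<Sum>\<^sub>i m\<^sub>i g\<^sub>i(m)\<close> of the right
  module \<open>M\<close>. It exists because a left semisimple algebra is von Neumann regular
  (\<open>a = a x a\<close> is solvable), a left-right symmetric condition that makes finitely generated right ideals
  generated by idempotents; this also shows that the opposite algebra is semisimple.

  The 1-cell components of \<open>y\<close> are identities, so \<open>y\<close> is an icon, and the inverse icon
  together with the unit constraints completes it to an adjoint equivalence.
\<close>

section \<open>Bicategories\<close>

text \<open>The comparison between the dual of a tensor product and the tensor product of the duals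
  has an explicit formula only in the direction
  \<open>g \<otimes> h \<mapsto> (m \<otimes> n \<mapsto> h (g(m) n))\<close>; the structure cell of
  the pseudofunctor is the abstract inverse of that map. Coherence laws are therefore verified for
  the explicit map, where both sides can be evaluated, and then carried over by inverting whole
  diagrams. The same device turns the axioms of a bicategory into those of its \<open>co\<close>,
  whose structure cells are inverses. A second obstacle is size: quotients of free groups and sets
  of linear maps have to be coded inside the fixed type of elements, so each construction comes with
  a cardinality bound, for which that type must be infinite. For duals the bound rests on a finite
  spanning set. Finite dimensionality of a dual comes from the dual basis too: the functionals
  \<open>g\<^sub>i\<close> generate the dual over the algebra, because
  \<open>h = \<Sum>\<^sub>i h(m\<^sub>i) g\<^sub>i\<close>.\<close>

lemma Cells_boundary: "\<sigma> \<in> Cells B f g \<Longrightarrow> vdom B \<sigma> = f \<and> vcod B \<sigma> = g"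
  by (simp add: Cells_def)

lemma IsosD: "\<sigma> \<in> Isos B f g \<Longrightarrow> \<sigma> \<in> Cells B f g"
  by (simp add: Isos_def)

section \<open>Calculus of invertible 2-cells\<close>

context bicategory
begin

lemma cell_arr:
  assumes "\<sigma> \<in> Cells B f g"
  shows "f \<in> Arr B" "g \<in> Arr B" "src B g = src B f" "trg B g = trg B f"
  using assms cell_boundary by (fastforce simp: Cells_def Hom_def)+

lemma inverse2_unique:
  assumes \<sigma>: "\<sigma> \<in> Cells B f g" and "inverse2 B \<sigma> \<tau>" "inverse2 B \<sigma> \<tau>'"
  shows "\<tau> = \<tau>'"
proof -
  have \<tau>: "\<tau> \<in> Cells B g f" "\<tau> \<bullet> \<sigma> = id2 B f" "\<sigma> \<bullet> \<tau> = id2 B g"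
    and \<tau>': "\<tau>' \<in> Cells B g f" "\<tau>' \<bullet> \<sigma> = id2 B f" "\<sigma> \<bullet> \<tau>' = id2 B g"
    using assms by (auto simp: inverse2_def Cells_def)
  have "\<tau> = (\<tau>' \<bullet> \<sigma>) \<bullet> \<tau>"
    using \<tau> \<tau>' vcomp_id_left by metis
  also have "\<dots> = \<tau>' \<bullet> (\<sigma> \<bullet> \<tau>)"
    using \<tau>(1) \<sigma> \<tau>'(1) by (rule vcomp_assoc)
  also have "\<dots> = \<tau>'"
    using \<tau> \<tau>' vcomp_id_right by metis
  finally show ?thesis .
qed

text \<open>\<open>inv2\<close> is a definite description, so a computed two-sided inverse becomes
  its value only through uniqueness. Inverses of composites, whiskerings and dual maps are all
  identified by this rule.\<close>

lemma inv2_eqI: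
  assumes "\<sigma> \<in> Cells B f g" "\<tau> \<in> Cells B g f" "\<tau> \<bullet> \<sigma> = id2 B f" "\<sigma> \<bullet> \<tau> = id2 B g"
  shows "\<sigma> \<in> Isos B f g" "inv2 B \<sigma> = \<tau>"
proof -
  have inv: "inverse2 B \<sigma> \<tau>"
    using assms by (auto simp: inverse2_def Cells_def)
  then show "\<sigma> \<in> Isos B f g"
    using assms(1) by (auto simp: Isos_def)
  show "inv2 B \<sigma> = \<tau>"
    unfolding inv2_def using inv inverse2_unique[OF assms(1)] by (intro the_equality) auto
qed

lemma inv2_props:
  assumes "\<sigma> \<in> Isos B f g"
  shows inv2_cell: "inv2 B \<sigma> \<in> Cells B g f"
    and inv2_left: "inv2 B \<sigma> \<bullet> \<sigma> = id2 B f"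
    and inv2_right: "\<sigma> \<bullet> inv2 B \<sigma> = id2 B g"
proof -
  obtain \<tau> where \<tau>: "inverse2 B \<sigma> \<tau>" and \<sigma>: "\<sigma> \<in> Cells B f g"
    using assms by (auto simp: Isos_def)
  then have t: "\<tau> \<in> Cells B g f" "\<tau> \<bullet> \<sigma> = id2 B f" "\<sigma> \<bullet> \<tau> = id2 B g"
    by (auto simp: inverse2_def Cells_def)
  note inv2_eqI(2)[OF \<sigma> t]
  with t show "inv2 B \<sigma> \<in> Cells B g f" "inv2 B \<sigma> \<bullet> \<sigma> = id2 B f" "\<sigma> \<bullet> inv2 B \<sigma> = id2 B g"
    by auto
qed

lemma inv2_iso: "\<sigma> \<in> Isos B f g \<Longrightarrow> inv2 B \<sigma> \<in> Isos B g f"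
  by (rule inv2_eqI(1)[OF _ IsosD]) (auto intro: inv2_cell inv2_left inv2_right)

lemma inv2_inv2: "\<sigma> \<in> Isos B f g \<Longrightarrow> inv2 B (inv2 B \<sigma>) = \<sigma>"
  by (rule inv2_eqI(2)[OF _ IsosD]) (auto intro: inv2_cell inv2_left inv2_right)

lemma id2_iso: "f \<in> Arr B \<Longrightarrow> id2 B f \<in> Isos B f f"
  and inv2_id2: "f \<in> Arr B \<Longrightarrow> inv2 B (id2 B f) = id2 B f"
  using inv2_eqI[OF id2_cell id2_cell] vcomp_id_left[OF id2_cell] by auto

lemma cancel_left:
  assumes "\<sigma> \<in> Isos B g h" "\<tau> \<in> Cells B f g"
  shows "inv2 B \<sigma> \<bullet> (\<sigma> \<bullet> \<tau>) = \<tau>"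
  using vcomp_assoc[OF assms(2) IsosD[OF assms(1)] inv2_cell[OF assms(1)]]
    inv2_left[OF assms(1)] vcomp_id_left[OF assms(2)] by simp

lemma cancel_left_inv:
  assumes "\<sigma> \<in> Isos B g h" "\<tau> \<in> Cells B f h"
  shows "\<sigma> \<bullet> (inv2 B \<sigma> \<bullet> \<tau>) = \<tau>"
  using cancel_left[OF inv2_iso[OF assms(1)] assms(2)] inv2_inv2[OF assms(1)] by simp

lemma cancel_right:
  assumes "\<sigma> \<in> Isos B f g" "\<tau> \<in> Cells B g h"
  shows "(\<tau> \<bullet> \<sigma>) \<bullet> inv2 B \<sigma> = \<tau>"
  using vcomp_assoc[OF inv2_cell[OF assms(1)] IsosD[OF assms(1)] assms(2)]
    inv2_right[OF assms(1)] vcomp_id_right[OF assms(2)] by simp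

lemma vcomp_iso:
  assumes \<sigma>: "\<sigma> \<in> Isos B f g" and \<tau>: "\<tau> \<in> Isos B g h"
  shows "\<tau> \<bullet> \<sigma> \<in> Isos B f h" and inv2_vcomp: "inv2 B (\<tau> \<bullet> \<sigma>) = inv2 B \<sigma> \<bullet> inv2 B \<tau>"
proof -
  note c = IsosD[OF \<sigma>] IsosD[OF \<tau>] inv2_cell[OF \<sigma>] inv2_cell[OF \<tau>]
  have "(inv2 B \<sigma> \<bullet> inv2 B \<tau>) \<bullet> (\<tau> \<bullet> \<sigma>) = inv2 B \<sigma> \<bullet> (inv2 B \<tau> \<bullet> (\<tau> \<bullet> \<sigma>))"
    by (rule vcomp_assoc[OF vcomp_cell]) (use c in auto)
  also have "\<dots> = id2 B f"
    using cancel_left[OF \<tau> c(1)] inv2_left[OF \<sigma>] by simp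
  finally have l: "(inv2 B \<sigma> \<bullet> inv2 B \<tau>) \<bullet> (\<tau> \<bullet> \<sigma>) = id2 B f" .
  have "(\<tau> \<bullet> \<sigma>) \<bullet> (inv2 B \<sigma> \<bullet> inv2 B \<tau>) = \<tau> \<bullet> (\<sigma> \<bullet> (inv2 B \<sigma> \<bullet> inv2 B \<tau>))"
    by (rule vcomp_assoc[OF vcomp_cell]) (use c in auto)
  also have "\<dots> = id2 B h"
    using cancel_left_inv[OF \<sigma> c(4)] inv2_right[OF \<tau>] by simp
  finally have r: "(\<tau> \<bullet> \<sigma>) \<bullet> (inv2 B \<sigma> \<bullet> inv2 B \<tau>) = id2 B h" .
  show "\<tau> \<bullet> \<sigma> \<in> Isos B f h" "inv2 B (\<tau> \<bullet> \<sigma>) = inv2 B \<sigma> \<bullet> inv2 B \<tau>"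
    using inv2_eqI[OF vcomp_cell[OF c(1,2)] vcomp_cell[OF c(4,3)] l r] by auto
qed

lemma hcomp_iso:
  assumes \<sigma>: "\<sigma> \<in> Isos B f f'" and \<tau>: "\<tau> \<in> Isos B g g'" and eq: "trg B f = src B g"
  shows "\<tau> \<star> \<sigma> \<in> Isos B (g \<circledcirc> f) (g' \<circledcirc> f')" and inv2_hcomp: "inv2 B (\<tau> \<star> \<sigma>) = inv2 B \<tau> \<star> inv2 B \<sigma>"
proof -
  note c = IsosD[OF \<sigma>] IsosD[OF \<tau>] inv2_cell[OF \<sigma>] inv2_cell[OF \<tau>]
  have eq': "trg B f' = src B g'"
    using eq cell_arr[OF c(1)] cell_arr[OF c(2)] by simp
  have h: "f \<in> Hom B (src B f) (trg B f)" "f' \<in> Hom B (src B f) (trg B f)"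
    "g \<in> Hom B (trg B f) (trg B g)" "g' \<in> Hom B (trg B f) (trg B g)"
    using eq cell_arr[OF c(1)] cell_arr[OF c(2)] by (auto simp: Hom_def)
  have "(inv2 B \<tau> \<star> inv2 B \<sigma>) \<bullet> (\<tau> \<star> \<sigma>) = id2 B (g \<circledcirc> f)"
    using interchange[OF c(1,3,2,4) eq] inv2_left[OF \<sigma>] inv2_left[OF \<tau>] hcomp_id[OF h(1,3)] by simp
  moreover have "(\<tau> \<star> \<sigma>) \<bullet> (inv2 B \<tau> \<star> inv2 B \<sigma>) = id2 B (g' \<circledcirc> f')"
    using interchange[OF c(3,1,4,2) eq'] inv2_right[OF \<sigma>] inv2_right[OF \<tau>] hcomp_id[OF h(2,4)] by simp
  ultimately show "\<tau> \<star> \<sigma> \<in> Isos B (g \<circledcirc> f) (g' \<circledcirc> f')" "inv2 B (\<tau> \<star> \<sigma>) = inv2 B \<tau> \<star> inv2 B \<sigma>"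
    using inv2_eqI[OF hcomp_cell[OF c(1,2) eq] hcomp_cell[OF c(3,4) eq']] by auto
qed

text \<open>Cancel \<open>b\<close> on the left and \<open>a\<close> on the right of
  \<open>q \<bullet> a = b \<bullet> p\<close>: a commuting square survives the reversal of two
  opposite invertible sides. This carries naturality from an explicit family of maps to the family
  of its inverses.\<close>

lemma inv2_square:
  assumes a: "a \<in> Isos B x y" and b: "b \<in> Isos B x' y'" and p: "p \<in> Cells B x x'" and q: "q \<in> Cells B y y'"
    and eq: "q \<bullet> a = b \<bullet> p"
  shows "inv2 B b \<bullet> q = p \<bullet> inv2 B a"
proof -
  have "inv2 B b \<bullet> q = inv2 B b \<bullet> ((q \<bullet> a) \<bullet> inv2 B a)"
    using cancel_right[OF a q] by simp
  also have "\<dots> = inv2 B b \<bullet> (b \<bullet> (p \<bullet> inv2 B a))"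
    using eq vcomp_assoc[OF inv2_cell[OF a] p IsosD[OF b]] by simp
  also have "\<dots> = p \<bullet> inv2 B a"
    by (rule cancel_left[OF b vcomp_cell[OF inv2_cell[OF a] p]])
  finally show ?thesis .
qed

lemma vcomp_inv2_right:
  assumes "a \<in> Isos B x y" "q \<in> Cells B y z" "p = q \<bullet> a"
  shows "p \<bullet> inv2 B a = q"
  using assms cancel_right by simp

text \<open>The shape is that of the associativity law of a pseudofunctor whose comparison cells are
  known through their inverses: \<open>v\<close>, \<open>u\<close> and \<open>y\<close>,
  \<open>x\<close> are the explicit comparison maps along the two bracketings, \<open>a\<close> and
  \<open>w\<close> are the associator and the image of an associator. Inverting both sides and
  cancelling \<open>a\<close> gives the law for the inverses.\<close>

lemma inv2_hexagon:
  assumes a: "a \<in> Isos B p q" and v: "v \<in> Isos B p r" and u: "u \<in> Isos B r s"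
    and y: "y \<in> Isos B q t" and x: "x \<in> Isos B t z" and w: "w \<in> Isos B z s"
    and eq: "u \<bullet> v = w \<bullet> x \<bullet> y \<bullet> a"
  shows "a \<bullet> inv2 B v \<bullet> inv2 B u = inv2 B y \<bullet> inv2 B x \<bullet> inv2 B w"
proof -
  note yx = vcomp_iso(1)[OF y x] and ya = vcomp_iso(1)[OF a y]
  note xya = vcomp_iso(1)[OF ya x] and xy = vcomp_iso(1)[OF y x]
  have "a \<bullet> inv2 B v \<bullet> inv2 B u = a \<bullet> inv2 B (w \<bullet> x \<bullet> y \<bullet> a)"
    using eq inv2_vcomp[OF v u] by simp
  also have "\<dots> = a \<bullet> ((inv2 B a \<bullet> inv2 B y) \<bullet> inv2 B x) \<bullet> inv2 B w"
    using inv2_vcomp[OF xya w] inv2_vcomp[OF ya x] inv2_vcomp[OF a y] by simp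
  also have "((inv2 B a \<bullet> inv2 B y) \<bullet> inv2 B x) \<bullet> inv2 B w
    = (inv2 B a \<bullet> inv2 B y) \<bullet> inv2 B x \<bullet> inv2 B w"
    using a y x w by (meson inv2_cell vcomp_assoc vcomp_cell)
  also have "\<dots> = inv2 B a \<bullet> inv2 B y \<bullet> inv2 B x \<bullet> inv2 B w"
    using a y x w by (meson inv2_cell vcomp_assoc vcomp_cell)
  also have "a \<bullet> \<dots> = inv2 B y \<bullet> inv2 B x \<bullet> inv2 B w"
    using a y x w by (meson inv2_cell cancel_left_inv vcomp_cell)
  finally show ?thesis .
qed

end

section \<open>The bicategory with reversed 2-cells\<close>

lemma co_simps [simp]:
  "Obj (co B) = Obj B" "Arr (co B) = Arr B" "Cell (co B) = Cell B" "src (co B) = src B"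
  "trg (co B) = trg B" "vdom (co B) = vcod B" "vcod (co B) = vdom B" "id1 (co B) = id1 B"
  "comp1 (co B) = comp1 B" "id2 (co B) = id2 B" "vcomp (co B) = (\<lambda>\<tau> \<sigma>. vcomp B \<sigma> \<tau>)"
  "hcomp (co B) = hcomp B" "Hom (co B) = Hom B" "Cells (co B) f g = Cells B g f"
  by (auto simp: co_def Hom_def Cells_def fun_eq_iff)

lemma inverse2_co [simp]: "inverse2 (co B) = inverse2 B"
  by (auto simp: inverse2_def fun_eq_iff)

lemma inv2_co [simp]: "inv2 (co B) = inv2 B"
  by (simp add: inv2_def fun_eq_iff)

lemma co_structure_simps [simp]:
  "assoc (co B) h g f = inv2 B (assoc B h g f)" "lunit (co B) f = inv2 B (lunit B f)"
  "runit (co B) f = inv2 B (runit B f)"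
  by (auto simp: co_def)

context bicategory
begin

lemma Isos_co: "Isos (co B) f g = Isos B g f"
  by (auto simp: Isos_def)

text \<open>The structure cells of \<open>co\<close> are inverses and its vertical composition is
  reversed. Inverting an equation of composites also reverses their order, so pentagon and triangle
  are the inverses of the original equations, and the naturality laws follow from
  \<open>inv2_square\<close>.\<close>

lemma bicategory_co: "bicategory (co B)"
proof
  fix f g h x y z w
  show "\<lbrakk>f \<in> Hom (co B) w x; g \<in> Hom (co B) x y; h \<in> Hom (co B) y z\<rbrakk> \<Longrightarrow>
      assoc (co B) h g f \<in> Isos (co B) ((h \<circledcirc>\<^bsub>co B\<^esub> g) \<circledcirc>\<^bsub>co B\<^esub> f) (h \<circledcirc>\<^bsub>co B\<^esub> (g \<circledcirc>\<^bsub>co B\<^esub> f))"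
    "f \<in> Hom (co B) x y \<Longrightarrow> lunit (co B) f \<in> Isos (co B) (id1 (co B) y \<circledcirc>\<^bsub>co B\<^esub> f) f"
    "f \<in> Hom (co B) x y \<Longrightarrow> runit (co B) f \<in> Isos (co B) (f \<circledcirc>\<^bsub>co B\<^esub> id1 (co B) x) f"
    unfolding Isos_co by (auto intro: inv2_iso assoc_iso lunit_iso runit_iso)
next
  fix \<sigma> \<tau> \<upsilon> f f' g g' h h'
  assume "\<sigma> \<in> Cells (co B) f f'" "\<tau> \<in> Cells (co B) g g'" "\<upsilon> \<in> Cells (co B) h h'"
    "trg (co B) f = src (co B) g" "trg (co B) g = src (co B) h"
  then have c: "\<sigma> \<in> Cells B f' f" "\<tau> \<in> Cells B g' g" "\<upsilon> \<in> Cells B h' h"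
    and e: "trg B f = src B g" "trg B g = src B h" by auto
  have e': "trg B f' = src B g'" "trg B g' = src B h'"
    using cell_arr[OF c(1)] cell_arr[OF c(2)] cell_arr[OF c(3)] e by auto
  have H: "f \<in> Hom B (src B f) (trg B f)" "g \<in> Hom B (trg B f) (trg B g)" "h \<in> Hom B (trg B g) (trg B h)"
    "f' \<in> Hom B (src B f') (trg B f')" "g' \<in> Hom B (trg B f') (trg B g')" "h' \<in> Hom B (trg B g') (trg B h')"
    using cell_arr[OF c(1)] cell_arr[OF c(2)] cell_arr[OF c(3)] e e' by (auto simp: Hom_def)
  have cc: "(\<upsilon> \<star> \<tau>) \<star> \<sigma> \<in> Cells B ((h' \<circledcirc> g') \<circledcirc> f') ((h \<circledcirc> g) \<circledcirc> f)"
    "\<upsilon> \<star> (\<tau> \<star> \<sigma>) \<in> Cells B (h' \<circledcirc> (g' \<circledcirc> f')) (h \<circledcirc> (g \<circledcirc> f))"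
    using c e' comp1_hom[OF H(4,5)] comp1_hom[OF H(5,6)]
    by (auto intro!: hcomp_cell simp: Hom_def)
  have "inv2 B (assoc B h g f) \<bullet> (\<upsilon> \<star> (\<tau> \<star> \<sigma>)) = ((\<upsilon> \<star> \<tau>) \<star> \<sigma>) \<bullet> inv2 B (assoc B h' g' f')"
    by (rule inv2_square[OF assoc_iso[OF H(4-6)] assoc_iso[OF H(1-3)] cc assoc_natural[OF c e', symmetric]])
  then show "assoc (co B) h' g' f' \<bullet>\<^bsub>co B\<^esub> ((\<upsilon> \<star>\<^bsub>co B\<^esub> \<tau>) \<star>\<^bsub>co B\<^esub> \<sigma>)
     = (\<upsilon> \<star>\<^bsub>co B\<^esub> (\<tau> \<star>\<^bsub>co B\<^esub> \<sigma>)) \<bullet>\<^bsub>co B\<^esub> assoc (co B) h g f"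
    by simp
next
  fix \<sigma> f f' x y
  assume "\<sigma> \<in> Cells (co B) f f'" "f \<in> Hom (co B) x y"
  then have c: "\<sigma> \<in> Cells B f' f" and H: "f \<in> Hom B x y" "f' \<in> Hom B x y"
    using cell_arr[of \<sigma> f' f] by (auto simp: Hom_def)
  then have xy: "x \<in> Obj B" "y \<in> Obj B"
    using src_obj trg_obj by (auto simp: Hom_def)
  note i = id1_hom[OF xy(1)] id1_hom[OF xy(2)]
  have cc: "id2 B (id1 B y) \<star> \<sigma> \<in> Cells B (id1 B y \<circledcirc> f') (id1 B y \<circledcirc> f)"
    "\<sigma> \<star> id2 B (id1 B x) \<in> Cells B (f' \<circledcirc> id1 B x) (f \<circledcirc> id1 B x)"
    using c H i by (auto intro!: hcomp_cell id2_cell simp: Hom_def)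
  show "lunit (co B) f' \<bullet>\<^bsub>co B\<^esub> (id2 (co B) (id1 (co B) y) \<star>\<^bsub>co B\<^esub> \<sigma>) = \<sigma> \<bullet>\<^bsub>co B\<^esub> lunit (co B) f"
    using inv2_square[OF lunit_iso[OF H(2)] lunit_iso[OF H(1)] cc(1) c lunit_natural[OF c H(2), symmetric]] by simp
  show "runit (co B) f' \<bullet>\<^bsub>co B\<^esub> (\<sigma> \<star>\<^bsub>co B\<^esub> id2 (co B) (id1 (co B) x)) = \<sigma> \<bullet>\<^bsub>co B\<^esub> runit (co B) f"
    using inv2_square[OF runit_iso[OF H(2)] runit_iso[OF H(1)] cc(2) c runit_natural[OF c H(2), symmetric]] by simp
next
  fix f g h k v w x y z
  assume "f \<in> Hom (co B) v w" "g \<in> Hom (co B) w x" "h \<in> Hom (co B) x y" "k \<in> Hom (co B) y z"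
  then have H: "f \<in> Hom B v w" "g \<in> Hom B w x" "h \<in> Hom B x y" "k \<in> Hom B y z" by auto
  note gf = comp1_hom[OF H(1,2)] and hg = comp1_hom[OF H(2,3)] and kh = comp1_hom[OF H(3,4)]
  note hgf = comp1_hom[OF H(1) hg] and khg = comp1_hom[OF hg H(4)]
  have arr: "f \<in> Arr B" "k \<in> Arr B" "trg B f = w" "src B k = y" using H by (auto simp: Hom_def)
  note a1 = assoc_iso[OF H(1-3)] and a2 = assoc_iso[OF H(1) hg H(4)] and a3 = assoc_iso[OF H(2-4)]
    and a4 = assoc_iso[OF gf H(3,4)] and a5 = assoc_iso[OF H(1,2) kh]
  have ka: "id2 B k \<star> assoc B h g f \<in> Isos B (k \<circledcirc> ((h \<circledcirc> g) \<circledcirc> f)) (k \<circledcirc> (h \<circledcirc> (g \<circledcirc> f)))"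
    "inv2 B (id2 B k \<star> assoc B h g f) = id2 B k \<star> inv2 B (assoc B h g f)"
    using hcomp_iso[OF a1 id2_iso[OF arr(2)]] comp1_hom[OF H(1) hg] arr inv2_id2[OF arr(2)] by (auto simp: Hom_def)
  have af: "assoc B k h g \<star> id2 B f \<in> Isos B (((k \<circledcirc> h) \<circledcirc> g) \<circledcirc> f) ((k \<circledcirc> (h \<circledcirc> g)) \<circledcirc> f)"
    "inv2 B (assoc B k h g \<star> id2 B f) = inv2 B (assoc B k h g) \<star> id2 B f"
    using hcomp_iso[OF id2_iso[OF arr(1)] a3] comp1_hom[OF H(2) kh] arr inv2_id2[OF arr(1)] by (auto simp: Hom_def)
  note p = pentagon[OF H]
  have "inv2 B ((id2 B k \<star> assoc B h g f) \<bullet> assoc B k (h \<circledcirc> g) f \<bullet> (assoc B k h g \<star> id2 B f))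
    = ((inv2 B (assoc B k h g) \<star> id2 B f) \<bullet> inv2 B (assoc B k (h \<circledcirc> g) f)) \<bullet> (id2 B k \<star> inv2 B (assoc B h g f))"
    using inv2_vcomp[OF vcomp_iso(1)[OF af(1) a2] ka(1)] inv2_vcomp[OF af(1) a2] af ka by simp
  moreover have "inv2 B (assoc B k h (g \<circledcirc> f) \<bullet> assoc B (k \<circledcirc> h) g f) =
     inv2 B (assoc B (k \<circledcirc> h) g f) \<bullet> inv2 B (assoc B k h (g \<circledcirc> f))"
    by (rule inv2_vcomp[OF a5 a4])
  ultimately show "(id2 (co B) k \<star>\<^bsub>co B\<^esub> assoc (co B) h g f) \<bullet>\<^bsub>co B\<^esub> assoc (co B) k (h \<circledcirc>\<^bsub>co B\<^esub> g) f
      \<bullet>\<^bsub>co B\<^esub> (assoc (co B) k h g \<star>\<^bsub>co B\<^esub> id2 (co B) f)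
      = assoc (co B) k h (g \<circledcirc>\<^bsub>co B\<^esub> f) \<bullet>\<^bsub>co B\<^esub> assoc (co B) (k \<circledcirc>\<^bsub>co B\<^esub> h) g f"
    using p by simp
next
  fix f g x y z
  assume "f \<in> Hom (co B) x y" "g \<in> Hom (co B) y z"
  then have H: "f \<in> Hom B x y" "g \<in> Hom B y z" by auto
  have arr: "f \<in> Arr B" "g \<in> Arr B" "trg B f = y" "src B g = y" and y: "y \<in> Obj B"
    using H trg_obj by (auto simp: Hom_def)
  note i = id1_hom[OF y]
  have s: "src B (g \<circledcirc> id1 B y) = y" "trg B (id1 B y \<circledcirc> f) = y"
    using comp1_hom[OF i H(2)] comp1_hom[OF H(1) i] by (auto simp: Hom_def)
  note a = assoc_iso[OF H(1) i H(2)]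
  have gl: "id2 B g \<star> lunit B f \<in> Isos B (g \<circledcirc> (id1 B y \<circledcirc> f)) (g \<circledcirc> f)"
    "inv2 B (id2 B g \<star> lunit B f) = id2 B g \<star> inv2 B (lunit B f)"
    using hcomp_iso[OF lunit_iso[OF H(1)] id2_iso[OF arr(2)]] inv2_id2[OF arr(2)] arr s by auto
  have rf: "inv2 B (runit B g \<star> id2 B f) = inv2 B (runit B g) \<star> id2 B f"
    using hcomp_iso[OF id2_iso[OF arr(1)] runit_iso[OF H(2)]] inv2_id2[OF arr(1)] arr s by auto
  show "(id2 (co B) g \<star>\<^bsub>co B\<^esub> lunit (co B) f) \<bullet>\<^bsub>co B\<^esub> assoc (co B) g (id1 (co B) y) f
      = runit (co B) g \<star>\<^bsub>co B\<^esub> id2 (co B) f"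
    using inv2_vcomp[OF a gl(1)] gl rf triangle[OF H] by simp
next
  fix \<sigma> f f' \<tau> g g'
  assume "\<sigma> \<in> Cells (co B) f f'" "\<tau> \<in> Cells (co B) g g'" "trg (co B) f = src (co B) g"
  then show "\<tau> \<star>\<^bsub>co B\<^esub> \<sigma> \<in> Cells (co B) (g \<circledcirc>\<^bsub>co B\<^esub> f) (g' \<circledcirc>\<^bsub>co B\<^esub> f')"
    using hcomp_cell cell_arr by fastforce
next
  fix \<sigma> f f' \<sigma>' f'' \<tau> g g' \<tau>' g''
  assume "\<sigma> \<in> Cells (co B) f f'" "\<sigma>' \<in> Cells (co B) f' f''" "\<tau> \<in> Cells (co B) g g'"
    "\<tau>' \<in> Cells (co B) g' g''" "trg (co B) f = src (co B) g"
  then have c: "\<sigma> \<in> Cells B f' f" "\<sigma>' \<in> Cells B f'' f'" "\<tau> \<in> Cells B g' g" "\<tau>' \<in> Cells B g'' g'"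
    and "trg B f'' = src B g''"
    using cell_arr[of \<sigma> f' f] cell_arr[of \<sigma>' f'' f'] cell_arr[of \<tau> g' g] cell_arr[of \<tau>' g'' g'] by auto
  then show "(\<tau>' \<bullet>\<^bsub>co B\<^esub> \<tau>) \<star>\<^bsub>co B\<^esub> (\<sigma>' \<bullet>\<^bsub>co B\<^esub> \<sigma>) =
    (\<tau>' \<star>\<^bsub>co B\<^esub> \<sigma>') \<bullet>\<^bsub>co B\<^esub> (\<tau> \<star>\<^bsub>co B\<^esub> \<sigma>)"
    using interchange[OF c(2,1,4,3)] by simp
next
  fix \<sigma>
  assume "\<sigma> \<in> Cell (co B)"
  then show "vdom (co B) \<sigma> \<in> Arr (co B) \<and>
    vcod (co B) \<sigma> \<in> Hom (co B) (src (co B) (vdom (co B) \<sigma>)) (trg (co B) (vdom (co B) \<sigma>))"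
    using cell_boundary[of \<sigma>] by (auto simp: Hom_def)
qed (simp_all add: src_obj trg_obj id1_hom comp1_hom id2_cell vcomp_cell hcomp_id
      vcomp_id_left vcomp_id_right vcomp_assoc)

end

section \<open>Full sub-bicategories\<close>

lemma full_subbicat_simps [simp]:
  "Obj (full_subbicat B S) = Obj B \<inter> S" "src (full_subbicat B S) = src B"
  "trg (full_subbicat B S) = trg B" "vdom (full_subbicat B S) = vdom B" "vcod (full_subbicat B S) = vcod B"
  "id1 (full_subbicat B S) = id1 B" "comp1 (full_subbicat B S) = comp1 B" "id2 (full_subbicat B S) = id2 B"
  "vcomp (full_subbicat B S) = vcomp B" "hcomp (full_subbicat B S) = hcomp B"
  "assoc (full_subbicat B S) = assoc B" "lunit (full_subbicat B S) = lunit B"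
  "runit (full_subbicat B S) = runit B"
  "Arr (full_subbicat B S) = {f \<in> Arr B. src B f \<in> S \<and> trg B f \<in> S}"
  "Cell (full_subbicat B S) = {\<sigma> \<in> Cell B. src B (vdom B \<sigma>) \<in> S \<and> trg B (vdom B \<sigma>) \<in> S}"
  "f \<in> Hom (full_subbicat B S) x y \<longleftrightarrow> f \<in> Hom B x y \<and> x \<in> S \<and> y \<in> S"
  "\<sigma> \<in> Cells (full_subbicat B S) f g \<longleftrightarrow> \<sigma> \<in> Cells B f g \<and> src B f \<in> S \<and> trg B f \<in> S"
  by (auto simp: full_subbicat_def Hom_def Cells_def)

text \<open>Fullness at work: an inverse has the same source and target objects as the cell itself,
  so it lies in the sub-bicategory as soon as the cell does.\<close>

lemma (in bicategory) Isos_full_subbicat [simp]: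
  "\<sigma> \<in> Isos (full_subbicat B S) f g \<longleftrightarrow> \<sigma> \<in> Isos B f g \<and> src B f \<in> S \<and> trg B f \<in> S"
proof -
  have "inverse2 (full_subbicat B S) \<sigma> \<tau> \<longleftrightarrow> inverse2 B \<sigma> \<tau>"
    if "\<sigma> \<in> Cells B f g" "src B f \<in> S" "trg B f \<in> S" for \<tau>
    using that cell_arr[OF that(1)] by (auto simp: inverse2_def Cells_def)
  then show ?thesis
    by (auto simp: Isos_def)
qed

lemma (in bicategory) inv2_full_subbicat:
  assumes "\<sigma> \<in> Isos B f g" "src B f \<in> S" "trg B f \<in> S"
  shows "inv2 (full_subbicat B S) \<sigma> = inv2 B \<sigma>"
proof -
  have "inverse2 (full_subbicat B S) \<sigma> = inverse2 B \<sigma>"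
    using assms cell_arr[OF IsosD[OF assms(1)]] Cells_boundary[OF IsosD[OF assms(1)]]
    by (auto simp: inverse2_def fun_eq_iff)
  then show ?thesis
    by (simp add: inv2_def)
qed

lemma (in bicategory) bicategory_full_subbicat: "bicategory (full_subbicat B S)"
proof -
  let ?F = "full_subbicat B S"
  show ?thesis
  proof
    fix \<sigma>
    assume "\<sigma> \<in> Cell ?F"
    then show "vdom ?F \<sigma> \<in> Arr ?F \<and> vcod ?F \<sigma> \<in>
      Hom ?F (src ?F (vdom ?F \<sigma>))
        (trg ?F (vdom ?F \<sigma>))"
      using cell_boundary[of \<sigma>] by (auto simp: full_subbicat_def Hom_def)
  next
    fix f g h w x y z
    assume "f \<in> Hom ?F w x" "g \<in> Hom ?F x y" "h \<in> Hom ?F y z"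
    then have H: "f \<in> Hom B w x" "g \<in> Hom B x y" "h \<in> Hom B y z" and S: "w \<in> S" "x \<in> S" "y \<in> S" "z \<in> S"
      by auto
    show "assoc ?F h g f \<in> Isos ?F
       ((h \<circledcirc>\<^bsub>?F\<^esub> g) \<circledcirc>\<^bsub>?F\<^esub> f) (h \<circledcirc>\<^bsub>?F\<^esub> (g \<circledcirc>\<^bsub>?F\<^esub> f))"
      using assoc_iso[OF H] comp1_hom[OF H(1) comp1_hom[OF H(2,3)]] S by (auto simp: Hom_def)
  next
    fix f x y
    assume "f \<in> Hom ?F x y"
    then have H: "f \<in> Hom B x y" and S: "x \<in> S" "y \<in> S" and o: "x \<in> Obj B" "y \<in> Obj B"
      using src_obj trg_obj by (auto simp: Hom_def)
    show "lunit ?F f \<in> Isos ?F (id1 ?F y \<circledcirc>\<^bsub>?F\<^esub> f) f"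
      using lunit_iso[OF H] comp1_hom[OF H id1_hom[OF o(2)]] S by (auto simp: Hom_def)
    show "runit ?F f \<in> Isos ?F (f \<circledcirc>\<^bsub>?F\<^esub> id1 ?F x) f"
      using runit_iso[OF H] comp1_hom[OF id1_hom[OF o(1)] H] S by (auto simp: Hom_def)
  next
    fix \<sigma> f f' \<tau> g g'
    assume a: "\<sigma> \<in> Cells ?F f f'" "\<tau> \<in> Cells ?F g g'"
      "trg ?F f = src ?F g"
    then have "f \<in> Hom B (src B f) (trg B f)" "g \<in> Hom B (trg B f) (trg B g)"
      using cell_arr by (auto simp: Hom_def)
    from comp1_hom[OF this] a
    show "\<tau> \<star>\<^bsub>?F\<^esub> \<sigma> \<in> Cells ?F (g \<circledcirc>\<^bsub>?F\<^esub> f) (g' \<circledcirc>\<^bsub>?F\<^esub> f')"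
      using hcomp_cell[of \<sigma> f f' \<tau> g g'] by (auto simp: Hom_def)
  next
    fix \<sigma> f f' \<tau> g g' \<upsilon> h h'
    assume "\<sigma> \<in> Cells ?F f f'" "\<tau> \<in> Cells ?F g g'"
      "\<upsilon> \<in> Cells ?F h h'"
      "trg ?F f = src ?F g" "trg ?F g = src ?F h"
    then show "assoc ?F h' g' f' \<bullet>\<^bsub>?F\<^esub> ((\<upsilon> \<star>\<^bsub>?F\<^esub> \<tau>) \<star>\<^bsub>?F\<^esub> \<sigma>)
       = (\<upsilon> \<star>\<^bsub>?F\<^esub> (\<tau> \<star>\<^bsub>?F\<^esub> \<sigma>)) \<bullet>\<^bsub>?F\<^esub> assoc ?F h g f"
      using assoc_natural[of \<sigma> f f' \<tau> g g' \<upsilon> h h'] by simp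
  next
    fix f g h k v w x y z
    assume "f \<in> Hom ?F v w" "g \<in> Hom ?F w x" "h \<in> Hom ?F x y" "k \<in> Hom ?F y z"
    then show "(id2 ?F k \<star>\<^bsub>?F\<^esub> assoc ?F h g f) \<bullet>\<^bsub>?F\<^esub> assoc ?F k (h \<circledcirc>\<^bsub>?F\<^esub> g) f
        \<bullet>\<^bsub>?F\<^esub> (assoc ?F k h g \<star>\<^bsub>?F\<^esub> id2 ?F f)
        = assoc ?F k h (g \<circledcirc>\<^bsub>?F\<^esub> f) \<bullet>\<^bsub>?F\<^esub> assoc ?F (k \<circledcirc>\<^bsub>?F\<^esub> h) g f"
      using pentagon[of f v w g x h y k z] by simp
  qed (auto simp: src_obj trg_obj id1_hom comp1_hom id2_cell vcomp_cell hcomp_id interchange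
    lunit_natural runit_natural triangle vcomp_id_left vcomp_id_right
    dest: vcomp_assoc cell_arr)
qed

section \<open>Tensor products\<close>

lemma inj_on_encode:
  assumes "S \<lesssim> (UNIV :: 'u set)"
  shows "inj_on (encode S :: 'x \<Rightarrow> 'u) S"
proof -
  have "\<exists>e :: 'x \<Rightarrow> 'u. inj_on e S"
    using assms by (auto simp: lepoll_def)
  then show ?thesis
    unfolding encode_def by (rule someI_ex)
qed

lemma decode_encode:
  assumes "S \<lesssim> (UNIV :: 'u set)" "x \<in> S"
  shows "decode S (encode S x :: 'u) = x"
  unfolding decode_def using inj_on_encode[OF assms(1)] assms(2) by (rule inv_into_f_f)

lemma times_UNIV_lepoll:
  assumes "infinite (UNIV :: 'u set)"
  shows "(UNIV :: ('u \<times> 'u) set) \<approx> (UNIV :: 'u set)"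
  using card_of_Times_same_infinite[OF assms] by (simp add: eqpoll_iff_card_of_ordIso)

text \<open>The free abelian group on an infinite set has the cardinality of that set, and an
  infinite type has as many pairs as elements. The tensor quotient is an image of a subset of such a
  free group, so it can be coded.\<close>

lemma tensor_quot_lepoll:
  fixes M N :: "('k, 'u) bimodule"
  assumes "infinite (UNIV :: 'u set)"
  shows "carrier (tensor_quot M N) \<lesssim> (UNIV :: 'u set)"
proof -
  have "infinite (UNIV :: ('u \<times> 'u) set)"
    using assms by (simp add: finite_prod)
  then have "carrier (free_Abelian_group (UNIV :: ('u \<times> 'u) set)) \<approx> (UNIV :: ('u \<times> 'u) set)"
    by (rule eqpoll_free_Abelian_group_infinite)
  also note times_UNIV_lepoll[OF assms]
  finally have 1: "carrier (free_Abelian_group (UNIV :: ('u \<times> 'u) set)) \<lesssim> (UNIV :: 'u set)"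
    by (rule eqpoll_imp_lepoll)
  have 2: "carrier (tensor_free M N) \<lesssim> carrier (free_Abelian_group (UNIV :: ('u \<times> 'u) set))"
    unfolding tensor_free_def by (intro subset_imp_lepoll subsetI) simp
  have "carrier (tensor_quot M N) \<lesssim> carrier (tensor_free M N)"
    unfolding tensor_quot_def carrier_FactGroup by (rule image_lepoll)
  from lepoll_trans[OF lepoll_trans[OF this 2] 1] show ?thesis .
qed

section \<open>The universal property of the tensor product\<close>

definition balanced ::
  "('k, 'u) bimodule \<Rightarrow> ('k, 'u) bimodule \<Rightarrow> ('v, 'x) monoid_scheme \<Rightarrow> ('u \<Rightarrow> 'u \<Rightarrow> 'v) \<Rightarrow> bool" where
  "balanced M N G \<beta> \<longleftrightarrow>
    (\<forall>m\<in>carrier M. \<forall>n\<in>carrier N. \<beta> m n \<in> carrier G) \<and>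
    (\<forall>m\<in>carrier M. \<forall>m'\<in>carrier M. \<forall>n\<in>carrier N. \<beta> (m \<oplus>\<^bsub>M\<^esub> m') n = \<beta> m n \<otimes>\<^bsub>G\<^esub> \<beta> m' n) \<and>
    (\<forall>m\<in>carrier M. \<forall>n\<in>carrier N. \<forall>n'\<in>carrier N. \<beta> m (n \<oplus>\<^bsub>N\<^esub> n') = \<beta> m n \<otimes>\<^bsub>G\<^esub> \<beta> m n') \<and>
    (\<forall>m\<in>carrier M. \<forall>b\<in>carrier (ralg M). \<forall>n\<in>carrier N. \<beta> (ract M m b) n = \<beta> m (lact N b n))"

lemma balancedI:
  assumes "\<And>m n. \<lbrakk>m \<in> carrier M; n \<in> carrier N\<rbrakk> \<Longrightarrow> \<beta> m n \<in> carrier G"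
    and "\<And>m m' n. \<lbrakk>m \<in> carrier M; m' \<in> carrier M; n \<in> carrier N\<rbrakk> \<Longrightarrow> \<beta> (m \<oplus>\<^bsub>M\<^esub> m') n = \<beta> m n \<otimes>\<^bsub>G\<^esub> \<beta> m' n"
    and "\<And>m n n'. \<lbrakk>m \<in> carrier M; n \<in> carrier N; n' \<in> carrier N\<rbrakk> \<Longrightarrow> \<beta> m (n \<oplus>\<^bsub>N\<^esub> n') = \<beta> m n \<otimes>\<^bsub>G\<^esub> \<beta> m n'"
    and "\<And>m b n. \<lbrakk>m \<in> carrier M; b \<in> carrier (ralg M); n \<in> carrier N\<rbrakk> \<Longrightarrow> \<beta> (ract M m b) n = \<beta> m (lact N b n)"
  shows "balanced M N G \<beta>"
  using assms by (simp add: balanced_def)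

lemma carrier_tensor: "carrier (tensor_group M N) = carrier (tensor M N)"
  and mult_tensor: "monoid.mult (tensor_group M N) = ring.add (tensor M N)"
  and one_tensor: "monoid.one (tensor_group M N) = ring.zero (tensor M N)"
  by (simp_all add: tensor_def Let_def)

lemma hom_from_tensor_group: "hom (tensor_group M N) G = hom (add_monoid (tensor M N)) G"
  by (simp add: hom_def carrier_tensor mult_tensor)

lemma hom_to_tensor_group: "hom G (tensor_group M N) = hom G (add_monoid (tensor M N))"
  by (simp add: hom_def carrier_tensor mult_tensor)

lemma (in group) eq_of_quotient:
  assumes "x \<in> carrier G" "y \<in> carrier G" "x \<otimes> inv y = \<one>"
  shows "x = y"
  using assms inv_equality[of x "inv y"] by simp

lemma (in comm_group) eq_mult_of_quotient:
  assumes "x \<in> carrier G" "y \<in> carrier G" "z \<in> carrier G" "x \<otimes> inv y \<otimes> inv z = \<one>"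
  shows "x = y \<otimes> z"
  by (rule eq_of_quotient) (use assms in \<open>simp_all add: inv_mult m_assoc[symmetric]\<close>)

lemma (in comm_group) quotient_mult:
  assumes "x \<in> carrier G" "y \<in> carrier G"
  shows "x \<otimes> y \<otimes> inv x \<otimes> inv y = \<one>"
proof -
  have "x \<otimes> y \<otimes> inv x = y"
    using assms m_comm[of x y] by (simp add: m_assoc)
  then show ?thesis
    using assms by simp
qed

locale morita =
  fixes K :: "'k ring" and U :: "'u itself"
  assumes field_K: "field K" and infinite_U: "infinite (UNIV :: 'u set)"
begin

abbreviation bim :: "('k, 'u) bimodule \<Rightarrow> bool" where
  "bim M \<equiv> fd_bimodule K M"

abbreviation alg :: "('k, 'u) module \<Rightarrow> bool" where
  "alg A \<equiv> fd_algebra K A"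

lemma cring_K: "cring K"
  using field_K by (simp add: field_def domain_def)

lemma bim_module: "bim M \<Longrightarrow> module K M"
  by (simp add: fd_bimodule_def)

lemma bim_alg [simp]: "bim M \<Longrightarrow> alg (lalg M)" "bim M \<Longrightarrow> alg (ralg M)"
  by (simp_all add: fd_bimodule_def)

lemma alg_module: "alg A \<Longrightarrow> module K A"
  by (simp add: fd_algebra_def)

lemma alg_ring: "alg A \<Longrightarrow> ring A"
  by (simp add: fd_algebra_def)

lemma bim_group: "bim M \<Longrightarrow> abelian_group M"
  using module.axioms(2)[OF bim_module] .

lemma bim_comm_group: "bim M \<Longrightarrow> comm_group (add_monoid M)"
  using bim_group abelian_group.a_comm_group by blast

lemma bim_add [simp]:
  assumes "bim M"
  shows "\<zero>\<^bsub>M\<^esub> \<in> carrier M"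
    and "\<lbrakk>x \<in> carrier M; y \<in> carrier M\<rbrakk> \<Longrightarrow> x \<oplus>\<^bsub>M\<^esub> y \<in> carrier M"
    and "x \<in> carrier M \<Longrightarrow> x \<oplus>\<^bsub>M\<^esub> \<zero>\<^bsub>M\<^esub> = x"
    and "x \<in> carrier M \<Longrightarrow> \<zero>\<^bsub>M\<^esub> \<oplus>\<^bsub>M\<^esub> x = x"
    and "x \<in> carrier M \<Longrightarrow> \<ominus>\<^bsub>M\<^esub> x \<in> carrier M"
    and "x \<in> carrier M \<Longrightarrow> \<ominus>\<^bsub>M\<^esub> x \<oplus>\<^bsub>M\<^esub> x = \<zero>\<^bsub>M\<^esub>"
    and "x \<in> carrier M \<Longrightarrow> x \<oplus>\<^bsub>M\<^esub> \<ominus>\<^bsub>M\<^esub> x = \<zero>\<^bsub>M\<^esub>"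
  using bim_group[OF assms]
  by (simp_all add: abelian_group.a_inv_closed abelian_group.l_neg abelian_group.r_neg
      abelian_monoid.zero_closed abelian_monoid.a_closed abelian_monoid.l_zero abelian_monoid.r_zero
      abelian_group.axioms(1))

lemma alg_simps [simp]:
  assumes "alg A"
  shows "\<zero>\<^bsub>A\<^esub> \<in> carrier A" "\<one>\<^bsub>A\<^esub> \<in> carrier A"
    and "\<lbrakk>x \<in> carrier A; y \<in> carrier A\<rbrakk> \<Longrightarrow> x \<oplus>\<^bsub>A\<^esub> y \<in> carrier A"
    and "\<lbrakk>x \<in> carrier A; y \<in> carrier A\<rbrakk> \<Longrightarrow> x \<otimes>\<^bsub>A\<^esub> y \<in> carrier A"
    and "x \<in> carrier A \<Longrightarrow> \<one>\<^bsub>A\<^esub> \<otimes>\<^bsub>A\<^esub> x = x"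
    and "x \<in> carrier A \<Longrightarrow> x \<otimes>\<^bsub>A\<^esub> \<one>\<^bsub>A\<^esub> = x"
    and "\<lbrakk>c \<in> carrier K; x \<in> carrier A\<rbrakk> \<Longrightarrow> c \<odot>\<^bsub>A\<^esub> x \<in> carrier A"
proof -
  interpret ring A using assms by (rule alg_ring)
  show "\<zero>\<^bsub>A\<^esub> \<in> carrier A" "\<one>\<^bsub>A\<^esub> \<in> carrier A"
    "\<lbrakk>x \<in> carrier A; y \<in> carrier A\<rbrakk> \<Longrightarrow> x \<oplus>\<^bsub>A\<^esub> y \<in> carrier A"
    "\<lbrakk>x \<in> carrier A; y \<in> carrier A\<rbrakk> \<Longrightarrow> x \<otimes>\<^bsub>A\<^esub> y \<in> carrier A"
    "x \<in> carrier A \<Longrightarrow> \<one>\<^bsub>A\<^esub> \<otimes>\<^bsub>A\<^esub> x = x"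
    "x \<in> carrier A \<Longrightarrow> x \<otimes>\<^bsub>A\<^esub> \<one>\<^bsub>A\<^esub> = x"
    by auto
  show "\<lbrakk>c \<in> carrier K; x \<in> carrier A\<rbrakk> \<Longrightarrow> c \<odot>\<^bsub>A\<^esub> x \<in> carrier A"
    using module.smult_closed[OF alg_module[OF assms]] by blast
qed

lemma bim_closed [simp]:
  "\<lbrakk>bim M; a \<in> carrier (lalg M); m \<in> carrier M\<rbrakk> \<Longrightarrow> lact M a m \<in> carrier M"
  "\<lbrakk>bim M; m \<in> carrier M; b \<in> carrier (ralg M)\<rbrakk> \<Longrightarrow> ract M m b \<in> carrier M"
  "\<lbrakk>bim M; c \<in> carrier K; m \<in> carrier M\<rbrakk> \<Longrightarrow> c \<odot>\<^bsub>M\<^esub> m \<in> carrier M"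
  "\<lbrakk>bim M; m \<in> carrier M\<rbrakk> \<Longrightarrow> lact M \<one>\<^bsub>lalg M\<^esub> m = m"
  "\<lbrakk>bim M; m \<in> carrier M\<rbrakk> \<Longrightarrow> ract M m \<one>\<^bsub>ralg M\<^esub> = m"
  by (simp_all add: fd_bimodule.lact_closed fd_bimodule.ract_closed fd_bimodule.lact_one
      fd_bimodule.ract_one module.smult_closed[OF bim_module])

context
  fixes M N :: "('k, 'u) bimodule"
  assumes M: "bim M" and N: "bim N" and alg_eq: "ralg M = lalg N"
begin

interpretation F: comm_group "tensor_free M N"
  unfolding tensor_free_def by (rule abelian_free_Abelian_group)

lemma tensor_rel_subgroup: "subgroup (tensor_rel M N) (tensor_free M N)"
proof -
  have "frag_of p - frag_of q - frag_of r \<in> carrier (tensor_free M N)"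
    "frag_of p - frag_of q \<in> carrier (tensor_free M N)"
    if "p \<in> carrier M \<times> carrier N" "q \<in> carrier M \<times> carrier N" "r \<in> carrier M \<times> carrier N" for p q r
    using that keys_diff[of "frag_of p - frag_of q" "frag_of r"] keys_diff[of "frag_of p" "frag_of q"]
    by (auto simp: tensor_free_def subset_iff split: if_splits)
  then show ?thesis
    unfolding tensor_rel_def
    by (intro F.generate_is_subgroup) (use M N alg_eq in auto)
qed

lemma tensor_rel_normal: "tensor_rel M N \<lhd> tensor_free M N"
  using tensor_rel_subgroup by (simp add: F.normal_iff_subgroup)

interpretation Q: comm_group "tensor_quot M N"
  unfolding tensor_quot_def by (rule F.abelian_FactGroup[OF tensor_rel_subgroup])

abbreviation "enc \<equiv> (encode (carrier (tensor_quot M N)) :: _ \<Rightarrow> 'u)"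
abbreviation "cls x \<equiv> tensor_rel M N #>\<^bsub>tensor_free M N\<^esub> x"

lemma enc_iso: "enc \<in> iso (tensor_quot M N) (tensor_group M N)"
proof -
  note le = tensor_quot_lepoll[OF infinite_U, of M N]
  show ?thesis
    by (rule isoI[OF homI])
      (auto simp: tensor_group_def Let_def decode_encode[OF le] bij_betw_def inj_on_encode[OF le])
qed

lemma comm_group_tensor_group: "comm_group (tensor_group M N)"
proof -
  \<comment> \<open>The transport of a group structure along an isomorphism yields the target with
    its unit overwritten by the image of the unit; here the overwriting changes nothing.\<close>
  have "tensor_group M N = (tensor_group M N)\<lparr>one := enc \<one>\<^bsub>tensor_quot M N\<^esub>\<rparr>"
    by (simp add: tensor_group_def Let_def)
  then show ?thesis
    using Q.iso_imp_img_comm_group[OF enc_iso] by metis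
qed

interpretation T: comm_group "tensor_group M N"
  by (rule comm_group_tensor_group)

lemma abelian_group_tensor: "abelian_group (tensor M N)"
proof (rule abelian_groupI)
  fix x assume "x \<in> carrier (tensor M N)"
  then show "\<exists>y\<in>carrier (tensor M N). y \<oplus>\<^bsub>tensor M N\<^esub> x = \<zero>\<^bsub>tensor M N\<^esub>"
    unfolding carrier_tensor[symmetric] mult_tensor[symmetric] one_tensor[symmetric]
    using T.l_inv T.inv_closed by blast
qed (auto simp: carrier_tensor[symmetric] mult_tensor[symmetric] one_tensor[symmetric] T.m_assoc T.m_comm T.m_lcomm)

lemma enc_cls_hom: "(\<lambda>x. enc (cls x)) \<in> hom (tensor_free M N) (tensor_group M N)"
proof -
  have "cls \<in> hom (tensor_free M N) (tensor_quot M N)"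
    unfolding tensor_quot_def by (rule normal.r_coset_hom_Mod[OF tensor_rel_normal])
  moreover have "enc \<in> hom (tensor_quot M N) (tensor_group M N)"
    using enc_iso by (simp add: iso_def)
  ultimately show ?thesis
    using Group.hom_compose by (fastforce simp: comp_def)
qed

lemma pure_tensor_eq: "pure_tensor M N m n = enc (cls (frag_of (m, n)))"
  by (simp add: pure_tensor_def)

lemma pure_closed: "\<lbrakk>m \<in> carrier M; n \<in> carrier N\<rbrakk> \<Longrightarrow> pure_tensor M N m n \<in> carrier (tensor M N)"
  using hom_in_carrier[OF enc_cls_hom, of "frag_of (m, n)"]
  by (auto simp: pure_tensor_eq carrier_tensor tensor_free_def)

lemma frag_in: "\<lbrakk>m \<in> carrier M; n \<in> carrier N\<rbrakk> \<Longrightarrow> frag_of (m, n) \<in> carrier (tensor_free M N)"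
  by (auto simp: tensor_free_def)

text \<open>The defining relations are differences of generators; this rule turns each of them into
  an equation in the tensor group.\<close>

lemma enc_cls_minus:
  assumes "x \<in> carrier (tensor_free M N)" "y \<in> carrier (tensor_free M N)"
  shows "enc (cls (x - y)) = enc (cls x) \<otimes>\<^bsub>tensor_group M N\<^esub> inv\<^bsub>tensor_group M N\<^esub> enc (cls y)"
proof -
  interpret h: group_hom "tensor_free M N" "tensor_group M N" "\<lambda>x. enc (cls x)"
    using enc_cls_hom by unfold_locales
  have "x - y = x \<otimes>\<^bsub>tensor_free M N\<^esub> inv\<^bsub>tensor_free M N\<^esub> y"
    using assms by (simp add: tensor_free_def)
  then show ?thesis
    using assms by (simp del: F.inv_mult_group)
qed

lemma minus_in:
  assumes "x \<in> carrier (tensor_free M N)" "y \<in> carrier (tensor_free M N)"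
  shows "x - y \<in> carrier (tensor_free M N)"
  using assms keys_diff[of x y] by (auto simp: tensor_free_def)

lemma enc_cls_rel:
  assumes "x \<in> tensor_rel M N"
  shows "enc (cls x) = \<one>\<^bsub>tensor_group M N\<^esub>"
proof -
  have "cls x = tensor_rel M N"
    using F.coset_join2[OF _ tensor_rel_subgroup assms] subgroup.subset[OF tensor_rel_subgroup] assms by blast
  then show ?thesis
    by (simp add: tensor_group_def Let_def tensor_quot_def)
qed

lemma pure_add_left:
  assumes "m \<in> carrier M" "m' \<in> carrier M" "n \<in> carrier N"
  shows "pure_tensor M N (m \<oplus>\<^bsub>M\<^esub> m') n = pure_tensor M N m n \<oplus>\<^bsub>tensor M N\<^esub> pure_tensor M N m' n"
proof -
  have "frag_of (m \<oplus>\<^bsub>M\<^esub> m', n) - frag_of (m, n) - frag_of (m', n) \<in> tensor_rel M N"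
    unfolding tensor_rel_def by (rule generate.incl) (use assms in blast)
  from enc_cls_rel[OF this] show ?thesis
    using assms unfolding pure_tensor_eq mult_tensor[symmetric]
    by (rule_tac T.eq_mult_of_quotient)
      (simp_all add: frag_in minus_in enc_cls_minus pure_closed[unfolded pure_tensor_eq] carrier_tensor M N)
qed

lemma pure_add_right:
  assumes "m \<in> carrier M" "n \<in> carrier N" "n' \<in> carrier N"
  shows "pure_tensor M N m (n \<oplus>\<^bsub>N\<^esub> n') = pure_tensor M N m n \<oplus>\<^bsub>tensor M N\<^esub> pure_tensor M N m n'"
proof -
  have "frag_of (m, n \<oplus>\<^bsub>N\<^esub> n') - frag_of (m, n) - frag_of (m, n') \<in> tensor_rel M N"
    unfolding tensor_rel_def by (rule generate.incl) (use assms in blast)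
  from enc_cls_rel[OF this] show ?thesis
    using assms unfolding pure_tensor_eq mult_tensor[symmetric]
    by (rule_tac T.eq_mult_of_quotient)
      (simp_all add: frag_in minus_in enc_cls_minus pure_closed[unfolded pure_tensor_eq] carrier_tensor M N)
qed

lemma pure_balanced:
  assumes "m \<in> carrier M" "b \<in> carrier (ralg M)" "n \<in> carrier N"
  shows "pure_tensor M N (ract M m b) n = pure_tensor M N m (lact N b n)"
proof -
  have "frag_of (ract M m b, n) - frag_of (m, lact N b n) \<in> tensor_rel M N"
    unfolding tensor_rel_def by (rule generate.incl) (use assms in blast)
  from enc_cls_rel[OF this] show ?thesis
    using assms unfolding pure_tensor_eq mult_tensor[symmetric]
    by (rule_tac T.eq_of_quotient)
      (simp_all add: frag_in minus_in enc_cls_minus pure_closed[unfolded pure_tensor_eq] carrier_tensor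
        M N alg_eq)
qed

text \<open>Negatives of pure tensors are again pure tensors. This is what lets the induction rule
  for tensors do without a case for inverses.\<close>

lemma pure_minus_left:
  assumes "m \<in> carrier M" "n \<in> carrier N"
  shows "pure_tensor M N (\<ominus>\<^bsub>M\<^esub> m) n = inv\<^bsub>tensor_group M N\<^esub> pure_tensor M N m n"
proof -
  have c: "pure_tensor M N \<zero>\<^bsub>M\<^esub> n \<in> carrier (tensor_group M N)"
    "pure_tensor M N m n \<in> carrier (tensor_group M N)"
    "pure_tensor M N (\<ominus>\<^bsub>M\<^esub> m) n \<in> carrier (tensor_group M N)"
    using assms M pure_closed by (auto simp: carrier_tensor)
  have "pure_tensor M N \<zero>\<^bsub>M\<^esub> n \<otimes>\<^bsub>tensor_group M N\<^esub> pure_tensor M N \<zero>\<^bsub>M\<^esub> n = pure_tensor M N \<zero>\<^bsub>M\<^esub> n"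
    using pure_add_left[of "\<zero>\<^bsub>M\<^esub>" "\<zero>\<^bsub>M\<^esub>" n] assms M by (simp add: mult_tensor)
  then have "pure_tensor M N \<zero>\<^bsub>M\<^esub> n = \<one>\<^bsub>tensor_group M N\<^esub>"
    using c by simp
  moreover have "pure_tensor M N (\<ominus>\<^bsub>M\<^esub> m) n \<otimes>\<^bsub>tensor_group M N\<^esub> pure_tensor M N m n = pure_tensor M N \<zero>\<^bsub>M\<^esub> n"
    using pure_add_left[of "\<ominus>\<^bsub>M\<^esub> m" m n] assms M by (simp add: mult_tensor)
  ultimately show ?thesis
    using c T.inv_equality by metis
qed

lemma tensor_induct [consumes 1, case_names pure add]:
  assumes x: "x \<in> carrier (tensor M N)"
    and pure: "\<And>m n. \<lbrakk>m \<in> carrier M; n \<in> carrier N\<rbrakk> \<Longrightarrow> P (pure_tensor M N m n)"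
    and add: "\<And>s t. \<lbrakk>s \<in> carrier (tensor M N); t \<in> carrier (tensor M N); P s; P t\<rbrakk> \<Longrightarrow> P (s \<oplus>\<^bsub>tensor M N\<^esub> t)"
  shows "P x"
proof -
  obtain c where c: "c \<in> carrier (tensor_free M N)" "x = enc (cls c)"
    using x by (auto simp: carrier_tensor[symmetric] tensor_group_def Let_def tensor_quot_def carrier_FactGroup)
  \<comment> \<open>Induction over a free abelian group proceeds by differences. Asking for
    \<open>P\<close> at the inverse as well makes the property stable under them, although the rule
    itself offers only sums.\<close>
  define S where "S y \<longleftrightarrow> y \<in> carrier (tensor_group M N) \<and> P y \<and> P (inv\<^bsub>tensor_group M N\<^esub> y)" for y
  have S_mult: "S (y \<otimes>\<^bsub>tensor_group M N\<^esub> z)" if "S y" "S z" for y z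
  proof -
    have c: "y \<in> carrier (tensor_group M N)" "z \<in> carrier (tensor_group M N)"
      using that by (auto simp: S_def)
    have "P (y \<otimes>\<^bsub>tensor_group M N\<^esub> z)" "P (inv\<^bsub>tensor_group M N\<^esub> y \<otimes>\<^bsub>tensor_group M N\<^esub> inv\<^bsub>tensor_group M N\<^esub> z)"
      using add[of y z] add[of "inv\<^bsub>tensor_group M N\<^esub> y" "inv\<^bsub>tensor_group M N\<^esub> z"] that c
      by (auto simp: S_def carrier_tensor[symmetric] mult_tensor[symmetric])
    then show ?thesis
      using c by (simp add: S_def T.inv_mult)
  qed
  have S_inv: "S (inv\<^bsub>tensor_group M N\<^esub> y)" if "S y" for y
    using that by (simp add: S_def)
  have S_pure: "S (pure_tensor M N m n)" if "m \<in> carrier M" "n \<in> carrier N" for m n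
    using that pure[of m n] pure[of "\<ominus>\<^bsub>M\<^esub> m" n] pure_closed M
    by (simp add: S_def carrier_tensor pure_minus_left)
  have "Poly_Mapping.keys c \<subseteq> carrier M \<times> carrier N"
    using c by (simp add: tensor_free_def)
  then have "S (enc (cls c)) \<and> Poly_Mapping.keys c \<subseteq> carrier M \<times> carrier N"
  proof (induction c rule: frag_induction)
    case zero
    \<comment> \<open>Zero is not a case of the rule either; it is reached as the pure tensor of two
      zeros minus itself.\<close>
    have "S (pure_tensor M N \<zero>\<^bsub>M\<^esub> \<zero>\<^bsub>N\<^esub>)" by (rule S_pure) (use M N in auto)
    from S_mult[OF this S_inv[OF this]] have "S \<one>\<^bsub>tensor_group M N\<^esub>"
      using \<open>S (pure_tensor M N \<zero>\<^bsub>M\<^esub> \<zero>\<^bsub>N\<^esub>)\<close> by (simp add: S_def)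
    moreover have "enc (cls 0) = \<one>\<^bsub>tensor_group M N\<^esub>"
      using enc_cls_rel[of 0] subgroup.one_closed[OF tensor_rel_subgroup] by (simp add: tensor_free_def)
    ultimately show ?case by simp
  next
    case (diff a b)
    then have "a \<in> carrier (tensor_free M N)" "b \<in> carrier (tensor_free M N)"
      by (auto simp: tensor_free_def)
    then show ?case
      using diff S_mult S_inv minus_in[of a b] by (simp add: enc_cls_minus) (simp add: tensor_free_def)
  next
    case (one a)
    then show ?case
      using S_pure by (auto simp: pure_tensor_eq[symmetric])
  qed
  then show ?thesis
    using c by (simp add: S_def)
qed

text \<open>The relations are exactly what \<open>balanced\<close> demands of
  \<open>\<beta>\<close>, so its extension to the free group has them in the kernel and descends.
  Uniqueness holds because a homomorphism is determined by its values on pure tensors. The target is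
  a commutative group in multiplicative notation, which covers both additive groups of modules and
  \<open>tensor_group\<close>.\<close>

lemma tensor_lift_exists:
  assumes G: "comm_group G" and \<beta>: "balanced M N G \<beta>"
  shows "\<exists>!h. h \<in> hom (tensor_group M N) G \<and> h \<in> extensional (carrier (tensor_group M N)) \<and>
     (\<forall>m\<in>carrier M. \<forall>n\<in>carrier N. h (pure_tensor M N m n) = \<beta> m n)"
proof -
  interpret G: comm_group G by (rule G)
  have b: "\<lbrakk>m \<in> carrier M; n \<in> carrier N\<rbrakk> \<Longrightarrow> \<beta> m n \<in> carrier G"
    "\<lbrakk>m \<in> carrier M; m' \<in> carrier M; n \<in> carrier N\<rbrakk> \<Longrightarrow> \<beta> (m \<oplus>\<^bsub>M\<^esub> m') n = \<beta> m n \<otimes>\<^bsub>G\<^esub> \<beta> m' n"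
    "\<lbrakk>m \<in> carrier M; n \<in> carrier N; n' \<in> carrier N\<rbrakk> \<Longrightarrow> \<beta> m (n \<oplus>\<^bsub>N\<^esub> n') = \<beta> m n \<otimes>\<^bsub>G\<^esub> \<beta> m n'"
    "\<lbrakk>m \<in> carrier M; b \<in> carrier (ralg M); n \<in> carrier N\<rbrakk> \<Longrightarrow> \<beta> (ract M m b) n = \<beta> m (lact N b n)"
    for m m' n n' b using \<beta> by (auto simp: balanced_def)
  obtain h0 where h0: "h0 \<in> hom (tensor_free M N) G"
    "\<And>p. p \<in> carrier M \<times> carrier N \<Longrightarrow> h0 (frag_of p) = \<beta> (fst p) (snd p)"
    unfolding tensor_free_def
    by (rule G.free_Abelian_group_universal[of "\<lambda>p. \<beta> (fst p) (snd p)" "carrier M \<times> carrier N"])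
      (use b(1) in auto)
  interpret h0: group_hom "tensor_free M N" G h0
    using h0(1) by unfold_locales
  have h0m: "h0 (x - y) = h0 x \<otimes>\<^bsub>G\<^esub> inv\<^bsub>G\<^esub> h0 y"
    if "x \<in> carrier (tensor_free M N)" "y \<in> carrier (tensor_free M N)" for x y
  proof -
    have "x - y = x \<otimes>\<^bsub>tensor_free M N\<^esub> inv\<^bsub>tensor_free M N\<^esub> y"
      using that by (simp add: tensor_free_def)
    then show ?thesis using that by simp
  qed
  have ker: "tensor_rel M N \<subseteq> kernel (tensor_free M N) G h0"
    unfolding tensor_rel_def
  proof (rule F.generate_subgroup_incl[OF _ h0.subgroup_kernel], safe)
    fix m m' n assume a: "m \<in> carrier M" "m' \<in> carrier M" "n \<in> carrier N"
    then show "frag_of (m \<oplus>\<^bsub>M\<^esub> m', n) - frag_of (m, n) - frag_of (m', n) \<in> kernel (tensor_free M N) G h0"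
      using frag_in minus_in b h0(2) M N by (simp add: kernel_def h0m G.quotient_mult)
  next
    fix m n n' assume a: "m \<in> carrier M" "n' \<in> carrier N" "n \<in> carrier N"
    then show "frag_of (m, n \<oplus>\<^bsub>N\<^esub> n') - frag_of (m, n) - frag_of (m, n') \<in> kernel (tensor_free M N) G h0"
      using frag_in minus_in b h0(2) M N by (simp add: kernel_def h0m G.quotient_mult)
  next
    fix m r n assume a: "m \<in> carrier M" "r \<in> carrier (ralg M)" "n \<in> carrier N"
    then show "frag_of (ract M m r, n) - frag_of (m, lact N r n) \<in> kernel (tensor_free M N) G h0"
      using frag_in minus_in b h0(2) M N alg_eq by (simp add: kernel_def h0m)
  qed
  obtain h1 where h1: "h1 \<in> hom (tensor_quot M N) G" "\<And>x. x \<in> carrier (tensor_free M N) \<Longrightarrow> h1 (cls x) = h0 x"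
    using h0.FactGroup_universal_kernel[OF tensor_rel_normal ker] unfolding tensor_quot_def by metis
  define e' where "e' = inv_into (carrier (tensor_quot M N)) enc"
  have e': "e' \<in> iso (tensor_group M N) (tensor_quot M N)"
    unfolding e'_def by (rule Q.iso_set_sym[OF enc_iso])
  define h where "h = restrict (h1 \<circ> e') (carrier (tensor_group M N))"
  have hh: "h1 \<circ> e' \<in> hom (tensor_group M N) G"
    using e' h1(1) by (auto simp: iso_def intro: Group.hom_compose)
  have "h \<in> hom (tensor_group M N) G"
    by (rule homI) (use hom_in_carrier[OF hh] hom_mult[OF hh] in \<open>auto simp: h_def\<close>)
  moreover have "h \<in> extensional (carrier (tensor_group M N))"
    by (simp add: h_def)
  moreover have "h (pure_tensor M N m n) = \<beta> m n" if mn: "m \<in> carrier M" "n \<in> carrier N" for m n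
  proof -
    have "cls (frag_of (m, n)) \<in> carrier (tensor_quot M N)"
      using frag_in[OF mn] by (auto simp: tensor_quot_def carrier_FactGroup)
    then have "e' (pure_tensor M N m n) = cls (frag_of (m, n))"
      unfolding e'_def pure_tensor_eq
      using inv_into_f_f inj_on_encode[OF tensor_quot_lepoll[OF infinite_U]] by metis
    then show ?thesis
      using mn pure_closed[OF mn] h1(2)[OF frag_in[OF mn]] h0(2) by (simp add: h_def carrier_tensor)
  qed
  moreover have "h' = h''" if "h' \<in> hom (tensor_group M N) G \<and> h' \<in> extensional (carrier (tensor_group M N)) \<and>
     (\<forall>m\<in>carrier M. \<forall>n\<in>carrier N. h' (pure_tensor M N m n) = \<beta> m n)"
    "h'' \<in> hom (tensor_group M N) G \<and> h'' \<in> extensional (carrier (tensor_group M N)) \<and>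
     (\<forall>m\<in>carrier M. \<forall>n\<in>carrier N. h'' (pure_tensor M N m n) = \<beta> m n)" for h' h''
  proof (rule extensionalityI)
    fix x assume "x \<in> carrier (tensor_group M N)"
    then have "x \<in> carrier (tensor M N)" by (simp add: carrier_tensor)
    then show "h' x = h'' x"
    proof (induction x rule: tensor_induct)
      case (add s t)
      then show ?case
        using that hom_mult[of h' "tensor_group M N" G s t] hom_mult[of h'' "tensor_group M N" G s t]
        by (simp add: carrier_tensor mult_tensor)
    qed (use that in auto)
  qed (use that in auto)
  ultimately show ?thesis by blast
qed

lemma tensor_lift_props:
  assumes "comm_group G" and "balanced M N G \<beta>"
  shows tensor_lift_hom: "tensor_lift M N G \<beta> \<in> hom (tensor_group M N) G"
    and tensor_lift_extensional: "tensor_lift M N G \<beta> \<in> extensional (carrier (tensor M N))"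
    and tensor_lift_pure: "\<lbrakk>m \<in> carrier M; n \<in> carrier N\<rbrakk> \<Longrightarrow> tensor_lift M N G \<beta> (pure_tensor M N m n) = \<beta> m n"
  using theI'[OF tensor_lift_exists[OF assms]] unfolding tensor_lift_def[symmetric]
  by (auto simp: carrier_tensor)

end

end

section \<open>The Morita bicategory\<close>

inductive_set lspan :: "('k, 'y) ring_scheme \<Rightarrow> ('k, 'u, 'x) module_scheme \<Rightarrow> 'u set \<Rightarrow> 'u set"
  for K M S where
  lspan_zero: "\<zero>\<^bsub>M\<^esub> \<in> lspan K M S"
| lspan_step: "\<lbrakk>c \<in> carrier K; s \<in> S; x \<in> lspan K M S\<rbrakk> \<Longrightarrow> c \<odot>\<^bsub>M\<^esub> s \<oplus>\<^bsub>M\<^esub> x \<in> lspan K M S"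

context module
begin

lemma lspan_closed:
  assumes "S \<subseteq> carrier M" "x \<in> lspan R M S"
  shows "x \<in> carrier M"
  using assms(2) by induction (use assms(1) in auto)

lemma lspan_add:
  assumes "S \<subseteq> carrier M" "x \<in> lspan R M S" "y \<in> lspan R M S"
  shows "x \<oplus>\<^bsub>M\<^esub> y \<in> lspan R M S"
  using assms(2)
proof induction
  case lspan_zero
  then show ?case using lspan_closed[OF assms(1,3)] assms(3) by simp
next
  case (lspan_step c s x)
  then have "c \<odot>\<^bsub>M\<^esub> s \<oplus>\<^bsub>M\<^esub> x \<oplus>\<^bsub>M\<^esub> y = c \<odot>\<^bsub>M\<^esub> s \<oplus>\<^bsub>M\<^esub> (x \<oplus>\<^bsub>M\<^esub> y)"
    using lspan_closed assms by (intro M.a_assoc) auto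
  then show ?case
    using lspan_step lspan.lspan_step by metis
qed

lemma lspan_smult:
  assumes "S \<subseteq> carrier M" "x \<in> lspan R M S" "c \<in> carrier R"
  shows "c \<odot>\<^bsub>M\<^esub> x \<in> lspan R M S"
  using assms(2)
proof induction
  case lspan_zero
  then show ?case using assms by (simp add: lspan.lspan_zero)
next
  case (lspan_step d s x)
  then have "c \<odot>\<^bsub>M\<^esub> (d \<odot>\<^bsub>M\<^esub> s \<oplus>\<^bsub>M\<^esub> x) = (c \<otimes> d) \<odot>\<^bsub>M\<^esub> s \<oplus>\<^bsub>M\<^esub> c \<odot>\<^bsub>M\<^esub> x"
    using lspan_closed assms by (subst smult_r_distr) (auto simp: smult_assoc1)
  then show ?case
    using lspan_step assms by (simp add: lspan.lspan_step)
qed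


lemma finsum_in_lspan:
  assumes "finite T" "T \<subseteq> S" "S \<subseteq> carrier M" "c \<in> T \<rightarrow> carrier R"
  shows "(\<Oplus>\<^bsub>M\<^esub>s\<in>T. c s \<odot>\<^bsub>M\<^esub> s) \<in> lspan R M S"
  using assms
proof (induction T)
  case empty
  then show ?case by (simp add: lspan.lspan_zero)
next
  case (insert s T)
  then have "(\<Oplus>\<^bsub>M\<^esub>t\<in>insert s T. c t \<odot>\<^bsub>M\<^esub> t) = c s \<odot>\<^bsub>M\<^esub> s \<oplus>\<^bsub>M\<^esub> (\<Oplus>\<^bsub>M\<^esub>t\<in>T. c t \<odot>\<^bsub>M\<^esub> t)"
    by (intro M.finsum_insert) (auto simp: Pi_iff)
  then show ?case
    using insert by (auto intro: lspan.lspan_step)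
qed

text \<open>A derivation of membership in the span may use a generator several times; its
  coefficients are collected into a single function on \<open>S\<close>.\<close>

lemma lspan_finsum:
  assumes "finite S" "S \<subseteq> carrier M" "x \<in> lspan R M S"
  shows "\<exists>c \<in> S \<rightarrow> carrier R. x = (\<Oplus>\<^bsub>M\<^esub>s\<in>S. c s \<odot>\<^bsub>M\<^esub> s)"
  using assms(3)
proof induction
  case lspan_zero
  have "\<zero>\<^bsub>M\<^esub> = (\<Oplus>\<^bsub>M\<^esub>s\<in>S. \<zero> \<odot>\<^bsub>M\<^esub> s)"
    by (rule M.add.finprod_one_eqI[symmetric]) (use assms in auto)
  then show ?case by (intro bexI[of _ "\<lambda>_. \<zero>"]) auto
next
  case (lspan_step d s x)
  then obtain c where c: "c \<in> S \<rightarrow> carrier R" "x = (\<Oplus>\<^bsub>M\<^esub>s\<in>S. c s \<odot>\<^bsub>M\<^esub> s)" by auto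
  \<comment> \<open>The new term is rewritten as a sum over all of \<open>S\<close> whose
    coefficients vanish away from \<open>s\<close>, so that it can be added to the sum for
    \<open>x\<close> coefficient by coefficient.\<close>
  define e where "e t = (if s = t then d else \<zero>)" for t
  have e: "e \<in> S \<rightarrow> carrier R" using lspan_step by (auto simp: e_def)
  have eq: "e t \<odot>\<^bsub>M\<^esub> t = (if s = t then d \<odot>\<^bsub>M\<^esub> t else \<zero>\<^bsub>M\<^esub>)" if "t \<in> S" for t
    using that assms by (auto simp: e_def)
  have "(\<Oplus>\<^bsub>M\<^esub>t\<in>S. e t \<odot>\<^bsub>M\<^esub> t) = (\<Oplus>\<^bsub>M\<^esub>t\<in>S. if s = t then d \<odot>\<^bsub>M\<^esub> t else \<zero>\<^bsub>M\<^esub>)"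
    by (rule M.finsum_cong') (use assms lspan_step eq in \<open>auto simp: Pi_iff subset_iff\<close>)
  also have "\<dots> = d \<odot>\<^bsub>M\<^esub> s"
    by (rule M.add.finprod_singleton) (use assms lspan_step in \<open>auto simp: Pi_iff subset_iff\<close>)
  finally have "d \<odot>\<^bsub>M\<^esub> s \<oplus>\<^bsub>M\<^esub> x = (\<Oplus>\<^bsub>M\<^esub>t\<in>S. e t \<odot>\<^bsub>M\<^esub> t \<oplus>\<^bsub>M\<^esub> c t \<odot>\<^bsub>M\<^esub> t)"
    unfolding c(2) by (subst M.finsum_addf) (use assms c e in \<open>auto simp: Pi_iff subset_iff\<close>)
  also have "\<dots> = (\<Oplus>\<^bsub>M\<^esub>t\<in>S. (e t \<oplus> c t) \<odot>\<^bsub>M\<^esub> t)"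
    by (rule M.finsum_cong') (use assms c e in \<open>auto simp: Pi_iff subset_iff smult_l_distr\<close>)
  finally show ?case
    using c e by (intro bexI[of _ "\<lambda>t. e t \<oplus> c t"]) (auto simp: Pi_iff)
qed

end

text \<open>The inductive span supports rule induction and spares the later finiteness arguments all
  bookkeeping with coefficient functions.\<close>

lemma fin_dim_iff_lspan:
  fixes K :: "'k ring"
  assumes "module K M"
  shows "fin_dim K M \<longleftrightarrow> (\<exists>S. finite S \<and> S \<subseteq> carrier M \<and> carrier M = lspan K M S)"
proof -
  have "{\<Oplus>\<^bsub>M\<^esub>s\<in>S. c s \<odot>\<^bsub>M\<^esub> s |c. c \<in> S \<rightarrow> carrier K} = lspan K M S"
    if "finite S" "S \<subseteq> carrier M" for S
    using module.finsum_in_lspan[OF assms that(1) subset_refl that(2)] module.lspan_finsum[OF assms that]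
    by (auto simp del: Pi_iff)
  then show ?thesis
    unfolding fin_dim_def by (intro ex_cong1 conj_cong refl) simp
qed

lemma fin_dimI:
  fixes K :: "'k ring"
  assumes "module K M" "finite S" "S \<subseteq> carrier M" "\<And>x. x \<in> carrier M \<Longrightarrow> x \<in> lspan K M S"
  shows "fin_dim K M"
  using assms module.lspan_closed[OF assms(1,3)] unfolding fin_dim_iff_lspan[OF assms(1)] by blast

lemma tensor_algs [simp]: "lalg (tensor M N) = lalg M" "ralg (tensor M N) = ralg N"
  by (simp_all add: tensor_def Let_def)

section \<open>The bimodule structure on a tensor product\<close>

context morita
begin

text \<open>The axioms relate scalars to the action only through the algebra argument, as in
  \<open>m (c b) = c (m b)\<close>. A scalar on \<open>m\<close> is therefore first written as the
  action of the algebra element \<open>c 1\<close>.\<close>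

lemma smult_ract:
  assumes "bim M" "c \<in> carrier K" "m \<in> carrier M" "b \<in> carrier (ralg M)"
  shows "c \<odot>\<^bsub>M\<^esub> ract M m b = ract M (c \<odot>\<^bsub>M\<^esub> m) b"
proof -
  have "c \<odot>\<^bsub>M\<^esub> m = ract M m (c \<odot>\<^bsub>ralg M\<^esub> \<one>\<^bsub>ralg M\<^esub>)"
    using fd_bimodule.ract_smult[OF assms(1,2,3)] assms by simp
  then have "ract M (c \<odot>\<^bsub>M\<^esub> m) b = ract M m ((c \<odot>\<^bsub>ralg M\<^esub> \<one>\<^bsub>ralg M\<^esub>) \<otimes>\<^bsub>ralg M\<^esub> b)"
    using fd_bimodule.ract_mult[OF assms(1)] assms by simp
  also have "(c \<odot>\<^bsub>ralg M\<^esub> \<one>\<^bsub>ralg M\<^esub>) \<otimes>\<^bsub>ralg M\<^esub> b = c \<odot>\<^bsub>ralg M\<^esub> b"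
    using fd_algebra.smult_mult_left[of K "ralg M" c] assms by simp
  finally show ?thesis
    using fd_bimodule.ract_smult[OF assms] by simp
qed


lemma add_hom:
  assumes "h \<in> hom (add_monoid M) (add_monoid N)"
  shows "x \<in> carrier M \<Longrightarrow> h x \<in> carrier N"
    and "\<lbrakk>x \<in> carrier M; y \<in> carrier M\<rbrakk> \<Longrightarrow> h (x \<oplus>\<^bsub>M\<^esub> y) = h x \<oplus>\<^bsub>N\<^esub> h y"
  using hom_in_carrier[OF assms] hom_mult[OF assms] by auto

lemma add_homI:
  assumes "\<And>x. x \<in> carrier M \<Longrightarrow> h x \<in> carrier N"
    and "\<And>x y. \<lbrakk>x \<in> carrier M; y \<in> carrier M\<rbrakk> \<Longrightarrow> h (x \<oplus>\<^bsub>M\<^esub> y) = h x \<oplus>\<^bsub>N\<^esub> h y"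
  shows "h \<in> hom (add_monoid M) (add_monoid N)"
  using assms by (auto intro: homI)

lemma balanced_maps:
  assumes M: "bim M" and N: "bim N" and M': "bim M'" and N': "bim N'"
    and eq: "ralg M = lalg N" "ralg M' = ralg M" "lalg N' = lalg N"
    and f: "f \<in> hom (add_monoid M) (add_monoid M')"
    and g: "g \<in> hom (add_monoid N) (add_monoid N')"
    and fb: "\<And>m b. \<lbrakk>m \<in> carrier M; b \<in> carrier (ralg M)\<rbrakk> \<Longrightarrow> f (ract M m b) = ract M' (f m) b"
    and gb: "\<And>b n. \<lbrakk>b \<in> carrier (ralg M); n \<in> carrier N\<rbrakk> \<Longrightarrow> g (lact N b n) = lact N' b (g n)"
  shows "balanced M N (tensor_group M' N') (\<lambda>m n. pure_tensor M' N' (f m) (g n))"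
  by (rule balancedI)
    (use assms in \<open>simp_all add: carrier_tensor mult_tensor add_hom[OF f] add_hom[OF g]
      pure_closed pure_add_left pure_add_right pure_balanced\<close>)

context
  fixes M N :: "('k, 'u) bimodule"
  assumes M: "bim M" and N: "bim N" and alg_eq: "ralg M = lalg N"
begin

text \<open>Common source of the scalar multiplication and of the two actions on a tensor product:
  each of them is induced by an endomorphism of one factor that respects the middle algebra.\<close>

lemma tensor_endo:
  assumes f: "f \<in> hom (add_monoid M) (add_monoid M)"
    and g: "g \<in> hom (add_monoid N) (add_monoid N)"
    and fb: "\<And>m b. \<lbrakk>m \<in> carrier M; b \<in> carrier (ralg M)\<rbrakk> \<Longrightarrow> f (ract M m b) = ract M (f m) b"
    and gb: "\<And>b n. \<lbrakk>b \<in> carrier (ralg M); n \<in> carrier N\<rbrakk> \<Longrightarrow> g (lact N b n) = lact N b (g n)"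
  defines "h \<equiv> tensor_lift M N (tensor_group M N) (\<lambda>m n. pure_tensor M N (f m) (g n))"
  shows "h \<in> hom (add_monoid (tensor M N)) (add_monoid (tensor M N))"
    and "\<lbrakk>m \<in> carrier M; n \<in> carrier N\<rbrakk> \<Longrightarrow> h (pure_tensor M N m n) = pure_tensor M N (f m) (g n)"
proof -
  note b = balanced_maps[OF M N M N alg_eq refl refl f g fb gb]
  note c = comm_group_tensor_group[OF M N alg_eq]
  show "h \<in> hom (add_monoid (tensor M N)) (add_monoid (tensor M N))"
    using tensor_lift_hom[OF M N alg_eq c b]
    by (simp add: h_def hom_from_tensor_group hom_to_tensor_group)
  show "\<lbrakk>m \<in> carrier M; n \<in> carrier N\<rbrakk> \<Longrightarrow> h (pure_tensor M N m n) = pure_tensor M N (f m) (g n)"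
    unfolding h_def by (rule tensor_lift_pure[OF M N alg_eq c b])
qed

lemma tensor_lact_hom:
  assumes "a \<in> carrier (lalg M)"
  shows "lact (tensor M N) a \<in> hom (add_monoid (tensor M N)) (add_monoid (tensor M N))"
    and "\<lbrakk>m \<in> carrier M; n \<in> carrier N\<rbrakk> \<Longrightarrow> lact (tensor M N) a (pure_tensor M N m n) = pure_tensor M N (lact M a m) n"
proof -
  have "lact M a \<in> hom (add_monoid M) (add_monoid M)" "(\<lambda>n. n) \<in> hom (add_monoid N) (add_monoid N)"
    using assms M by (auto intro!: add_homI simp: fd_bimodule.lact_add_right)
  from tensor_endo[OF this]
  show "lact (tensor M N) a \<in> hom (add_monoid (tensor M N)) (add_monoid (tensor M N))"
    "\<lbrakk>m \<in> carrier M; n \<in> carrier N\<rbrakk> \<Longrightarrow> lact (tensor M N) a (pure_tensor M N m n) = pure_tensor M N (lact M a m) n"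
    using fd_bimodule.lact_ract[OF M] assms by (simp_all add: tensor_def Let_def)
qed

lemma tensor_smult_hom:
  assumes "c \<in> carrier K"
  shows "smult (tensor M N) c \<in> hom (add_monoid (tensor M N)) (add_monoid (tensor M N))"
    and "\<lbrakk>m \<in> carrier M; n \<in> carrier N\<rbrakk> \<Longrightarrow> c \<odot>\<^bsub>tensor M N\<^esub> pure_tensor M N m n = pure_tensor M N (c \<odot>\<^bsub>M\<^esub> m) n"
proof -
  have "smult M c \<in> hom (add_monoid M) (add_monoid M)" "(\<lambda>n. n) \<in> hom (add_monoid N) (add_monoid N)"
    using assms M by (auto intro!: add_homI simp: module.smult_r_distr[OF bim_module])
  from tensor_endo[OF this]
  show "smult (tensor M N) c \<in> hom (add_monoid (tensor M N)) (add_monoid (tensor M N))"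
    "\<lbrakk>m \<in> carrier M; n \<in> carrier N\<rbrakk> \<Longrightarrow> c \<odot>\<^bsub>tensor M N\<^esub> pure_tensor M N m n = pure_tensor M N (c \<odot>\<^bsub>M\<^esub> m) n"
    using smult_ract[OF M] assms by (simp_all add: tensor_def Let_def)
qed

lemma tensor_ract_hom:
  assumes "b \<in> carrier (ralg N)"
  shows "(\<lambda>t. ract (tensor M N) t b) \<in> hom (add_monoid (tensor M N)) (add_monoid (tensor M N))"
    and "\<lbrakk>m \<in> carrier M; n \<in> carrier N\<rbrakk> \<Longrightarrow> ract (tensor M N) (pure_tensor M N m n) b = pure_tensor M N m (ract N n b)"
proof -
  have "(\<lambda>m. m) \<in> hom (add_monoid M) (add_monoid M)" "(\<lambda>n. ract N n b) \<in> hom (add_monoid N) (add_monoid N)"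
    using assms N by (auto intro!: add_homI simp: fd_bimodule.ract_add_left)
  from tensor_endo[OF this]
  show "(\<lambda>t. ract (tensor M N) t b) \<in> hom (add_monoid (tensor M N)) (add_monoid (tensor M N))"
    "\<lbrakk>m \<in> carrier M; n \<in> carrier N\<rbrakk> \<Longrightarrow> ract (tensor M N) (pure_tensor M N m n) b = pure_tensor M N m (ract N n b)"
    using fd_bimodule.lact_ract[OF N] assms by (simp_all add: tensor_def Let_def alg_eq)
qed

text \<open>Scalars cross the tensor sign because they act on both factors through the element
  \<open>c 1\<close> of the middle algebra.\<close>

lemma pure_smult_right:
  assumes "m \<in> carrier M" "n \<in> carrier N" "c \<in> carrier K"
  shows "pure_tensor M N m (c \<odot>\<^bsub>N\<^esub> n) = pure_tensor M N (c \<odot>\<^bsub>M\<^esub> m) n"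
proof -
  have "c \<odot>\<^bsub>N\<^esub> n = lact N (c \<odot>\<^bsub>lalg N\<^esub> \<one>\<^bsub>lalg N\<^esub>) n"
    using assms N fd_bimodule.lact_smult[OF N] by simp
  moreover have "c \<odot>\<^bsub>M\<^esub> m = ract M m (c \<odot>\<^bsub>ralg M\<^esub> \<one>\<^bsub>ralg M\<^esub>)"
    using assms M fd_bimodule.ract_smult[OF M] by simp
  ultimately show ?thesis
    using assms pure_balanced[OF M N alg_eq] M N alg_eq[symmetric] by simp
qed

text \<open>Products of two finite spanning sets span. A pure tensor with a generator on the left is
  expanded in its right factor; after that the left factor is expanded.\<close>

lemma tensor_span:
  assumes "finite S" "S \<subseteq> carrier M" "\<And>x. x \<in> carrier M \<Longrightarrow> x \<in> lspan K M S"
    and "finite S'" "S' \<subseteq> carrier N" "\<And>x. x \<in> carrier N \<Longrightarrow> x \<in> lspan K N S'"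
    and T: "module K (tensor M N)"
  shows "fin_dim K (tensor M N)"
proof -
  interpret T: module K "tensor M N" by (rule T)
  let ?S = "(\<lambda>(s, s'). pure_tensor M N s s') ` (S \<times> S')"
  have sub: "?S \<subseteq> carrier (tensor M N)"
    using assms(2,5) by (auto intro!: pure_closed[OF M N alg_eq])
  \<comment> \<open>A tensor with a zero factor equals its own double, hence is zero by
    cancellation.\<close>
  have zero: "pure_tensor M N \<zero>\<^bsub>M\<^esub> n = \<zero>\<^bsub>tensor M N\<^esub>" "pure_tensor M N m \<zero>\<^bsub>N\<^esub> = \<zero>\<^bsub>tensor M N\<^esub>"
    if "n \<in> carrier N" "m \<in> carrier M" for m n
    using that pure_add_left[OF M N alg_eq, of "\<zero>\<^bsub>M\<^esub>" "\<zero>\<^bsub>M\<^esub>" n] pure_add_right[OF M N alg_eq, of m "\<zero>\<^bsub>N\<^esub>" "\<zero>\<^bsub>N\<^esub>"]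
      T.M.add.l_cancel_one'[of "pure_tensor M N \<zero>\<^bsub>M\<^esub> n" "pure_tensor M N \<zero>\<^bsub>M\<^esub> n"]
      T.M.add.l_cancel_one'[of "pure_tensor M N m \<zero>\<^bsub>N\<^esub>" "pure_tensor M N m \<zero>\<^bsub>N\<^esub>"] M N
    by (auto simp: pure_closed[OF M N alg_eq])
  have c: "pure_tensor M N m (c \<odot>\<^bsub>N\<^esub> n) = c \<odot>\<^bsub>tensor M N\<^esub> pure_tensor M N m n"
    if "m \<in> carrier M" "n \<in> carrier N" "c \<in> carrier K" for m n c
    using that by (simp add: pure_smult_right tensor_smult_hom(2))
  have base: "pure_tensor M N s n \<in> lspan K (tensor M N) ?S" if "s \<in> S" "n \<in> lspan K N S'" for s n
    using that(2)
  proof induction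
    case lspan_zero
    then show ?case using zero(2)[of "\<zero>\<^bsub>N\<^esub>" s] that N assms(2) by (auto simp: lspan.lspan_zero)
  next
    case (lspan_step c t x)
    then have "x \<in> carrier N" "t \<in> carrier N" "s \<in> carrier M"
      using assms that module.lspan_closed[OF bim_module[OF N]] by auto
    moreover have "pure_tensor M N s t \<in> ?S" using that lspan_step by auto
    ultimately show ?case
      using lspan_step lspan.lspan_step[of c K _ ?S] N by (simp add: pure_add_right[OF M N alg_eq] c)
  qed
  have pure: "pure_tensor M N m n \<in> lspan K (tensor M N) ?S" if "m \<in> lspan K M S" "n \<in> carrier N" for m n
    using that(1)
  proof induction
    case lspan_zero
    then show ?case using zero(1)[of n "\<zero>\<^bsub>M\<^esub>"] that M by (auto simp: lspan.lspan_zero)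
  next
    case (lspan_step c s x)
    then have "x \<in> carrier M" "s \<in> carrier M"
      using assms that module.lspan_closed[OF bim_module[OF M]] by auto
    then show ?case
      using lspan_step that M base[of s n] assms(6)
      by (simp add: pure_add_left[OF M N alg_eq] tensor_smult_hom(2)[symmetric] T.lspan_add[OF sub] T.lspan_smult[OF sub])
  qed
  have "x \<in> lspan K (tensor M N) ?S" if "x \<in> carrier (tensor M N)" for x
    using that by (induction x rule: tensor_induct[OF M N alg_eq, consumes 1])
      (use pure assms T.lspan_add[OF sub] in auto)
  then show ?thesis
    using assms sub by (intro fin_dimI[of _ _ ?S]) auto
qed

text \<open>The module and action laws are additive in \<open>x\<close>, so induction over tensors
  reduces each of them to the corresponding law of one factor.\<close>

lemma bim_tensor: "bim (tensor M N)"
proof -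
  interpret T: abelian_group "tensor M N" by (rule abelian_group_tensor[OF M N alg_eq])
  note ind = tensor_induct[OF M N alg_eq, consumes 1, case_names pure add]
  note hs = add_hom[OF tensor_smult_hom(1)] and hl = add_hom[OF tensor_lact_hom(1)] and hr = add_hom[OF tensor_ract_hom(1)]
  note p = pure_closed[OF M N alg_eq] pure_add_left[OF M N alg_eq] pure_add_right[OF M N alg_eq]
    tensor_smult_hom(2) tensor_lact_hom(2) tensor_ract_hom(2)
  note mM = bim_module[OF M] and mN = bim_module[OF N]
  have mod: "module K (tensor M N)"
  proof (rule moduleI)
    fix c d x y
    show "cring K" by (rule cring_K)
    show "abelian_group (tensor M N)" by (rule T.abelian_group_axioms)
    show "c \<odot>\<^bsub>tensor M N\<^esub> x \<in> carrier (tensor M N)" if "c \<in> carrier K" "x \<in> carrier (tensor M N)"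
      using that by (rule hs)
    show "c \<odot>\<^bsub>tensor M N\<^esub> (x \<oplus>\<^bsub>tensor M N\<^esub> y) = c \<odot>\<^bsub>tensor M N\<^esub> x \<oplus>\<^bsub>tensor M N\<^esub> c \<odot>\<^bsub>tensor M N\<^esub> y"
      if "c \<in> carrier K" "x \<in> carrier (tensor M N)" "y \<in> carrier (tensor M N)"
      using that by (rule hs)
    assume x: "x \<in> carrier (tensor M N)"
    show "\<one>\<^bsub>K\<^esub> \<odot>\<^bsub>tensor M N\<^esub> x = x"
      using x by (induction x rule: ind)
        (use x cring.cring_simprules(6)[OF cring_K] in \<open>auto simp: p hs module.smult_one[OF mM]\<close>)
    assume c: "c \<in> carrier K" and d: "d \<in> carrier K"
    show "(c \<oplus>\<^bsub>K\<^esub> d) \<odot>\<^bsub>tensor M N\<^esub> x = c \<odot>\<^bsub>tensor M N\<^esub> x \<oplus>\<^bsub>tensor M N\<^esub> d \<odot>\<^bsub>tensor M N\<^esub> x"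
      using x by (induction x rule: ind)
        (use c d M in \<open>auto simp: p hs module.smult_l_distr[OF mM] cring.cring_simprules(1)[OF cring_K] T.a_ac\<close>)
    show "(c \<otimes>\<^bsub>K\<^esub> d) \<odot>\<^bsub>tensor M N\<^esub> x = c \<odot>\<^bsub>tensor M N\<^esub> (d \<odot>\<^bsub>tensor M N\<^esub> x)"
      using x by (induction x rule: ind)
        (use c d M in \<open>auto simp: p hs module.smult_assoc1[OF mM] cring.cring_simprules(5)[OF cring_K]\<close>)
  qed
  have fin: "fin_dim K (tensor M N)"
  proof -
    obtain S where "finite S" "S \<subseteq> carrier M" "carrier M = lspan K M S"
      using fd_bimodule.finite_dimensional[OF M] unfolding fin_dim_iff_lspan[OF mM] by blast
    moreover obtain S' where "finite S'" "S' \<subseteq> carrier N" "carrier N = lspan K N S'"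
      using fd_bimodule.finite_dimensional[OF N] unfolding fin_dim_iff_lspan[OF mN] by blast
    ultimately show ?thesis using tensor_span[of S S'] mod by simp
  qed
  show ?thesis
  proof (intro fd_bimodule.intro mod fd_bimodule_axioms.intro fin, simp_all only: tensor_algs)
    show "alg (lalg M)" "alg (ralg N)" using M N by auto
    fix a a' b b' c x y
    assume x: "x \<in> carrier (tensor M N)"
    show "lact (tensor M N) \<one>\<^bsub>lalg M\<^esub> x = x" "ract (tensor M N) x \<one>\<^bsub>ralg N\<^esub> = x"
      using x by (induction x rule: ind; use M N in \<open>simp add: p hl hr\<close>)+
    {
      assume c: "c \<in> carrier K" and a: "a \<in> carrier (lalg M)"
      show "lact (tensor M N) (c \<odot>\<^bsub>lalg M\<^esub> a) x = c \<odot>\<^bsub>tensor M N\<^esub> lact (tensor M N) a x"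
        using x by (induction x rule: ind) (use a c M N in \<open>auto simp: p hl hs fd_bimodule.lact_smult\<close>)
    next
      assume c: "c \<in> carrier K" and b: "b \<in> carrier (ralg N)"
      show "ract (tensor M N) x (c \<odot>\<^bsub>ralg N\<^esub> b) = c \<odot>\<^bsub>tensor M N\<^esub> ract (tensor M N) x b"
        using x by (induction x rule: ind) (use b c M N in \<open>auto simp: p hr hs fd_bimodule.ract_smult pure_smult_right\<close>)
    next
      assume a: "a \<in> carrier (lalg M)" and b: "b \<in> carrier (ralg N)"
      show "ract (tensor M N) (lact (tensor M N) a x) b = lact (tensor M N) a (ract (tensor M N) x b)"
        using x by (induction x rule: ind) (use a b M N in \<open>auto simp: p hl hr\<close>)
    next
      assume a: "a \<in> carrier (lalg M)"
      show "lact (tensor M N) a x \<in> carrier (tensor M N)" using a x by (rule hl)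
      show "lact (tensor M N) a (x \<oplus>\<^bsub>tensor M N\<^esub> y) = lact (tensor M N) a x \<oplus>\<^bsub>tensor M N\<^esub> lact (tensor M N) a y"
        if "y \<in> carrier (tensor M N)" using a x that by (rule hl)
      assume a': "a' \<in> carrier (lalg M)"
      show "lact (tensor M N) (a \<oplus>\<^bsub>lalg M\<^esub> a') x = lact (tensor M N) a x \<oplus>\<^bsub>tensor M N\<^esub> lact (tensor M N) a' x"
        using x by (induction x rule: ind) (use a a' M N in \<open>auto simp: p hl fd_bimodule.lact_add_left T.a_ac\<close>)
      show "lact (tensor M N) (a \<otimes>\<^bsub>lalg M\<^esub> a') x = lact (tensor M N) a (lact (tensor M N) a' x)"
        using x by (induction x rule: ind) (use a a' M N in \<open>auto simp: p hl fd_bimodule.lact_mult\<close>)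
    next
      assume b: "b \<in> carrier (ralg N)"
      show "ract (tensor M N) x b \<in> carrier (tensor M N)" using b x by (rule hr)
      show "ract (tensor M N) (x \<oplus>\<^bsub>tensor M N\<^esub> y) b = ract (tensor M N) x b \<oplus>\<^bsub>tensor M N\<^esub> ract (tensor M N) y b"
        if "y \<in> carrier (tensor M N)" using b x that by (rule hr)
      assume b': "b' \<in> carrier (ralg N)"
      show "ract (tensor M N) x (b \<oplus>\<^bsub>ralg N\<^esub> b') = ract (tensor M N) x b \<oplus>\<^bsub>tensor M N\<^esub> ract (tensor M N) x b'"
        using x by (induction x rule: ind) (use b b' M N in \<open>auto simp: p hr fd_bimodule.ract_add_right T.a_ac\<close>)
      show "ract (tensor M N) x (b \<otimes>\<^bsub>ralg N\<^esub> b') = ract (tensor M N) (ract (tensor M N) x b) b'"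
        using x by (induction x rule: ind) (use b b' M N in \<open>auto simp: p hr fd_bimodule.ract_mult\<close>)
    }
  qed
qed

end

end

section \<open>Bimodule maps as cells\<close>

lemma regular_simps [simp]:
  "carrier (regular A) = carrier A" "ring.zero (regular A) = ring.zero A" "ring.add (regular A) = ring.add A"
  "smult (regular A) = smult A" "lalg (regular A) = A" "ralg (regular A) = A"
  "lact (regular A) = monoid.mult A" "ract (regular A) = monoid.mult A"
  by (simp_all add: regular_def)

lemma Alg2_simps [simp]:
  "Obj (Alg2 K) = {A. fd_algebra K A}" "Arr (Alg2 K) = {M. fd_bimodule K M}" "Cell (Alg2 K) = {f. bimodule_map K f}"
  "src (Alg2 K) = lalg" "trg (Alg2 K) = ralg" "vdom (Alg2 K) = bdom" "vcod (Alg2 K) = bcod"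
  "id1 (Alg2 K) = regular" "comp1 (Alg2 K) = (\<lambda>N M. tensor M N)" "hcomp (Alg2 K) = (\<lambda>g f. tensor_map f g)"
  "M \<in> Hom (Alg2 K) A B \<longleftrightarrow> fd_bimodule K M \<and> lalg M = A \<and> ralg M = B"
  "f \<in> Cells (Alg2 K) M N \<longleftrightarrow> bimodule_map K f \<and> bdom f = M \<and> bcod f = N"
  by (auto simp: Alg2_def Hom_def Cells_def)

lemma Alg2_cell_boundaries [simp]:
  "bdom (id2 (Alg2 K) M) = M" "bcod (id2 (Alg2 K) M) = M"
  "bdom (vcomp (Alg2 K) g f) = bdom f" "bcod (vcomp (Alg2 K) g f) = bcod g"
  "bdom (assoc (Alg2 K) P N M) = tensor M (tensor N P)" "bcod (assoc (Alg2 K) P N M) = tensor (tensor M N) P"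
  "bdom (lunit (Alg2 K) M) = tensor M (regular (ralg M))" "bcod (lunit (Alg2 K) M) = M"
  "bdom (runit (Alg2 K) M) = tensor (regular (lalg M)) M" "bcod (runit (Alg2 K) M) = M"
  by (simp_all add: Alg2_def)

lemma tensor_map_boundaries [simp]:
  "bdom (tensor_map f g) = tensor (bdom f) (bdom g)" "bcod (tensor_map f g) = tensor (bcod f) (bcod g)"
  by (simp_all add: tensor_map_def)

context morita
begin

abbreviation cell :: "('k, 'u) bimod_map \<Rightarrow> bool" where
  "cell f \<equiv> bimodule_map K f"

lemma bim_distrib:
  "\<lbrakk>bim M; a \<in> carrier (lalg M); a' \<in> carrier (lalg M); m \<in> carrier M\<rbrakk> \<Longrightarrow>
      lact M (a \<oplus>\<^bsub>lalg M\<^esub> a') m = lact M a m \<oplus>\<^bsub>M\<^esub> lact M a' m"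
  "\<lbrakk>bim M; a \<in> carrier (lalg M); m \<in> carrier M; m' \<in> carrier M\<rbrakk> \<Longrightarrow>
      lact M a (m \<oplus>\<^bsub>M\<^esub> m') = lact M a m \<oplus>\<^bsub>M\<^esub> lact M a m'"
  "\<lbrakk>bim M; m \<in> carrier M; m' \<in> carrier M; b \<in> carrier (ralg M)\<rbrakk> \<Longrightarrow>
      ract M (m \<oplus>\<^bsub>M\<^esub> m') b = ract M m b \<oplus>\<^bsub>M\<^esub> ract M m' b"
  "\<lbrakk>bim M; m \<in> carrier M; b \<in> carrier (ralg M); b' \<in> carrier (ralg M)\<rbrakk> \<Longrightarrow>
      ract M m (b \<oplus>\<^bsub>ralg M\<^esub> b') = ract M m b \<oplus>\<^bsub>M\<^esub> ract M m b'"
  by (simp_all add: fd_bimodule.lact_add_left fd_bimodule.lact_add_right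
      fd_bimodule.ract_add_left fd_bimodule.ract_add_right)

lemma bim_assoc:
  "\<lbrakk>bim M; a \<in> carrier (lalg M); a' \<in> carrier (lalg M); m \<in> carrier M\<rbrakk> \<Longrightarrow>
      lact M (a \<otimes>\<^bsub>lalg M\<^esub> a') m = lact M a (lact M a' m)"
  "\<lbrakk>bim M; m \<in> carrier M; b \<in> carrier (ralg M); b' \<in> carrier (ralg M)\<rbrakk> \<Longrightarrow>
      ract M m (b \<otimes>\<^bsub>ralg M\<^esub> b') = ract M (ract M m b) b'"
  "\<lbrakk>bim M; a \<in> carrier (lalg M); m \<in> carrier M; b \<in> carrier (ralg M)\<rbrakk> \<Longrightarrow>
      ract M (lact M a m) b = lact M a (ract M m b)"
  by (simp_all add: fd_bimodule.lact_mult fd_bimodule.ract_mult fd_bimodule.lact_ract)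

lemma bim_ac:
  assumes "bim M" "x \<in> carrier M" "y \<in> carrier M" "z \<in> carrier M"
  shows "x \<oplus>\<^bsub>M\<^esub> y \<oplus>\<^bsub>M\<^esub> z = x \<oplus>\<^bsub>M\<^esub> (y \<oplus>\<^bsub>M\<^esub> z)" "x \<oplus>\<^bsub>M\<^esub> y = y \<oplus>\<^bsub>M\<^esub> x"
    "x \<oplus>\<^bsub>M\<^esub> (y \<oplus>\<^bsub>M\<^esub> z) = y \<oplus>\<^bsub>M\<^esub> (x \<oplus>\<^bsub>M\<^esub> z)"
proof -
  interpret abelian_group M using assms(1) by (rule bim_group)
  show "x \<oplus>\<^bsub>M\<^esub> y \<oplus>\<^bsub>M\<^esub> z = x \<oplus>\<^bsub>M\<^esub> (y \<oplus>\<^bsub>M\<^esub> z)" "x \<oplus>\<^bsub>M\<^esub> y = y \<oplus>\<^bsub>M\<^esub> x"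
    "x \<oplus>\<^bsub>M\<^esub> (y \<oplus>\<^bsub>M\<^esub> z) = y \<oplus>\<^bsub>M\<^esub> (x \<oplus>\<^bsub>M\<^esub> z)"
    using a_assoc[OF assms(2-4)] a_comm[OF assms(2,3)] a_lcomm[OF assms(2-4)] by auto
qed

lemma add_swap:
  assumes "bim M" "a \<in> carrier M" "b \<in> carrier M" "c \<in> carrier M" "d \<in> carrier M"
  shows "a \<oplus>\<^bsub>M\<^esub> b \<oplus>\<^bsub>M\<^esub> (c \<oplus>\<^bsub>M\<^esub> d) = a \<oplus>\<^bsub>M\<^esub> c \<oplus>\<^bsub>M\<^esub> (b \<oplus>\<^bsub>M\<^esub> d)"
  using assms by (simp add: bim_ac(1) bim_ac(3)[of M b c d])

lemma alg_assoc:
  "\<lbrakk>alg A; x \<in> carrier A; y \<in> carrier A; z \<in> carrier A\<rbrakk> \<Longrightarrow>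
    x \<otimes>\<^bsub>A\<^esub> y \<otimes>\<^bsub>A\<^esub> z = x \<otimes>\<^bsub>A\<^esub> (y \<otimes>\<^bsub>A\<^esub> z)"
  by (rule monoid.m_assoc[OF ring.is_monoid[OF alg_ring]])

lemma alg_distrib:
  assumes "alg A" "x \<in> carrier A" "y \<in> carrier A" "z \<in> carrier A"
  shows "(x \<oplus>\<^bsub>A\<^esub> y) \<otimes>\<^bsub>A\<^esub> z = x \<otimes>\<^bsub>A\<^esub> z \<oplus>\<^bsub>A\<^esub> y \<otimes>\<^bsub>A\<^esub> z"
    and "z \<otimes>\<^bsub>A\<^esub> (x \<oplus>\<^bsub>A\<^esub> y) = z \<otimes>\<^bsub>A\<^esub> x \<oplus>\<^bsub>A\<^esub> z \<otimes>\<^bsub>A\<^esub> y"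
proof -
  interpret ring A using assms(1) by (rule alg_ring)
  show "(x \<oplus>\<^bsub>A\<^esub> y) \<otimes>\<^bsub>A\<^esub> z = x \<otimes>\<^bsub>A\<^esub> z \<oplus>\<^bsub>A\<^esub> y \<otimes>\<^bsub>A\<^esub> z"
    "z \<otimes>\<^bsub>A\<^esub> (x \<oplus>\<^bsub>A\<^esub> y) = z \<otimes>\<^bsub>A\<^esub> x \<oplus>\<^bsub>A\<^esub> z \<otimes>\<^bsub>A\<^esub> y"
    using l_distr r_distr assms by auto
qed

lemma bim_regular [simp]:
  assumes "alg A"
  shows "bim (regular A)"
proof -
  interpret A: fd_algebra K A by (rule assms)
  have "module K (regular A)"
    by (rule moduleI) (use A.R.cring_axioms in \<open>auto intro!: abelian_groupI bexI[of _ "\<ominus>\<^bsub>A\<^esub> _"]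
      simp: A.smult_l_distr A.smult_r_distr A.smult_assoc1 A.M.a_ac A.M.l_neg A.M.r_neg\<close>)
  moreover have "fin_dim K (regular A)"
  proof -
    obtain S where S: "finite S" "S \<subseteq> carrier A" "carrier A = lspan K A S"
      using A.finite_dimensional unfolding fin_dim_iff_lspan[OF alg_module[OF assms]] by blast
    have "x \<in> lspan K (regular A) S" if "x \<in> lspan K A S" for x
      using that
    proof induction
      case lspan_zero
      then show ?case using lspan.lspan_zero[of "regular A"] by simp
    next
      case (lspan_step c s x)
      then show ?case using lspan.lspan_step[of c K s S x "regular A"] by simp
    qed
    then show ?thesis
      using S by (intro fin_dimI[OF \<open>module K (regular A)\<close>, of S]) auto
  qed
  ultimately show ?thesis
    by (intro fd_bimodule.intro fd_bimodule_axioms.intro)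
      (use assms in \<open>auto simp: A.smult_mult_left A.smult_mult_right alg_assoc alg_distrib\<close>)
qed

declare pure_closed [simp] bim_tensor [simp] tensor_lact_hom(2) [simp] tensor_ract_hom(2) [simp]
  tensor_smult_hom(2) [simp]

text \<open>Linearity is kept apart from extensionality, so that it can be checked on an
  unrestricted representative and then transferred to the extensional map by
  \<open>bilin_cong\<close>.\<close>

definition bilin :: "('k, 'u) bimodule \<Rightarrow> ('k, 'u) bimodule \<Rightarrow> ('u \<Rightarrow> 'u) \<Rightarrow> bool" where
  "bilin M N h \<longleftrightarrow> bim M \<and> bim N \<and> lalg N = lalg M \<and> ralg N = ralg M \<and>
    h \<in> hom (add_monoid M) (add_monoid N) \<and>
    (\<forall>a\<in>carrier (lalg M). \<forall>m\<in>carrier M. h (lact M a m) = lact N a (h m)) \<and>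
    (\<forall>m\<in>carrier M. \<forall>b\<in>carrier (ralg M). h (ract M m b) = ract N (h m) b)"

lemma cell_iff: "cell f \<longleftrightarrow> bilin (bdom f) (bcod f) (bmap f) \<and> bmap f \<in> extensional (carrier (bdom f))"
  by (auto simp: bilin_def bimodule_map_def bimodule_map_axioms_def)

lemma cellI:
  "\<lbrakk>bilin M N h; h \<in> extensional (carrier M)\<rbrakk> \<Longrightarrow> cell \<lparr>bdom = M, bcod = N, bmap = h\<rparr>"
  by (simp add: cell_iff)

lemma bilin_cong:
  assumes "bilin M N h" "\<And>x. x \<in> carrier M \<Longrightarrow> h' x = h x"
  shows "bilin M N h'"
  using assms unfolding bilin_def by (auto simp: hom_def Pi_def)

lemma cell_props [simp]:
  assumes "cell f"
  shows "bim (bdom f)" "bim (bcod f)" "lalg (bcod f) = lalg (bdom f)" "ralg (bcod f) = ralg (bdom f)"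
  using assms by (auto simp: cell_iff bilin_def)

lemma cell_closed [simp]:
  "\<lbrakk>cell f; bcod f = N; m \<in> carrier (bdom f)\<rbrakk> \<Longrightarrow> bmap f m \<in> carrier N"
  unfolding cell_iff bilin_def by (auto simp: add_hom)

lemma cell_additive: "cell f \<Longrightarrow> bmap f \<in> hom (add_monoid (bdom f)) (add_monoid (bcod f))"
  unfolding cell_iff bilin_def by auto

lemma cell_linear:
  "\<lbrakk>cell f; bdom f = M; m \<in> carrier M; m' \<in> carrier M\<rbrakk> \<Longrightarrow> bmap f (m \<oplus>\<^bsub>M\<^esub> m') = bmap f m \<oplus>\<^bsub>bcod f\<^esub> bmap f m'"
  "\<lbrakk>cell f; bdom f = M; a \<in> carrier (lalg M); m \<in> carrier M\<rbrakk> \<Longrightarrow> bmap f (lact M a m) = lact (bcod f) a (bmap f m)"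
  "\<lbrakk>cell f; bdom f = M; m \<in> carrier M; b \<in> carrier (ralg M)\<rbrakk> \<Longrightarrow> bmap f (ract M m b) = ract (bcod f) (bmap f m) b"
  unfolding cell_iff bilin_def by (auto simp: add_hom)

text \<open>Extensionality fixes the values off the carrier; agreement of values on the carrier is
  therefore equality of cells.\<close>

lemma cell_eqI:
  assumes "cell f" "cell g" "bdom f = bdom g" "bcod f = bcod g"
    and "\<And>x. x \<in> carrier (bdom g) \<Longrightarrow> bmap f x = bmap g x"
  shows "f = g"
proof -
  have "bmap f = bmap g"
    by (rule extensionalityI[of _ "carrier (bdom g)"]) (use assms(1-3)[unfolded cell_iff] assms(5) in auto)
  then show ?thesis using assms by simp
qed

text \<open>Only compatibility with addition enters, so the target is left arbitrary: bimodules
  occur as targets of cells, algebras as targets of functionals.\<close>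

lemma hom_eq_tensor:
  assumes "bim M" "bim N" "ralg M = lalg N" "h \<in> hom (add_monoid (tensor M N)) G" "h' \<in> hom (add_monoid (tensor M N)) G"
    and "\<And>m n. \<lbrakk>m \<in> carrier M; n \<in> carrier N\<rbrakk> \<Longrightarrow> h (pure_tensor M N m n) = h' (pure_tensor M N m n)"
    and "x \<in> carrier (tensor M N)"
  shows "h x = h' x"
  using assms(7)
proof (induction x rule: tensor_induct[OF assms(1-3), consumes 1, case_names pure add])
  case (add s t)
  then show ?case using hom_mult[OF assms(4)] hom_mult[OF assms(5)] by auto
qed (use assms in auto)

lemma hom_pure_right:
  assumes "bim M" "bim N" "ralg M = lalg N" "h \<in> hom (add_monoid (tensor M N)) G" "m \<in> carrier M"
  shows "(\<lambda>n. h (pure_tensor M N m n)) \<in> hom (add_monoid N) G"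
  by (rule homI) (use assms hom_in_carrier[OF assms(4)] hom_mult[OF assms(4)] in \<open>auto simp: pure_add_right\<close>)

lemma hom_pure_left:
  assumes "bim M" "bim N" "ralg M = lalg N" "h \<in> hom (add_monoid (tensor M N)) G" "n \<in> carrier N"
  shows "(\<lambda>m. h (pure_tensor M N m n)) \<in> hom (add_monoid M) G"
  by (rule homI) (use assms hom_in_carrier[OF assms(4)] hom_mult[OF assms(4)] in \<open>auto simp: pure_add_left\<close>)

text \<open>Freezing one argument of a pure tensor leaves an additive map in the other, so the
  principle for two factors can be applied once per tensor sign.\<close>

lemma hom_eq_tensor_right:
  assumes M: "bim M" "bim N" "bim P" "ralg M = lalg N" "ralg N = lalg P"
    and h: "h \<in> hom (add_monoid (tensor M (tensor N P))) G" "h' \<in> hom (add_monoid (tensor M (tensor N P))) G"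
    and eq: "\<And>m n p. \<lbrakk>m \<in> carrier M; n \<in> carrier N; p \<in> carrier P\<rbrakk> \<Longrightarrow>
      h (pure_tensor M (tensor N P) m (pure_tensor N P n p)) = h' (pure_tensor M (tensor N P) m (pure_tensor N P n p))"
    and x: "x \<in> carrier (tensor M (tensor N P))"
  shows "h x = h' x"
proof (rule hom_eq_tensor[OF _ _ _ h _ x])
  fix m y assume m: "m \<in> carrier M" and y: "y \<in> carrier (tensor N P)"
  show "h (pure_tensor M (tensor N P) m y) = h' (pure_tensor M (tensor N P) m y)"
    by (rule hom_eq_tensor[OF M(2,3,5) hom_pure_right[OF _ _ _ h(1) m] hom_pure_right[OF _ _ _ h(2) m] eq[OF m] y])
      (use M in auto)
qed (use M in auto)

lemma hom_eq_tensor_left: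
  assumes M: "bim M" "bim N" "bim P" "ralg M = lalg N" "ralg N = lalg P"
    and h: "h \<in> hom (add_monoid (tensor (tensor M N) P)) G" "h' \<in> hom (add_monoid (tensor (tensor M N) P)) G"
    and eq: "\<And>m n p. \<lbrakk>m \<in> carrier M; n \<in> carrier N; p \<in> carrier P\<rbrakk> \<Longrightarrow>
      h (pure_tensor (tensor M N) P (pure_tensor M N m n) p) = h' (pure_tensor (tensor M N) P (pure_tensor M N m n) p)"
    and x: "x \<in> carrier (tensor (tensor M N) P)"
  shows "h x = h' x"
proof (rule hom_eq_tensor[OF _ _ _ h _ x])
  fix y p assume p: "p \<in> carrier P" and y: "y \<in> carrier (tensor M N)"
  show "h (pure_tensor (tensor M N) P y p) = h' (pure_tensor (tensor M N) P y p)"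
    by (rule hom_eq_tensor[OF M(1,2,4) hom_pure_left[OF _ _ _ h(1) p] hom_pure_left[OF _ _ _ h(2) p] eq[OF _ _ p] y])
      (use M in auto)
qed (use M in auto)

lemma hom_eq_tensor_right4:
  assumes M: "bim M" "bim N" "bim P" "bim Q" "ralg M = lalg N" "ralg N = lalg P" "ralg P = lalg Q"
    and h: "h \<in> hom (add_monoid (tensor M (tensor N (tensor P Q)))) G" "h' \<in> hom (add_monoid (tensor M (tensor N (tensor P Q)))) G"
    and eq: "\<And>m n p q. \<lbrakk>m \<in> carrier M; n \<in> carrier N; p \<in> carrier P; q \<in> carrier Q\<rbrakk> \<Longrightarrow>
      h (pure_tensor M (tensor N (tensor P Q)) m (pure_tensor N (tensor P Q) n (pure_tensor P Q p q)))
      = h' (pure_tensor M (tensor N (tensor P Q)) m (pure_tensor N (tensor P Q) n (pure_tensor P Q p q)))"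
    and x: "x \<in> carrier (tensor M (tensor N (tensor P Q)))"
  shows "h x = h' x"
proof (rule hom_eq_tensor[OF _ _ _ h _ x])
  fix m y assume m: "m \<in> carrier M" and y: "y \<in> carrier (tensor N (tensor P Q))"
  show "h (pure_tensor M (tensor N (tensor P Q)) m y) = h' (pure_tensor M (tensor N (tensor P Q)) m y)"
    by (rule hom_eq_tensor_right[OF M(2-4,6,7) hom_pure_right[OF _ _ _ h(1) m] hom_pure_right[OF _ _ _ h(2) m] eq[OF m] y])
      (use M in auto)
qed (use M in auto)

lemma cell_eq_tensor:
  assumes "cell f" "cell g" "bdom f = tensor M N" "bdom g = tensor M N" "bcod f = bcod g"
    and "bim M" "bim N" "ralg M = lalg N"
    and "\<And>m n. \<lbrakk>m \<in> carrier M; n \<in> carrier N\<rbrakk> \<Longrightarrow> bmap f (pure_tensor M N m n) = bmap g (pure_tensor M N m n)"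
  shows "f = g"
  using assms cell_additive[of f] cell_additive[of g]
  by (intro cell_eqI) (auto intro: hom_eq_tensor[of M N "bmap f" "add_monoid (bcod g)"])

lemma cell_eq_tensor_right:
  assumes "cell f" "cell g" "bdom f = tensor M (tensor N P)" "bdom g = tensor M (tensor N P)" "bcod f = bcod g"
    and "bim M" "bim N" "bim P" "ralg M = lalg N" "ralg N = lalg P"
    and "\<And>m n p. \<lbrakk>m \<in> carrier M; n \<in> carrier N; p \<in> carrier P\<rbrakk> \<Longrightarrow>
      bmap f (pure_tensor M (tensor N P) m (pure_tensor N P n p)) = bmap g (pure_tensor M (tensor N P) m (pure_tensor N P n p))"
  shows "f = g"
  using assms cell_additive[of f] cell_additive[of g]
  by (intro cell_eqI) (auto intro: hom_eq_tensor_right[of M N P "bmap f" "add_monoid (bcod g)"])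

lemma cell_eq_tensor_left:
  assumes "cell f" "cell g" "bdom f = tensor (tensor M N) P" "bdom g = tensor (tensor M N) P" "bcod f = bcod g"
    and "bim M" "bim N" "bim P" "ralg M = lalg N" "ralg N = lalg P"
    and "\<And>m n p. \<lbrakk>m \<in> carrier M; n \<in> carrier N; p \<in> carrier P\<rbrakk> \<Longrightarrow>
      bmap f (pure_tensor (tensor M N) P (pure_tensor M N m n) p) = bmap g (pure_tensor (tensor M N) P (pure_tensor M N m n) p)"
  shows "f = g"
  using assms cell_additive[of f] cell_additive[of g]
  by (intro cell_eqI) (auto intro: hom_eq_tensor_left[of M N P "bmap f" "add_monoid (bcod g)"])

lemma cell_eq_tensor_right4:
  assumes "cell f" "cell g" "bdom f = tensor M (tensor N (tensor P Q))" "bdom g = tensor M (tensor N (tensor P Q))" "bcod f = bcod g"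
    and "bim M" "bim N" "bim P" "bim Q" "ralg M = lalg N" "ralg N = lalg P" "ralg P = lalg Q"
    and "\<And>m n p q. \<lbrakk>m \<in> carrier M; n \<in> carrier N; p \<in> carrier P; q \<in> carrier Q\<rbrakk> \<Longrightarrow>
      bmap f (pure_tensor M (tensor N (tensor P Q)) m (pure_tensor N (tensor P Q) n (pure_tensor P Q p q)))
      = bmap g (pure_tensor M (tensor N (tensor P Q)) m (pure_tensor N (tensor P Q) n (pure_tensor P Q p q)))"
  shows "f = g"
  using assms cell_additive[of f] cell_additive[of g]
  by (intro cell_eqI) (auto intro: hom_eq_tensor_right4[of M N P Q "bmap f" "add_monoid (bcod g)"])

text \<open>\<open>G\<close> is separate from \<open>P\<close> because some of the lifts are taken
  into \<open>tensor_group\<close> and others into \<open>add_monoid P\<close>. The two records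
  differ, but their sets of homomorphisms agree, and that is all the argument looks at.\<close>

lemma tensor_lift_bilin:
  assumes M: "bim M" "bim N" "ralg M = lalg N" and P: "bim P" "lalg P = lalg M" "ralg P = ralg N"
    and G: "hom (tensor_group M N) G = hom (tensor_group M N) (add_monoid P)" "comm_group G"
    and b: "balanced M N G \<beta>"
    and l: "\<And>a m n. \<lbrakk>a \<in> carrier (lalg M); m \<in> carrier M; n \<in> carrier N\<rbrakk> \<Longrightarrow> \<beta> (lact M a m) n = lact P a (\<beta> m n)"
    and r: "\<And>m n c. \<lbrakk>m \<in> carrier M; n \<in> carrier N; c \<in> carrier (ralg N)\<rbrakk> \<Longrightarrow> \<beta> m (ract N n c) = ract P (\<beta> m n) c"
  shows "bilin (tensor M N) P (tensor_lift M N G \<beta>)"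
proof -
  let ?h = "tensor_lift M N G \<beta>"
  have h: "?h \<in> hom (add_monoid (tensor M N)) (add_monoid P)"
    using tensor_lift_hom[OF M G(2) b] G by (simp add: hom_from_tensor_group)
  note hp = tensor_lift_pure[OF M G(2) b]
  have T: "bim (tensor M N)" using M by simp
  have "?h (lact (tensor M N) a x) = lact P a (?h x)" if a: "a \<in> carrier (lalg M)" and x: "x \<in> carrier (tensor M N)" for a x
    using M(1) M(2) M(3) _ _ _ x
  proof (rule hom_eq_tensor)
    show "(\<lambda>x. ?h (lact (tensor M N) a x)) \<in> hom (add_monoid (tensor M N)) (add_monoid P)"
      by (rule add_homI) (use a T add_hom[OF h] M in \<open>auto simp: bim_distrib\<close>)
    show "(\<lambda>x. lact P a (?h x)) \<in> hom (add_monoid (tensor M N)) (add_monoid P)"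
      by (rule add_homI) (use a T P add_hom[OF h] M in \<open>auto simp: bim_distrib\<close>)
  qed (use a l M in \<open>auto simp: hp\<close>)
  moreover have "?h (ract (tensor M N) x c) = ract P (?h x) c" if a: "c \<in> carrier (ralg N)" and x: "x \<in> carrier (tensor M N)" for c x
    using M(1) M(2) M(3) _ _ _ x
  proof (rule hom_eq_tensor)
    show "(\<lambda>x. ?h (ract (tensor M N) x c)) \<in> hom (add_monoid (tensor M N)) (add_monoid P)"
      by (rule add_homI) (use a T add_hom[OF h] M in \<open>auto simp: bim_distrib\<close>)
    show "(\<lambda>x. ract P (?h x) c) \<in> hom (add_monoid (tensor M N)) (add_monoid P)"
      by (rule add_homI) (use a T P add_hom[OF h] M in \<open>auto simp: bim_distrib\<close>)
  qed (use a r M in \<open>auto simp: hp\<close>)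
  ultimately show ?thesis
    using h P M by (simp add: bilin_def)
qed

lemma id2_cell_Alg2 [simp]:
  "m \<in> carrier M \<Longrightarrow> bmap (id2 (Alg2 K) M) m = m"
  "bim M \<Longrightarrow> cell (id2 (Alg2 K) M)"
  unfolding cell_iff bilin_def by (auto simp: Alg2_def intro!: add_homI)

lemma vcomp_Alg2 [simp]:
  "m \<in> carrier (bdom f) \<Longrightarrow> bmap (vcomp (Alg2 K) g f) m = bmap g (bmap f m)"
  "\<lbrakk>cell f; cell g; bcod f = bdom g\<rbrakk> \<Longrightarrow> cell (vcomp (Alg2 K) g f)"
proof -
  show b: "m \<in> carrier (bdom f) \<Longrightarrow> bmap (vcomp (Alg2 K) g f) m = bmap g (bmap f m)" for m
    by (simp add: Alg2_def compose_def)
  assume *: "cell f" "cell g" "bcod f = bdom g"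
  have "bilin (bdom f) (bcod g) (\<lambda>m. bmap g (bmap f m))"
    unfolding bilin_def using * cell_props(3)[OF *(1)] cell_props(4)[OF *(1)]
    by (auto intro!: add_homI simp: cell_linear)
  from bilin_cong[OF this b] show "cell (vcomp (Alg2 K) g f)"
    unfolding cell_iff by (simp add: Alg2_def)
qed

lemma tensor_map_Alg2 [simp]:
  assumes "cell f" "cell g" "ralg (bdom f) = lalg (bdom g)"
  shows "cell (tensor_map f g)"
    and "\<lbrakk>bdom f = M; bdom g = N; m \<in> carrier M; n \<in> carrier N\<rbrakk> \<Longrightarrow>
      bmap (tensor_map f g) (pure_tensor M N m n) = pure_tensor (bcod f) (bcod g) (bmap f m) (bmap g n)"
proof -
  have c: "comm_group (tensor_group (bcod f) (bcod g))"
    using assms by (intro comm_group_tensor_group) auto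
  have b: "balanced (bdom f) (bdom g) (tensor_group (bcod f) (bcod g))
     (\<lambda>m n. pure_tensor (bcod f) (bcod g) (bmap f m) (bmap g n))"
    using assms by (intro balanced_maps cell_additive) (auto simp: cell_linear)
  note lb = cell_linear[OF assms(1) refl] cell_linear[OF assms(2) refl]
  have "bilin (bdom (tensor_map f g)) (bcod (tensor_map f g)) (bmap (tensor_map f g))"
    unfolding tensor_map_def bimod_map.simps
    by (rule tensor_lift_bilin[OF _ _ _ _ _ _ _ c b]) (use assms in \<open>auto simp: lb hom_to_tensor_group\<close>)
  then show "cell (tensor_map f g)"
    unfolding cell_iff using assms tensor_lift_extensional[OF _ _ _ c b] by (simp add: tensor_map_def)
  show "\<lbrakk>bdom f = M; bdom g = N; m \<in> carrier M; n \<in> carrier N\<rbrakk> \<Longrightarrow>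
      bmap (tensor_map f g) (pure_tensor M N m n) = pure_tensor (bcod f) (bcod g) (bmap f m) (bmap g n)"
    using tensor_lift_pure[OF _ _ _ c b] assms by (auto simp: tensor_map_def)
qed

text \<open>The premise \<open>A = ralg M\<close>, in place of a literal \<open>ralg M\<close> in
  the pattern, lets the evaluation rule fire after the algebra has been rewritten to a name. Later
  evaluation rules have equational premises for the same reason.\<close>

lemma lunit_Alg2 [simp]:
  assumes "bim M"
  shows "cell (lunit (Alg2 K) M)"
    and "\<lbrakk>A = ralg M; m \<in> carrier M; b \<in> carrier A\<rbrakk> \<Longrightarrow>
      bmap (lunit (Alg2 K) M) (pure_tensor M (regular A) m b) = ract M m b"
proof -
  have b: "balanced M (regular (ralg M)) (add_monoid M) (ract M)"
    using assms by (auto intro!: balancedI simp: bim_distrib bim_assoc)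
  have r: "bim (regular (ralg M))" "ralg M = lalg (regular (ralg M))" using assms by auto
  note c = bim_comm_group[OF assms]
  have "bilin (tensor M (regular (ralg M))) M (tensor_lift M (regular (ralg M)) (add_monoid M) (ract M))"
    by (rule tensor_lift_bilin[OF assms r assms _ _ _ c b]) (use assms in \<open>auto simp: bim_assoc\<close>)
  then show "cell (lunit (Alg2 K) M)"
    unfolding cell_iff using tensor_lift_extensional[OF assms r c b] by (simp add: Alg2_def)
  show "\<lbrakk>A = ralg M; m \<in> carrier M; b \<in> carrier A\<rbrakk> \<Longrightarrow>
      bmap (lunit (Alg2 K) M) (pure_tensor M (regular A) m b) = ract M m b"
    using tensor_lift_pure[OF assms r c b] by (simp add: Alg2_def)
qed

lemma runit_Alg2 [simp]:
  assumes "bim M"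
  shows "cell (runit (Alg2 K) M)"
    and "\<lbrakk>A = lalg M; m \<in> carrier M; a \<in> carrier A\<rbrakk> \<Longrightarrow>
      bmap (runit (Alg2 K) M) (pure_tensor (regular A) M a m) = lact M a m"
proof -
  have b: "balanced (regular (lalg M)) M (add_monoid M) (lact M)"
    using assms by (auto intro!: balancedI simp: bim_distrib bim_assoc)
  have r: "bim (regular (lalg M))" "ralg (regular (lalg M)) = lalg M" using assms by auto
  note c = bim_comm_group[OF assms]
  have "bilin (tensor (regular (lalg M)) M) M (tensor_lift (regular (lalg M)) M (add_monoid M) (lact M))"
    by (rule tensor_lift_bilin[OF r(1) assms r(2) assms _ _ _ c b]) (use assms in \<open>auto simp: bim_assoc\<close>)
  then show "cell (runit (Alg2 K) M)"
    unfolding cell_iff using tensor_lift_extensional[OF r(1) assms r(2) c b] by (simp add: Alg2_def)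
  show "\<lbrakk>A = lalg M; m \<in> carrier M; a \<in> carrier A\<rbrakk> \<Longrightarrow>
      bmap (runit (Alg2 K) M) (pure_tensor (regular A) M a m) = lact M a m"
    using tensor_lift_pure[OF r(1) assms r(2) c b] by (simp add: Alg2_def)
qed

text \<open>Supplies the pointwise sums of lifts that appear when a nested lift is shown to be
  additive in its parameter.\<close>

lemma add_hom_add:
  assumes "bim N" "h \<in> hom (add_monoid M) (add_monoid N)" "h' \<in> hom (add_monoid M) (add_monoid N)"
  shows "(\<lambda>x. h x \<oplus>\<^bsub>N\<^esub> h' x) \<in> hom (add_monoid M) (add_monoid N)"
  by (rule add_homI) (use assms in \<open>auto simp: add_hom[OF assms(2)] add_hom[OF assms(3)] intro: add_swap\<close>)

section \<open>The associator and its inverse\<close>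

context
  fixes M N P :: "('k, 'u) bimodule"
  assumes M: "bim M" and N: "bim N" and P: "bim P"
    and eq: "ralg M = lalg N" "ralg N = lalg P"
begin

abbreviation "assoc_group \<equiv> tensor_group (tensor M N) P"
abbreviation "assoc_group' \<equiv> tensor_group M (tensor N P)"

lemma assoc_bims: "bim (tensor M N)" "bim (tensor N P)" "bim (tensor (tensor M N) P)" "bim (tensor M (tensor N P))"
  using M N P eq by auto

lemma assoc_comm_groups: "comm_group assoc_group" "comm_group assoc_group'"
  using M N P eq assoc_bims by (auto intro: comm_group_tensor_group)

text \<open>The associator is a nested lift: for fixed \<open>m\<close> the inner lift treats the
  tensors of \<open>N\<close> and \<open>P\<close>. Balancedness of the outer lift is then an
  identity between inner lifts and again a matter of pure tensors. The primed versions fix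
  \<open>p\<close> instead and serve the opposite direction.\<close>

lemma assoc_inner_balanced:
  assumes "m \<in> carrier M"
  shows "balanced N P assoc_group (\<lambda>n p. pure_tensor (tensor M N) P (pure_tensor M N m n) p)"
  by (rule balanced_maps) (use assms M N P eq assoc_bims in \<open>auto intro!: add_homI simp: pure_add_right\<close>)

lemma assoc_inner_balanced':
  assumes "p \<in> carrier P"
  shows "balanced M N assoc_group' (\<lambda>m n. pure_tensor M (tensor N P) m (pure_tensor N P n p))"
  by (rule balanced_maps) (use assms M N P eq assoc_bims in \<open>auto intro!: add_homI simp: pure_add_left\<close>)

abbreviation "assoc_inner m \<equiv> tensor_lift N P assoc_group (\<lambda>n p. pure_tensor (tensor M N) P (pure_tensor M N m n) p)"
abbreviation "assoc_inner' p \<equiv> tensor_lift M N assoc_group' (\<lambda>m n. pure_tensor M (tensor N P) m (pure_tensor N P n p))"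

lemma assoc_inner_hom: "m \<in> carrier M \<Longrightarrow> assoc_inner m \<in> hom (add_monoid (tensor N P)) (add_monoid (tensor (tensor M N) P))"
  using tensor_lift_hom[OF N P eq(2) assoc_comm_groups(1) assoc_inner_balanced]
  by (simp add: hom_to_tensor_group hom_from_tensor_group)

lemma assoc_inner'_hom: "p \<in> carrier P \<Longrightarrow> assoc_inner' p \<in> hom (add_monoid (tensor M N)) (add_monoid (tensor M (tensor N P)))"
  using tensor_lift_hom[OF M N eq(1) assoc_comm_groups(2) assoc_inner_balanced']
  by (simp add: hom_to_tensor_group hom_from_tensor_group)

lemmas assoc_inner_pure = tensor_lift_pure[OF N P eq(2) assoc_comm_groups(1) assoc_inner_balanced]
lemmas assoc_inner'_pure = tensor_lift_pure[OF M N eq(1) assoc_comm_groups(2) assoc_inner_balanced']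

lemma assoc_inner_eqI:
  assumes "h \<in> hom (add_monoid (tensor N P)) (add_monoid (tensor (tensor M N) P))"
    "h' \<in> hom (add_monoid (tensor N P)) (add_monoid (tensor (tensor M N) P))"
    "\<And>n p. \<lbrakk>n \<in> carrier N; p \<in> carrier P\<rbrakk> \<Longrightarrow> h (pure_tensor N P n p) = h' (pure_tensor N P n p)"
    "x \<in> carrier (tensor N P)"
  shows "h x = h' x"
  using hom_eq_tensor[OF N P eq(2) assms] .

lemma assoc_inner'_eqI:
  assumes "h \<in> hom (add_monoid (tensor M N)) (add_monoid (tensor M (tensor N P)))"
    "h' \<in> hom (add_monoid (tensor M N)) (add_monoid (tensor M (tensor N P)))"
    "\<And>m n. \<lbrakk>m \<in> carrier M; n \<in> carrier N\<rbrakk> \<Longrightarrow> h (pure_tensor M N m n) = h' (pure_tensor M N m n)"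
    "x \<in> carrier (tensor M N)"
  shows "h x = h' x"
  using hom_eq_tensor[OF M N eq(1) assms] .

lemmas assoc_tensor_simps = M N P eq assoc_bims assoc_inner_pure assoc_inner'_pure add_hom[OF assoc_inner_hom] add_hom[OF assoc_inner'_hom]
  pure_add_left pure_add_right pure_balanced bim_distrib

lemma assoc_outer_balanced: "balanced M (tensor N P) assoc_group assoc_inner"
proof (rule balancedI)
  fix m x assume a: "m \<in> carrier M" "x \<in> carrier (tensor N P)"
  then show "assoc_inner m x \<in> carrier assoc_group"
    using add_hom(1)[OF assoc_inner_hom] by (simp add: carrier_tensor)
next
  fix m x x' assume "m \<in> carrier M" "x \<in> carrier (tensor N P)" "x' \<in> carrier (tensor N P)"
  then show "assoc_inner m (x \<oplus>\<^bsub>tensor N P\<^esub> x') = assoc_inner m x \<otimes>\<^bsub>assoc_group\<^esub> assoc_inner m x'"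
    using add_hom(2)[OF assoc_inner_hom] by (simp add: mult_tensor)
next
  fix m m' x assume a: "m \<in> carrier M" "m' \<in> carrier M" and x: "x \<in> carrier (tensor N P)"
  show "assoc_inner (m \<oplus>\<^bsub>M\<^esub> m') x = assoc_inner m x \<otimes>\<^bsub>assoc_group\<^esub> assoc_inner m' x"
    unfolding mult_tensor by (rule assoc_inner_eqI[OF _ add_hom_add _ x]) (use a in \<open>auto simp: assoc_tensor_simps intro!: assoc_inner_hom\<close>)
next
  fix m b x assume a: "m \<in> carrier M" "b \<in> carrier (ralg M)" and x: "x \<in> carrier (tensor N P)"
  then show "assoc_inner (ract M m b) x = assoc_inner m (lact (tensor N P) b x)"
    by (rule_tac assoc_inner_eqI[OF _ _ _ x]) (use a in \<open>auto simp: assoc_tensor_simps intro!: add_homI\<close>)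
qed

lemma assoc_outer_balanced': "balanced (tensor M N) P assoc_group' (\<lambda>x p. assoc_inner' p x)"
proof (rule balancedI)
  fix p x assume a: "p \<in> carrier P" "x \<in> carrier (tensor M N)"
  then show "assoc_inner' p x \<in> carrier assoc_group'"
    using add_hom(1)[OF assoc_inner'_hom] by (simp add: carrier_tensor)
next
  fix p x x' assume "p \<in> carrier P" "x \<in> carrier (tensor M N)" "x' \<in> carrier (tensor M N)"
  then show "assoc_inner' p (x \<oplus>\<^bsub>tensor M N\<^esub> x') = assoc_inner' p x \<otimes>\<^bsub>assoc_group'\<^esub> assoc_inner' p x'"
    using add_hom(2)[OF assoc_inner'_hom] by (simp add: mult_tensor)
next
  fix p p' x assume a: "p \<in> carrier P" "p' \<in> carrier P" and x: "x \<in> carrier (tensor M N)"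
  show "assoc_inner' (p \<oplus>\<^bsub>P\<^esub> p') x = assoc_inner' p x \<otimes>\<^bsub>assoc_group'\<^esub> assoc_inner' p' x"
    unfolding mult_tensor by (rule assoc_inner'_eqI[OF _ add_hom_add _ x]) (use a in \<open>auto simp: assoc_tensor_simps intro!: assoc_inner'_hom\<close>)
next
  fix p b x assume a: "p \<in> carrier P" "b \<in> carrier (ralg (tensor M N))" and x: "x \<in> carrier (tensor M N)"
  then show "assoc_inner' p (ract (tensor M N) x b) = assoc_inner' (lact P b p) x"
    by (rule_tac assoc_inner'_eqI[OF _ _ _ x]) (use a in \<open>auto simp: assoc_tensor_simps intro!: add_homI\<close>)
qed

lemma assoc_cell: "cell (assoc (Alg2 K) P N M)"
proof -
  have "bilin (tensor M (tensor N P)) (tensor (tensor M N) P) (tensor_lift M (tensor N P) assoc_group assoc_inner)"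
  proof (rule tensor_lift_bilin[OF _ _ _ _ _ _ _ assoc_comm_groups(1) assoc_outer_balanced])
    fix a m x assume a: "a \<in> carrier (lalg M)" "m \<in> carrier M" and x: "x \<in> carrier (tensor N P)"
    then show "assoc_inner (lact M a m) x = lact (tensor (tensor M N) P) a (assoc_inner m x)"
      by (rule_tac assoc_inner_eqI[OF _ _ _ x]) (use a in \<open>auto simp: assoc_tensor_simps intro!: add_homI\<close>)
  next
    fix m x c assume a: "c \<in> carrier (ralg (tensor N P))" "m \<in> carrier M" and x: "x \<in> carrier (tensor N P)"
    then show "assoc_inner m (ract (tensor N P) x c) = ract (tensor (tensor M N) P) (assoc_inner m x) c"
      by (rule_tac assoc_inner_eqI[OF _ _ _ x]) (use a in \<open>auto simp: assoc_tensor_simps intro!: add_homI\<close>)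
  qed (auto simp: assoc_tensor_simps hom_to_tensor_group)
  then show ?thesis
    unfolding cell_iff
    using tensor_lift_extensional[OF M assoc_bims(2) _ assoc_comm_groups(1) assoc_outer_balanced] eq by (simp add: Alg2_def)
qed

lemma assoc_pure:
  "\<lbrakk>m \<in> carrier M; n \<in> carrier N; p \<in> carrier P\<rbrakk> \<Longrightarrow>
    bmap (assoc (Alg2 K) P N M) (pure_tensor M (tensor N P) m (pure_tensor N P n p))
      = pure_tensor (tensor M N) P (pure_tensor M N m n) p"
  using tensor_lift_pure[OF M assoc_bims(2) _ assoc_comm_groups(1) assoc_outer_balanced] eq N P by (simp add: Alg2_def assoc_inner_pure)

text \<open>Additivity and the values on pure tensors determine both composites with the associator;
  linearity of the reverse map then follows from its being an inverse.\<close>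

lemma assoc_backward:
  obtains h where "h \<in> hom (add_monoid (tensor (tensor M N) P)) (add_monoid (tensor M (tensor N P)))"
    "\<And>m n p. \<lbrakk>m \<in> carrier M; n \<in> carrier N; p \<in> carrier P\<rbrakk> \<Longrightarrow>
      h (pure_tensor (tensor M N) P (pure_tensor M N m n) p) = pure_tensor M (tensor N P) m (pure_tensor N P n p)"
proof
  let ?h = "tensor_lift (tensor M N) P assoc_group' (\<lambda>x p. assoc_inner' p x)"
  show "?h \<in> hom (add_monoid (tensor (tensor M N) P)) (add_monoid (tensor M (tensor N P)))"
    using tensor_lift_hom[OF assoc_bims(1) P _ assoc_comm_groups(2) assoc_outer_balanced'] eq
    by (simp add: hom_to_tensor_group hom_from_tensor_group)
  show "\<And>m n p. \<lbrakk>m \<in> carrier M; n \<in> carrier N; p \<in> carrier P\<rbrakk> \<Longrightarrow>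
      ?h (pure_tensor (tensor M N) P (pure_tensor M N m n) p) = pure_tensor M (tensor N P) m (pure_tensor N P n p)"
    using tensor_lift_pure[OF assoc_bims(1) P _ assoc_comm_groups(2) assoc_outer_balanced'] eq M N by (simp add: assoc_inner'_pure)
qed

end

section \<open>Invertible cells and the bicategory axioms\<close>

declare assoc_cell [simp] assoc_pure [simp]

text \<open>The inverse function of a bilinear map is itself bilinear, so \<open>g\<close> may be
  given as a mere function. The inverses built from sums over a dual basis enter through this
  rule.\<close>

lemma cell_IsosI:
  assumes f: "cell f" "bdom f = M" "bcod f = N"
    and g: "\<And>y. y \<in> carrier N \<Longrightarrow> g y \<in> carrier M"
    and gf: "\<And>x. x \<in> carrier M \<Longrightarrow> g (bmap f x) = x"
    and fg: "\<And>y. y \<in> carrier N \<Longrightarrow> bmap f (g y) = y"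
  shows "f \<in> Isos (Alg2 K) M N"
proof -
  let ?t = "\<lparr>bdom = N, bcod = M, bmap = restrict g (carrier N)\<rparr>"
  have M: "bim M" "bim N" "lalg N = lalg M" "ralg N = ralg M" using f by auto
  \<comment> \<open>Injectivity of \<open>bmap f\<close> in a directed form: to identify
    \<open>g y\<close> it suffices to exhibit a preimage of \<open>y\<close>.\<close>
  have *: "g y = x" if "x \<in> carrier M" "bmap f x = y" for x y
    using gf[OF that(1)] that(2) by simp
  have "bilin N M g"
    unfolding bilin_def
  proof (intro conjI ballI add_homI g M M(3,4)[symmetric])
    fix x y assume "x \<in> carrier N" "y \<in> carrier N"
    then show "g (x \<oplus>\<^bsub>N\<^esub> y) = g x \<oplus>\<^bsub>M\<^esub> g y"
      using f g fg M by (intro *) (auto simp: cell_linear)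
  next
    fix a y assume "a \<in> carrier (lalg N)" "y \<in> carrier N"
    then show "g (lact N a y) = lact M a (g y)"
      using f g fg M by (intro *) (auto simp: cell_linear)
  next
    fix y b assume "y \<in> carrier N" "b \<in> carrier (ralg N)"
    then show "g (ract N y b) = ract M (g y) b"
      using f g fg M by (intro *) (auto simp: cell_linear)
  qed auto
  then have t: "cell ?t"
    by (intro cellI, elim bilin_cong) auto
  have "vcomp (Alg2 K) ?t f = id2 (Alg2 K) M"
    by (rule cell_eqI) (use f t M gf in auto)
  moreover have "vcomp (Alg2 K) f ?t = id2 (Alg2 K) N"
    by (rule cell_eqI) (use f t M fg g in auto)
  ultimately have "inverse2 (Alg2 K) f ?t"
    using f t by (simp add: inverse2_def)
  then show ?thesis
    using f by (auto simp: Isos_def)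
qed

lemma assoc_Isos:
  assumes M: "bim M" "bim N" "bim P" "ralg M = lalg N" "ralg N = lalg P"
  shows "assoc (Alg2 K) P N M \<in> Isos (Alg2 K) (tensor M (tensor N P)) (tensor (tensor M N) P)"
proof -
  obtain h where h: "h \<in> hom (add_monoid (tensor (tensor M N) P)) (add_monoid (tensor M (tensor N P)))"
    "\<And>m n p. \<lbrakk>m \<in> carrier M; n \<in> carrier N; p \<in> carrier P\<rbrakk> \<Longrightarrow>
      h (pure_tensor (tensor M N) P (pure_tensor M N m n) p) = pure_tensor M (tensor N P) m (pure_tensor N P n p)"
    using assoc_backward[OF M] by blast
  let ?a = "bmap (assoc (Alg2 K) P N M)"
  have a: "?a \<in> hom (add_monoid (tensor M (tensor N P))) (add_monoid (tensor (tensor M N) P))"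
    using cell_additive[OF assoc_cell[OF M]] by simp
  show ?thesis
  proof (rule cell_IsosI[where g = h])
    fix x assume x: "x \<in> carrier (tensor M (tensor N P))"
    show "h (?a x) = x"
      by (rule hom_eq_tensor_right[OF M _ _ _ x, of "\<lambda>x. h (?a x)" "add_monoid (tensor M (tensor N P))" "\<lambda>x. x"])
        (use M h(2) add_hom[OF h(1)] add_hom[OF a] in \<open>auto intro!: add_homI\<close>)
  next
    fix x assume x: "x \<in> carrier (tensor (tensor M N) P)"
    show "?a (h x) = x"
      by (rule hom_eq_tensor_left[OF M _ _ _ x, of "\<lambda>x. ?a (h x)" "add_monoid (tensor (tensor M N) P)" "\<lambda>x. x"])
        (use M h(2) add_hom[OF h(1)] add_hom[OF a] in \<open>auto intro!: add_homI\<close>)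
  qed (use M add_hom[OF h(1)] in auto)
qed

lemma lunit_Isos:
  assumes M: "bim M"
  shows "lunit (Alg2 K) M \<in> Isos (Alg2 K) (tensor M (regular (ralg M))) M"
proof (rule cell_IsosI[where g = "\<lambda>m. pure_tensor M (regular (ralg M)) m \<one>\<^bsub>ralg M\<^esub>"])
  let ?l = "bmap (lunit (Alg2 K) M)" and ?p = "\<lambda>m. pure_tensor M (regular (ralg M)) m \<one>\<^bsub>ralg M\<^esub>"
  have a: "?l \<in> hom (add_monoid (tensor M (regular (ralg M)))) (add_monoid M)"
    using cell_additive[OF lunit_Alg2(1)[OF M]] by simp
  fix x assume x: "x \<in> carrier (tensor M (regular (ralg M)))"
  show "?p (?l x) = x"
    by (rule hom_eq_tensor[OF M _ _ _ _ _ x, of "\<lambda>x. ?p (?l x)" "add_monoid (tensor M (regular (ralg M)))" "\<lambda>x. x"])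
      (use M add_hom[OF a] in \<open>auto intro!: add_homI simp: pure_balanced pure_add_left\<close>)
qed (use M in auto)

lemma runit_Isos:
  assumes M: "bim M"
  shows "runit (Alg2 K) M \<in> Isos (Alg2 K) (tensor (regular (lalg M)) M) M"
proof (rule cell_IsosI[where g = "\<lambda>m. pure_tensor (regular (lalg M)) M \<one>\<^bsub>lalg M\<^esub> m"])
  let ?r = "bmap (runit (Alg2 K) M)" and ?p = "\<lambda>m. pure_tensor (regular (lalg M)) M \<one>\<^bsub>lalg M\<^esub> m"
  have a: "?r \<in> hom (add_monoid (tensor (regular (lalg M)) M)) (add_monoid M)"
    using cell_additive[OF runit_Alg2(1)[OF M]] by simp
  fix x assume x: "x \<in> carrier (tensor (regular (lalg M)) M)"
  show "?p (?r x) = x"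
    by (rule hom_eq_tensor[OF _ M _ _ _ _ x, of "\<lambda>x. ?p (?r x)" "add_monoid (tensor (regular (lalg M)) M)" "\<lambda>x. x"])
      (use M add_hom[OF a] in \<open>auto intro!: add_homI simp: pure_balanced[symmetric] pure_add_right\<close>)
qed (use M in auto)

text \<open>Since \<open>N \<circledcirc> M\<close> is \<open>tensor M N\<close>, the associator out
  of \<open>(P \<circledcirc> N) \<circledcirc> M\<close> starts at
  \<open>tensor M (tensor N P)\<close>. This is why naturality, pentagon and triangle are tested on
  pure tensors nested to the right.\<close>

lemma bicategory_Alg2: "bicategory (Alg2 K :: (('k, 'u) module, ('k, 'u) bimodule, ('k, 'u) bimod_map) bicat)"
proof
  fix M N P A B C D :: "('k, 'u) bimodule" and w x y z :: "('k, 'u) module"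
  assume a: "M \<in> Hom (Alg2 K) w x" "N \<in> Hom (Alg2 K) x y" "P \<in> Hom (Alg2 K) y z"
  then show "assoc (Alg2 K) P N M \<in> Isos (Alg2 K) ((P \<circledcirc>\<^bsub>Alg2 K\<^esub> N) \<circledcirc>\<^bsub>Alg2 K\<^esub> M) (P \<circledcirc>\<^bsub>Alg2 K\<^esub> (N \<circledcirc>\<^bsub>Alg2 K\<^esub> M))"
    by (simp add: assoc_Isos)
next
  fix M :: "('k, 'u) bimodule" and x y
  assume "M \<in> Hom (Alg2 K) x y"
  then show "lunit (Alg2 K) M \<in> Isos (Alg2 K) (id1 (Alg2 K) y \<circledcirc>\<^bsub>Alg2 K\<^esub> M) M"
    "runit (Alg2 K) M \<in> Isos (Alg2 K) (M \<circledcirc>\<^bsub>Alg2 K\<^esub> id1 (Alg2 K) x) M"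
    using lunit_Isos[of M] runit_Isos[of M] by auto
next
  fix \<sigma> \<sigma>' \<tau> \<tau>' :: "('k, 'u) bimod_map" and M M' M'' N N' N'' :: "('k, 'u) bimodule"
  assume "\<sigma> \<in> Cells (Alg2 K) M M'" "\<sigma>' \<in> Cells (Alg2 K) M' M''" "\<tau> \<in> Cells (Alg2 K) N N'"
    "\<tau>' \<in> Cells (Alg2 K) N' N''" "trg (Alg2 K) M = src (Alg2 K) N"
  then have c: "cell \<sigma>" "cell \<sigma>'" "cell \<tau>" "cell \<tau>'" "bdom \<sigma> = M" "bcod \<sigma> = M'" "bdom \<sigma>' = M'"
    "bcod \<sigma>' = M''" "bdom \<tau> = N" "bcod \<tau> = N'" "bdom \<tau>' = N'" "bcod \<tau>' = N''" and e: "ralg M = lalg N" by auto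
  have b: "bim M" "bim N" "bim M'" "bim N'" "ralg M' = ralg M" "lalg N' = lalg N"
    using c cell_props[of \<sigma>] cell_props[of \<tau>] by auto
  show "(\<tau>' \<bullet>\<^bsub>Alg2 K\<^esub> \<tau>) \<star>\<^bsub>Alg2 K\<^esub> (\<sigma>' \<bullet>\<^bsub>Alg2 K\<^esub> \<sigma>) = (\<tau>' \<star>\<^bsub>Alg2 K\<^esub> \<sigma>') \<bullet>\<^bsub>Alg2 K\<^esub> (\<tau> \<star>\<^bsub>Alg2 K\<^esub> \<sigma>)"
    by (rule cell_eq_tensor[of _ _ M N]) (use c b e in auto)
next
  fix \<sigma> \<tau> \<upsilon> :: "('k, 'u) bimod_map" and M M' N N' P P' :: "('k, 'u) bimodule"
  assume "\<sigma> \<in> Cells (Alg2 K) M M'" "\<tau> \<in> Cells (Alg2 K) N N'" "\<upsilon> \<in> Cells (Alg2 K) P P'"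
    "trg (Alg2 K) M = src (Alg2 K) N" "trg (Alg2 K) N = src (Alg2 K) P"
  then have c: "cell \<sigma>" "cell \<tau>" "cell \<upsilon>" "bdom \<sigma> = M" "bcod \<sigma> = M'" "bdom \<tau> = N" "bcod \<tau> = N'"
    "bdom \<upsilon> = P" "bcod \<upsilon> = P'" and e: "ralg M = lalg N" "ralg N = lalg P" by auto
  have b: "bim M" "bim N" "bim P" "bim M'" "bim N'" "bim P'"
    "ralg M' = ralg M" "lalg N' = lalg N" "ralg N' = ralg N" "lalg P' = lalg P"
    using c cell_props[of \<sigma>] cell_props[of \<tau>] cell_props[of \<upsilon>] by auto
  show "assoc (Alg2 K) P' N' M' \<bullet>\<^bsub>Alg2 K\<^esub> ((\<upsilon> \<star>\<^bsub>Alg2 K\<^esub> \<tau>) \<star>\<^bsub>Alg2 K\<^esub> \<sigma>)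
    = (\<upsilon> \<star>\<^bsub>Alg2 K\<^esub> (\<tau> \<star>\<^bsub>Alg2 K\<^esub> \<sigma>)) \<bullet>\<^bsub>Alg2 K\<^esub> assoc (Alg2 K) P N M"
    by (rule cell_eq_tensor_right[of _ _ M N P]) (use c b e in auto)
next
  fix \<sigma> :: "('k, 'u) bimod_map" and M M' :: "('k, 'u) bimodule" and x y
  assume "\<sigma> \<in> Cells (Alg2 K) M M'" "M \<in> Hom (Alg2 K) x y"
  then have c: "cell \<sigma>" "bdom \<sigma> = M" "bcod \<sigma> = M'" and e: "lalg M = x" "ralg M = y" by auto
  have b: "bim M" "bim M'" "lalg M' = x" "ralg M' = y" "alg x" "alg y"
    using c e cell_props[of \<sigma>] by auto
  show "lunit (Alg2 K) M' \<bullet>\<^bsub>Alg2 K\<^esub> (id2 (Alg2 K) (id1 (Alg2 K) y) \<star>\<^bsub>Alg2 K\<^esub> \<sigma>) = \<sigma> \<bullet>\<^bsub>Alg2 K\<^esub> lunit (Alg2 K) M"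
    by (rule cell_eq_tensor[of _ _ M "regular y"]) (use c b e in \<open>auto simp: cell_linear\<close>)
  show "runit (Alg2 K) M' \<bullet>\<^bsub>Alg2 K\<^esub> (\<sigma> \<star>\<^bsub>Alg2 K\<^esub> id2 (Alg2 K) (id1 (Alg2 K) x)) = \<sigma> \<bullet>\<^bsub>Alg2 K\<^esub> runit (Alg2 K) M"
    by (rule cell_eq_tensor[of _ _ "regular x" M]) (use c b e in \<open>auto simp: cell_linear\<close>)
next
  fix M N P Q :: "('k, 'u) bimodule" and v w x y z
  assume "M \<in> Hom (Alg2 K) v w" "N \<in> Hom (Alg2 K) w x" "P \<in> Hom (Alg2 K) x y" "Q \<in> Hom (Alg2 K) y z"
  then have b: "bim M" "bim N" "bim P" "bim Q" "lalg M = v" "ralg M = w" "lalg N = w" "ralg N = x"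
    "lalg P = x" "ralg P = y" "lalg Q = y" "ralg Q = z" by auto
  show "(id2 (Alg2 K) Q \<star>\<^bsub>Alg2 K\<^esub> assoc (Alg2 K) P N M) \<bullet>\<^bsub>Alg2 K\<^esub> assoc (Alg2 K) Q (P \<circledcirc>\<^bsub>Alg2 K\<^esub> N) M
      \<bullet>\<^bsub>Alg2 K\<^esub> (assoc (Alg2 K) Q P N \<star>\<^bsub>Alg2 K\<^esub> id2 (Alg2 K) M)
    = assoc (Alg2 K) Q P (N \<circledcirc>\<^bsub>Alg2 K\<^esub> M) \<bullet>\<^bsub>Alg2 K\<^esub> assoc (Alg2 K) (Q \<circledcirc>\<^bsub>Alg2 K\<^esub> P) N M"
    by (rule cell_eq_tensor_right4[of _ _ M N P Q]) (use b in auto)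
next
  fix M N :: "('k, 'u) bimodule" and x y z
  assume "M \<in> Hom (Alg2 K) x y" "N \<in> Hom (Alg2 K) y z"
  then have b: "bim M" "bim N" "lalg M = x" "ralg M = y" "lalg N = y" "ralg N = z" "alg y" by auto
  show "(id2 (Alg2 K) N \<star>\<^bsub>Alg2 K\<^esub> lunit (Alg2 K) M) \<bullet>\<^bsub>Alg2 K\<^esub> assoc (Alg2 K) N (id1 (Alg2 K) y) M
     = runit (Alg2 K) N \<star>\<^bsub>Alg2 K\<^esub> id2 (Alg2 K) M"
    by (rule cell_eq_tensor_right[of _ _ M "regular y" N]) (use b in \<open>auto simp: pure_balanced\<close>)
next
  fix \<sigma> \<tau> \<upsilon> :: "('k, 'u) bimod_map" and M N P Q :: "('k, 'u) bimodule"
  assume "\<sigma> \<in> Cells (Alg2 K) M N" "\<tau> \<in> Cells (Alg2 K) N P" "\<upsilon> \<in> Cells (Alg2 K) P Q"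
  then show "(\<upsilon> \<bullet>\<^bsub>Alg2 K\<^esub> \<tau>) \<bullet>\<^bsub>Alg2 K\<^esub> \<sigma> = \<upsilon> \<bullet>\<^bsub>Alg2 K\<^esub> (\<tau> \<bullet>\<^bsub>Alg2 K\<^esub> \<sigma>)"
    by (intro cell_eqI) auto
next
  fix \<sigma> :: "('k, 'u) bimod_map" and M N :: "('k, 'u) bimodule"
  assume "\<sigma> \<in> Cells (Alg2 K) M N"
  then have c: "cell \<sigma>" "bdom \<sigma> = M" "bcod \<sigma> = N" and b: "bim M" "bim N" by auto
  show "\<sigma> \<bullet>\<^bsub>Alg2 K\<^esub> id2 (Alg2 K) M = \<sigma>" "id2 (Alg2 K) N \<bullet>\<^bsub>Alg2 K\<^esub> \<sigma> = \<sigma>"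
    by (rule cell_eqI; use c b in simp)+
next
  fix M N :: "('k, 'u) bimodule" and x y z
  assume "M \<in> Hom (Alg2 K) x y" "N \<in> Hom (Alg2 K) y z"
  then have b: "bim M" "bim N" "ralg M = lalg N" by auto
  show "id2 (Alg2 K) N \<star>\<^bsub>Alg2 K\<^esub> id2 (Alg2 K) M = id2 (Alg2 K) (N \<circledcirc>\<^bsub>Alg2 K\<^esub> M)"
    by (rule cell_eq_tensor[of _ _ M N]) (use b in auto)
qed auto

sublocale Alg2: bicategory "Alg2 K :: (('k, 'u) module, ('k, 'u) bimodule, ('k, 'u) bimod_map) bicat"
  by (rule bicategory_Alg2)

lemma inv2_Alg2:
  fixes f :: "('k, 'u) bimod_map"
  assumes "f \<in> Isos (Alg2 K) M N"
  shows "cell (inv2 (Alg2 K) f)" "bdom (inv2 (Alg2 K) f) = N" "bcod (inv2 (Alg2 K) f) = M"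
  using Alg2.inv2_cell[OF assms] by auto

text \<open>An abstract inverse has no formula; its value at \<open>y\<close> is found by naming a
  preimage of \<open>y\<close>. This is the way in which inverse cells are evaluated
  throughout.\<close>

lemma bmap_inv2:
  fixes f :: "('k, 'u) bimod_map"
  assumes f: "f \<in> Isos (Alg2 K) M N" and x: "x \<in> carrier M" "bmap f x = y"
  shows "bmap (inv2 (Alg2 K) f) y = x"
proof -
  have "bmap (vcomp (Alg2 K) (inv2 (Alg2 K) f) f) x = x"
    using Alg2.inv2_left[OF f] x by simp
  then show ?thesis
    using x IsosD[OF f] by auto
qed

lemma inv2_lunit [simp]:
  assumes "bim M"
  shows "cell (inv2 (Alg2 K) (lunit (Alg2 K) M))"
    "bdom (inv2 (Alg2 K) (lunit (Alg2 K) M)) = M"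
    "bcod (inv2 (Alg2 K) (lunit (Alg2 K) M)) = tensor M (regular (ralg M))"
    "m \<in> carrier M \<Longrightarrow> bmap (inv2 (Alg2 K) (lunit (Alg2 K) M)) m = pure_tensor M (regular (ralg M)) m \<one>\<^bsub>ralg M\<^esub>"
  using inv2_Alg2[OF lunit_Isos[OF assms]] bmap_inv2[OF lunit_Isos[OF assms]] assms by auto

lemma inv2_runit [simp]:
  assumes "bim M"
  shows "cell (inv2 (Alg2 K) (runit (Alg2 K) M))"
    "bdom (inv2 (Alg2 K) (runit (Alg2 K) M)) = M"
    "bcod (inv2 (Alg2 K) (runit (Alg2 K) M)) = tensor (regular (lalg M)) M"
    "m \<in> carrier M \<Longrightarrow> bmap (inv2 (Alg2 K) (runit (Alg2 K) M)) m = pure_tensor (regular (lalg M)) M \<one>\<^bsub>lalg M\<^esub> m"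
  using inv2_Alg2[OF runit_Isos[OF assms]] bmap_inv2[OF runit_Isos[OF assms]] assms by auto

lemma inv2_assoc [simp]:
  assumes "bim M" "bim N" "bim P" "ralg M = lalg N" "ralg N = lalg P"
  shows "cell (inv2 (Alg2 K) (assoc (Alg2 K) P N M))"
    "bdom (inv2 (Alg2 K) (assoc (Alg2 K) P N M)) = tensor (tensor M N) P"
    "bcod (inv2 (Alg2 K) (assoc (Alg2 K) P N M)) = tensor M (tensor N P)"
    "\<lbrakk>m \<in> carrier M; n \<in> carrier N; p \<in> carrier P\<rbrakk> \<Longrightarrow>
      bmap (inv2 (Alg2 K) (assoc (Alg2 K) P N M)) (pure_tensor (tensor M N) P (pure_tensor M N m n) p)
        = pure_tensor M (tensor N P) m (pure_tensor N P n p)"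
  using inv2_Alg2[OF assoc_Isos[OF assms]] bmap_inv2[OF assoc_Isos[OF assms]] assms by auto

end

section \<open>Semisimple algebras\<close>

lemma op_simps [simp]:
  "carrier (op A) = carrier A" "\<one>\<^bsub>op A\<^esub> = \<one>\<^bsub>A\<^esub>" "ring.zero (op A) = ring.zero A" "ring.add (op A) = ring.add A"
  "smult (op A) = smult A" "x \<otimes>\<^bsub>op A\<^esub> y = y \<otimes>\<^bsub>A\<^esub> x" "op (op A) = A"
  by (simp_all add: op_def)

section \<open>Von Neumann regularity and idempotent generators\<close>

context ring
begin

text \<open>Put \<open>f = c y\<close>. Regularity of \<open>c\<close> makes \<open>f\<close> an
  idempotent that fixes \<open>c\<close>, and \<open>e f = 0\<close>. The corrected sum
  \<open>d = e + f - f e\<close> fixes both \<open>e\<close> and \<open>c\<close> from the left, so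
  \<open>d\<close> is idempotent and \<open>e R + c R = d R\<close>.\<close>

lemma idempotent_extend:
  assumes R: "e \<in> carrier R" "c \<in> carrier R" "y \<in> carrier R"
    and e: "e \<otimes> e = e" and ec: "e \<otimes> c = \<zero>" and c: "c \<otimes> (y \<otimes> c) = c"
  defines "d \<equiv> e \<oplus> (c \<otimes> y \<ominus> c \<otimes> y \<otimes> e)"
  shows "d \<in> carrier R" "d \<otimes> d = d" "d \<otimes> e = e" "d \<otimes> c = c"
proof -
  define f where "f = c \<otimes> y"
  have f: "f \<in> carrier R" "f \<otimes> f = f" "e \<otimes> f = \<zero>" "f \<otimes> c = c"
    using R ec c by (auto simp: f_def m_assoc) (metis R(2,3) c m_assoc m_closed, metis R ec m_assoc l_null)
  have d: "d = e \<oplus> (f \<ominus> f \<otimes> e)" by (simp add: d_def f_def)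
  show dR: "d \<in> carrier R" using R f by (simp add: d)
  show de: "d \<otimes> e = e"
    using R f e by (simp add: d l_distr minus_eq l_minus m_assoc r_neg)
  have fe: "f \<otimes> (e \<otimes> f) = \<zero>" using R f by simp
  show dc: "d \<otimes> c = c"
    using R f ec by (simp add: d l_distr minus_eq l_minus m_assoc)
  have "d \<otimes> f = f"
  proof -
    have "d \<otimes> f = (d \<otimes> c) \<otimes> y" using R f dR by (simp add: f_def m_assoc)
    then show ?thesis using dc by (simp add: f_def)
  qed
  then have "d \<otimes> (f \<ominus> f \<otimes> e) = f \<ominus> f \<otimes> e"
    using R f dR by (simp add: minus_eq r_distr r_minus m_assoc[symmetric])
  then show "d \<otimes> d = d"
    using R f dR de by (simp add: d r_distr)
qed

end

text \<open>Closure under negatives needs no premise of its own: multiply by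
  \<open>- 1\<close>.\<close>

lemma left_idealI:
  assumes "ring A" "I \<subseteq> carrier A" "\<zero>\<^bsub>A\<^esub> \<in> I"
    and "\<And>x y. \<lbrakk>x \<in> I; y \<in> I\<rbrakk> \<Longrightarrow> x \<oplus>\<^bsub>A\<^esub> y \<in> I"
    and "\<And>a x. \<lbrakk>a \<in> carrier A; x \<in> I\<rbrakk> \<Longrightarrow> a \<otimes>\<^bsub>A\<^esub> x \<in> I"
  shows "left_ideal A I"
proof -
  interpret ring A by fact
  have "subgroup I (add_monoid A)"
  proof (rule group.subgroupI[OF add.group_axioms])
    fix x assume "x \<in> I"
    then have "\<ominus>\<^bsub>A\<^esub> \<one>\<^bsub>A\<^esub> \<otimes>\<^bsub>A\<^esub> x \<in> I" "x \<in> carrier A" using assms by auto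
    then show "inv\<^bsub>add_monoid A\<^esub> x \<in> I"
      by (simp add: l_minus flip: a_inv_def)
  qed (use assms in auto)
  then show ?thesis
    using assms(5) by (simp add: left_ideal_def additive_subgroup_def)
qed

lemma left_idealD:
  assumes "ring A" "left_ideal A I"
  shows "I \<subseteq> carrier A" "\<zero>\<^bsub>A\<^esub> \<in> I"
    and "\<lbrakk>x \<in> I; y \<in> I\<rbrakk> \<Longrightarrow> x \<oplus>\<^bsub>A\<^esub> y \<in> I"
    and "\<lbrakk>x \<in> I; y \<in> I\<rbrakk> \<Longrightarrow> x \<ominus>\<^bsub>A\<^esub> y \<in> I"
    and "\<lbrakk>a \<in> carrier A; x \<in> I\<rbrakk> \<Longrightarrow> a \<otimes>\<^bsub>A\<^esub> x \<in> I"
proof -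
  interpret ring A by fact
  interpret I: additive_subgroup I A using assms(2) by (simp add: left_ideal_def)
  show "I \<subseteq> carrier A" "\<zero>\<^bsub>A\<^esub> \<in> I" "\<lbrakk>x \<in> I; y \<in> I\<rbrakk> \<Longrightarrow> x \<oplus>\<^bsub>A\<^esub> y \<in> I"
    "\<lbrakk>x \<in> I; y \<in> I\<rbrakk> \<Longrightarrow> x \<ominus>\<^bsub>A\<^esub> y \<in> I"
    by (auto simp: I.a_closed I.a_subset I.zero_closed minus_eq I.a_inv_closed)
  show "\<lbrakk>a \<in> carrier A; x \<in> I\<rbrakk> \<Longrightarrow> a \<otimes>\<^bsub>A\<^esub> x \<in> I"
    using assms(2) by (simp add: left_ideal_def)
qed

text \<open>Choose a complement \<open>J\<close> of the left ideal \<open>A a\<close> and write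
  \<open>1 = x a + j\<close>. Then \<open>a - a x a = a j\<close> lies in \<open>A a\<close> and in
  \<open>J\<close>, so it vanishes.\<close>

lemma semisimple_regular:
  assumes "ring A" "semisimple A" "a \<in> carrier A"
  shows "\<exists>x\<in>carrier A. a \<otimes>\<^bsub>A\<^esub> (x \<otimes>\<^bsub>A\<^esub> a) = a"
proof -
  interpret ring A by fact
  define I where "I = {x \<otimes>\<^bsub>A\<^esub> a |x. x \<in> carrier A}"
  have I: "left_ideal A I"
  proof (rule left_idealI[OF assms(1)])
    show "I \<subseteq> carrier A" using assms by (auto simp: I_def)
    show "\<zero>\<^bsub>A\<^esub> \<in> I" unfolding I_def using assms l_null[of a] zero_closed by (metis (mono_tags, lifting) mem_Collect_eq)
    show "x \<oplus>\<^bsub>A\<^esub> y \<in> I" if "x \<in> I" "y \<in> I" for x y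
      using that assms(3) l_distr[of _ _ a] unfolding I_def by (auto simp flip: l_distr)
    show "b \<otimes>\<^bsub>A\<^esub> x \<in> I" if "b \<in> carrier A" "x \<in> I" for b x
      using that assms(3) unfolding I_def by (auto simp flip: m_assoc)
  qed
  then obtain J where J: "left_ideal A J" "I \<inter> J = {\<zero>\<^bsub>A\<^esub>}" "I <+>\<^bsub>A\<^esub> J = carrier A"
    using assms(2) unfolding semisimple_def by blast
  have "\<one>\<^bsub>A\<^esub> \<in> I <+>\<^bsub>A\<^esub> J" using J by simp
  then obtain x j where x: "x \<in> carrier A" and j: "j \<in> J" and one: "\<one>\<^bsub>A\<^esub> = x \<otimes>\<^bsub>A\<^esub> a \<oplus>\<^bsub>A\<^esub> j"
    unfolding set_add_def' I_def by auto
  note JD = left_idealD[OF assms(1) J(1)] and ID = left_idealD[OF assms(1) I]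
  have jA: "j \<in> carrier A" using JD j by auto
  have a: "a = a \<otimes>\<^bsub>A\<^esub> (x \<otimes>\<^bsub>A\<^esub> a) \<oplus>\<^bsub>A\<^esub> a \<otimes>\<^bsub>A\<^esub> j"
    using arg_cong[OF one, of "\<lambda>t. a \<otimes>\<^bsub>A\<^esub> t"] assms(3) x jA by (simp add: r_distr)
  have "a \<in> I" unfolding I_def using assms(3) l_one[of a] by (metis (mono_tags, lifting) mem_Collect_eq one_closed)
  moreover have "a \<otimes>\<^bsub>A\<^esub> (x \<otimes>\<^bsub>A\<^esub> a) \<in> I"
    unfolding I_def using assms(3) x m_assoc[of a x a] by (metis (mono_tags, lifting) mem_Collect_eq m_closed)
  ultimately have "a \<ominus>\<^bsub>A\<^esub> a \<otimes>\<^bsub>A\<^esub> (x \<otimes>\<^bsub>A\<^esub> a) \<in> I" by (rule ID)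
  moreover have "a \<ominus>\<^bsub>A\<^esub> a \<otimes>\<^bsub>A\<^esub> (x \<otimes>\<^bsub>A\<^esub> a) = a \<otimes>\<^bsub>A\<^esub> j"
  proof -
    have c: "a \<otimes>\<^bsub>A\<^esub> (x \<otimes>\<^bsub>A\<^esub> a) \<in> carrier A" "a \<otimes>\<^bsub>A\<^esub> j \<in> carrier A" using assms(3) x jA by auto
    show ?thesis
      using arg_cong[OF a, of "\<lambda>t. t \<ominus>\<^bsub>A\<^esub> a \<otimes>\<^bsub>A\<^esub> (x \<otimes>\<^bsub>A\<^esub> a)"] c
        a_comm[OF c] by (simp add: minus_eq a_assoc r_neg)
  qed
  ultimately have "a \<otimes>\<^bsub>A\<^esub> j \<in> I \<inter> J" using JD(5)[OF assms(3) j] by simp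
  then have "a \<otimes>\<^bsub>A\<^esub> j = \<zero>\<^bsub>A\<^esub>" using J(2) by simp
  then have "a \<otimes>\<^bsub>A\<^esub> (x \<otimes>\<^bsub>A\<^esub> a) = a" using a assms(3) x by simp
  then show ?thesis using x by blast
qed

lemma lspan_mono: "\<lbrakk>x \<in> lspan K M S; S \<subseteq> T\<rbrakk> \<Longrightarrow> x \<in> lspan K M T"
  by (induction rule: lspan.induct) (auto intro: lspan.intros)

context morita
begin

lemma alg_op [simp]:
  assumes "alg A"
  shows "alg (op A)"
proof -
  interpret A: fd_algebra K A by (rule assms)
  have grp: "abelian_group (op A)"
    by (rule abelian_groupI) (auto simp: A.M.a_ac intro: A.M.l_neg bexI[of _ "\<ominus>\<^bsub>A\<^esub> _"])
  have mon: "monoid (op A)"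
    by (rule monoidI) (auto simp: A.m_assoc)
  have ring: "ring (op A)"
    by (rule ringI[OF grp mon]) (auto simp: A.l_distr A.r_distr)
  have mod: "module K (op A)"
    by (rule moduleI[OF A.R.cring_axioms grp])
      (auto simp: A.smult_l_distr A.smult_r_distr A.smult_assoc1)
  have "fin_dim K (op A)"
  proof -
    obtain S where S: "finite S" "S \<subseteq> carrier A" "carrier A = lspan K A S"
      using A.finite_dimensional unfolding fin_dim_iff_lspan[OF alg_module[OF assms]] by blast
    have "x \<in> lspan K (op A) S" if "x \<in> lspan K A S" for x
      using that
    proof induction
      case lspan_zero
      then show ?case using lspan.lspan_zero[of "op A"] by simp
    next
      case (lspan_step c s x)
      then show ?case using lspan.lspan_step[of c K s S x "op A"] by simp
    qed
    then show ?thesis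
      using S by (intro fin_dimI[OF mod, of S]) auto
  qed
  then show ?thesis
    by (intro fd_algebra.intro mod ring fd_algebra_axioms.intro)
      (auto simp: A.smult_mult_left A.smult_mult_right)
qed

text \<open>Elimination of one generator \<open>s\<close> at a time. If \<open>W\<close> reaches
  outside the span of the remaining generators, a single pivot \<open>w\<close> in \<open>W\<close>
  with nonzero coefficient at \<open>s\<close> clears that coefficient from every other element of
  \<open>W\<close>, and what is left lies in \<open>W \<inter> lspan K M S\<close>, where the
  induction hypothesis applies.\<close>

lemma subspace_lspan:
  assumes M: "module K M" and "finite S" "S \<subseteq> carrier M"
    and "W \<subseteq> lspan K M S" "\<And>x y. \<lbrakk>x \<in> W; y \<in> W\<rbrakk> \<Longrightarrow> x \<oplus>\<^bsub>M\<^esub> y \<in> W"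
    "\<And>c x. \<lbrakk>c \<in> carrier K; x \<in> W\<rbrakk> \<Longrightarrow> c \<odot>\<^bsub>M\<^esub> x \<in> W"
  shows "\<exists>T. finite T \<and> T \<subseteq> W \<and> W \<subseteq> lspan K M T"
  using assms(2-)
proof (induction S arbitrary: W)
  case empty
  have "x = \<zero>\<^bsub>M\<^esub>" if "x \<in> lspan K M {}" for x
    using that by induction auto
  then have "W \<subseteq> lspan K M {}"
    using empty by (auto intro: lspan.lspan_zero)
  then show ?case by (intro exI[of _ "{}"]) auto
next
  case (insert s S)
  interpret module K M by (rule M)
  interpret K: field K by (rule field_K)
  have s: "s \<in> carrier M" and S: "S \<subseteq> carrier M" using insert by auto
  have split: "\<exists>c\<in>carrier K. \<exists>v\<in>lspan K M S. x = c \<odot>\<^bsub>M\<^esub> s \<oplus>\<^bsub>M\<^esub> v" if "x \<in> lspan K M (insert s S)" for x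
    using that
  proof induction
    case lspan_zero
    show ?case using s by (intro bexI[of _ "\<zero>\<^bsub>K\<^esub>"] bexI[of _ "\<zero>\<^bsub>M\<^esub>"]) (auto intro: lspan.lspan_zero)
  next
    case (lspan_step c t x)
    then obtain d v where dv: "d \<in> carrier K" "v \<in> lspan K M S" "x = d \<odot>\<^bsub>M\<^esub> s \<oplus>\<^bsub>M\<^esub> v" by auto
    have v: "v \<in> carrier M" using lspan_closed[OF S dv(2)] .
    show ?case
    proof (cases "t = s")
      case True
      then have "c \<odot>\<^bsub>M\<^esub> t \<oplus>\<^bsub>M\<^esub> x = (c \<oplus>\<^bsub>K\<^esub> d) \<odot>\<^bsub>M\<^esub> s \<oplus>\<^bsub>M\<^esub> v"
        using dv v s lspan_step by (simp add: smult_l_distr M.a_assoc)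
      then show ?thesis using dv(1,2) lspan_step(1) by (intro bexI[of _ "c \<oplus>\<^bsub>K\<^esub> d"] bexI[of _ v]) auto
    next
      case False
      then have t: "t \<in> S" "t \<in> carrier M" using lspan_step S by auto
      then have "c \<odot>\<^bsub>M\<^esub> t \<oplus>\<^bsub>M\<^esub> x = d \<odot>\<^bsub>M\<^esub> s \<oplus>\<^bsub>M\<^esub> (c \<odot>\<^bsub>M\<^esub> t \<oplus>\<^bsub>M\<^esub> v)"
        using dv v s lspan_step by (simp add: M.a_lcomm)
      then show ?thesis using dv(1) lspan.lspan_step[OF lspan_step(1) t(1) dv(2)] by (intro bexI)
    qed
  qed
  define W0 where "W0 = W \<inter> lspan K M S"
  have "\<exists>T. finite T \<and> T \<subseteq> W0 \<and> W0 \<subseteq> lspan K M T"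
    by (rule insert.IH[OF S]) (use insert lspan_add[OF S] lspan_smult[OF S] in \<open>auto simp: W0_def\<close>)
  then obtain T where T: "finite T" "T \<subseteq> W0" "W0 \<subseteq> lspan K M T" by blast
  have TM: "T \<subseteq> carrier M" using T lspan_closed[OF S] by (auto simp: W0_def)
  show ?case
  proof (cases "W \<subseteq> lspan K M S")
    case True
    then show ?thesis using T by (auto simp: W0_def)
  next
    case False
    then obtain w where w: "w \<in> W" "w \<notin> lspan K M S" by auto
    then obtain c v where cv: "c \<in> carrier K" "v \<in> lspan K M S" "w = c \<odot>\<^bsub>M\<^esub> s \<oplus>\<^bsub>M\<^esub> v"
      using split insert.prems(2) by blast
    have wM: "w \<in> carrier M" and v: "v \<in> carrier M" using cv s lspan_closed[OF S] by auto
    have c0: "c \<noteq> \<zero>\<^bsub>K\<^esub>" using cv w s v by (metis M.l_zero smult_l_null)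
    then have cu: "c \<in> Units K" using cv K.field_Units by auto
    have "x \<in> lspan K M (insert w T)" if x: "x \<in> W" for x
    proof -
      obtain d u where du: "d \<in> carrier K" "u \<in> lspan K M S" "x = d \<odot>\<^bsub>M\<^esub> s \<oplus>\<^bsub>M\<^esub> u"
        using split insert.prems(2) x by blast
      have u: "u \<in> carrier M" and xM: "x \<in> carrier M" using du s lspan_closed[OF S] by auto
      \<comment> \<open>The multiple of the pivot that cancels the coefficient \<open>d\<close> of
        \<open>x\<close> at \<open>s\<close>; division by \<open>c\<close> is possible because the
        pivot has \<open>c\<close> nonzero.\<close>
      define r where "r = d \<otimes>\<^bsub>K\<^esub> inv\<^bsub>K\<^esub> c"
      have r: "r \<in> carrier K" "r \<otimes>\<^bsub>K\<^esub> c = d" using du cu cv by (auto simp: r_def m_assoc)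
      have rw: "r \<odot>\<^bsub>M\<^esub> w = d \<odot>\<^bsub>M\<^esub> s \<oplus>\<^bsub>M\<^esub> r \<odot>\<^bsub>M\<^esub> v"
        using cv r s v by (simp add: smult_r_distr smult_assoc1[symmetric])
      define z where "z = u \<oplus>\<^bsub>M\<^esub> (\<ominus>\<^bsub>K\<^esub> r) \<odot>\<^bsub>M\<^esub> v"
      have z: "z \<in> lspan K M S" "z \<in> carrier M"
        using du cv r u v by (auto simp: z_def intro!: lspan_add[OF S] lspan_smult[OF S])
      have zv: "z \<oplus>\<^bsub>M\<^esub> r \<odot>\<^bsub>M\<^esub> v = u"
        using r u v by (simp add: z_def M.a_assoc smult_l_distr[symmetric] R.l_neg)
      have xeq: "x = r \<odot>\<^bsub>M\<^esub> w \<oplus>\<^bsub>M\<^esub> z"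
      proof -
        have "r \<odot>\<^bsub>M\<^esub> w \<oplus>\<^bsub>M\<^esub> z = d \<odot>\<^bsub>M\<^esub> s \<oplus>\<^bsub>M\<^esub> (z \<oplus>\<^bsub>M\<^esub> r \<odot>\<^bsub>M\<^esub> v)"
          using r du s v z by (simp add: rw M.a_assoc M.a_comm[of "r \<odot>\<^bsub>M\<^esub> v" z])
        then show ?thesis using zv du by simp
      qed
      have "z = x \<oplus>\<^bsub>M\<^esub> (\<ominus>\<^bsub>K\<^esub> r) \<odot>\<^bsub>M\<^esub> w"
      proof -
        have "x \<oplus>\<^bsub>M\<^esub> (\<ominus>\<^bsub>K\<^esub> r) \<odot>\<^bsub>M\<^esub> w = z \<oplus>\<^bsub>M\<^esub> (r \<odot>\<^bsub>M\<^esub> w \<oplus>\<^bsub>M\<^esub> (\<ominus>\<^bsub>K\<^esub> r) \<odot>\<^bsub>M\<^esub> w)"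
          using xeq r wM z by (simp add: M.a_assoc M.a_comm M.a_lcomm)
        then show ?thesis using r wM z by (simp add: smult_l_distr[symmetric] R.r_neg)
      qed
      then have "z \<in> W0"
        using z insert.prems(3,4) x w r by (auto simp: W0_def)
      then have "z \<in> lspan K M (insert w T)"
        using T lspan_mono[of _ K M T "insert w T"] by auto
      then show ?thesis
        unfolding xeq using r by (auto intro: lspan.lspan_step)
    qed
    then show ?thesis
      using T w by (intro exI[of _ "insert w T"]) (auto simp: W0_def)
  qed
qed

text \<open>Right ideals of \<open>A\<close> are left ideals of \<open>op A\<close>.\<close>

lemma right_ideal_idempotent:
  assumes A: "alg A" "semisimple A" and I: "left_ideal (op A) I"
  obtains e where "e \<in> I" "e \<otimes>\<^bsub>A\<^esub> e = e" "\<And>x. x \<in> I \<Longrightarrow> e \<otimes>\<^bsub>A\<^esub> x = x"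
proof -
  interpret A: fd_algebra K A by (rule A)
  note ID = left_idealD[OF alg_ring[OF alg_op[OF A(1)]] I, simplified]
  have sub: "x \<ominus>\<^bsub>A\<^esub> y \<in> I" if "x \<in> I" "y \<in> I" for x y
  proof -
    have "\<ominus>\<^bsub>A\<^esub> y = y \<otimes>\<^bsub>A\<^esub> (\<ominus>\<^bsub>A\<^esub> \<one>\<^bsub>A\<^esub>)" using that ID(1) by (auto simp: A.r_minus)
    then show ?thesis using that ID by (simp add: A.minus_eq)
  qed
  \<comment> \<open>Generators are absorbed one at a time. The idempotent \<open>e\<close> already
    fixes those in \<open>S\<close> and misses only the part \<open>c = b - e b\<close> of a new
    generator \<open>b\<close>; this part satisfies \<open>e c = 0\<close>, as
    \<open>idempotent_extend\<close> requires.\<close>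
  have step: "\<exists>e\<in>I. e \<otimes>\<^bsub>A\<^esub> e = e \<and> (\<forall>s\<in>S. e \<otimes>\<^bsub>A\<^esub> s = s)" if "finite S" "S \<subseteq> I" for S
    using that
  proof (induction S)
    case empty
    then show ?case using ID by (intro bexI[of _ "\<zero>\<^bsub>A\<^esub>"]) auto
  next
    case (insert b S)
    then obtain e where e: "e \<in> I" "e \<otimes>\<^bsub>A\<^esub> e = e" "\<forall>s\<in>S. e \<otimes>\<^bsub>A\<^esub> s = s" by auto
    define c where "c = b \<ominus>\<^bsub>A\<^esub> e \<otimes>\<^bsub>A\<^esub> b"
    have eA: "e \<in> carrier A" and bA: "b \<in> carrier A" using e insert ID by auto
    have c: "c \<in> I" "c \<in> carrier A" using sub e insert ID eA bA by (auto simp: c_def)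
    obtain y where y: "y \<in> carrier A" "c \<otimes>\<^bsub>A\<^esub> (y \<otimes>\<^bsub>A\<^esub> c) = c"
      using semisimple_regular[OF alg_ring[OF A(1)] A(2) c(2)] by auto
    have ec: "e \<otimes>\<^bsub>A\<^esub> c = \<zero>\<^bsub>A\<^esub>"
      using eA bA e by (simp add: c_def A.minus_eq A.r_distr A.r_minus A.m_assoc[symmetric] A.r_neg)
    define d where "d = e \<oplus>\<^bsub>A\<^esub> (c \<otimes>\<^bsub>A\<^esub> y \<ominus>\<^bsub>A\<^esub> c \<otimes>\<^bsub>A\<^esub> y \<otimes>\<^bsub>A\<^esub> e)"
    note d = A.idempotent_extend[OF eA c(2) y(1) e(2) ec y(2), folded d_def]
    have "d \<in> I" using e c y eA ID sub by (simp add: d_def)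
    moreover have "d \<otimes>\<^bsub>A\<^esub> s = s" if "s \<in> S" for s
    proof -
      have s: "s \<in> carrier A" "s = e \<otimes>\<^bsub>A\<^esub> s" using that insert ID e by auto
      then have "d \<otimes>\<^bsub>A\<^esub> s = d \<otimes>\<^bsub>A\<^esub> e \<otimes>\<^bsub>A\<^esub> s" using d(1) eA by (simp add: A.m_assoc)
      then show ?thesis using d s by simp
    qed
    moreover have "d \<otimes>\<^bsub>A\<^esub> b = b"
    proof -
      have b: "b = e \<otimes>\<^bsub>A\<^esub> b \<oplus>\<^bsub>A\<^esub> c"
        using eA bA by (simp add: c_def A.minus_eq A.a_lcomm[of "e \<otimes>\<^bsub>A\<^esub> b"] A.r_neg)
      have "d \<otimes>\<^bsub>A\<^esub> (e \<otimes>\<^bsub>A\<^esub> b \<oplus>\<^bsub>A\<^esub> c) = e \<otimes>\<^bsub>A\<^esub> b \<oplus>\<^bsub>A\<^esub> c"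
        using d eA bA c by (simp add: A.r_distr A.m_assoc[symmetric])
      then show ?thesis using b by simp
    qed
    ultimately show ?case using d(2) by auto
  qed
  obtain S where S: "finite S" "S \<subseteq> carrier A" "carrier A = lspan K A S"
    using A.finite_dimensional unfolding fin_dim_iff_lspan[OF alg_module[OF A(1)]] by blast
  \<comment> \<open>A right ideal is a linear subspace, since a scalar acts as right multiplication
    by \<open>c 1\<close>; hence finitely many of its elements span it.\<close>
  have "\<exists>T. finite T \<and> T \<subseteq> I \<and> I \<subseteq> lspan K A T"
  proof (rule subspace_lspan[OF alg_module[OF A(1)] S(1,2)])
    show "I \<subseteq> lspan K A S" using S(3) ID(1) by simp
    fix c x assume "c \<in> carrier K" "x \<in> I"
    moreover from this have "c \<odot>\<^bsub>A\<^esub> x = x \<otimes>\<^bsub>A\<^esub> (c \<odot>\<^bsub>A\<^esub> \<one>\<^bsub>A\<^esub>)"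
      using ID(1) A.smult_mult_right[of c x "\<one>\<^bsub>A\<^esub>"] by auto
    ultimately show "c \<odot>\<^bsub>A\<^esub> x \<in> I" using ID(5) by simp
  qed (rule ID)
  then obtain T where T: "finite T" "T \<subseteq> I" "I \<subseteq> lspan K A T" by blast
  then obtain e where e: "e \<in> I" "e \<otimes>\<^bsub>A\<^esub> e = e" "\<forall>s\<in>T. e \<otimes>\<^bsub>A\<^esub> s = s" using step by blast
  have eA: "e \<in> carrier A" using e ID by auto
  have TA: "T \<subseteq> carrier A" using T ID(1) by auto
  have "e \<otimes>\<^bsub>A\<^esub> x = x" if "x \<in> lspan K A T" for x
    using that
  proof induction
    case (lspan_step c s x)
    then have "s \<in> carrier A" "x \<in> carrier A" using TA A.lspan_closed[OF TA] by auto
    then show ?case using lspan_step eA e by (simp add: A.r_distr A.smult_mult_right)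
  qed (use eA in auto)
  then show thesis using that e T by blast
qed

text \<open>A right ideal with idempotent generator \<open>e\<close> is complemented by the right
  annihilator of \<open>e\<close>, through the Peirce decomposition
  \<open>x = e x + (x - e x)\<close>.\<close>

lemma semisimple_op:
  assumes A: "alg A" "semisimple A"
  shows "semisimple (op A)"
  unfolding semisimple_def
proof (intro allI impI)
  fix I assume I: "left_ideal (op A) I"
  interpret A: fd_algebra K A by (rule A)
  obtain e where e: "e \<in> I" "e \<otimes>\<^bsub>A\<^esub> e = e" "\<And>x. x \<in> I \<Longrightarrow> e \<otimes>\<^bsub>A\<^esub> x = x"
    using right_ideal_idempotent[OF A I] by blast
  note ID = left_idealD[OF alg_ring[OF alg_op[OF A(1)]] I, simplified]
  have eA: "e \<in> carrier A" using e ID by auto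
  define J where "J = {x \<in> carrier A. e \<otimes>\<^bsub>A\<^esub> x = \<zero>\<^bsub>A\<^esub>}"
  have "left_ideal (op A) J"
    by (rule left_idealI[OF alg_ring[OF alg_op[OF A(1)]]])
      (use eA in \<open>auto simp: J_def A.r_distr A.m_assoc[symmetric]\<close>)
  moreover have "I \<inter> J = {\<zero>\<^bsub>op A\<^esub>}"
    using e(3) ID eA by (auto simp: J_def)
  moreover have "I <+>\<^bsub>op A\<^esub> J = carrier (op A)"
  proof
    show "I <+>\<^bsub>op A\<^esub> J \<subseteq> carrier (op A)"
      using ID(1) by (auto simp: set_add_def' J_def)
    show "carrier (op A) \<subseteq> I <+>\<^bsub>op A\<^esub> J"
    proof
      fix x assume "x \<in> carrier (op A)"
      then have x: "x \<in> carrier A" by simp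
      have "x \<ominus>\<^bsub>A\<^esub> e \<otimes>\<^bsub>A\<^esub> x \<in> J"
        using x eA e by (simp add: J_def A.minus_eq A.r_distr A.r_minus A.m_assoc[symmetric] A.r_neg)
      moreover have "e \<otimes>\<^bsub>A\<^esub> x \<in> I" using ID(5)[of x e] x e by simp
      moreover have "x = e \<otimes>\<^bsub>A\<^esub> x \<oplus>\<^bsub>A\<^esub> (x \<ominus>\<^bsub>A\<^esub> e \<otimes>\<^bsub>A\<^esub> x)"
        using x eA by (simp add: A.minus_eq A.a_lcomm[of "e \<otimes>\<^bsub>A\<^esub> x"] A.r_neg)
      ultimately show "x \<in> I <+>\<^bsub>op A\<^esub> J"
        unfolding set_add_def' by auto
    qed
  qed
  ultimately show "\<exists>J. left_ideal (op A) J \<and> I \<inter> J = {\<zero>\<^bsub>op A\<^esub>} \<and> I <+>\<^bsub>op A\<^esub> J = carrier (op A)"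
    by blast
qed

end

section \<open>Dual bases\<close>

definition lsum :: "('u, 'x) ring_scheme \<Rightarrow> ('b \<Rightarrow> 'u) \<Rightarrow> 'b list \<Rightarrow> 'u" where
  "lsum G f xs = foldr (\<lambda>x s. f x \<oplus>\<^bsub>G\<^esub> s) xs \<zero>\<^bsub>G\<^esub>"

lemma lsum_simps [simp]: "lsum G f [] = \<zero>\<^bsub>G\<^esub>" "lsum G f (x # xs) = f x \<oplus>\<^bsub>G\<^esub> lsum G f xs"
  by (simp_all add: lsum_def)

lemma lsum_map: "lsum G f (map g xs) = lsum G (\<lambda>x. f (g x)) xs"
  by (induction xs) auto

lemma lsum_cong: "(\<And>x. x \<in> set xs \<Longrightarrow> f x = g x) \<Longrightarrow> lsum G f xs = lsum G g xs"
  by (induction xs) auto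

definition dual_set :: "('k, 'u) bimodule \<Rightarrow> ('u \<Rightarrow> 'u) set" where
  "dual_set M = rhom_set M (regular (ralg M))"

text \<open>A list admits repetitions and grows by one generator without any disjointness condition.
  The functionals are kept as functions instead of codes, because the basis is needed to show that
  the dual is a finite-dimensional bimodule in the first place.\<close>

definition dual_basis :: "('k, 'u) bimodule \<Rightarrow> ('u \<times> ('u \<Rightarrow> 'u)) list \<Rightarrow> bool" where
  "dual_basis M xs \<longleftrightarrow>
    (\<forall>(m, g)\<in>set xs. m \<in> carrier M \<and> g \<in> dual_set M) \<and>
    (\<forall>x\<in>carrier M. lsum M (\<lambda>(m, g). ract M m (g x)) xs = x)"

lemma (in abelian_group) diff_eq_diff:
  assumes "n \<in> carrier G" "p \<in> carrier G" "n' \<in> carrier G" "p' \<in> carrier G" "n \<oplus> p = n' \<oplus> p'"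
  shows "p \<ominus> p' = n' \<ominus> n"
proof -
  have "p \<ominus> p' = \<ominus> n \<oplus> (n \<oplus> p) \<ominus> p'"
    using assms(1-4) by (simp add: minus_eq a_assoc[symmetric] l_neg)
  also have "\<dots> = n' \<ominus> n"
    unfolding assms(5) using assms(1-4) by (simp add: minus_eq a_assoc r_neg r_neg1 r_neg2 a_comm[of n'])
  finally show ?thesis .
qed

context morita
begin

lemma add_hom_zero:
  assumes "bim M" "bim N" "h \<in> hom (add_monoid M) (add_monoid N)"
  shows "h \<zero>\<^bsub>M\<^esub> = \<zero>\<^bsub>N\<^esub>"
proof -
  have "group_hom (add_monoid M) (add_monoid N) h"
    using assms bim_comm_group by (simp add: group_hom_def group_hom_axioms_def comm_group_def)
  from group_hom.hom_one[OF this] show ?thesis by simp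
qed


lemma lsum_closed:
  assumes "bim M" "\<And>x. x \<in> set xs \<Longrightarrow> f x \<in> carrier M"
  shows "lsum M f xs \<in> carrier M"
  using assms(2) by (induction xs) (use assms(1) in auto)

lemma lsum_hom:
  assumes "bim M" "bim N" "h \<in> hom (add_monoid M) (add_monoid N)" "\<And>x. x \<in> set xs \<Longrightarrow> f x \<in> carrier M"
  shows "h (lsum M f xs) = lsum N (\<lambda>x. h (f x)) xs"
  using assms(4) by (induction xs) (use assms(1-3) in \<open>auto simp: add_hom_zero add_hom[OF assms(3)] lsum_closed\<close>)

lemma ract_hom: "\<lbrakk>bim M; b \<in> carrier (ralg M)\<rbrakk> \<Longrightarrow> (\<lambda>m. ract M m b) \<in> hom (add_monoid M) (add_monoid M)"
  by (rule add_homI) (auto simp: bim_distrib)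

lemma ract_hom': "\<lbrakk>bim M; m \<in> carrier M\<rbrakk> \<Longrightarrow> ract M m \<in> hom (add_monoid (regular (ralg M))) (add_monoid M)"
  by (rule add_homI) (auto simp: bim_distrib)


text \<open>A dual basis of the submodule \<open>N\<close> only. The functionals are constrained on
  \<open>N\<close> alone, which leaves them free to be replaced when \<open>N\<close> grows; they
  are made extensional once \<open>N\<close> is all of \<open>M\<close>.\<close>

definition partial_dual_basis :: "('k, 'u) bimodule \<Rightarrow> 'u set \<Rightarrow> ('u \<times> ('u \<Rightarrow> 'u)) list \<Rightarrow> bool" where
  "partial_dual_basis M N xs \<longleftrightarrow>
    N \<subseteq> carrier M \<and> \<zero>\<^bsub>M\<^esub> \<in> N \<and> (\<forall>x\<in>N. \<forall>y\<in>N. x \<oplus>\<^bsub>M\<^esub> y \<in> N) \<and>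
    (\<forall>x\<in>N. \<forall>b\<in>carrier (ralg M). ract M x b \<in> N) \<and>
    (\<forall>(m, g)\<in>set xs. m \<in> N \<and> (\<forall>x\<in>N. g x \<in> carrier (ralg M)) \<and>
      (\<forall>x\<in>N. \<forall>y\<in>N. g (x \<oplus>\<^bsub>M\<^esub> y) = g x \<oplus>\<^bsub>ralg M\<^esub> g y) \<and>
      (\<forall>x\<in>N. \<forall>b\<in>carrier (ralg M). g (ract M x b) = g x \<otimes>\<^bsub>ralg M\<^esub> b)) \<and>
    (\<forall>x\<in>N. lsum M (\<lambda>(m, g). ract M m (g x)) xs = x)"

text \<open>Adjoining a generator \<open>b\<close>: the right ideal of all \<open>r\<close> with \<open>b r \<in> N\<close> is generated by an
  idempotent \<open>e\<close>, and \<open>N + bB\<close> is the direct sum of \<open>N\<close> and \<open>b (1 - e) B\<close>, where the second summand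
  is isomorphic to \<open>(1 - e) B\<close>.\<close>

lemma partial_dual_basis_extend:
  assumes M: "bim M" and ss: "semisimple (ralg M)" and N: "partial_dual_basis M N xs" and b: "b \<in> carrier M"
  obtains N' xs' where "partial_dual_basis M N' xs'" "N \<subseteq> N'" "b \<in> N'"
proof -
  let ?B = "ralg M"
  interpret B: ring ?B using M by (intro alg_ring) auto
  interpret M: abelian_group M using M by (rule bim_group)
  have sub: "N \<subseteq> carrier M" "\<zero>\<^bsub>M\<^esub> \<in> N" "\<And>x y. \<lbrakk>x \<in> N; y \<in> N\<rbrakk> \<Longrightarrow> x \<oplus>\<^bsub>M\<^esub> y \<in> N"
    "\<And>x r. \<lbrakk>x \<in> N; r \<in> carrier ?B\<rbrakk> \<Longrightarrow> ract M x r \<in> N"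
    and g: "\<And>m g. (m, g) \<in> set xs \<Longrightarrow> m \<in> N \<and> (\<forall>x\<in>N. g x \<in> carrier ?B) \<and>
      (\<forall>x\<in>N. \<forall>y\<in>N. g (x \<oplus>\<^bsub>M\<^esub> y) = g x \<oplus>\<^bsub>ralg M\<^esub> g y) \<and>
      (\<forall>x\<in>N. \<forall>b\<in>carrier (ralg M). g (ract M x b) = g x \<otimes>\<^bsub>ralg M\<^esub> b)"
    and sum: "\<And>x. x \<in> N \<Longrightarrow> lsum M (\<lambda>(m, g). ract M m (g x)) xs = x"
    using N unfolding partial_dual_basis_def by auto
  have zero: "ract M m \<zero>\<^bsub>?B\<^esub> = \<zero>\<^bsub>M\<^esub>" if "m \<in> carrier M" for m
    using add_hom_zero[OF _ M ract_hom'[OF M that]] M by simp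
  have minus: "ract M m (\<ominus>\<^bsub>?B\<^esub> r) = \<ominus>\<^bsub>M\<^esub> ract M m r" if "m \<in> carrier M" "r \<in> carrier ?B" for m r
  proof (rule M.minus_equality[symmetric])
    show "ract M m (\<ominus>\<^bsub>?B\<^esub> r) \<oplus>\<^bsub>M\<^esub> ract M m r = \<zero>\<^bsub>M\<^esub>"
      using that M zero[OF that(1)] by (simp add: bim_distrib(4)[symmetric] B.l_neg)
  qed (use that M in auto)
  have Nminus: "x \<ominus>\<^bsub>M\<^esub> y \<in> N" if "x \<in> N" "y \<in> N" for x y
  proof -
    have "y \<in> carrier M" using that sub by auto
    then have "\<ominus>\<^bsub>M\<^esub> y = ract M y (\<ominus>\<^bsub>?B\<^esub> \<one>\<^bsub>?B\<^esub>)" using minus[of y "\<one>\<^bsub>?B\<^esub>"] M by simp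
    then show ?thesis using that sub by (simp add: M.minus_eq)
  qed
  define I where "I = {r \<in> carrier ?B. ract M b r \<in> N}"
  have "left_ideal (op ?B) I"
    by (rule left_idealI[OF alg_ring[OF alg_op]]) (use M b sub zero in \<open>auto simp: I_def bim_distrib bim_assoc\<close>)
  then obtain e where e: "e \<in> I" "e \<otimes>\<^bsub>?B\<^esub> e = e" "\<And>x. x \<in> I \<Longrightarrow> e \<otimes>\<^bsub>?B\<^esub> x = x"
    using right_ideal_idempotent[OF _ ss] M by auto
  have eB: "e \<in> carrier ?B" "ract M b e \<in> N" using e by (auto simp: I_def)
  define f where "f = \<one>\<^bsub>?B\<^esub> \<ominus>\<^bsub>?B\<^esub> e"
  have f: "f \<in> carrier ?B" "e \<otimes>\<^bsub>?B\<^esub> f = \<zero>\<^bsub>?B\<^esub>" "f \<otimes>\<^bsub>?B\<^esub> f = f" "e \<oplus>\<^bsub>?B\<^esub> f = \<one>\<^bsub>?B\<^esub>"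
    using eB e(2) by (simp_all add: f_def B.minus_eq B.r_distr B.l_distr B.r_minus B.l_minus B.r_neg B.l_neg B.a_lcomm[of e])
  \<comment> \<open>Replacing \<open>b\<close> by \<open>b (1 - e)\<close> makes the sum with
    \<open>N\<close> direct, and nothing is lost because \<open>b e\<close> already lies in
    \<open>N\<close>.\<close>
  define b' where "b' = ract M b f"
  have b': "b' \<in> carrier M" using b f M by (simp add: b'_def)
  have b'f: "ract M b' r = ract M b r" if "r \<in> carrier ?B" "f \<otimes>\<^bsub>?B\<^esub> r = r" for r
    using that b f M bim_assoc(2)[of M b f r] by (simp add: b'_def)
  \<comment> \<open>If two representations agree, then \<open>b (r - r')\<close> lies in
    \<open>N\<close>, so \<open>r - r'\<close> belongs to \<open>I\<close> and is fixed by
    \<open>e\<close>. It is also fixed by \<open>f\<close>, and \<open>e f = 0\<close> forces it to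
    vanish.\<close>
  have uniq: "n = n' \<and> r = r'" if n: "n \<in> N" "n' \<in> N" and r: "r \<in> carrier ?B" "r' \<in> carrier ?B"
    "f \<otimes>\<^bsub>?B\<^esub> r = r" "f \<otimes>\<^bsub>?B\<^esub> r' = r'" and eq: "n \<oplus>\<^bsub>M\<^esub> ract M b' r = n' \<oplus>\<^bsub>M\<^esub> ract M b' r'" for n n' r r'
  proof -
    have c: "n \<in> carrier M" "n' \<in> carrier M" "ract M b' r \<in> carrier M" "ract M b' r' \<in> carrier M"
      using n r sub(1) b' M by auto
    have fr: "f \<otimes>\<^bsub>?B\<^esub> (r \<ominus>\<^bsub>?B\<^esub> r') = r \<ominus>\<^bsub>?B\<^esub> r'" "r \<ominus>\<^bsub>?B\<^esub> r' \<in> carrier ?B"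
      using r f by (simp_all add: B.minus_eq B.r_distr B.r_minus)
    have "ract M b (r \<ominus>\<^bsub>?B\<^esub> r') = ract M b' r \<ominus>\<^bsub>M\<^esub> ract M b' r'"
      using b'f[OF fr(2,1)] r b' M by (simp add: B.minus_eq M.minus_eq bim_distrib minus)
    also have "\<dots> = n' \<ominus>\<^bsub>M\<^esub> n" by (rule M.diff_eq_diff[OF c(1,3,2,4) eq])
    finally have "r \<ominus>\<^bsub>?B\<^esub> r' \<in> I" using fr n Nminus by (simp add: I_def)
    from e(3)[OF this] have "e \<otimes>\<^bsub>?B\<^esub> (f \<otimes>\<^bsub>?B\<^esub> (r \<ominus>\<^bsub>?B\<^esub> r')) = r \<ominus>\<^bsub>?B\<^esub> r'" using fr by simp
    then have "r \<ominus>\<^bsub>?B\<^esub> r' = \<zero>\<^bsub>?B\<^esub>" using f fr(2) eB by (simp add: B.m_assoc[symmetric])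
    then have "r = r'" using r by (simp add: B.r_right_minus_eq)
    then show ?thesis using eq c by simp
  qed
  define N' where "N' = {n \<oplus>\<^bsub>M\<^esub> ract M b' r |n r. n \<in> N \<and> r \<in> carrier ?B}"
  have ex: "\<exists>n r. n \<in> N \<and> r \<in> carrier ?B \<and> f \<otimes>\<^bsub>?B\<^esub> r = r \<and> x = n \<oplus>\<^bsub>M\<^esub> ract M b' r" if x: "x \<in> N'" for x
  proof -
    obtain n r where nr: "n \<in> N" "r \<in> carrier ?B" "x = n \<oplus>\<^bsub>M\<^esub> ract M b' r" using x by (auto simp: N'_def)
    have f': "f \<otimes>\<^bsub>?B\<^esub> (f \<otimes>\<^bsub>?B\<^esub> r) = f \<otimes>\<^bsub>?B\<^esub> r" using f nr by (simp add: B.m_assoc[symmetric])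
    then have "ract M b' (f \<otimes>\<^bsub>?B\<^esub> r) = ract M b' r"
      using b'f[OF _ f'] f nr b M by (simp add: b'_def bim_assoc)
    then show ?thesis using nr f f' by (intro exI[of _ n] exI[of _ "f \<otimes>\<^bsub>?B\<^esub> r"]) auto
  qed
  \<comment> \<open>Coordinates are picked by choice and become linear only through
    \<open>uniq\<close>. The coordinate \<open>\<rho>\<close> is the functional that belongs to the
    new element \<open>b'\<close>, while the old functionals are composed with
    \<open>\<nu>\<close>.\<close>
  obtain \<nu> \<rho> where nr: "\<And>x. x \<in> N' \<Longrightarrow> \<nu> x \<in> N" "\<And>x. x \<in> N' \<Longrightarrow> \<rho> x \<in> carrier ?B"
    "\<And>x. x \<in> N' \<Longrightarrow> f \<otimes>\<^bsub>?B\<^esub> \<rho> x = \<rho> x" "\<And>x. x \<in> N' \<Longrightarrow> \<nu> x \<oplus>\<^bsub>M\<^esub> ract M b' (\<rho> x) = x"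
    using ex by metis
  have N'I: "n \<oplus>\<^bsub>M\<^esub> ract M b' r \<in> N'" if "n \<in> N" "r \<in> carrier ?B" for n r using that by (auto simp: N'_def)
  have add: "\<nu> x \<oplus>\<^bsub>M\<^esub> \<nu> y \<oplus>\<^bsub>M\<^esub> ract M b' (\<rho> x \<oplus>\<^bsub>?B\<^esub> \<rho> y) = x \<oplus>\<^bsub>M\<^esub> y" if "x \<in> N'" "y \<in> N'" for x y
  proof -
    have c: "\<nu> x \<in> carrier M" "\<nu> y \<in> carrier M" using that nr sub by auto
    have "x \<oplus>\<^bsub>M\<^esub> y = \<nu> x \<oplus>\<^bsub>M\<^esub> ract M b' (\<rho> x) \<oplus>\<^bsub>M\<^esub> (\<nu> y \<oplus>\<^bsub>M\<^esub> ract M b' (\<rho> y))"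
      using that nr by simp
    then show ?thesis using that nr c M b' add_swap[OF M c(1) _ c(2), of "ract M b' (\<rho> x)" "ract M b' (\<rho> y)"] by (simp add: bim_distrib)
  qed
  have act: "ract M (\<nu> x) c \<oplus>\<^bsub>M\<^esub> ract M b' (\<rho> x \<otimes>\<^bsub>?B\<^esub> c) = ract M x c" if "x \<in> N'" "c \<in> carrier ?B" for x c
  proof -
    have v: "\<nu> x \<in> carrier M" using that nr sub by auto
    then have "ract M (\<nu> x \<oplus>\<^bsub>M\<^esub> ract M b' (\<rho> x)) c = ract M (\<nu> x) c \<oplus>\<^bsub>M\<^esub> ract M b' (\<rho> x \<otimes>\<^bsub>?B\<^esub> c)"
      using that nr(1-3) M b' by (simp add: bim_distrib bim_assoc)
    then show ?thesis using nr(4)[OF that(1)] by simp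
  qed
  have N'add: "x \<oplus>\<^bsub>M\<^esub> y \<in> N'" if "x \<in> N'" "y \<in> N'" for x y
    using N'I[of "\<nu> x \<oplus>\<^bsub>M\<^esub> \<nu> y" "\<rho> x \<oplus>\<^bsub>?B\<^esub> \<rho> y"] add[OF that] nr that sub by simp
  have N'act: "ract M x c \<in> N'" if "x \<in> N'" "c \<in> carrier ?B" for x c
    using N'I[of "ract M (\<nu> x) c" "\<rho> x \<otimes>\<^bsub>?B\<^esub> c"] act[OF that] nr that sub by simp
  have lin: "\<nu> (x \<oplus>\<^bsub>M\<^esub> y) = \<nu> x \<oplus>\<^bsub>M\<^esub> \<nu> y \<and> \<rho> (x \<oplus>\<^bsub>M\<^esub> y) = \<rho> x \<oplus>\<^bsub>?B\<^esub> \<rho> y" if "x \<in> N'" "y \<in> N'" for x y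
    by (rule uniq) (use that nr N'add add f sub in \<open>auto simp: B.r_distr\<close>)
  have lin': "\<nu> (ract M x c) = ract M (\<nu> x) c \<and> \<rho> (ract M x c) = \<rho> x \<otimes>\<^bsub>?B\<^esub> c" if "x \<in> N'" "c \<in> carrier ?B" for x c
    by (rule uniq) (use that nr N'act act f sub in \<open>auto simp: B.m_assoc[symmetric]\<close>)
  have NN': "N \<subseteq> N'"
  proof
    fix x assume x: "x \<in> N"
    then show "x \<in> N'" using N'I[of x "\<zero>\<^bsub>?B\<^esub>"] zero[OF b'] sub(1) M by auto
  qed
  define xs' where "xs' = (b', \<rho>) # map (\<lambda>(m, g). (m, \<lambda>x. g (\<nu> x))) xs"
  have "partial_dual_basis M N' xs'"
    unfolding partial_dual_basis_def
  proof (intro conjI ballI)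
    show "N' \<subseteq> carrier M" using sub(1) b' M by (auto simp: N'_def)
    show "\<zero>\<^bsub>M\<^esub> \<in> N'" using NN' sub by auto
    fix x assume x: "x \<in> N'"
    have "lsum M (\<lambda>(m, g). ract M m (g x)) xs' = ract M b' (\<rho> x) \<oplus>\<^bsub>M\<^esub> lsum M (\<lambda>(m, g). ract M m (g (\<nu> x))) xs"
      by (simp add: xs'_def lsum_map case_prod_unfold)
    also have "\<dots> = \<nu> x \<oplus>\<^bsub>M\<^esub> ract M b' (\<rho> x)"
      using sum[OF nr(1)[OF x]] nr(1,2)[OF x] sub(1) b' M by (simp add: M.a_comm subset_iff)
    finally show "lsum M (\<lambda>(m, g). ract M m (g x)) xs' = x" using nr(4)[OF x] by simp
  next
    fix p assume "p \<in> set xs'"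
    then consider "p = (b', \<rho>)" | m g where "(m, g) \<in> set xs" "p = (m, \<lambda>x. g (\<nu> x))"
      by (auto simp: xs'_def)
    then show "case p of (m, g) \<Rightarrow> m \<in> N' \<and> (\<forall>x\<in>N'. g x \<in> carrier (ralg M)) \<and>
      (\<forall>x\<in>N'. \<forall>y\<in>N'. g (x \<oplus>\<^bsub>M\<^esub> y) = g x \<oplus>\<^bsub>ralg M\<^esub> g y) \<and>
      (\<forall>x\<in>N'. \<forall>b\<in>carrier (ralg M). g (ract M x b) = g x \<otimes>\<^bsub>ralg M\<^esub> b)"
    proof cases
      case 1
      have "b' \<in> N'" using N'I[of "\<zero>\<^bsub>M\<^esub>" "\<one>\<^bsub>?B\<^esub>"] sub b' M by simp
      then show ?thesis using 1 nr lin lin' by auto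
    next
      case (2 m g')
      then show ?thesis using g[OF 2(1)] nr lin lin' NN' by auto
    qed
  qed (use N'add N'act in auto)
  moreover have "b \<in> N'"
  proof -
    have "b = ract M b e \<oplus>\<^bsub>M\<^esub> ract M b' \<one>\<^bsub>?B\<^esub>"
      using f eB b b' M bim_distrib(4)[of M b e f] by (simp add: b'_def)
    then show ?thesis using N'I[OF eB(2), of "\<one>\<^bsub>?B\<^esub>"] by simp
  qed
  ultimately show thesis using that NN' by blast
qed

text \<open>Start from the zero submodule with the empty list and adjoin the members of a finite
  spanning set. A submodule containing them is everything, because scalars act through
  \<open>ralg M\<close>.\<close>

lemma dual_basis_exists:
  assumes M: "bim M" and ss: "semisimple (ralg M)"
  obtains xs where "dual_basis M xs"
proof -
  note mM = bim_module[OF M]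
  have ex: "\<exists>N xs. partial_dual_basis M N xs \<and> S \<subseteq> N" if "finite S" "S \<subseteq> carrier M" for S
    using that
  proof (induction S)
    case empty
    have "ract M \<zero>\<^bsub>M\<^esub> b = \<zero>\<^bsub>M\<^esub>" if "b \<in> carrier (ralg M)" for b
      using add_hom_zero[OF M M ract_hom[OF M that]] .
    then have "partial_dual_basis M {\<zero>\<^bsub>M\<^esub>} []"
      using M by (auto simp: partial_dual_basis_def)
    then show ?case by blast
  next
    case (insert b S)
    then obtain N xs where "partial_dual_basis M N xs" "S \<subseteq> N" by auto
    then show ?case
      using partial_dual_basis_extend[OF M ss, of N xs b] insert.prems by (metis insert_subset order_trans)
  qed
  obtain S where S: "finite S" "S \<subseteq> carrier M" "carrier M = lspan K M S"
    using fd_bimodule.finite_dimensional[OF M] unfolding fin_dim_iff_lspan[OF mM] by blast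
  obtain N xs where N: "partial_dual_basis M N xs" "S \<subseteq> N" using ex[OF S(1,2)] by blast
  have sub: "N \<subseteq> carrier M" "\<zero>\<^bsub>M\<^esub> \<in> N" "\<And>x y. \<lbrakk>x \<in> N; y \<in> N\<rbrakk> \<Longrightarrow> x \<oplus>\<^bsub>M\<^esub> y \<in> N"
    "\<And>x r. \<lbrakk>x \<in> N; r \<in> carrier (ralg M)\<rbrakk> \<Longrightarrow> ract M x r \<in> N"
    using N unfolding partial_dual_basis_def by auto
  have "x \<in> N" if "x \<in> lspan K M S" for x
    using that
  proof induction
    case (lspan_step c s x)
    have s: "s \<in> N" "s \<in> carrier M" using lspan_step N S by auto
    then have "c \<odot>\<^bsub>M\<^esub> s = ract M s (c \<odot>\<^bsub>ralg M\<^esub> \<one>\<^bsub>ralg M\<^esub>)"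
      using fd_bimodule.ract_smult[OF M lspan_step(1), of s "\<one>\<^bsub>ralg M\<^esub>"] M by simp
    then show ?case using sub s lspan_step M by simp
  qed (use sub in auto)
  then have NM: "N = carrier M" using S sub by auto
  define ys where "ys = map (\<lambda>(m, g). (m, restrict g (carrier M))) xs"
  have "lsum M (\<lambda>(m, g). ract M m (g x)) ys = x" if "x \<in> carrier M" for x
  proof -
    have "lsum M (\<lambda>(m, g). ract M m (g x)) xs = x"
      using N(1) that NM by (simp add: partial_dual_basis_def)
    moreover have "lsum M (\<lambda>(m, g). ract M m (g x)) ys = lsum M (\<lambda>(m, g). ract M m (g x)) xs"
      unfolding ys_def lsum_map by (rule lsum_cong) (use that in auto)
    ultimately show ?thesis by simp
  qed
  moreover have "m \<in> carrier M \<and> g \<in> dual_set M" if mg: "(m, g) \<in> set ys" for m g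
  proof -
    obtain g' where "(m, g') \<in> set xs" "g = restrict g' (carrier M)"
      using mg by (auto simp: ys_def)
    then show ?thesis
      using N(1) M unfolding NM partial_dual_basis_def dual_set_def rhom_set_def
      by (auto intro!: homI dest!: bspec[of "set xs" _ "(m, g')"])
  qed
  ultimately show thesis using that unfolding dual_basis_def by blast
qed

end

section \<open>Duals\<close>

lemma lists_eqpoll:
  assumes "infinite (UNIV :: 'u set)"
  shows "(UNIV :: 'u list set) \<approx> (UNIV :: 'u set)"
  using card_of_lists_infinite[OF assms] by (simp add: eqpoll_iff_card_of_ordIso)

lemma dual_algs [simp]: "lalg (dual M) = op (lalg M)" "ralg (dual M) = op (ralg M)"
  by (simp_all add: dual_def op_bimodule_def rhom_def Let_def)

text \<open>These constants hide from the simplifier the subterm \<open>regular (ralg M)\<close> of the abbreviations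
  \<open>dual_fun\<close> and \<open>dual_code\<close>.\<close>

definition dual_ev :: "('k, 'u) bimodule \<Rightarrow> 'u \<Rightarrow> 'u \<Rightarrow> 'u" where
  "dual_ev M = dual_fun M"

definition dual_enc :: "('k, 'u) bimodule \<Rightarrow> ('u \<Rightarrow> 'u) \<Rightarrow> 'u" where
  "dual_enc M = dual_code M"

lemma dual_structure:
  "carrier (dual M) = dual_enc M ` dual_set M"
  "\<zero>\<^bsub>dual M\<^esub> = dual_enc M (\<lambda>m\<in>carrier M. \<zero>\<^bsub>ralg M\<^esub>)"
  "g \<oplus>\<^bsub>dual M\<^esub> h = dual_enc M (\<lambda>m\<in>carrier M. dual_ev M g m \<oplus>\<^bsub>ralg M\<^esub> dual_ev M h m)"
  "c \<odot>\<^bsub>dual M\<^esub> h = dual_enc M (\<lambda>m\<in>carrier M. c \<odot>\<^bsub>ralg M\<^esub> dual_ev M h m)"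
  "lact (dual M) a h = dual_enc M (\<lambda>m\<in>carrier M. dual_ev M h (lact M a m))"
  "ract (dual M) h b = dual_enc M (\<lambda>m\<in>carrier M. b \<otimes>\<^bsub>ralg M\<^esub> dual_ev M h m)"
  by (simp_all add: dual_def op_bimodule_def rhom_def Let_def dual_ev_def dual_enc_def dual_set_def)

section \<open>The dual bimodule\<close>

context morita
begin

lemma alg_group: "alg A \<Longrightarrow> comm_group (add_monoid A)"
  using module.axioms(2)[OF alg_module] abelian_group.a_comm_group by blast

lemma alg_zero [simp]:
  assumes "alg A" "x \<in> carrier A"
  shows "\<zero>\<^bsub>A\<^esub> \<otimes>\<^bsub>A\<^esub> x = \<zero>\<^bsub>A\<^esub>" "x \<otimes>\<^bsub>A\<^esub> \<zero>\<^bsub>A\<^esub> = \<zero>\<^bsub>A\<^esub>" "\<zero>\<^bsub>A\<^esub> \<oplus>\<^bsub>A\<^esub> x = x" "x \<oplus>\<^bsub>A\<^esub> \<zero>\<^bsub>A\<^esub> = x"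
proof -
  interpret ring A using assms(1) by (rule alg_ring)
  show "\<zero>\<^bsub>A\<^esub> \<otimes>\<^bsub>A\<^esub> x = \<zero>\<^bsub>A\<^esub>" "x \<otimes>\<^bsub>A\<^esub> \<zero>\<^bsub>A\<^esub> = \<zero>\<^bsub>A\<^esub>" "\<zero>\<^bsub>A\<^esub> \<oplus>\<^bsub>A\<^esub> x = x" "x \<oplus>\<^bsub>A\<^esub> \<zero>\<^bsub>A\<^esub> = x"
    using assms(2) by auto
qed

lemma dual_set_iff:
  "h \<in> dual_set M \<longleftrightarrow> h \<in> extensional (carrier M) \<and>
    (\<forall>m\<in>carrier M. h m \<in> carrier (ralg M)) \<and>
    (\<forall>m\<in>carrier M. \<forall>m'\<in>carrier M. h (m \<oplus>\<^bsub>M\<^esub> m') = h m \<oplus>\<^bsub>ralg M\<^esub> h m') \<and>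
    (\<forall>m\<in>carrier M. \<forall>b\<in>carrier (ralg M). h (ract M m b) = h m \<otimes>\<^bsub>ralg M\<^esub> b)"
  by (auto simp: dual_set_def rhom_set_def hom_def Pi_iff)

lemma dual_setI:
  assumes "\<And>m. m \<in> carrier M \<Longrightarrow> h m \<in> carrier (ralg M)"
    and "\<And>m m'. \<lbrakk>m \<in> carrier M; m' \<in> carrier M\<rbrakk> \<Longrightarrow> h (m \<oplus>\<^bsub>M\<^esub> m') = h m \<oplus>\<^bsub>ralg M\<^esub> h m'"
    and "\<And>m b. \<lbrakk>m \<in> carrier M; b \<in> carrier (ralg M)\<rbrakk> \<Longrightarrow> h (ract M m b) = h m \<otimes>\<^bsub>ralg M\<^esub> b"
    and "bim M"
  shows "(\<lambda>m\<in>carrier M. h m) \<in> dual_set M"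
  using assms by (simp add: dual_set_iff)

text \<open>A functional is determined by its values on a finite spanning set, so the dual injects
  into lists over \<open>'u\<close>, and an infinite type has as many lists as elements.\<close>

lemma dual_set_lepoll:
  assumes M: "bim M"
  shows "dual_set M \<lesssim> (UNIV :: 'u set)"
proof -
  obtain S where S: "finite S" "S \<subseteq> carrier M" "carrier M = lspan K M S"
    using fd_bimodule.finite_dimensional[OF M] unfolding fin_dim_iff_lspan[OF bim_module[OF M]] by blast
  obtain ss where ss: "set ss = S" using finite_list[OF S(1)] by blast
  have "inj_on (\<lambda>h. map h ss) (dual_set M)"
  proof (rule inj_onI)
    fix h h' assume h: "h \<in> dual_set M" and h': "h' \<in> dual_set M"
      and eq: "map h ss = map h' ss"
    have hh: "h \<in> hom (add_monoid M) (add_monoid (regular (ralg M)))" "h' \<in> hom (add_monoid M) (add_monoid (regular (ralg M)))"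
      using h h' by (auto simp: dual_set_def rhom_set_def)
    have zero: "h \<zero>\<^bsub>M\<^esub> = \<zero>\<^bsub>ralg M\<^esub>" "h' \<zero>\<^bsub>M\<^esub> = \<zero>\<^bsub>ralg M\<^esub>"
      using add_hom_zero[OF M _ hh(1)] add_hom_zero[OF M _ hh(2)] M by auto
    have "h x = h' x" if "x \<in> lspan K M S" for x
      using that
    proof induction
      case (lspan_step c s x)
      have s: "s \<in> carrier M" "x \<in> carrier M" using lspan_step S by auto
      have "c \<odot>\<^bsub>M\<^esub> s = ract M s (c \<odot>\<^bsub>ralg M\<^esub> \<one>\<^bsub>ralg M\<^esub>)"
        using fd_bimodule.ract_smult[OF M lspan_step(1) s(1), of "\<one>\<^bsub>ralg M\<^esub>"] M s by simp
      moreover have "h s = h' s" using eq lspan_step ss by (simp add: map_eq_conv)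
      ultimately show ?case using h h' s lspan_step M unfolding dual_set_iff by simp
    qed (simp add: zero)
    then show "h = h'"
      using h h' S(3) by (intro extensionalityI[of _ "carrier M"]) (auto simp: dual_set_iff)
  qed
  then have "dual_set M \<lesssim> (UNIV :: 'u list set)"
    by (auto simp: lepoll_def)
  from lepoll_trans[OF this eqpoll_imp_lepoll[OF lists_eqpoll[OF infinite_U]]] show ?thesis .
qed

lemma dual_ev_code [simp]:
  "\<lbrakk>bim M; h \<in> dual_set M\<rbrakk> \<Longrightarrow> dual_ev M (dual_enc M h) = h"
  unfolding dual_ev_def dual_enc_def rhom_fun_def rhom_code_def dual_set_def[symmetric]
  using dual_set_lepoll by (rule decode_encode)

lemma dual_enc_closed [simp]: "h \<in> dual_set M \<Longrightarrow> dual_enc M h \<in> carrier (dual M)"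
  by (simp add: dual_structure)

lemma dual_ev_in: "\<lbrakk>bim M; g \<in> carrier (dual M)\<rbrakk> \<Longrightarrow> dual_ev M g \<in> dual_set M"
  by (auto simp: dual_structure)

lemma dual_ev_linear [simp]:
  assumes "bim M" "g \<in> carrier (dual M)"
  shows "\<lbrakk>m \<in> carrier M; ralg M = A\<rbrakk> \<Longrightarrow> dual_ev M g m \<in> carrier A"
    and "\<lbrakk>m \<in> carrier M; m' \<in> carrier M\<rbrakk> \<Longrightarrow> dual_ev M g (m \<oplus>\<^bsub>M\<^esub> m') = dual_ev M g m \<oplus>\<^bsub>ralg M\<^esub> dual_ev M g m'"
    and "\<lbrakk>m \<in> carrier M; b \<in> carrier (ralg M)\<rbrakk> \<Longrightarrow> dual_ev M g (ract M m b) = dual_ev M g m \<otimes>\<^bsub>ralg M\<^esub> b"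
  using dual_ev_in[OF assms] unfolding dual_set_iff by auto

lemma dual_ext:
  assumes "bim M" "g \<in> carrier (dual M)" "h \<in> carrier (dual M)"
    and "\<And>m. m \<in> carrier M \<Longrightarrow> dual_ev M g m = dual_ev M h m"
  shows "g = h"
proof -
  have "dual_ev M g = dual_ev M h"
    using dual_ev_in[OF assms(1,2)] dual_ev_in[OF assms(1,3)] assms(4)
    by (intro extensionalityI[of _ "carrier M"]) (auto simp: dual_set_iff)
  moreover obtain g' h' where "g = dual_enc M g'" "g' \<in> dual_set M"
    "h = dual_enc M h'" "h' \<in> dual_set M"
    using assms by (auto simp: dual_structure)
  ultimately show ?thesis using assms(1) by simp
qed

lemma alg_add_swap:
  assumes "alg A" "a \<in> carrier A" "b \<in> carrier A" "c \<in> carrier A" "d \<in> carrier A"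
  shows "a \<oplus>\<^bsub>A\<^esub> b \<oplus>\<^bsub>A\<^esub> (c \<oplus>\<^bsub>A\<^esub> d) = a \<oplus>\<^bsub>A\<^esub> c \<oplus>\<^bsub>A\<^esub> (b \<oplus>\<^bsub>A\<^esub> d)"
  using add_swap[of "regular A" a b c d] assms by simp

lemma smult_mult:
  "\<lbrakk>alg A; c \<in> carrier K; a \<in> carrier A; b \<in> carrier A\<rbrakk> \<Longrightarrow> (c \<odot>\<^bsub>A\<^esub> a) \<otimes>\<^bsub>A\<^esub> b = c \<odot>\<^bsub>A\<^esub> (a \<otimes>\<^bsub>A\<^esub> b)"
  "\<lbrakk>alg A; c \<in> carrier K; a \<in> carrier A; b \<in> carrier A\<rbrakk> \<Longrightarrow> a \<otimes>\<^bsub>A\<^esub> (c \<odot>\<^bsub>A\<^esub> b) = c \<odot>\<^bsub>A\<^esub> (a \<otimes>\<^bsub>A\<^esub> b)"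
  by (rule fd_algebra.smult_mult_left fd_algebra.smult_mult_right; assumption)+

lemma smult_add:
  "\<lbrakk>alg A; c \<in> carrier K; a \<in> carrier A; b \<in> carrier A\<rbrakk> \<Longrightarrow> c \<odot>\<^bsub>A\<^esub> (a \<oplus>\<^bsub>A\<^esub> b) = c \<odot>\<^bsub>A\<^esub> a \<oplus>\<^bsub>A\<^esub> c \<odot>\<^bsub>A\<^esub> b"
  by (rule module.smult_r_distr[OF alg_module])

lemma dual_ops:
  assumes M: "bim M"
  shows "(\<lambda>m\<in>carrier M. \<zero>\<^bsub>ralg M\<^esub>) \<in> dual_set M"
    and "\<lbrakk>g \<in> carrier (dual M); h \<in> carrier (dual M)\<rbrakk> \<Longrightarrow>
      (\<lambda>m\<in>carrier M. dual_ev M g m \<oplus>\<^bsub>ralg M\<^esub> dual_ev M h m) \<in> dual_set M"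
    and "\<lbrakk>h \<in> carrier (dual M); c \<in> carrier K\<rbrakk> \<Longrightarrow>
      (\<lambda>m\<in>carrier M. c \<odot>\<^bsub>ralg M\<^esub> dual_ev M h m) \<in> dual_set M"
    and "\<lbrakk>h \<in> carrier (dual M); a \<in> carrier (lalg M)\<rbrakk> \<Longrightarrow>
      (\<lambda>m\<in>carrier M. dual_ev M h (lact M a m)) \<in> dual_set M"
    and "\<lbrakk>h \<in> carrier (dual M); b \<in> carrier (ralg M)\<rbrakk> \<Longrightarrow>
      (\<lambda>m\<in>carrier M. b \<otimes>\<^bsub>ralg M\<^esub> dual_ev M h m) \<in> dual_set M"
proof -
  have B: "alg (ralg M)" "ring (ralg M)" using M alg_ring by auto
  show "(\<lambda>m\<in>carrier M. \<zero>\<^bsub>ralg M\<^esub>) \<in> dual_set M"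
    by (rule dual_setI) (use M B in auto)
  show "\<lbrakk>g \<in> carrier (dual M); h \<in> carrier (dual M)\<rbrakk> \<Longrightarrow>
      (\<lambda>m\<in>carrier M. dual_ev M g m \<oplus>\<^bsub>ralg M\<^esub> dual_ev M h m) \<in> dual_set M"
    by (rule dual_setI) (use M B in \<open>auto simp: alg_distrib alg_add_swap\<close>)
  show "\<lbrakk>h \<in> carrier (dual M); c \<in> carrier K\<rbrakk> \<Longrightarrow>
      (\<lambda>m\<in>carrier M. c \<odot>\<^bsub>ralg M\<^esub> dual_ev M h m) \<in> dual_set M"
    by (rule dual_setI) (use M B in \<open>auto simp: smult_mult smult_add\<close>)
  show "\<lbrakk>h \<in> carrier (dual M); a \<in> carrier (lalg M)\<rbrakk> \<Longrightarrow>
      (\<lambda>m\<in>carrier M. dual_ev M h (lact M a m)) \<in> dual_set M"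
    by (rule dual_setI) (use M B in \<open>auto simp: bim_distrib bim_assoc(3)[symmetric]\<close>)
  show "\<lbrakk>h \<in> carrier (dual M); b \<in> carrier (ralg M)\<rbrakk> \<Longrightarrow>
      (\<lambda>m\<in>carrier M. b \<otimes>\<^bsub>ralg M\<^esub> dual_ev M h m) \<in> dual_set M"
    by (rule dual_setI) (use M B in \<open>auto simp: alg_distrib alg_assoc\<close>)
qed

lemma dual_closed:
  assumes M: "bim M"
  shows "\<zero>\<^bsub>dual M\<^esub> \<in> carrier (dual M)"
    and "\<lbrakk>g \<in> carrier (dual M); h \<in> carrier (dual M)\<rbrakk> \<Longrightarrow> g \<oplus>\<^bsub>dual M\<^esub> h \<in> carrier (dual M)"
    and "\<lbrakk>h \<in> carrier (dual M); c \<in> carrier K\<rbrakk> \<Longrightarrow> c \<odot>\<^bsub>dual M\<^esub> h \<in> carrier (dual M)"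
    and "\<lbrakk>h \<in> carrier (dual M); a \<in> carrier (lalg M)\<rbrakk> \<Longrightarrow> lact (dual M) a h \<in> carrier (dual M)"
    and "\<lbrakk>h \<in> carrier (dual M); b \<in> carrier (ralg M)\<rbrakk> \<Longrightarrow> ract (dual M) h b \<in> carrier (dual M)"
  using dual_ops[OF M] by (simp_all add: dual_structure(2-6))

lemma dual_eval [simp]:
  assumes M: "bim M" and m: "m \<in> carrier M"
  shows "dual_ev M \<zero>\<^bsub>dual M\<^esub> m = \<zero>\<^bsub>ralg M\<^esub>"
    and "\<lbrakk>g \<in> carrier (dual M); h \<in> carrier (dual M)\<rbrakk> \<Longrightarrow>
      dual_ev M (g \<oplus>\<^bsub>dual M\<^esub> h) m = dual_ev M g m \<oplus>\<^bsub>ralg M\<^esub> dual_ev M h m"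
    and "\<lbrakk>h \<in> carrier (dual M); c \<in> carrier K\<rbrakk> \<Longrightarrow> dual_ev M (c \<odot>\<^bsub>dual M\<^esub> h) m = c \<odot>\<^bsub>ralg M\<^esub> dual_ev M h m"
    and "\<lbrakk>h \<in> carrier (dual M); a \<in> carrier (lalg M)\<rbrakk> \<Longrightarrow>
      dual_ev M (lact (dual M) a h) m = dual_ev M h (lact M a m)"
    and "\<lbrakk>h \<in> carrier (dual M); b \<in> carrier (ralg M)\<rbrakk> \<Longrightarrow>
      dual_ev M (ract (dual M) h b) m = b \<otimes>\<^bsub>ralg M\<^esub> dual_ev M h m"
  using dual_ops[OF M] m M by (simp_all add: dual_structure(2-6))

lemma dual_lsum_closed:
  assumes "bim M" "\<And>x. x \<in> set xs \<Longrightarrow> f x \<in> carrier (dual M)"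
  shows "lsum (dual M) f xs \<in> carrier (dual M)"
  using assms(2) by (induction xs) (use assms(1) in \<open>auto simp: dual_closed\<close>)

lemma dual_ev_lsum:
  assumes M: "bim M" "m \<in> carrier M" "\<And>x. x \<in> set xs \<Longrightarrow> f x \<in> carrier (dual M)"
  shows "dual_ev M (lsum (dual M) f xs) m = lsum (ralg M) (\<lambda>x. dual_ev M (f x) m) xs"
  using assms(3) by (induction xs) (use assms(1,2) in \<open>auto simp: dual_lsum_closed\<close>)

lemma lsum_regular: "lsum (regular A) f xs = lsum A f xs"
  by (induction xs) auto

text \<open>Apply \<open>h\<close> to \<open>m = \<Sum>\<^sub>i m\<^sub>i g\<^sub>i(m)\<close> and
  use right linearity: \<open>h = \<Sum>\<^sub>i h(m\<^sub>i) g\<^sub>i\<close>. The right action on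
  the dual is left multiplication of values, which is why the coefficients
  \<open>h(m\<^sub>i)\<close> appear as right actions.\<close>

lemma dual_basis_expand:
  assumes M: "bim M" and xs: "dual_basis M xs" and h: "h \<in> carrier (dual M)"
  shows "lsum (dual M) (\<lambda>(m, g). ract (dual M) (dual_enc M g) (dual_ev M h m)) xs = h"
proof -
  let ?f = "\<lambda>(m, g). ract (dual M) (dual_enc M g) (dual_ev M h m)"
  have x: "m \<in> carrier M" "g \<in> dual_set M" "\<And>m. m \<in> carrier M \<Longrightarrow> g m \<in> carrier (ralg M)"
    if "(m, g) \<in> set xs" for m g
    using xs that unfolding dual_basis_def dual_set_iff by auto
  have f: "\<And>x. x \<in> set xs \<Longrightarrow> ?f x \<in> carrier (dual M)"
    using x M h by (auto intro!: dual_closed)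
  have hh: "dual_ev M h \<in> hom (add_monoid M) (add_monoid (regular (ralg M)))"
    using M h by (intro add_homI) auto
  show ?thesis
  proof (rule dual_ext[OF M dual_lsum_closed[OF M f] h])
    fix m assume m: "m \<in> carrier M"
    have "dual_ev M (lsum (dual M) ?f xs) m = lsum (ralg M) (\<lambda>x. dual_ev M (?f x) m) xs"
      by (rule dual_ev_lsum[OF M m f])
    also have "\<dots> = lsum (regular (ralg M)) (\<lambda>x. dual_ev M h ((\<lambda>(m', g). ract M m' (g m)) x)) xs"
      unfolding lsum_regular by (rule lsum_cong) (use x M h m in auto)
    also have "\<dots> = dual_ev M h (lsum M (\<lambda>(m', g). ract M m' (g m)) xs)"
      by (rule lsum_hom[OF M _ hh, symmetric]) (use x M m in auto)
    also have "\<dots> = dual_ev M h m"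
      using xs m by (simp add: dual_basis_def)
    finally show "dual_ev M (lsum (dual M) ?f xs) m = dual_ev M h m" .
  qed
qed

lemma bim_dual [simp]:
  assumes M: "bim M" and ss: "semisimple (ralg M)"
  shows "bim (dual M)"
proof -
  have B: "alg (ralg M)" "alg (lalg M)" and R: "bim (regular (ralg M))" using M by auto
  note ext = dual_ext[OF M] and cl = dual_closed[OF M]
  note mod = alg_module[OF B(1)]
  have grp: "abelian_group (dual M)"
  proof (rule abelian_groupI)
    fix g h k assume g: "g \<in> carrier (dual M)" and h: "h \<in> carrier (dual M)" and k: "k \<in> carrier (dual M)"
    show "g \<oplus>\<^bsub>dual M\<^esub> h \<oplus>\<^bsub>dual M\<^esub> k = g \<oplus>\<^bsub>dual M\<^esub> (h \<oplus>\<^bsub>dual M\<^esub> k)"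
      by (rule ext) (use g h k M cl bim_ac(1)[OF R, simplified] in auto)
    show "g \<oplus>\<^bsub>dual M\<^esub> h = h \<oplus>\<^bsub>dual M\<^esub> g"
      by (rule ext) (use g h M cl bim_ac(2)[OF R _ _ bim_add(1)[OF R], simplified] in auto)
  next
    fix g assume g: "g \<in> carrier (dual M)"
    show "\<zero>\<^bsub>dual M\<^esub> \<oplus>\<^bsub>dual M\<^esub> g = g"
      by (rule ext) (use g M cl bim_add(4)[OF R, simplified] in auto)
    \<comment> \<open>Negatives of functionals are formed as multiples by \<open>- 1\<close>, since
      scalar multiplication is already known to stay inside the dual.\<close>
    have m1: "\<ominus>\<^bsub>K\<^esub> \<one>\<^bsub>K\<^esub> \<in> carrier K"
      using cring_K by (simp add: cring.cring_simprules)
    have "(\<ominus>\<^bsub>K\<^esub> \<one>\<^bsub>K\<^esub>) \<odot>\<^bsub>dual M\<^esub> g \<oplus>\<^bsub>dual M\<^esub> g = \<zero>\<^bsub>dual M\<^esub>"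
    proof (rule ext)
      fix m assume m: "m \<in> carrier M"
      interpret B: module K "ralg M" by (rule mod)
      have b: "dual_ev M g m \<in> carrier (ralg M)" using g m M by simp
      have "(\<ominus>\<^bsub>K\<^esub> \<one>\<^bsub>K\<^esub>) \<odot>\<^bsub>ralg M\<^esub> dual_ev M g m \<oplus>\<^bsub>ralg M\<^esub> dual_ev M g m = \<zero>\<^bsub>ralg M\<^esub>"
        using b B.smult_l_distr[of "\<ominus>\<^bsub>K\<^esub> \<one>\<^bsub>K\<^esub>" "\<one>\<^bsub>K\<^esub>" "dual_ev M g m"] by (simp add: B.R.l_neg)
      then show "dual_ev M ((\<ominus>\<^bsub>K\<^esub> \<one>\<^bsub>K\<^esub>) \<odot>\<^bsub>dual M\<^esub> g \<oplus>\<^bsub>dual M\<^esub> g) m = dual_ev M \<zero>\<^bsub>dual M\<^esub> m"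
        using g m M m1 cl by simp
    qed (use g m1 cl in auto)
    then show "\<exists>h\<in>carrier (dual M). h \<oplus>\<^bsub>dual M\<^esub> g = \<zero>\<^bsub>dual M\<^esub>"
      using cl(3)[OF g m1] by blast
  qed (use cl in auto)
  have mod': "module K (dual M)"
  proof (rule moduleI[OF cring_K grp])
    fix c g assume c: "c \<in> carrier K" and g: "g \<in> carrier (dual M)"
    show "c \<odot>\<^bsub>dual M\<^esub> g \<in> carrier (dual M)" using c g by (rule cl(3)[rotated])
    {
      fix d assume d: "d \<in> carrier K"
      show "(c \<oplus>\<^bsub>K\<^esub> d) \<odot>\<^bsub>dual M\<^esub> g = c \<odot>\<^bsub>dual M\<^esub> g \<oplus>\<^bsub>dual M\<^esub> d \<odot>\<^bsub>dual M\<^esub> g"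
        by (rule ext) (use c d g M cl cring_K in \<open>auto simp: module.smult_l_distr[OF mod] cring.cring_simprules(1)\<close>)
      show "(c \<otimes>\<^bsub>K\<^esub> d) \<odot>\<^bsub>dual M\<^esub> g = c \<odot>\<^bsub>dual M\<^esub> (d \<odot>\<^bsub>dual M\<^esub> g)"
        by (rule ext) (use c d g M cl cring_K in \<open>auto simp: module.smult_assoc1[OF mod] cring.cring_simprules(5)\<close>)
    next
      fix h assume h: "h \<in> carrier (dual M)"
      show "c \<odot>\<^bsub>dual M\<^esub> (g \<oplus>\<^bsub>dual M\<^esub> h) = c \<odot>\<^bsub>dual M\<^esub> g \<oplus>\<^bsub>dual M\<^esub> c \<odot>\<^bsub>dual M\<^esub> h"
        by (rule ext) (use c h g M cl in \<open>auto simp: module.smult_r_distr[OF mod]\<close>)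
    }
  next
    fix g assume g: "g \<in> carrier (dual M)"
    show "\<one>\<^bsub>K\<^esub> \<odot>\<^bsub>dual M\<^esub> g = g"
      by (rule ext) (use g M cl cring_K in \<open>auto simp: module.smult_one[OF mod] cring.cring_simprules(6)\<close>)
  qed
  have radd: "ract (dual M) g (b \<oplus>\<^bsub>ralg M\<^esub> b') = ract (dual M) g b \<oplus>\<^bsub>dual M\<^esub> ract (dual M) g b'"
    if "g \<in> carrier (dual M)" "b \<in> carrier (ralg M)" "b' \<in> carrier (ralg M)" for g b b'
    by (rule ext) (use that M B cl in \<open>auto simp: alg_distrib\<close>)
  have rsmult: "ract (dual M) g (c \<odot>\<^bsub>ralg M\<^esub> b) = c \<odot>\<^bsub>dual M\<^esub> ract (dual M) g b"
    if "g \<in> carrier (dual M)" "b \<in> carrier (ralg M)" "c \<in> carrier K" for g b c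
    by (rule ext) (use that M B cl in \<open>auto simp: smult_mult\<close>)
  have rzero: "ract (dual M) g \<zero>\<^bsub>ralg M\<^esub> = \<zero>\<^bsub>dual M\<^esub>" if "g \<in> carrier (dual M)" for g
    by (rule ext) (use that M B cl in auto)
  have fin: "fin_dim K (dual M)"
  proof -
    interpret D: module K "dual M" by (rule mod')
    obtain xs where xs: "dual_basis M xs" using dual_basis_exists[OF M ss] by blast
    obtain S where S: "finite S" "S \<subseteq> carrier (ralg M)" "carrier (ralg M) = lspan K (ralg M) S"
      using fd_algebra.finite_dimensional[OF B(1)] unfolding fin_dim_iff_lspan[OF mod] by blast
    have x: "m \<in> carrier M" "dual_enc M g \<in> carrier (dual M)" if "(m, g) \<in> set xs" for m g
      using xs that unfolding dual_basis_def by auto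
    \<comment> \<open>A spanning set over \<open>K\<close>: the functionals of a dual basis, acted
      on by spanning elements of the algebra.\<close>
    let ?T = "(\<lambda>((m, g), s). ract (dual M) (dual_enc M g) s) ` (set xs \<times> S)"
    have T: "?T \<subseteq> carrier (dual M)"
      using x S(2) by (auto intro!: cl(5))
    have r: "ract (dual M) (dual_enc M g) b \<in> lspan K (dual M) ?T" if mg: "(m, g) \<in> set xs" and "b \<in> lspan K (ralg M) S" for m g b
      using that(2)
    proof induction
      case lspan_zero
      then show ?case using rzero x[OF mg] by (auto intro: lspan.lspan_zero)
    next
      case (lspan_step c s b)
      then have "s \<in> carrier (ralg M)" "b \<in> carrier (ralg M)" using S by auto
      moreover have "ract (dual M) (dual_enc M g) s \<in> ?T" using mg lspan_step by force
      ultimately show ?case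
        using lspan_step B x[OF mg] by (simp add: radd rsmult lspan.lspan_step)
    qed
    have "h \<in> lspan K (dual M) ?T" if h: "h \<in> carrier (dual M)" for h
    proof -
      have hl: "dual_ev M h m \<in> lspan K (ralg M) S" if "m \<in> carrier M" for m
        using dual_ev_linear(1)[OF M h that refl] unfolding S(3) .
      have "lsum (dual M) (\<lambda>(m, g). ract (dual M) (dual_enc M g) (dual_ev M h m)) ys \<in> lspan K (dual M) ?T"
        if "set ys \<subseteq> set xs" for ys
        using that
      proof (induction ys)
        case (Cons p ys)
        then have "(case p of (m, g) \<Rightarrow> ract (dual M) (dual_enc M g) (dual_ev M h m)) \<in> lspan K (dual M) ?T"
          using r x hl by (cases p) auto
        then show ?case using Cons D.lspan_add[OF T] by simp
      qed (simp add: lspan.lspan_zero)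
      from this[of xs] show ?thesis using dual_basis_expand[OF M xs h] by simp
    qed
    then show ?thesis using S(1) T by (intro fin_dimI[OF mod', of ?T]) auto
  qed
  show ?thesis
  proof (intro fd_bimodule.intro mod' fin fd_bimodule_axioms.intro)
    show "alg (lalg (dual M))" "alg (ralg (dual M))" using B by auto
    fix g assume g: "g \<in> carrier (dual M)"
    show "lact (dual M) \<one>\<^bsub>lalg (dual M)\<^esub> g = g" "ract (dual M) g \<one>\<^bsub>ralg (dual M)\<^esub> = g"
      by (rule ext; use g M B cl in simp)+
    {
      fix a assume "a \<in> carrier (lalg (dual M))" then have a: "a \<in> carrier (lalg M)" by simp
      show "lact (dual M) a g \<in> carrier (dual M)" using g a by (rule cl)
      {
        fix a' assume "a' \<in> carrier (lalg (dual M))" then have a': "a' \<in> carrier (lalg M)" by simp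
        show "lact (dual M) (a \<oplus>\<^bsub>lalg (dual M)\<^esub> a') g = lact (dual M) a g \<oplus>\<^bsub>dual M\<^esub> lact (dual M) a' g"
          by (rule ext) (use g a a' M B cl in \<open>auto simp: bim_distrib\<close>)
        show "lact (dual M) (a \<otimes>\<^bsub>lalg (dual M)\<^esub> a') g = lact (dual M) a (lact (dual M) a' g)"
          by (rule ext) (use g a a' M B cl in \<open>auto simp: bim_assoc\<close>)
      next
        fix h assume h: "h \<in> carrier (dual M)"
        show "lact (dual M) a (g \<oplus>\<^bsub>dual M\<^esub> h) = lact (dual M) a g \<oplus>\<^bsub>dual M\<^esub> lact (dual M) a h"
          by (rule ext) (use g a h M B cl in auto)
      next
        fix b assume "b \<in> carrier (ralg (dual M))" then have b: "b \<in> carrier (ralg M)" by simp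
        show "ract (dual M) (lact (dual M) a g) b = lact (dual M) a (ract (dual M) g b)"
          by (rule ext) (use g a b M B cl in auto)
      }
    }
    {
      fix b assume "b \<in> carrier (ralg (dual M))" then have b: "b \<in> carrier (ralg M)" by simp
      show "ract (dual M) g b \<in> carrier (dual M)" using g b by (rule cl)
      {
        fix b' assume "b' \<in> carrier (ralg (dual M))" then have b': "b' \<in> carrier (ralg M)" by simp
        show "ract (dual M) g (b \<oplus>\<^bsub>ralg (dual M)\<^esub> b') = ract (dual M) g b \<oplus>\<^bsub>dual M\<^esub> ract (dual M) g b'"
          using radd[OF g b b'] by simp
        show "ract (dual M) g (b \<otimes>\<^bsub>ralg (dual M)\<^esub> b') = ract (dual M) (ract (dual M) g b) b'"
          by (rule ext) (use g b b' M B cl in \<open>auto simp: alg_assoc\<close>)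
      next
        fix h assume h: "h \<in> carrier (dual M)"
        show "ract (dual M) (g \<oplus>\<^bsub>dual M\<^esub> h) b = ract (dual M) g b \<oplus>\<^bsub>dual M\<^esub> ract (dual M) h b"
          by (rule ext) (use g b h M B cl in \<open>auto simp: alg_distrib\<close>)
      }
    }
  next
    fix c a g assume c: "c \<in> carrier K" and "a \<in> carrier (lalg (dual M))" and g: "g \<in> carrier (dual M)"
    then have a: "a \<in> carrier (lalg M)" by simp
    \<comment> \<open>A functional respects scalars because they act on \<open>M\<close> through the
      element \<open>c 1\<close> of \<open>ralg M\<close>.\<close>
    have *: "dual_ev M g (c \<odot>\<^bsub>M\<^esub> m) = c \<odot>\<^bsub>ralg M\<^esub> dual_ev M g m" if m: "m \<in> carrier M" for m
    proof -
      have "c \<odot>\<^bsub>M\<^esub> m = ract M m (c \<odot>\<^bsub>ralg M\<^esub> \<one>\<^bsub>ralg M\<^esub>)"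
        using fd_bimodule.ract_smult[OF M c m, of "\<one>\<^bsub>ralg M\<^esub>"] M m by simp
      then show ?thesis using M B g m c by (simp add: smult_mult)
    qed
    show "lact (dual M) (c \<odot>\<^bsub>lalg (dual M)\<^esub> a) g = c \<odot>\<^bsub>dual M\<^esub> lact (dual M) a g"
      by (rule ext) (use c a g M B cl * in \<open>auto simp: fd_bimodule.lact_smult\<close>)
  next
    fix c b g assume c: "c \<in> carrier K" and "b \<in> carrier (ralg (dual M))" and g: "g \<in> carrier (dual M)"
    then show "ract (dual M) g (c \<odot>\<^bsub>ralg (dual M)\<^esub> b) = c \<odot>\<^bsub>dual M\<^esub> ract (dual M) g b"
      using rsmult by simp
  qed
qed

section \<open>Dual maps\<close>

lemma dual_map_boundaries [simp]: "bdom (dual_map f) = dual (bcod f)" "bcod (dual_map f) = dual (bdom f)"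
  by (simp_all add: dual_map_def)

lemma dual_map_eval [simp]:
  assumes f: "cell f" and ss: "semisimple (ralg (bdom f))"
  shows "cell (dual_map f)"
    and "\<lbrakk>bdom f = M; m \<in> carrier M; g \<in> carrier (dual (bcod f))\<rbrakk> \<Longrightarrow>
      dual_ev M (bmap (dual_map f) g) m = dual_ev (bcod f) g (bmap f m)"
proof -
  let ?h = "\<lambda>g. \<lambda>m\<in>carrier (bdom f). dual_ev (bcod f) g (bmap f m)"
  have r: "?h g \<in> dual_set (bdom f)" if "g \<in> carrier (dual (bcod f))" for g
    by (rule dual_setI) (use f that in \<open>auto simp: cell_linear\<close>)
  have m: "bmap (dual_map f) g = dual_enc (bdom f) (?h g)" if "g \<in> carrier (dual (bcod f))" for g
    using that by (simp add: dual_map_def dual_ev_def dual_enc_def)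
  have e: "dual_ev (bdom f) (bmap (dual_map f) g) m = dual_ev (bcod f) g (bmap f m)"
    if "g \<in> carrier (dual (bcod f))" "m \<in> carrier (bdom f)" for g m
    using m[OF that(1)] r[OF that(1)] that f by simp
  then show "\<lbrakk>bdom f = M; m \<in> carrier M; g \<in> carrier (dual (bcod f))\<rbrakk> \<Longrightarrow>
      dual_ev M (bmap (dual_map f) g) m = dual_ev (bcod f) g (bmap f m)" by auto
  have c: "bmap (dual_map f) g \<in> carrier (dual (bdom f))" if "g \<in> carrier (dual (bcod f))" for g
    using m[OF that] r[OF that] by simp
  note M = cell_props[OF f]
  note cl = dual_closed[OF M(1)] dual_closed[OF M(2)]
  have "bilin (dual (bcod f)) (dual (bdom f)) (bmap (dual_map f))"
    unfolding bilin_def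
  proof (intro conjI ballI add_homI)
    fix x y assume "x \<in> carrier (dual (bcod f))" "y \<in> carrier (dual (bcod f))"
    then show "bmap (dual_map f) (x \<oplus>\<^bsub>dual (bcod f)\<^esub> y) = bmap (dual_map f) x \<oplus>\<^bsub>dual (bdom f)\<^esub> bmap (dual_map f) y"
      by (rule_tac dual_ext[OF M(1)]) (use M(1,2) f c cl in \<open>auto simp: e\<close>)
  next
    fix a x assume "a \<in> carrier (lalg (dual (bcod f)))" "x \<in> carrier (dual (bcod f))"
    then show "bmap (dual_map f) (lact (dual (bcod f)) a x) = lact (dual (bdom f)) a (bmap (dual_map f) x)"
      by (rule_tac dual_ext[OF M(1)]) (use M(1,2) f c cl in \<open>auto simp: e cell_linear\<close>)
  next
    fix b x assume "b \<in> carrier (ralg (dual (bcod f)))" "x \<in> carrier (dual (bcod f))"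
    then show "bmap (dual_map f) (ract (dual (bcod f)) x b) = ract (dual (bdom f)) (bmap (dual_map f) x) b"
      by (rule_tac dual_ext[OF M(1)]) (use M(1,2) f c cl in \<open>auto simp: e cell_linear\<close>)
  qed (use M f c ss in auto)
  then show "cell (dual_map f)"
    unfolding cell_iff by (simp add: dual_map_def)
qed

end

section \<open>The map into the double dual\<close>

lemma psi_boundaries [simp]: "bdom (psi M) = M" "bcod (psi M) = dual (dual M)"
  by (simp_all add: psi_def)

lemma dual_comp_inv_boundaries [simp]:
  "bdom (dual_comp_inv M N) = tensor (dual M) (dual N)" "bcod (dual_comp_inv M N) = dual (tensor M N)"
  by (simp_all add: dual_comp_inv_def)

lemma dual_unit_boundaries [simp]:
  "bdom (dual_unit A) = dual (regular A)" "bcod (dual_unit A) = regular (op A)"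
  by (simp_all add: dual_unit_def)

lemma dual_zeta_boundaries [simp]:
  "bdom (dual_zeta A) = regular (op A)" "bcod (dual_zeta A) = dual (regular A)"
  by (simp_all add: dual_zeta_def)

context morita
begin

declare semisimple_op [simp]

lemma add_hom_lsum:
  assumes "bim M" "bim N" "\<And>x. x \<in> set xs \<Longrightarrow> F x \<in> hom (add_monoid M) (add_monoid N)"
  shows "(\<lambda>y. lsum N (\<lambda>x. F x y) xs) \<in> hom (add_monoid M) (add_monoid N)"
  using assms(3)
proof (induction xs)
  case Nil
  show ?case by (rule add_homI) (use assms(2) in auto)
next
  case (Cons x xs)
  then show ?case using add_hom_add[OF assms(2), of "F x" M] by simp
qed

lemma dual_ev_op [simp]:
  "\<lbrakk>bim M; g \<in> carrier (dual M); m \<in> carrier M; ralg M = op A\<rbrakk> \<Longrightarrow> dual_ev M g m \<in> carrier A"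
  using dual_ev_linear(1)[of M g m "op A"] by simp

lemma psi_eval [simp]:
  assumes M: "bim M" and ss: "semisimple (ralg M)"
  shows "cell (psi M)"
    and "\<lbrakk>p \<in> carrier M; D = dual M; g \<in> carrier D\<rbrakk> \<Longrightarrow> dual_ev D (bmap (psi M) p) g = dual_ev M g p"
proof -
  note D = bim_dual[OF M ss]
  note cl = dual_closed[OF M]
  have B: "alg (ralg M)" using M by simp
  have r: "(\<lambda>g\<in>carrier (dual M). dual_ev M g p) \<in> dual_set (dual M)" if "p \<in> carrier M" for p
    by (rule dual_setI) (use M D that cl in auto)
  have m: "bmap (psi M) p = dual_enc (dual M) (\<lambda>g\<in>carrier (dual M). dual_ev M g p)" if "p \<in> carrier M" for p
    using that by (simp add: psi_def dual_enc_def dual_ev_def)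
  have e: "dual_ev (dual M) (bmap (psi M) p) g = dual_ev M g p" if "p \<in> carrier M" "g \<in> carrier (dual M)" for p g
    using m[OF that(1)] r[OF that(1)] that D by simp
  then show "\<lbrakk>p \<in> carrier M; D = dual M; g \<in> carrier D\<rbrakk> \<Longrightarrow> dual_ev D (bmap (psi M) p) g = dual_ev M g p" by simp
  have c: "bmap (psi M) p \<in> carrier (dual (dual M))" if "p \<in> carrier M" for p
    using m[OF that] r[OF that] by simp
  have DD: "bim (dual (dual M))" using D B ss by simp
  note cl' = dual_closed[OF D]
  have "bilin M (dual (dual M)) (bmap (psi M))"
    unfolding bilin_def
  proof (intro conjI ballI add_homI c M DD)
    fix x y assume "x \<in> carrier M" "y \<in> carrier M"
    then show "bmap (psi M) (x \<oplus>\<^bsub>M\<^esub> y) = bmap (psi M) x \<oplus>\<^bsub>dual (dual M)\<^esub> bmap (psi M) y"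
      by (rule_tac dual_ext[OF D]) (use M D c cl cl' in \<open>auto simp: e\<close>)
  next
    fix a x assume "a \<in> carrier (lalg M)" "x \<in> carrier M"
    then show "bmap (psi M) (lact M a x) = lact (dual (dual M)) a (bmap (psi M) x)"
      by (rule_tac dual_ext[OF D]) (use M D c cl cl' in \<open>auto simp: e\<close>)
  next
    fix b x assume "b \<in> carrier (ralg M)" "x \<in> carrier M"
    then show "bmap (psi M) (ract M x b) = ract (dual (dual M)) (bmap (psi M) x) b"
      by (rule_tac dual_ext[OF D]) (use M D c cl cl' in \<open>auto simp: e\<close>)
  qed auto
  then show "cell (psi M)"
    unfolding cell_iff by (simp add: psi_def)
qed

lemma dual_ev_hom: "\<lbrakk>bim M; g \<in> carrier (dual M)\<rbrakk> \<Longrightarrow> dual_ev M g \<in> hom (add_monoid M) (add_monoid (regular (ralg M)))"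
  by (intro add_homI) auto

text \<open>The inverse is
  \<open>\<phi> \<mapsto> \<Sum>\<^sub>i m\<^sub>i \<phi>(g\<^sub>i)\<close>. One composite is the
  dual basis identity itself, the other is the expansion of functionals,
  \<open>dual_basis_expand\<close>, once \<open>h\<close> and \<open>\<phi>\<close> have been moved
  through the sums.\<close>

lemma psi_Isos:
  assumes M: "bim M" and ss: "semisimple (ralg M)"
  shows "psi M \<in> Isos (Alg2 K) M (dual (dual M))"
proof -
  obtain xs where xs: "dual_basis M xs" using dual_basis_exists[OF M ss] by blast
  note D = bim_dual[OF M ss]
  have B: "alg (ralg M)" using M by simp
  have x: "m \<in> carrier M" "g \<in> dual_set M" "dual_enc M g \<in> carrier (dual M)" if "(m, g) \<in> set xs" for m g
    using xs that unfolding dual_basis_def by auto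
  let ?k = "\<lambda>\<phi>. lsum M (\<lambda>(m, g). ract M m (dual_ev (dual M) \<phi> (dual_enc M g))) xs"
  have kc: "?k \<phi> \<in> carrier M" if "\<phi> \<in> carrier (dual (dual M))" for \<phi>
    by (rule lsum_closed[OF M]) (use x that M D in auto)
  show ?thesis
  proof (rule cell_IsosI[where g = ?k])
    fix p assume p: "p \<in> carrier M"
    have "?k (bmap (psi M) p) = lsum M (\<lambda>(m, g). ract M m (g p)) xs"
      by (rule lsum_cong) (use x p M ss in auto)
    then show "?k (bmap (psi M) p) = p"
      using xs p by (simp add: dual_basis_def)
  next
    fix \<phi> assume \<phi>: "\<phi> \<in> carrier (dual (dual M))"
    show "bmap (psi M) (?k \<phi>) = \<phi>"
    proof (rule dual_ext[OF D _ \<phi>])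
      fix h assume h: "h \<in> carrier (dual M)"
      have "dual_ev (dual M) (bmap (psi M) (?k \<phi>)) h = dual_ev M h (?k \<phi>)"
        using M ss kc[OF \<phi>] h by simp
      also have "\<dots> = lsum (regular (ralg M)) (\<lambda>x. dual_ev M h ((\<lambda>(m, g). ract M m (dual_ev (dual M) \<phi> (dual_enc M g))) x)) xs"
        by (rule lsum_hom[OF M _ dual_ev_hom[OF M h]]) (use x \<phi> M D in auto)
      \<comment> \<open>Termwise, \<open>h(m\<^sub>i \<phi>(g\<^sub>i))\<close> is the product
        \<open>h(m\<^sub>i) \<phi>(g\<^sub>i)\<close> in \<open>ralg M\<close>. Read in the opposite
        algebra, where \<open>\<phi>\<close> is right linear, this is the value of
        \<open>\<phi>\<close> at \<open>g\<^sub>i\<close> acted on by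
        \<open>h(m\<^sub>i)\<close>.\<close>
      also have "\<dots> = lsum (regular (op (ralg M))) (\<lambda>x. dual_ev (dual M) \<phi> ((\<lambda>(m, g). ract (dual M) (dual_enc M g) (dual_ev M h m)) x)) xs"
        unfolding lsum_regular
        by (simp add: lsum_def, rule foldr_cong[OF refl refl]) (use x \<phi> h M D in auto)
      also have "\<dots> = dual_ev (dual M) \<phi> (lsum (dual M) (\<lambda>(m, g). ract (dual M) (dual_enc M g) (dual_ev M h m)) xs)"
        by (rule lsum_hom[symmetric, OF D]) (use x h \<phi> M D B dual_ev_hom[OF D \<phi>] in \<open>auto intro!: dual_closed\<close>)
      also have "\<dots> = dual_ev (dual M) \<phi> h"
        using dual_basis_expand[OF M xs h] by simp
      finally show "dual_ev (dual M) (bmap (psi M) (?k \<phi>)) h = dual_ev (dual M) \<phi> h" .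
    qed (use kc[OF \<phi>] M ss in auto)
  qed (use M ss kc in auto)
qed

section \<open>Duals of tensor products\<close>

context
  fixes M N :: "('k, 'u) bimodule"
  assumes M: "bim M" and N: "bim N" and eq: "ralg M = lalg N"
    and ssM: "semisimple (ralg M)" and ssN: "semisimple (ralg N)"
begin

lemma dual_tensor_ext:
  assumes "f \<in> carrier (dual (tensor M N))" "g \<in> carrier (dual (tensor M N))"
    and "\<And>m n. \<lbrakk>m \<in> carrier M; n \<in> carrier N\<rbrakk> \<Longrightarrow>
      dual_ev (tensor M N) f (pure_tensor M N m n) = dual_ev (tensor M N) g (pure_tensor M N m n)"
  shows "f = g"
proof (rule dual_ext[OF bim_tensor[OF M N eq] assms(1,2)])
  have T: "bim (tensor M N)" using M N eq by simp
  fix x assume "x \<in> carrier (tensor M N)"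
  then show "dual_ev (tensor M N) f x = dual_ev (tensor M N) g x"
    using hom_eq_tensor[OF M N eq dual_ev_hom[OF T assms(1)] dual_ev_hom[OF T assms(2)]] assms(3) by blast
qed

abbreviation "inner g h \<equiv> tensor_lift M N (add_monoid (ralg N)) (\<lambda>m n. dual_ev N h (lact N (dual_ev M g m) n))"

lemma dual_comp_inner_balanced:
  assumes "g \<in> carrier (dual M)" "h \<in> carrier (dual N)"
  shows "balanced M N (add_monoid (ralg N)) (\<lambda>m n. dual_ev N h (lact N (dual_ev M g m) n))"
  by (rule balancedI) (use assms M N eq in \<open>auto simp: bim_distrib bim_assoc\<close>)

lemma dual_comp_inner:
  assumes g: "g \<in> carrier (dual M)" and h: "h \<in> carrier (dual N)"
  shows "inner g h \<in> dual_set (tensor M N)"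
    and "\<lbrakk>m \<in> carrier M; n \<in> carrier N\<rbrakk> \<Longrightarrow> inner g h (pure_tensor M N m n) = dual_ev N h (lact N (dual_ev M g m) n)"
proof -
  have C: "alg (ralg N)" and T: "bim (tensor M N)" using M N eq by auto
  note props = alg_group[OF C] dual_comp_inner_balanced[OF g h]
  show p: "\<lbrakk>m \<in> carrier M; n \<in> carrier N\<rbrakk> \<Longrightarrow> inner g h (pure_tensor M N m n) = dual_ev N h (lact N (dual_ev M g m) n)" for m n
    by (rule tensor_lift_pure[OF M N eq props])
  have hom: "inner g h \<in> hom (add_monoid (tensor M N)) (add_monoid (ralg N))"
    using tensor_lift_hom[OF M N eq props] by (simp add: hom_from_tensor_group)
  have "inner g h (ract (tensor M N) x c) = inner g h x \<otimes>\<^bsub>ralg N\<^esub> c"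
    if x: "x \<in> carrier (tensor M N)" and c: "c \<in> carrier (ralg N)" for x c
    using M N eq _ _ _ x
  proof (rule hom_eq_tensor)
    show "(\<lambda>x. inner g h (ract (tensor M N) x c)) \<in> hom (add_monoid (tensor M N)) (add_monoid (ralg N))"
      by (rule homI) (use c T add_hom[OF hom] in \<open>auto simp: bim_distrib\<close>)
    show "(\<lambda>x. inner g h x \<otimes>\<^bsub>ralg N\<^esub> c) \<in> hom (add_monoid (tensor M N)) (add_monoid (ralg N))"
      by (rule homI) (use c C T add_hom[OF hom] in \<open>auto simp: alg_distrib\<close>)
  qed (use g h c M N eq in \<open>auto simp: p bim_assoc(3)[symmetric]\<close>)
  then show "inner g h \<in> dual_set (tensor M N)"
    unfolding dual_set_iff using tensor_lift_extensional[OF M N eq props] add_hom[OF hom] by auto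
qed

lemma dual_comp_ev:
  assumes "g \<in> carrier (dual M)" "h \<in> carrier (dual N)"
  shows "dual_enc (tensor M N) (inner g h) \<in> carrier (dual (tensor M N))"
    and "\<lbrakk>m \<in> carrier M; n \<in> carrier N\<rbrakk> \<Longrightarrow>
      dual_ev (tensor M N) (dual_enc (tensor M N) (inner g h)) (pure_tensor M N m n) = dual_ev N h (lact N (dual_ev M g m) n)"
  using dual_comp_inner[OF assms] M N eq by auto

lemma dual_comp_bims: "bim (dual M)" "bim (dual N)" "ralg (dual M) = lalg (dual N)" "bim (tensor M N)" "bim (dual (tensor M N))"
  using M N eq ssM ssN by auto

text \<open>Balancing over the middle algebra is the identity
  \<open>h ((b g(m)) n) = h (b (g(m) n))\<close>: an element \<open>b\<close> acts on the dual of
  \<open>M\<close> by left multiplication of values, and on the dual of \<open>N\<close> by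
  precomposition with its action on \<open>N\<close>.\<close>

lemma dual_comp_balanced:
  "balanced (dual M) (dual N) (add_monoid (dual (tensor M N))) (\<lambda>g h. dual_enc (tensor M N) (inner g h))"
proof (rule balancedI)
  note [simp] = M N eq dual_comp_bims dual_comp_ev
  note cl = dual_closed[OF dual_comp_bims(4)] dual_closed[OF M] dual_closed[OF N]
  fix g h assume g: "g \<in> carrier (dual M)" and h: "h \<in> carrier (dual N)"
  show "dual_enc (tensor M N) (inner g h) \<in> carrier (add_monoid (dual (tensor M N)))" using g h by simp
  {
    fix g' assume g': "g' \<in> carrier (dual M)"
    show "dual_enc (tensor M N) (inner (g \<oplus>\<^bsub>dual M\<^esub> g') h) =
      dual_enc (tensor M N) (inner g h) \<otimes>\<^bsub>add_monoid (dual (tensor M N))\<^esub> dual_enc (tensor M N) (inner g' h)"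
      by (rule dual_tensor_ext) (use g g' h cl in \<open>auto simp: bim_distrib\<close>)
  next
    fix h' assume h': "h' \<in> carrier (dual N)"
    show "dual_enc (tensor M N) (inner g (h \<oplus>\<^bsub>dual N\<^esub> h')) =
      dual_enc (tensor M N) (inner g h) \<otimes>\<^bsub>add_monoid (dual (tensor M N))\<^esub> dual_enc (tensor M N) (inner g h')"
      by (rule dual_tensor_ext) (use g h h' in \<open>simp_all add: cl\<close>)
  next
    fix b assume b: "b \<in> carrier (ralg (dual M))"
    show "dual_enc (tensor M N) (inner (ract (dual M) g b) h) = dual_enc (tensor M N) (inner g (lact (dual N) b h))"
      by (rule dual_tensor_ext) (use g h b in \<open>simp_all add: cl bim_assoc\<close>)
  }
qed

lemma dual_comp_inv_bmap:
  "bmap (dual_comp_inv M N) = tensor_lift (dual M) (dual N) (add_monoid (dual (tensor M N)))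
    (\<lambda>g h. dual_enc (tensor M N) (inner g h))"
  by (simp add: dual_comp_inv_def dual_enc_def dual_ev_def)

lemma dual_comp_inv_pure:
  assumes "g \<in> carrier (dual M)" "h \<in> carrier (dual N)"
  shows "bmap (dual_comp_inv M N) (pure_tensor (dual M) (dual N) g h) = dual_enc (tensor M N) (inner g h)"
  unfolding dual_comp_inv_bmap
  by (rule tensor_lift_pure[OF dual_comp_bims(1-3) bim_comm_group[OF dual_comp_bims(5)] dual_comp_balanced assms])

lemma dual_comp_inv_eval:
  "\<lbrakk>g \<in> carrier (dual M); h \<in> carrier (dual N); m \<in> carrier M; n \<in> carrier N; DM = dual M; DN = dual N; T = tensor M N\<rbrakk> \<Longrightarrow>
      dual_ev T (bmap (dual_comp_inv M N) (pure_tensor DM DN g h)) (pure_tensor M N m n)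
        = dual_ev N h (lact N (dual_ev M g m) n)"
  using dual_comp_inv_pure dual_comp_ev by simp

lemma dual_comp_inv_cell: "cell (dual_comp_inv M N)"
proof -
  note [simp] = M N eq dual_comp_bims dual_comp_ev
  note cl = dual_closed[OF dual_comp_bims(4)] dual_closed[OF M] dual_closed[OF N]
  note c = bim_comm_group[OF dual_comp_bims(5)]
  have "bilin (tensor (dual M) (dual N)) (dual (tensor M N)) (bmap (dual_comp_inv M N))"
    unfolding dual_comp_inv_bmap
  proof (rule tensor_lift_bilin[OF dual_comp_bims(1-3) _ _ _ _ c dual_comp_balanced])
    fix a g h assume "a \<in> carrier (lalg (dual M))" "g \<in> carrier (dual M)" "h \<in> carrier (dual N)"
    then show "dual_enc (tensor M N) (inner (lact (dual M) a g) h) = lact (dual (tensor M N)) a (dual_enc (tensor M N) (inner g h))"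
      by (rule_tac dual_tensor_ext) (use cl in auto)
  next
    fix g h b assume "g \<in> carrier (dual M)" "h \<in> carrier (dual N)" "b \<in> carrier (ralg (dual N))"
    then show "dual_enc (tensor M N) (inner g (ract (dual N) h b)) = ract (dual (tensor M N)) (dual_enc (tensor M N) (inner g h)) b"
      by (rule_tac dual_tensor_ext) (simp_all add: cl)
  qed auto
  moreover have "bmap (dual_comp_inv M N) \<in> extensional (carrier (tensor (dual M) (dual N)))"
    unfolding dual_comp_inv_bmap by (rule tensor_lift_extensional[OF dual_comp_bims(1-3) c dual_comp_balanced])
  ultimately show ?thesis
    unfolding cell_iff by simp
qed

text \<open>For a dual basis \<open>(m\<^sub>i, g\<^sub>i)\<close> of \<open>M\<close>, the inverse is \<open>f \<mapsto> \<Sum>\<^sub>i g\<^sub>i \<otimes> f(m\<^sub>i \<otimes> -)\<close>.\<close>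

lemma dual_comp_inv_Isos: "dual_comp_inv M N \<in> Isos (Alg2 K) (tensor (dual M) (dual N)) (dual (tensor M N))"
proof -
  note [simp] = M N eq[symmetric] dual_comp_bims dual_comp_inv_cell
  note cl = dual_closed[OF dual_comp_bims(4)] dual_closed[OF M] dual_closed[OF N]
  let ?T = "tensor M N" and ?D = "tensor (dual M) (dual N)" and ?c = "bmap (dual_comp_inv M N)"
  obtain xs where xs: "dual_basis M xs" using dual_basis_exists[OF M ssM] by blast
  have x: "m \<in> carrier M" "g \<in> dual_set M" "dual_enc M g \<in> carrier (dual M)" "\<And>y. y \<in> carrier M \<Longrightarrow> g y \<in> carrier (ralg M)"
    if "(m, g) \<in> set xs" for m g
  proof -
    show mg: "m \<in> carrier M" "g \<in> dual_set M"
      using xs that unfolding dual_basis_def by auto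
    show "dual_enc M g \<in> carrier (dual M)" "\<And>y. y \<in> carrier M \<Longrightarrow> g y \<in> carrier (ralg M)"
      using mg by (auto simp: dual_set_iff)
  qed
  define k where "k m f = dual_enc N (\<lambda>n\<in>carrier N. dual_ev ?T f (pure_tensor M N m n))" for m f
  have ks: "(\<lambda>n\<in>carrier N. dual_ev ?T f (pure_tensor M N m n)) \<in> dual_set N"
    if "m \<in> carrier M" "f \<in> carrier (dual ?T)" for m f
  proof (rule dual_setI)
    fix n b assume "n \<in> carrier N" "b \<in> carrier (ralg N)"
    then have "pure_tensor M N m (ract N n b) = ract ?T (pure_tensor M N m n) b" using that by simp
    then show "dual_ev ?T f (pure_tensor M N m (ract N n b)) = dual_ev ?T f (pure_tensor M N m n) \<otimes>\<^bsub>ralg N\<^esub> b"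
      using that \<open>n \<in> carrier N\<close> \<open>b \<in> carrier (ralg N)\<close> by (simp del: tensor_ract_hom)
  qed (use that in \<open>auto simp: pure_add_right\<close>)
  have kc: "k m f \<in> carrier (dual N)" and ke: "n \<in> carrier N \<Longrightarrow> dual_ev N (k m f) n = dual_ev ?T f (pure_tensor M N m n)"
    if "m \<in> carrier M" "f \<in> carrier (dual ?T)" for m f n
    using ks[OF that] by (auto simp: k_def)
  let ?i = "\<lambda>f. lsum ?D (\<lambda>(m, g). pure_tensor (dual M) (dual N) (dual_enc M g) (k m f)) xs"
  have Db: "bim ?D" by simp
  \<comment> \<open>Additivity of the candidate inverse allows its composite with the comparison map
    to be tested on pure tensors.\<close>
  have i_hom: "?i \<in> hom (add_monoid (dual ?T)) (add_monoid ?D)"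
  proof (rule add_hom_lsum)
    fix p assume "p \<in> set xs"
    moreover obtain m g where p: "p = (m, g)" by (cases p)
    ultimately have m: "m \<in> carrier M" and g: "dual_enc M g \<in> carrier (dual M)" using x by auto
    have "k m (f \<oplus>\<^bsub>dual ?T\<^esub> f') = k m f \<oplus>\<^bsub>dual N\<^esub> k m f'" if "f \<in> carrier (dual ?T)" "f' \<in> carrier (dual ?T)" for f f'
      by (rule dual_ext[OF N]) (use that m cl in \<open>auto simp: kc ke\<close>)
    then have "(\<lambda>f. pure_tensor (dual M) (dual N) (dual_enc M g) (k m f)) \<in> hom (add_monoid (dual ?T)) (add_monoid ?D)"
      by (intro add_homI) (use m g in \<open>auto simp: kc pure_add_right\<close>)
    then show "(\<lambda>f. case p of (m, g) \<Rightarrow> pure_tensor (dual M) (dual N) (dual_enc M g) (k m f)) \<in> hom (add_monoid (dual ?T)) (add_monoid ?D)"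
      by (simp add: p)
  qed auto
  have c_hom: "?c \<in> hom (add_monoid ?D) (add_monoid (dual ?T))"
    using cell_additive[OF dual_comp_inv_cell] by simp
  show ?thesis
  proof (rule cell_IsosI[where g = ?i])
    fix z assume z: "z \<in> carrier ?D"
    show "?i (?c z) = z"
    proof (rule hom_eq_tensor[OF dual_comp_bims(1-3) _ _ _ z, of "\<lambda>z. ?i (?c z)" "add_monoid ?D" "\<lambda>z. z"])
      fix g h assume g: "g \<in> carrier (dual M)" and h: "h \<in> carrier (dual N)"
      let ?p = "pure_tensor (dual M) (dual N)"
      have c: "?c (?p g h) \<in> carrier (dual ?T)" using g h by simp
      \<comment> \<open>On a pure tensor the partial evaluation at \<open>m\<close> is
        \<open>g(m)\<close> acting on \<open>h\<close>. Moving \<open>g(m)\<close> across the tensor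
        sign turns the sum into the dual basis expansion of \<open>g\<close>.\<close>
      have kk: "k m (?c (?p g h)) = lact (dual N) (dual_ev M g m) h" if m: "m \<in> carrier M" for m
        by (rule dual_ext[OF N]) (use m g h c cl in \<open>auto simp: kc ke dual_comp_inv_eval\<close>)
      have "?i (?c (?p g h)) = lsum ?D (\<lambda>q. ?p ((\<lambda>(m, g'). ract (dual M) (dual_enc M g') (dual_ev M g m)) q) h) xs"
        by (rule lsum_cong) (use x g h in \<open>auto simp: kk pure_balanced\<close>)
      also have "\<dots> = ?p (lsum (dual M) (\<lambda>(m, g'). ract (dual M) (dual_enc M g') (dual_ev M g m)) xs) h"
      proof (rule lsum_hom[symmetric])
        show "(\<lambda>g. ?p g h) \<in> hom (add_monoid (dual M)) (add_monoid ?D)"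
          by (rule add_homI) (use h in \<open>auto simp: pure_add_left\<close>)
      qed (use x g cl in auto)
      finally show "?i (?c (?p g h)) = ?p g h"
        using dual_basis_expand[OF M xs g] by simp
    qed (use add_hom[OF i_hom] add_hom[OF c_hom] Db in \<open>auto intro!: add_homI\<close>)
  next
    fix f assume f: "f \<in> carrier (dual ?T)"
    have "?c (?i f) = lsum (dual ?T) (\<lambda>q. ?c ((\<lambda>(m, g). pure_tensor (dual M) (dual N) (dual_enc M g) (k m f)) q)) xs"
      by (rule lsum_hom[OF _ _ c_hom]) (use x f kc in auto)
    also have "\<dots> = f"
    proof (rule dual_tensor_ext[OF dual_lsum_closed f])
      fix y n assume y: "y \<in> carrier M" and n: "n \<in> carrier N"
      let ?F = "\<lambda>q. ?c ((\<lambda>(m, g). pure_tensor (dual M) (dual N) (dual_enc M g) (k m f)) q)"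
      have "dual_ev ?T (lsum (dual ?T) ?F xs) (pure_tensor M N y n) = lsum (ralg ?T) (\<lambda>q. dual_ev ?T (?F q) (pure_tensor M N y n)) xs"
        by (rule dual_ev_lsum) (use x f kc y n in auto)
      also have "\<dots> = lsum (regular (ralg N)) (\<lambda>q. dual_ev ?T f (pure_tensor M N ((\<lambda>(m, g). ract M m (g y)) q) n)) xs"
        unfolding lsum_regular tensor_algs
        by (rule lsum_cong) (use x f kc ke y n in \<open>auto simp: dual_comp_inv_eval pure_balanced\<close>)
      also have "\<dots> = dual_ev ?T f (pure_tensor M N (lsum M (\<lambda>(m, g). ract M m (g y)) xs) n)"
      proof (rule lsum_hom[symmetric])
        show "(\<lambda>z. dual_ev ?T f (pure_tensor M N z n)) \<in> hom (add_monoid M) (add_monoid (regular (ralg N)))"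
          by (rule add_homI) (use n f in \<open>auto simp: pure_add_left\<close>)
      qed (use x y in auto)
      also have "\<dots> = dual_ev ?T f (pure_tensor M N y n)"
        using xs y by (simp add: dual_basis_def)
      finally show "dual_ev ?T (lsum (dual ?T) ?F xs) (pure_tensor M N y n) = dual_ev ?T f (pure_tensor M N y n)" .
    qed (use x f kc in auto)
    finally show "?c (?i f) = f" .
  qed (use add_hom[OF i_hom] in auto)
qed

end

section \<open>Duals of regular bimodules\<close>

declare dual_comp_inv_cell [simp] dual_comp_inv_eval [simp]

text \<open>Right linearity at \<open>1\<close>. It shows that evaluation at \<open>1\<close> loses
  nothing.\<close>

lemma dual_ev_regular:
  assumes "alg A" "h \<in> carrier (dual (regular A))" "a \<in> carrier A"
  shows "dual_ev (regular A) h \<one>\<^bsub>A\<^esub> \<otimes>\<^bsub>A\<^esub> a = dual_ev (regular A) h a"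
  using dual_ev_linear(3)[of "regular A" h "\<one>\<^bsub>A\<^esub>" a] assms by simp

lemma dual_unit_eval [simp]:
  assumes A: "alg A" and ss: "semisimple A"
  shows "cell (dual_unit A)"
    and "h \<in> carrier (dual (regular A)) \<Longrightarrow> bmap (dual_unit A) h = dual_ev (regular A) h \<one>\<^bsub>A\<^esub>"
proof -
  have R: "bim (regular A)" using A by simp
  show e: "h \<in> carrier (dual (regular A)) \<Longrightarrow> bmap (dual_unit A) h = dual_ev (regular A) h \<one>\<^bsub>A\<^esub>" for h
    by (simp add: dual_unit_def dual_ev_def)
  note cl = dual_closed[OF R]
  have "bilin (dual (regular A)) (regular (op A)) (bmap (dual_unit A))"
    unfolding bilin_def
  proof (intro conjI ballI add_homI)
    fix a x assume "a \<in> carrier (lalg (dual (regular A)))" "x \<in> carrier (dual (regular A))"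
    then show "bmap (dual_unit A) (lact (dual (regular A)) a x) = lact (regular (op A)) a (bmap (dual_unit A) x)"
      using cl A R by (simp add: e dual_ev_regular)
  qed (use A R ss cl in \<open>auto simp: e\<close>)
  then show "cell (dual_unit A)"
    unfolding cell_iff by (simp add: dual_unit_def)
qed

lemma dual_zeta_code:
  assumes A: "alg A" and x: "x \<in> carrier A"
  shows "bmap (dual_zeta A) x \<in> carrier (dual (regular A))"
    and "a \<in> carrier A \<Longrightarrow> dual_ev (regular A) (bmap (dual_zeta A) x) a = x \<otimes>\<^bsub>A\<^esub> a"
proof -
  have R: "bim (regular A)" using A by simp
  have s: "(\<lambda>a\<in>carrier (regular A). x \<otimes>\<^bsub>A\<^esub> a) \<in> dual_set (regular A)"
    by (rule dual_setI) (use A x in \<open>auto simp: alg_distrib alg_assoc\<close>)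
  have "bmap (dual_zeta A) x = dual_enc (regular A) (\<lambda>a\<in>carrier (regular A). x \<otimes>\<^bsub>A\<^esub> a)"
    using x by (simp add: dual_zeta_def dual_enc_def)
  then show "bmap (dual_zeta A) x \<in> carrier (dual (regular A))"
    "a \<in> carrier A \<Longrightarrow> dual_ev (regular A) (bmap (dual_zeta A) x) a = x \<otimes>\<^bsub>A\<^esub> a"
    using s R dual_enc_closed[OF s] dual_ev_code[OF R s] by auto
qed

lemma dual_zeta_eval [simp]:
  assumes A: "alg A" and ss: "semisimple A"
  shows "cell (dual_zeta A)"
    and "\<lbrakk>x \<in> carrier A; a \<in> carrier A\<rbrakk> \<Longrightarrow> dual_ev (regular A) (bmap (dual_zeta A) x) a = x \<otimes>\<^bsub>A\<^esub> a"
proof -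
  have R: "bim (regular A)" using A by simp
  note e = dual_zeta_code[OF A]
  then show "\<lbrakk>x \<in> carrier A; a \<in> carrier A\<rbrakk> \<Longrightarrow> dual_ev (regular A) (bmap (dual_zeta A) x) a = x \<otimes>\<^bsub>A\<^esub> a" by simp
  note cl = dual_closed[OF R]
  have "bilin (regular (op A)) (dual (regular A)) (bmap (dual_zeta A))"
    unfolding bilin_def
  proof (intro conjI ballI add_homI)
    fix x y assume "x \<in> carrier (regular (op A))" "y \<in> carrier (regular (op A))"
    then show "bmap (dual_zeta A) (x \<oplus>\<^bsub>regular (op A)\<^esub> y) = bmap (dual_zeta A) x \<oplus>\<^bsub>dual (regular A)\<^esub> bmap (dual_zeta A) y"
      by (rule_tac dual_ext[OF R]) (use A R e cl in \<open>auto simp: alg_distrib\<close>)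
  next
    fix a x assume "a \<in> carrier (lalg (regular (op A)))" "x \<in> carrier (regular (op A))"
    then show "bmap (dual_zeta A) (lact (regular (op A)) a x) = lact (dual (regular A)) a (bmap (dual_zeta A) x)"
      by (rule_tac dual_ext[OF R]) (use A R e cl in \<open>auto simp: alg_assoc\<close>)
  next
    fix a x assume "a \<in> carrier (ralg (regular (op A)))" "x \<in> carrier (regular (op A))"
    then show "bmap (dual_zeta A) (ract (regular (op A)) x a) = ract (dual (regular A)) (bmap (dual_zeta A) x) a"
      by (rule_tac dual_ext[OF R]) (use A R e cl in \<open>auto simp: alg_assoc\<close>)
  qed (use A R ss e in auto)
  then show "cell (dual_zeta A)"
    unfolding cell_iff by (simp add: dual_zeta_def)
qed

text \<open>Evaluation at \<open>1\<close> and \<open>x \<mapsto> (a \<mapsto> x a)\<close> are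
  inverse to each other, so one pair of computations yields both claims.\<close>

lemma dual_unit_zeta_Isos:
  assumes A: "alg A" and ss: "semisimple A"
  shows "dual_unit A \<in> Isos (Alg2 K) (dual (regular A)) (regular (op A))"
    and "dual_zeta A \<in> Isos (Alg2 K) (regular (op A)) (dual (regular A))"
proof -
  have R: "bim (regular A)" using A by simp
  note z = dual_zeta_code[OF A]
  have "bmap (dual_unit A) (bmap (dual_zeta A) x) = x" if "x \<in> carrier A" for x
    using that A ss z by simp
  moreover have "bmap (dual_zeta A) (bmap (dual_unit A) h) = h" if h: "h \<in> carrier (dual (regular A))" for h
    by (rule dual_ext[OF R _ h]) (use h A ss z R in \<open>auto simp: dual_ev_regular\<close>)
  moreover have "bmap (dual_unit A) h \<in> carrier A" if h: "h \<in> carrier (dual (regular A))" for h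
    using that A ss R by simp
  ultimately show "dual_unit A \<in> Isos (Alg2 K) (dual (regular A)) (regular (op A))"
    "dual_zeta A \<in> Isos (Alg2 K) (regular (op A)) (dual (regular A))"
    using A ss z by (auto intro!: cell_IsosI[of "dual_unit A" _ _ "bmap (dual_zeta A)"]
        cell_IsosI[of "dual_zeta A" _ _ "bmap (dual_unit A)"])
qed

end

section \<open>The duality pseudofunctor\<close>

lemma Alg2_fd_simps [simp]:
  "Obj (Alg2_fd K) = {A. fd_algebra K A \<and> semisimple A}" "src (Alg2_fd K) = lalg" "trg (Alg2_fd K) = ralg"
  "vdom (Alg2_fd K) = bdom" "vcod (Alg2_fd K) = bcod"
  "Arr (Alg2_fd K) = {M. fd_bimodule K M \<and> semisimple (lalg M) \<and> semisimple (ralg M)}"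
  "id1 (Alg2_fd K) = regular" "comp1 (Alg2_fd K) = (\<lambda>N M. tensor M N)" "hcomp (Alg2_fd K) = (\<lambda>g f. tensor_map f g)"
  "id2 (Alg2_fd K) = id2 (Alg2 K)" "vcomp (Alg2_fd K) = vcomp (Alg2 K)" "assoc (Alg2_fd K) = assoc (Alg2 K)"
  "lunit (Alg2_fd K) = lunit (Alg2 K)" "runit (Alg2_fd K) = runit (Alg2 K)"
  "M \<in> Hom (Alg2_fd K) A B \<longleftrightarrow> fd_bimodule K M \<and> lalg M = A \<and> ralg M = B \<and> semisimple A \<and> semisimple B"
  "f \<in> Cells (Alg2_fd K) M N \<longleftrightarrow> bimodule_map K f \<and> bdom f = M \<and> bcod f = N \<and>
    semisimple (lalg M) \<and> semisimple (ralg M)"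
  by (auto simp: Alg2_fd_def)

lemma duality_simps [simp]:
  "pf_obj (duality K) = op" "pf_arr (duality K) = dual" "pf_cell (duality K) = dual_map"
  "pf_unit (duality K) = dual_unit" "pf_comp (duality K) N M = inv2 (Alg2_fd K) (dual_comp_inv M N)"
  by (simp_all add: duality_def)

text \<open>The form of the unit laws of the pseudofunctor: \<open>a\<close> is the explicit
  comparison map, and its inverse is the structure cell that the law mentions.\<close>

lemma (in bicategory) vcomp_inv2_right3:
  assumes a: "a \<in> Isos B x y" and s: "s \<in> Cells B x w" and t: "t \<in> Cells B w z" and q: "q \<in> Cells B y z"
    and eq: "t \<bullet> s = q \<bullet> a"
  shows "t \<bullet> s \<bullet> inv2 B a = q"
  using vcomp_inv2_right[OF a q eq] vcomp_assoc[OF inv2_cell[OF a] s t] by simp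

context morita
begin

abbreviation "BB \<equiv> (Alg2 K :: (('k, 'u) module, ('k, 'u) bimodule, ('k, 'u) bimod_map) bicat)"
abbreviation "FF \<equiv> (Alg2_fd K :: (('k, 'u) module, ('k, 'u) bimodule, ('k, 'u) bimod_map) bicat)"

abbreviation sbim :: "('k, 'u) bimodule \<Rightarrow> bool" where
  "sbim M \<equiv> bim M \<and> semisimple (lalg M) \<and> semisimple (ralg M)"

sublocale FF: bicategory FF
  unfolding Alg2_fd_def by (rule Alg2.bicategory_full_subbicat)

lemma Isos_FF [simp]: "f \<in> Isos FF M N \<longleftrightarrow> f \<in> Isos BB M N \<and> semisimple (lalg M) \<and> semisimple (ralg M)"
  unfolding Alg2_fd_def by simp

lemma inv2_FF:
  assumes "f \<in> Isos BB M N" "semisimple (lalg M)" "semisimple (ralg M)"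
  shows "inv2 FF f = inv2 BB f"
  unfolding Alg2_fd_def using Alg2.inv2_full_subbicat[OF assms(1)] assms(2,3) by simp

text \<open>\<open>inv2\<close> is a description over the cells of its bicategory, so inverses
  formed in the semisimple part have to be matched with those computed in the whole Morita
  bicategory. Double inverses occur because \<open>pf_co\<close> inverts a comparison cell that is
  an inverse already.\<close>

lemma inv2_FF_structure [simp]:
  "sbim M \<Longrightarrow> inv2 FF (lunit BB M) = inv2 BB (lunit BB M)"
  "sbim M \<Longrightarrow> inv2 FF (runit BB M) = inv2 BB (runit BB M)"
  "\<lbrakk>sbim M; bim N; sbim P; ralg M = lalg N; ralg N = lalg P\<rbrakk> \<Longrightarrow> inv2 FF (assoc BB P N M) = inv2 BB (assoc BB P N M)"
  "\<lbrakk>sbim M; sbim N; ralg M = lalg N\<rbrakk> \<Longrightarrow> inv2 FF (dual_comp_inv M N) = inv2 BB (dual_comp_inv M N)"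
  "\<lbrakk>sbim M; sbim N; ralg M = lalg N\<rbrakk> \<Longrightarrow> inv2 FF (inv2 BB (dual_comp_inv M N)) = dual_comp_inv M N"
  "\<lbrakk>alg A; semisimple A\<rbrakk> \<Longrightarrow> inv2 FF (dual_unit A) = inv2 BB (dual_unit A)"
proof -
  show "sbim M \<Longrightarrow> inv2 FF (lunit BB M) = inv2 BB (lunit BB M)"
    by (rule inv2_FF[OF lunit_Isos]) auto
  show "sbim M \<Longrightarrow> inv2 FF (runit BB M) = inv2 BB (runit BB M)"
    by (rule inv2_FF[OF runit_Isos]) auto
  show "\<lbrakk>sbim M; bim N; sbim P; ralg M = lalg N; ralg N = lalg P\<rbrakk> \<Longrightarrow> inv2 FF (assoc BB P N M) = inv2 BB (assoc BB P N M)"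
    by (rule inv2_FF[OF assoc_Isos]) auto
  show *: "\<lbrakk>sbim M; sbim N; ralg M = lalg N\<rbrakk> \<Longrightarrow> inv2 FF (dual_comp_inv M N) = inv2 BB (dual_comp_inv M N)"
    by (rule inv2_FF[OF dual_comp_inv_Isos]) auto
  show "inv2 FF (inv2 BB (dual_comp_inv M N)) = dual_comp_inv M N"
    if "sbim M" "sbim N" "ralg M = lalg N"
    using FF.inv2_inv2[of "dual_comp_inv M N" "tensor (dual M) (dual N)" "dual (tensor M N)"]
      dual_comp_inv_Isos[of M N] that *[OF that] by simp
  show "\<lbrakk>alg A; semisimple A\<rbrakk> \<Longrightarrow> inv2 FF (dual_unit A) = inv2 BB (dual_unit A)"
    by (rule inv2_FF[OF dual_unit_zeta_Isos(1)]) auto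
qed

lemma dual_comp_simps [simp]:
  assumes "bim M" "bim N" "ralg M = lalg N" "semisimple (lalg N)" "semisimple (ralg N)"
  shows "cell (inv2 BB (dual_comp_inv M N))" "bdom (inv2 BB (dual_comp_inv M N)) = dual (tensor M N)"
    "bcod (inv2 BB (dual_comp_inv M N)) = tensor (dual M) (dual N)"
  using inv2_Alg2[OF dual_comp_inv_Isos[of M N]] assms by auto

text \<open>The unit cell of the double dual contains the inverse of evaluation at \<open>1\<close>;
  its values are read off from \<open>dual_zeta\<close>.\<close>

lemma inv2_dual_unit [simp]:
  assumes "alg A" "semisimple A"
  shows "cell (inv2 BB (dual_unit A))" "bdom (inv2 BB (dual_unit A)) = regular (op A)"
    "bcod (inv2 BB (dual_unit A)) = dual (regular A)"
    "x \<in> carrier A \<Longrightarrow> bmap (inv2 BB (dual_unit A)) x = bmap (dual_zeta A) x"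
  using inv2_Alg2[OF dual_unit_zeta_Isos(1)[OF assms]] assms dual_zeta_code[OF assms(1)]
  by (auto intro!: bmap_inv2[OF dual_unit_zeta_Isos(1)[OF assms]])

lemma dual_tensor_ext_right:
  assumes M: "bim M" "bim N" "bim P" "ralg M = lalg N" "ralg N = lalg P"
    and f: "f \<in> carrier (dual (tensor M (tensor N P)))" "g \<in> carrier (dual (tensor M (tensor N P)))"
    and eq: "\<And>m n p. \<lbrakk>m \<in> carrier M; n \<in> carrier N; p \<in> carrier P\<rbrakk> \<Longrightarrow>
      dual_ev (tensor M (tensor N P)) f (pure_tensor M (tensor N P) m (pure_tensor N P n p)) =
      dual_ev (tensor M (tensor N P)) g (pure_tensor M (tensor N P) m (pure_tensor N P n p))"
  shows "f = g"
proof -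
  have T: "bim (tensor M (tensor N P))" using M by simp
  show ?thesis
    by (rule dual_ext[OF T f], rule hom_eq_tensor_right[OF M dual_ev_hom[OF T f(1)] dual_ev_hom[OF T f(2)] eq])
qed

section \<open>Functoriality of dualisation and its coherence laws\<close>

lemma dual_map_vcomp:
  assumes "cell f" "cell g" "bcod f = bdom g" "semisimple (ralg (bdom f))"
  shows "dual_map (vcomp BB g f) = vcomp BB (dual_map f) (dual_map g)"
proof (rule cell_eqI)
  fix x assume x: "x \<in> carrier (bdom (vcomp BB (dual_map f) (dual_map g)))"
  have c: "bmap (dual_map (vcomp BB g f)) x \<in> carrier (dual (bdom f))" using assms x by simp
  have M: "bim (bdom f)" "bim (bdom g)" "ralg (bdom g) = ralg (bdom f)"
    using assms cell_props(4)[OF assms(1)] by auto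
  show "bmap (dual_map (vcomp BB g f)) x = bmap (vcomp BB (dual_map f) (dual_map g)) x"
    by (rule dual_ext[OF M(1) c]) (use assms x M in auto)
qed (use assms cell_props(4)[OF assms(1)] in auto)

lemma dual_map_id:
  assumes "bim M" "semisimple (ralg M)"
  shows "dual_map (id2 BB M) = id2 BB (dual M)"
proof (rule cell_eqI)
  fix x assume x: "x \<in> carrier (bdom (id2 BB (dual M)))"
  show "bmap (dual_map (id2 BB M)) x = bmap (id2 BB (dual M)) x"
    by (rule dual_ext[OF assms(1)]) (use assms x in auto)
qed (use assms in auto)

text \<open>Since \<open>co\<close> replaces structure cells by their inverses, duality gets applied
  to an inverse associator; functoriality moves the inverse outside.\<close>

lemma dual_map_Isos:
  assumes f: "f \<in> Isos BB M N" and ss: "semisimple (ralg M)"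
  shows "dual_map f \<in> Isos BB (dual N) (dual M)" "inv2 BB (dual_map f) = dual_map (inv2 BB f)"
proof -
  note i = inv2_Alg2[OF f] and c = IsosD[OF f]
  have M: "bim M" "bim N" "ralg N = ralg M" using c by auto
  have "vcomp BB (dual_map (inv2 BB f)) (dual_map f) = id2 BB (dual N)"
    using dual_map_vcomp[of "inv2 BB f" f] dual_map_id[of N] Alg2.inv2_right[OF f] i c M ss by auto
  moreover have "vcomp BB (dual_map f) (dual_map (inv2 BB f)) = id2 BB (dual M)"
    using dual_map_vcomp[of f "inv2 BB f"] dual_map_id[of M] Alg2.inv2_left[OF f] i c M ss by auto
  ultimately show "dual_map f \<in> Isos BB (dual N) (dual M)" "inv2 BB (dual_map f) = dual_map (inv2 BB f)"
    using Alg2.inv2_eqI[of "dual_map f" "dual N" "dual M" "dual_map (inv2 BB f)"] i c M ss by auto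
qed

lemma pseudofunctor_duality: "pseudofunctor (co FF) FF (duality K)"
proof (intro pseudofunctor.intro FF.bicategory_co FF.bicategory_axioms pseudofunctor_axioms.intro; (unfold co_simps)?)
  fix x assume "x \<in> Obj FF"
  then have x: "alg x" "semisimple x" by auto
  show "pf_obj (duality K) x \<in> Obj FF" using x by simp
  show "pf_unit (duality K) x \<in> Isos FF (pf_arr (duality K) (id1 FF x)) (id1 FF (pf_obj (duality K) x))"
    using x dual_unit_zeta_Isos by simp
next
  fix M x y assume "M \<in> Hom FF x y"
  then show "pf_arr (duality K) M \<in> Hom FF (pf_obj (duality K) x) (pf_obj (duality K) y)" by auto
next
  fix \<sigma> M N assume "\<sigma> \<in> Cells FF N M"
  then have c: "cell \<sigma>" "bdom \<sigma> = N" "bcod \<sigma> = M" and s: "semisimple (lalg N)" "semisimple (ralg N)" by auto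
  have "lalg M = lalg N" "ralg M = ralg N" "bim N" "bim M" using c by auto
  then show "pf_cell (duality K) \<sigma> \<in> Cells FF (pf_arr (duality K) M) (pf_arr (duality K) N)"
    using c s by simp
next
  fix M assume "M \<in> Arr FF"
  then show "pf_cell (duality K) (id2 FF M) = id2 FF (pf_arr (duality K) M)"
    using dual_map_id by simp
next
  fix \<sigma> \<tau> M N P assume "\<sigma> \<in> Cells FF N M" "\<tau> \<in> Cells FF P N"
  then show "pf_cell (duality K) (\<sigma> \<bullet>\<^bsub>FF\<^esub> \<tau>) = pf_cell (duality K) \<tau> \<bullet>\<^bsub>FF\<^esub> pf_cell (duality K) \<sigma>"
    using dual_map_vcomp[of \<tau> \<sigma>] by simp
next
  fix M N x y z assume "M \<in> Hom FF x y" "N \<in> Hom FF y z"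
  then have b: "bim M" "bim N" "ralg M = y" "lalg N = y" "lalg M = x" "ralg N = z"
    "semisimple x" "semisimple y" "semisimple z" "alg x" "alg y" "alg z" by auto
  have "inv2 BB (dual_comp_inv M N) \<in> Isos BB (dual (tensor M N)) (tensor (dual M) (dual N))"
    by (rule Alg2.inv2_iso[OF dual_comp_inv_Isos]) (use b in auto)
  then show "pf_comp (duality K) N M \<in> Isos FF (pf_arr (duality K) (N \<circledcirc>\<^bsub>FF\<^esub> M)) (pf_arr (duality K) N \<circledcirc>\<^bsub>FF\<^esub> pf_arr (duality K) M)"
    using b by simp
next
  fix \<sigma> \<tau> M M' N N' assume "\<sigma> \<in> Cells FF M' M" "\<tau> \<in> Cells FF N' N" "trg FF M = src FF N"
  then have c: "cell \<sigma>" "cell \<tau>" "bdom \<sigma> = M'" "bcod \<sigma> = M" "bdom \<tau> = N'" "bcod \<tau> = N" "ralg M = lalg N"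
    and s: "semisimple (lalg M')" "semisimple (ralg M')" "semisimple (ralg N')" by auto
  have b: "bim M" "bim N" "bim M'" "bim N'" "lalg M' = lalg M" "ralg M' = lalg N" "lalg N' = lalg N" "ralg N' = ralg N"
    using c cell_props[OF c(1)] cell_props[OF c(2)] by auto
  have s': "semisimple (lalg M)" "semisimple (lalg N)" "semisimple (ralg N)" using s b by auto
  let ?D = dual_map and ?c = "dual_comp_inv M N" and ?c' = "dual_comp_inv M' N'"
  \<comment> \<open>For the explicit comparison the two sides give the functionals
    \<open>h (g(\<sigma> m) \<tau>(n))\<close> and \<open>h (\<tau> (g(\<sigma> m) n))\<close>,
    equal by left linearity of \<open>\<tau>\<close>. The square is inverted afterwards.\<close>
  have sq: "vcomp BB (?D (tensor_map \<sigma> \<tau>)) ?c = vcomp BB ?c' (tensor_map (?D \<sigma>) (?D \<tau>))"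
  proof (rule cell_eq_tensor[of _ _ "dual M" "dual N"])
    fix g h assume g: "g \<in> carrier (dual M)" "h \<in> carrier (dual N)"
    show "bmap (vcomp BB (?D (tensor_map \<sigma> \<tau>)) ?c) (pure_tensor (dual M) (dual N) g h)
        = bmap (vcomp BB ?c' (tensor_map (?D \<sigma>) (?D \<tau>))) (pure_tensor (dual M) (dual N) g h)"
      by (rule dual_tensor_ext[of M' N']) (use g b c s' in \<open>auto simp: cell_linear\<close>)
  qed (use b c s' in auto)
  have "vcomp BB (inv2 BB ?c') (?D (tensor_map \<sigma> \<tau>)) = vcomp BB (tensor_map (?D \<sigma>) (?D \<tau>)) (inv2 BB ?c)"
    by (rule Alg2.inv2_square[OF dual_comp_inv_Isos dual_comp_inv_Isos _ _ sq]) (use b c s' in auto)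
  then show "pf_comp (duality K) N' M' \<bullet>\<^bsub>FF\<^esub> pf_cell (duality K) (\<tau> \<star>\<^bsub>FF\<^esub> \<sigma>)
    = (pf_cell (duality K) \<tau> \<star>\<^bsub>FF\<^esub> pf_cell (duality K) \<sigma>) \<bullet>\<^bsub>FF\<^esub> pf_comp (duality K) N M"
    using b c s' by simp
next
  fix M N P w x y z assume "M \<in> Hom FF w x" "N \<in> Hom FF x y" "P \<in> Hom FF y z"
  then have b: "bim M" "bim N" "bim P" "lalg M = w" "ralg M = x" "lalg N = x" "ralg N = y" "lalg P = y" "ralg P = z"
    "semisimple w" "semisimple x" "semisimple y" "semisimple z" by auto
  have algs: "alg w" "alg x" "alg y" "alg z" using b by auto
  let ?c = dual_comp_inv
  let ?a = "assoc BB (dual P) (dual N) (dual M)" and ?as = "assoc BB P N M"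
  let ?v = "tensor_map (id2 BB (dual M)) (?c N P)" and ?u = "?c M (tensor N P)"
  let ?y = "tensor_map (?c M N) (id2 BB (dual P))" and ?x = "?c (tensor M N) P" and ?w = "dual_map ?as"
  \<comment> \<open>Both paths send \<open>f \<otimes> (g \<otimes> h)\<close> to the functional
    \<open>m \<otimes> (n \<otimes> p) \<mapsto> h (g (f(m) n) p)\<close>.\<close>
  have eq: "vcomp BB ?u ?v = vcomp BB ?w (vcomp BB ?x (vcomp BB ?y ?a))"
  proof (rule cell_eq_tensor_right[of _ _ "dual M" "dual N" "dual P"])
    fix f g h assume f: "f \<in> carrier (dual M)" "g \<in> carrier (dual N)" "h \<in> carrier (dual P)"
    let ?p = "pure_tensor (dual M) (tensor (dual N) (dual P)) f (pure_tensor (dual N) (dual P) g h)"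
    show "bmap (vcomp BB ?u ?v) ?p = bmap (vcomp BB ?w (vcomp BB ?x (vcomp BB ?y ?a))) ?p"
      by (rule dual_tensor_ext_right[of M N P]) (use f b algs in auto)
  qed (use b algs in auto)
  have isos: "?a \<in> Isos BB (tensor (dual M) (tensor (dual N) (dual P))) (tensor (tensor (dual M) (dual N)) (dual P))"
    "?as \<in> Isos BB (tensor M (tensor N P)) (tensor (tensor M N) P)"
    "?u \<in> Isos BB (tensor (dual M) (dual (tensor N P))) (dual (tensor M (tensor N P)))"
    "?x \<in> Isos BB (tensor (dual (tensor M N)) (dual P)) (dual (tensor (tensor M N) P))"
    "?c N P \<in> Isos BB (tensor (dual N) (dual P)) (dual (tensor N P))"
    "?c M N \<in> Isos BB (tensor (dual M) (dual N)) (dual (tensor M N))"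
    using b algs by (auto intro!: assoc_Isos dual_comp_inv_Isos)
  have idi: "id2 BB (dual M) \<in> Isos BB (dual M) (dual M)" "id2 BB (dual P) \<in> Isos BB (dual P) (dual P)"
    "inv2 BB (id2 BB (dual M)) = id2 BB (dual M)" "inv2 BB (id2 BB (dual P)) = id2 BB (dual P)"
    using b algs by (auto intro!: Alg2.id2_iso Alg2.inv2_id2)
  have v: "?v \<in> Isos BB (tensor (dual M) (tensor (dual N) (dual P))) (tensor (dual M) (dual (tensor N P)))"
    "inv2 BB ?v = tensor_map (id2 BB (dual M)) (inv2 BB (?c N P))"
    using Alg2.hcomp_iso[OF idi(1) isos(5)] idi b by auto
  have y: "?y \<in> Isos BB (tensor (tensor (dual M) (dual N)) (dual P)) (tensor (dual (tensor M N)) (dual P))"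
    "inv2 BB ?y = tensor_map (inv2 BB (?c M N)) (id2 BB (dual P))"
    using Alg2.hcomp_iso[OF isos(6) idi(2)] idi b by auto
  have w: "?w \<in> Isos BB (dual (tensor (tensor M N) P)) (dual (tensor M (tensor N P)))" "inv2 BB ?w = dual_map (inv2 BB ?as)"
    using dual_map_Isos[OF isos(2)] b by auto
  note Alg2.inv2_hexagon[OF isos(1) v(1) isos(3) y(1) isos(4) w(1) eq]
  then show "assoc FF (pf_arr (duality K) P) (pf_arr (duality K) N) (pf_arr (duality K) M)
      \<bullet>\<^bsub>FF\<^esub> (pf_comp (duality K) P N \<star>\<^bsub>FF\<^esub> id2 FF (pf_arr (duality K) M)) \<bullet>\<^bsub>FF\<^esub> pf_comp (duality K) (P \<circledcirc>\<^bsub>FF\<^esub> N) M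
    = (id2 FF (pf_arr (duality K) P) \<star>\<^bsub>FF\<^esub> pf_comp (duality K) N M)
      \<bullet>\<^bsub>FF\<^esub> pf_comp (duality K) P (N \<circledcirc>\<^bsub>FF\<^esub> M) \<bullet>\<^bsub>FF\<^esub> pf_cell (duality K) (assoc (co FF) P N M)"
    using v(2) y(2) w(2) b algs by simp
next
  fix M x y assume "M \<in> Hom FF x y"
  then have b: "bim M" "lalg M = x" "ralg M = y" "semisimple x" "semisimple y" "alg x" "alg y" by auto
  let ?c = "dual_comp_inv M (regular y)" and ?t = "tensor_map (id2 BB (dual M)) (dual_unit y)"
  \<comment> \<open>The unitor of \<open>co\<close> is an inverse, so the map that is dualised is
    \<open>m \<mapsto> m \<otimes> 1\<close>. One side gives the functional
    \<open>h(1) g(m)\<close>, the other \<open>h (g(m))\<close>, equal because \<open>h\<close> is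
    right linear.\<close>
  have eq: "vcomp BB (lunit BB (dual M)) ?t = vcomp BB (dual_map (inv2 BB (lunit BB M))) ?c"
  proof (rule cell_eq_tensor[of _ _ "dual M" "dual (regular y)"])
    fix g h assume g: "g \<in> carrier (dual M)" "h \<in> carrier (dual (regular y))"
    show "bmap (vcomp BB (lunit BB (dual M)) ?t) (pure_tensor (dual M) (dual (regular y)) g h)
      = bmap (vcomp BB (dual_map (inv2 BB (lunit BB M))) ?c) (pure_tensor (dual M) (dual (regular y)) g h)"
      by (rule dual_ext[of M]) (use g b in \<open>auto simp: dual_ev_regular\<close>)
  qed (use b in auto)
  have "vcomp BB (lunit BB (dual M)) (vcomp BB ?t (inv2 BB ?c)) = dual_map (inv2 BB (lunit BB M))"
    by (rule Alg2.vcomp_inv2_right3[OF dual_comp_inv_Isos _ _ _ eq]) (use b in auto)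
  then show "lunit FF (pf_arr (duality K) M) \<bullet>\<^bsub>FF\<^esub> (pf_unit (duality K) y \<star>\<^bsub>FF\<^esub> id2 FF (pf_arr (duality K) M))
        \<bullet>\<^bsub>FF\<^esub> pf_comp (duality K) (id1 FF y) M = pf_cell (duality K) (lunit (co FF) M)"
    using b by simp
next
  fix M x y assume "M \<in> Hom FF x y"
  then have b: "bim M" "lalg M = x" "ralg M = y" "semisimple x" "semisimple y" "alg x" "alg y" by auto
  let ?c = "dual_comp_inv (regular x) M" and ?t = "tensor_map (dual_unit x) (id2 BB (dual M))"
  \<comment> \<open>Here the dualised map is \<open>m \<mapsto> 1 \<otimes> m\<close>, and both
    sides give the functional \<open>h (g(1) m)\<close>.\<close>
  have eq: "vcomp BB (runit BB (dual M)) ?t = vcomp BB (dual_map (inv2 BB (runit BB M))) ?c"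
  proof (rule cell_eq_tensor[of _ _ "dual (regular x)" "dual M"])
    fix g h assume g: "g \<in> carrier (dual (regular x))" "h \<in> carrier (dual M)"
    show "bmap (vcomp BB (runit BB (dual M)) ?t) (pure_tensor (dual (regular x)) (dual M) g h)
      = bmap (vcomp BB (dual_map (inv2 BB (runit BB M))) ?c) (pure_tensor (dual (regular x)) (dual M) g h)"
      by (rule dual_ext[of M]) (use g b in auto)
  qed (use b in auto)
  have "vcomp BB (runit BB (dual M)) (vcomp BB ?t (inv2 BB ?c)) = dual_map (inv2 BB (runit BB M))"
    by (rule Alg2.vcomp_inv2_right3[OF dual_comp_inv_Isos _ _ _ eq]) (use b in auto)
  then show "runit FF (pf_arr (duality K) M) \<bullet>\<^bsub>FF\<^esub> (id2 FF (pf_arr (duality K) M) \<star>\<^bsub>FF\<^esub> pf_unit (duality K) x)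
        \<bullet>\<^bsub>FF\<^esub> pf_comp (duality K) M (id1 FF x) = pf_cell (duality K) (runit (co FF) M)"
    using b by simp
qed

end

section \<open>The adjoint equivalence\<close>

type_synonym ('k, 'u) endofun = "(('k, 'u) module, ('k, 'u) bimodule, ('k, 'u) bimod_map,
  ('k, 'u) module, ('k, 'u) bimodule, ('k, 'u) bimod_map) psfun"

section \<open>Icons and their inverses\<close>

context morita
begin

text \<open>Typing conditions on the data of \<open>P\<close> over semisimple algebras. They say
  where its structure cells live, which is what an evaluation on pure tensors has to know.\<close>

definition fixes_objects :: "('k, 'u) endofun \<Rightarrow> bool" where
  "fixes_objects P \<longleftrightarrow>
    (\<forall>A. pf_obj P A = A) \<and>
    (\<forall>M. sbim M \<longrightarrow> bim (pf_arr P M) \<and> lalg (pf_arr P M) = lalg M \<and> ralg (pf_arr P M) = ralg M) \<and>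
    (\<forall>\<sigma>. cell \<sigma> \<and> sbim (bdom \<sigma>) \<longrightarrow>
      cell (pf_cell P \<sigma>) \<and> bdom (pf_cell P \<sigma>) = pf_arr P (bdom \<sigma>) \<and> bcod (pf_cell P \<sigma>) = pf_arr P (bcod \<sigma>)) \<and>
    (\<forall>M N. sbim M \<and> sbim N \<and> ralg M = lalg N \<longrightarrow> cell (pf_comp P N M) \<and>
      bdom (pf_comp P N M) = pf_arr P (tensor M N) \<and> bcod (pf_comp P N M) = tensor (pf_arr P M) (pf_arr P N)) \<and>
    (\<forall>A. alg A \<and> semisimple A \<longrightarrow> cell (pf_unit P A) \<and>
      bdom (pf_unit P A) = pf_arr P (regular A) \<and> bcod (pf_unit P A) = regular A)"

text \<open>The data of a transformation between pseudofunctors that fix the objects whose 1-cell components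
  are identities.\<close>

definition icon :: "('k, 'u) endofun \<Rightarrow> ('k, 'u) endofun \<Rightarrow> (('k, 'u) bimodule \<Rightarrow> ('k, 'u) bimod_map) \<Rightarrow> bool" where
  "icon P Q \<psi> \<longleftrightarrow> fixes_objects P \<and> fixes_objects Q \<and>
    (\<forall>M. sbim M \<longrightarrow> \<psi> M \<in> Isos BB (pf_arr P M) (pf_arr Q M)) \<and>
    (\<forall>\<sigma>. cell \<sigma> \<and> sbim (bdom \<sigma>) \<longrightarrow> vcomp BB (pf_cell Q \<sigma>) (\<psi> (bdom \<sigma>)) = vcomp BB (\<psi> (bcod \<sigma>)) (pf_cell P \<sigma>)) \<and>
    (\<forall>M N. sbim M \<and> sbim N \<and> ralg M = lalg N \<longrightarrow>
      vcomp BB (pf_comp Q N M) (\<psi> (tensor M N)) = vcomp BB (tensor_map (\<psi> M) (\<psi> N)) (pf_comp P N M)) \<and>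
    (\<forall>A. alg A \<and> semisimple A \<longrightarrow> vcomp BB (pf_unit Q A) (\<psi> (regular A)) = pf_unit P A)"

text \<open>Unitors on both sides turn the cells \<open>\<psi>\<close> into components between
  composites with regular bimodules. The inverse is taken in the semisimple part, so that
  \<open>dual_y\<close> becomes an instance by mere unfolding.\<close>

definition icon_trans :: "('k, 'u) endofun \<Rightarrow> ('k, 'u) endofun \<Rightarrow> (('k, 'u) bimodule \<Rightarrow> ('k, 'u) bimod_map) \<Rightarrow>
    (('k, 'u) module, ('k, 'u) bimodule, ('k, 'u) bimodule, ('k, 'u) bimod_map) pstrans" where
  "icon_trans P Q \<psi> = \<lparr>pt_obj = regular,
     pt_arr = (\<lambda>M. vcomp BB (inv2 FF (runit BB (pf_arr Q M))) (vcomp BB (\<psi> M) (lunit BB (pf_arr P M))))\<rparr>"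

lemma fixes_objectsD:
  assumes "fixes_objects P"
  shows "pf_obj P A = A"
    and "sbim M \<Longrightarrow> bim (pf_arr P M)" "sbim M \<Longrightarrow> lalg (pf_arr P M) = lalg M" "sbim M \<Longrightarrow> ralg (pf_arr P M) = ralg M"
    and "\<lbrakk>cell \<sigma>; sbim (bdom \<sigma>)\<rbrakk> \<Longrightarrow> cell (pf_cell P \<sigma>)"
    and "\<lbrakk>cell \<sigma>; sbim (bdom \<sigma>)\<rbrakk> \<Longrightarrow> bdom (pf_cell P \<sigma>) = pf_arr P (bdom \<sigma>)"
    and "\<lbrakk>cell \<sigma>; sbim (bdom \<sigma>)\<rbrakk> \<Longrightarrow> bcod (pf_cell P \<sigma>) = pf_arr P (bcod \<sigma>)"
    and "\<lbrakk>sbim M; sbim N; ralg M = lalg N\<rbrakk> \<Longrightarrow> cell (pf_comp P N M)"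
    and "\<lbrakk>sbim M; sbim N; ralg M = lalg N\<rbrakk> \<Longrightarrow> bdom (pf_comp P N M) = pf_arr P (tensor M N)"
    and "\<lbrakk>sbim M; sbim N; ralg M = lalg N\<rbrakk> \<Longrightarrow> bcod (pf_comp P N M) = tensor (pf_arr P M) (pf_arr P N)"
    and "\<lbrakk>alg A; semisimple A\<rbrakk> \<Longrightarrow> cell (pf_unit P A)"
    and "\<lbrakk>alg A; semisimple A\<rbrakk> \<Longrightarrow> bdom (pf_unit P A) = pf_arr P (regular A)"
    and "\<lbrakk>alg A; semisimple A\<rbrakk> \<Longrightarrow> bcod (pf_unit P A) = regular A"
  using assms unfolding fixes_objects_def by auto

lemma iconD:
  assumes "icon P Q \<psi>"
  shows "fixes_objects P" "fixes_objects Q"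
    and "sbim M \<Longrightarrow> \<psi> M \<in> Isos BB (pf_arr P M) (pf_arr Q M)"
    and "\<lbrakk>cell \<sigma>; sbim (bdom \<sigma>)\<rbrakk> \<Longrightarrow> vcomp BB (pf_cell Q \<sigma>) (\<psi> (bdom \<sigma>)) = vcomp BB (\<psi> (bcod \<sigma>)) (pf_cell P \<sigma>)"
    and "\<lbrakk>sbim M; sbim N; ralg M = lalg N\<rbrakk> \<Longrightarrow>
      vcomp BB (pf_comp Q N M) (\<psi> (tensor M N)) = vcomp BB (tensor_map (\<psi> M) (\<psi> N)) (pf_comp P N M)"
    and "\<lbrakk>alg A; semisimple A\<rbrakk> \<Longrightarrow> vcomp BB (pf_unit Q A) (\<psi> (regular A)) = pf_unit P A"
  using assms unfolding icon_def by auto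

lemma icon_cell:
  assumes "icon P Q \<psi>" "sbim M"
  shows "cell (\<psi> M)" "bdom (\<psi> M) = pf_arr P M" "bcod (\<psi> M) = pf_arr Q M"
  using IsosD[OF iconD(3)[OF assms]] by auto

lemma bim_one [simp]:
  "\<lbrakk>bim M; m \<in> carrier M; lalg M = A\<rbrakk> \<Longrightarrow> lact M \<one>\<^bsub>A\<^esub> m = m"
  "\<lbrakk>bim M; m \<in> carrier M; ralg M = A\<rbrakk> \<Longrightarrow> ract M m \<one>\<^bsub>A\<^esub> = m"
  by auto

lemma vcomp_eqD:
  assumes "vcomp BB g f = vcomp BB g' f'" "x \<in> carrier (bdom f)" "x \<in> carrier (bdom f')"
  shows "bmap g (bmap f x) = bmap g' (bmap f' x)"
  using arg_cong[OF assms(1), of "\<lambda>h. bmap h x"] assms(2,3) by simp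

text \<open>Naturality and the comparison law are squares with \<open>\<psi>\<close> on two opposite
  sides, and the unit law is a triangle with \<open>\<psi>\<close> on one side; all of them survive
  inversion.\<close>

lemma icon_inverse:
  assumes i: "icon P Q \<psi>"
  shows "icon Q P (\<lambda>M. inv2 BB (\<psi> M))"
  unfolding icon_def
proof (intro conjI allI impI)
  note PQ = iconD(1,2)[OF i] and P = fixes_objectsD[OF iconD(1)[OF i]] and Q = fixes_objectsD[OF iconD(2)[OF i]]
  show "fixes_objects P" "fixes_objects Q" by (rule PQ)+
  show "inv2 BB (\<psi> M) \<in> Isos BB (pf_arr Q M) (pf_arr P M)" if "sbim M" for M
    by (rule Alg2.inv2_iso[OF iconD(3)[OF i that]])
  show "vcomp BB (pf_cell P \<sigma>) (inv2 BB (\<psi> (bdom \<sigma>))) = vcomp BB (inv2 BB (\<psi> (bcod \<sigma>))) (pf_cell Q \<sigma>)"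
    if \<sigma>: "cell \<sigma> \<and> sbim (bdom \<sigma>)" for \<sigma>
  proof -
    have s: "sbim (bdom \<sigma>)" "sbim (bcod \<sigma>)" using \<sigma> cell_props[of \<sigma>] by auto
    show ?thesis
      by (rule Alg2.inv2_square[OF iconD(3)[OF i s(1)] iconD(3)[OF i s(2)] _ _ iconD(4)[OF i], symmetric])
        (use \<sigma> s P Q in auto)
  qed
  show "vcomp BB (pf_comp P N M) (inv2 BB (\<psi> (tensor M N))) =
      vcomp BB (tensor_map (inv2 BB (\<psi> M)) (inv2 BB (\<psi> N))) (pf_comp Q N M)"
    if s: "sbim M \<and> sbim N \<and> ralg M = lalg N" for M N
  proof -
    have t: "sbim (tensor M N)" "sbim M" "sbim N" "ralg M = lalg N" using s by auto
    have h: "tensor_map (\<psi> M) (\<psi> N) \<in> Isos BB (tensor (pf_arr P M) (pf_arr P N)) (tensor (pf_arr Q M) (pf_arr Q N))"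
      "inv2 BB (tensor_map (\<psi> M) (\<psi> N)) = tensor_map (inv2 BB (\<psi> M)) (inv2 BB (\<psi> N))"
      using Alg2.hcomp_iso[OF iconD(3)[OF i t(2)] iconD(3)[OF i t(3)]] t P Q by auto
    show ?thesis
      unfolding h(2)[symmetric]
      by (rule Alg2.inv2_square[OF iconD(3)[OF i t(1)] h(1) _ _ iconD(5)[OF i t(2-4)], symmetric])
        (use t P Q in auto)
  qed
  show "vcomp BB (pf_unit P A) (inv2 BB (\<psi> (regular A))) = pf_unit Q A" if A: "alg A \<and> semisimple A" for A
  proof -
    have r: "sbim (regular A)" using A by auto
    show ?thesis
      by (rule Alg2.vcomp_inv2_right[OF iconD(3)[OF i r], of _ "regular A"]) (use A r P Q iconD(6)[OF i] in auto)
  qed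
qed

text \<open>The inverse unitor sends \<open>q\<close> to \<open>1 \<otimes> q\<close>, so in this
  normal form all algebra elements have been collected in the factor other than the regular
  bimodule.\<close>

lemma icon_trans_simps:
  assumes i: "icon P Q \<psi>" and M: "sbim M"
  shows "pt_arr (icon_trans P Q \<psi>) M \<in> Isos BB (tensor (pf_arr P M) (regular (ralg M))) (tensor (regular (lalg M)) (pf_arr Q M))"
    and "cell (pt_arr (icon_trans P Q \<psi>) M)"
    and "bdom (pt_arr (icon_trans P Q \<psi>) M) = tensor (pf_arr P M) (regular (ralg M))"
    and "bcod (pt_arr (icon_trans P Q \<psi>) M) = tensor (regular (lalg M)) (pf_arr Q M)"
    and "\<lbrakk>PM = pf_arr P M; m \<in> carrier PM; A = ralg M; b \<in> carrier A\<rbrakk> \<Longrightarrow>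
      bmap (pt_arr (icon_trans P Q \<psi>) M) (pure_tensor PM (regular A) m b)
        = pure_tensor (regular (lalg M)) (pf_arr Q M) \<one>\<^bsub>lalg M\<^esub> (bmap (\<psi> M) (ract PM m b))"
proof -
  note P = fixes_objectsD[OF iconD(1)[OF i]] and Q = fixes_objectsD[OF iconD(2)[OF i]] and c = icon_cell[OF i M]
  show "pt_arr (icon_trans P Q \<psi>) M \<in> Isos BB (tensor (pf_arr P M) (regular (ralg M))) (tensor (regular (lalg M)) (pf_arr Q M))"
    using Alg2.vcomp_iso(1)[OF Alg2.vcomp_iso(1)[OF lunit_Isos iconD(3)[OF i M]] Alg2.inv2_iso[OF runit_Isos]] M P Q
    by (simp add: icon_trans_def)
  show "\<lbrakk>PM = pf_arr P M; m \<in> carrier PM; A = ralg M; b \<in> carrier A\<rbrakk> \<Longrightarrow>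
      bmap (pt_arr (icon_trans P Q \<psi>) M) (pure_tensor PM (regular A) m b)
        = pure_tensor (regular (lalg M)) (pf_arr Q M) \<one>\<^bsub>lalg M\<^esub> (bmap (\<psi> M) (ract PM m b))"
    using M P Q c by (simp add: icon_trans_def)
qed (use assms fixes_objectsD[OF iconD(1)[OF i]] fixes_objectsD[OF iconD(2)[OF i]] icon_cell[OF i M] in \<open>simp_all add: icon_trans_def\<close>)

lemma pt_obj_icon_trans [simp]: "pt_obj (icon_trans P Q \<psi>) = regular"
  by (simp add: icon_trans_def)

lemma pure_tensor_unit:
  assumes "alg A" "a \<in> carrier A"
  shows "pure_tensor (regular A) (regular A) a \<one>\<^bsub>A\<^esub> = pure_tensor (regular A) (regular A) \<one>\<^bsub>A\<^esub> a"
  using pure_balanced[of "regular A" "regular A" "\<one>\<^bsub>A\<^esub>" a "\<one>\<^bsub>A\<^esub>"] assms by simp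

lemma pure_tensor_unit_left:
  assumes "bim M" "A = lalg M" "a \<in> carrier A" "m \<in> carrier M"
  shows "pure_tensor (regular A) M a m = pure_tensor (regular A) M \<one>\<^bsub>A\<^esub> (lact M a m)"
  using pure_balanced[of "regular A" M "\<one>\<^bsub>A\<^esub>" a m] assms by simp

lemma pseudonatural_icon:
  assumes i: "icon P Q \<psi>"
  shows "pseudonatural FF FF P Q (icon_trans P Q \<psi>)"
proof
  note P = fixes_objectsD[OF iconD(1)[OF i]] and Q = fixes_objectsD[OF iconD(2)[OF i]] and ic = icon_cell[OF i]
    and t = icon_trans_simps[OF i]
  {
    fix x assume x: "x \<in> Obj FF"
    show "pt_obj (icon_trans P Q \<psi>) x \<in> Hom FF (pf_obj P x) (pf_obj Q x)"
      using x P(1) Q(1) by simp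
  next
    fix M x y assume "M \<in> Hom FF x y"
    then show "pt_arr (icon_trans P Q \<psi>) M \<in> Isos FF (pt_obj (icon_trans P Q \<psi>) y \<circledcirc>\<^bsub>FF\<^esub> pf_arr P M)
      (pf_arr Q M \<circledcirc>\<^bsub>FF\<^esub> pt_obj (icon_trans P Q \<psi>) x)"
      using t(1)[of M] P(3)[of M] by auto
  next
    fix \<sigma> M M' x y assume "\<sigma> \<in> Cells FF M M'" "M \<in> Hom FF x y"
    then have c: "cell \<sigma>" "bdom \<sigma> = M" "bcod \<sigma> = M'" and b: "bim M" "lalg M = x" "ralg M = y" "semisimple x" "semisimple y"
      by auto
    then have b': "bim M'" "lalg M' = x" "ralg M' = y" "alg x" "alg y" using cell_props[OF c(1)] by auto
    have s: "sbim M" "sbim M'" "sbim (bdom \<sigma>)" using b b' c by auto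
    note simps = c b b' P(2-4)[OF s(1)] P(2-4)[OF s(2)] Q(2-4)[OF s(1)] Q(2-4)[OF s(2)] ic[OF s(1)] ic[OF s(2)]
      t(2-5)[OF s(1)] t(2-5)[OF s(2)] P(5-7)[OF c(1) s(3), unfolded c] Q(5-7)[OF c(1) s(3), unfolded c]
    have nat: "bmap (pf_cell Q \<sigma>) (bmap (\<psi> M) z) = bmap (\<psi> M') (bmap (pf_cell P \<sigma>) z)" if "z \<in> carrier (pf_arr P M)" for z
      using vcomp_eqD[OF iconD(4)[OF i c(1) s(3)], unfolded c, of z] that simps by simp
    show "(pf_cell Q \<sigma> \<star>\<^bsub>FF\<^esub> id2 FF (pt_obj (icon_trans P Q \<psi>) x)) \<bullet>\<^bsub>FF\<^esub> pt_arr (icon_trans P Q \<psi>) M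
        = pt_arr (icon_trans P Q \<psi>) M' \<bullet>\<^bsub>FF\<^esub> (id2 FF (pt_obj (icon_trans P Q \<psi>) y) \<star>\<^bsub>FF\<^esub> pf_cell P \<sigma>)"
      unfolding pt_obj_icon_trans Alg2_fd_simps
      by (rule cell_eq_tensor[of _ _ "pf_arr P M" "regular y"]) (simp_all add: simps nat cell_linear)
  next
    fix M N x y z assume "M \<in> Hom FF x y" "N \<in> Hom FF y z"
    then have b: "bim M" "bim N" "lalg M = x" "ralg M = y" "lalg N = y" "ralg N = z"
      "semisimple x" "semisimple y" "semisimple z" and a: "alg x" "alg y" "alg z" by auto
    have s: "sbim M" "sbim N" "sbim (tensor M N)" "ralg M = lalg N" using b by auto
    note simps = b a P(2-4)[OF s(1)] P(2-4)[OF s(2)] P(2-4)[OF s(3)] Q(2-4)[OF s(1)] Q(2-4)[OF s(2)] Q(2-4)[OF s(3)]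
      ic[OF s(1)] ic[OF s(2)] ic[OF s(3)] t(2-5)[OF s(1)] t(2-5)[OF s(2)] t(2-5)[OF s(3)]
      P(8-10)[OF s(1,2,4)] Q(8-10)[OF s(1,2,4)]
    \<comment> \<open>\<open>?R\<close> is the pasting of the two components before the comparison
      cell is attached. On pure tensors its associators and unitors cancel, and what remains is the
      tensor product of \<open>\<psi> M\<close> and \<open>\<psi> N\<close> between unitors, that is
      \<open>?S\<close>.\<close>
    let ?R = "vcomp BB (inv2 BB (assoc BB (pf_arr Q N) (pf_arr Q M) (regular x)))
          (vcomp BB (tensor_map (pt_arr (icon_trans P Q \<psi>) M) (id2 BB (pf_arr Q N)))
          (vcomp BB (assoc BB (pf_arr Q N) (regular y) (pf_arr P M))
          (vcomp BB (tensor_map (id2 BB (pf_arr P M)) (pt_arr (icon_trans P Q \<psi>) N))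
          (inv2 BB (assoc BB (regular z) (pf_arr P N) (pf_arr P M))))))"
    let ?S = "vcomp BB (inv2 BB (runit BB (tensor (pf_arr Q M) (pf_arr Q N))))
      (vcomp BB (tensor_map (\<psi> M) (\<psi> N)) (lunit BB (tensor (pf_arr P M) (pf_arr P N))))"
    have RS: "?R = ?S"
      by (rule cell_eq_tensor_left[of _ _ "pf_arr P M" "pf_arr P N" "regular z"]) (simp_all add: simps)
    \<comment> \<open>The elementwise form is required below, where the left factor of the argument
      is a value of \<open>pf_comp P N M\<close> and need not be a pure tensor, so that the
      individual maps cannot be evaluated on it.\<close>
    have RS': "bmap (inv2 BB (assoc BB (pf_arr Q N) (pf_arr Q M) (regular x)))
          (bmap (tensor_map (pt_arr (icon_trans P Q \<psi>) M) (id2 BB (pf_arr Q N)))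
          (bmap (assoc BB (pf_arr Q N) (regular y) (pf_arr P M))
          (bmap (tensor_map (id2 BB (pf_arr P M)) (pt_arr (icon_trans P Q \<psi>) N))
          (bmap (inv2 BB (assoc BB (regular z) (pf_arr P N) (pf_arr P M))) w)))) = bmap ?S w"
      if "w \<in> carrier (tensor (tensor (pf_arr P M) (pf_arr P N)) (regular z))" for w
      using arg_cong[OF RS, of "\<lambda>h. bmap h w"] that by (simp add: simps)
    have comp: "bmap (pf_comp Q N M) (bmap (\<psi> (tensor M N)) w) = bmap (tensor_map (\<psi> M) (\<psi> N)) (bmap (pf_comp P N M) w)"
      if "w \<in> carrier (pf_arr P (tensor M N))" for w
      using vcomp_eqD[OF iconD(5)[OF i s(1,2,4)], of w] that simps by simp
    show "(pf_comp Q N M \<star>\<^bsub>FF\<^esub> id2 FF (pt_obj (icon_trans P Q \<psi>) x)) \<bullet>\<^bsub>FF\<^esub> pt_arr (icon_trans P Q \<psi>) (N \<circledcirc>\<^bsub>FF\<^esub> M)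
        = inv2 FF (assoc FF (pf_arr Q N) (pf_arr Q M) (pt_obj (icon_trans P Q \<psi>) x))
          \<bullet>\<^bsub>FF\<^esub> (id2 FF (pf_arr Q N) \<star>\<^bsub>FF\<^esub> pt_arr (icon_trans P Q \<psi>) M)
          \<bullet>\<^bsub>FF\<^esub> assoc FF (pf_arr Q N) (pt_obj (icon_trans P Q \<psi>) y) (pf_arr P M)
          \<bullet>\<^bsub>FF\<^esub> (pt_arr (icon_trans P Q \<psi>) N \<star>\<^bsub>FF\<^esub> id2 FF (pf_arr P M))
          \<bullet>\<^bsub>FF\<^esub> inv2 FF (assoc FF (pt_obj (icon_trans P Q \<psi>) z) (pf_arr P N) (pf_arr P M))
          \<bullet>\<^bsub>FF\<^esub> (id2 FF (pt_obj (icon_trans P Q \<psi>) z) \<star>\<^bsub>FF\<^esub> pf_comp P N M)"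
      unfolding pt_obj_icon_trans Alg2_fd_simps
    proof (rule cell_eq_tensor[of _ _ "pf_arr P (tensor M N)" "regular z"])
      fix v c assume v: "v \<in> carrier (pf_arr P (tensor M N))" and c: "c \<in> carrier (regular z)"
      let ?p = "pure_tensor (tensor (pf_arr P M) (pf_arr P N)) (regular z) (bmap (pf_comp P N M) v) c"
      have p: "?p \<in> carrier (tensor (tensor (pf_arr P M) (pf_arr P N)) (regular z))"
        using v c by (simp add: simps)
      show "bmap (vcomp BB (tensor_map (id2 BB (regular x)) (pf_comp Q N M)) (pt_arr (icon_trans P Q \<psi>) (tensor M N)))
          (pure_tensor (pf_arr P (tensor M N)) (regular z) v c) =
        bmap (vcomp BB (inv2 FF (assoc BB (pf_arr Q N) (pf_arr Q M) (regular x)))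
          (vcomp BB (tensor_map (pt_arr (icon_trans P Q \<psi>) M) (id2 BB (pf_arr Q N)))
          (vcomp BB (assoc BB (pf_arr Q N) (regular y) (pf_arr P M))
          (vcomp BB (tensor_map (id2 BB (pf_arr P M)) (pt_arr (icon_trans P Q \<psi>) N))
          (vcomp BB (inv2 FF (assoc BB (regular z) (pf_arr P N) (pf_arr P M)))
          (tensor_map (pf_comp P N M) (id2 BB (regular z))))))))
          (pure_tensor (pf_arr P (tensor M N)) (regular z) v c)"
        using v c RS'[OF p] by (simp add: simps comp cell_linear)
    qed (simp_all add: simps)
  next
    fix x assume "x \<in> Obj FF"
    then have x: "alg x" "semisimple x" by auto
    have s: "sbim (regular x)" using x by simp
    note simps = x P(2-4)[OF s] Q(2-4)[OF s] ic[OF s] t(2-5)[OF s] P(11-13)[OF x] Q(11-13)[OF x] P(1) Q(1)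
    have unit: "bmap (pf_unit Q x) (bmap (\<psi> (regular x)) w) = bmap (pf_unit P x) w"
      if "w \<in> carrier (pf_arr P (regular x))" for w
      using arg_cong[OF iconD(6)[OF i x], of "\<lambda>h. bmap h w"] that by (simp add: simps)
    have lin: "bmap (pf_unit P x) (ract (pf_arr P (regular x)) w b) = bmap (pf_unit P x) w \<otimes>\<^bsub>x\<^esub> b"
      if "w \<in> carrier (pf_arr P (regular x))" "b \<in> carrier x" for w b
      using that by (simp add: simps cell_linear)
    have cl: "bmap (pf_unit P x) w \<in> carrier x" if "w \<in> carrier (pf_arr P (regular x))" for w
      using cell_closed[of "pf_unit P x" "regular x" w] that by (simp add: simps)
    show "(pf_unit Q x \<star>\<^bsub>FF\<^esub> id2 FF (pt_obj (icon_trans P Q \<psi>) x)) \<bullet>\<^bsub>FF\<^esub> pt_arr (icon_trans P Q \<psi>) (id1 FF x)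
        = inv2 FF (lunit FF (pt_obj (icon_trans P Q \<psi>) x)) \<bullet>\<^bsub>FF\<^esub> runit FF (pt_obj (icon_trans P Q \<psi>) x)
          \<bullet>\<^bsub>FF\<^esub> (id2 FF (pt_obj (icon_trans P Q \<psi>) x) \<star>\<^bsub>FF\<^esub> pf_unit P x)"
      unfolding pt_obj_icon_trans Alg2_fd_simps
      by (rule cell_eq_tensor[of _ _ "pf_arr P (regular x)" "regular x"])
        (simp_all add: simps unit lin cl pure_tensor_unit)
  }
qed

text \<open>The 1-cells of both composites are tensor squares of regular bimodules, so the unitor of
  the regular bimodule serves as counit and its inverse as unit. Left and right unitor of a regular
  bimodule are both its multiplication, and this yields the triangle identities.\<close>

lemma icon_adjoint_equivalence:
  assumes i: "icon P Q \<psi>"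
  shows "pseudonatural_adjoint_equivalence FF FF P Q (icon_trans P Q \<psi>) (icon_trans Q P (\<lambda>M. inv2 BB (\<psi> M)))
    (\<lambda>A. inv2 BB (lunit BB (regular A))) (\<lambda>A. lunit BB (regular A))"
proof (rule pseudonatural_adjoint_equivalence.intro)
  let ?\<alpha> = "icon_trans P Q \<psi>" and ?\<beta> = "icon_trans Q P (\<lambda>M. inv2 BB (\<psi> M))"
  note j = icon_inverse[OF i]
  note P = fixes_objectsD[OF iconD(1)[OF i]] and Q = fixes_objectsD[OF iconD(2)[OF i]] and ic = icon_cell[OF i] and jc = icon_cell[OF j]
    and t = icon_trans_simps[OF i] and u = icon_trans_simps[OF j]
  have inv: "bmap (inv2 BB (\<psi> M)) (bmap (\<psi> M) w) = w" if "sbim M" "w \<in> carrier (pf_arr P M)" for M w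
    using bmap_inv2[OF iconD(3)[OF i that(1)] that(2) refl] .
  have inv': "bmap (\<psi> M) (bmap (inv2 BB (\<psi> M)) w) = w" if "sbim M" "w \<in> carrier (pf_arr Q M)" for M w
    using arg_cong[OF Alg2.inv2_right[OF iconD(3)[OF i that(1)]], of "\<lambda>h. bmap h w"] that jc[OF that(1)] by simp
  \<comment> \<open>Unfolded for arbitrary pseudofunctors and transformations, so that the same
    equations serve the unit and the counit.\<close>
  have comp_simps: "pt_obj (pt_Comp FF FF P' Q' P'' \<beta> \<alpha>) x = tensor (pt_obj \<alpha> x) (pt_obj \<beta> x)"
    "pt_obj (pt_Id FF P') x = regular (pf_obj P' x)"
    "pt_arr (pt_Id FF P') M = vcomp BB (inv2 FF (runit BB (pf_arr P' M))) (lunit BB (pf_arr P' M))"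
    "pt_arr (pt_Comp FF FF P' Q' P'' \<beta> \<alpha>) M =
      vcomp BB (assoc BB (pf_arr P'' M) (pt_obj \<beta> (lalg M)) (pt_obj \<alpha> (lalg M)))
       (vcomp BB (tensor_map (id2 BB (pt_obj \<alpha> (lalg M))) (pt_arr \<beta> M))
       (vcomp BB (inv2 FF (assoc BB (pt_obj \<beta> (ralg M)) (pf_arr Q' M) (pt_obj \<alpha> (lalg M))))
       (vcomp BB (tensor_map (pt_arr \<alpha> M) (id2 BB (pt_obj \<beta> (ralg M))))
       (assoc BB (pt_obj \<beta> (ralg M)) (pt_obj \<alpha> (ralg M)) (pf_arr P' M)))))"
    for P' Q' P'' and \<alpha> \<beta> and x M
    by (simp_all add: pt_Comp_def pt_Id_def Let_def)
  show "pseudonatural FF FF P Q ?\<alpha>" "pseudonatural FF FF Q P ?\<beta>"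
    using pseudonatural_icon i j by blast+
  show "invertible_modification FF FF P P (pt_Id FF P) (pt_Comp FF FF P Q P ?\<beta> ?\<alpha>) (\<lambda>A. inv2 BB (lunit BB (regular A)))"
  proof
    fix x assume "x \<in> Obj FF"
    then have x: "alg x" "semisimple x" by auto
    show "inv2 BB (lunit BB (regular x)) \<in> Isos FF (pt_obj (pt_Id FF P) x) (pt_obj (pt_Comp FF FF P Q P ?\<beta> ?\<alpha>) x)"
      unfolding comp_simps pt_obj_icon_trans P(1) using Alg2.inv2_iso[OF lunit_Isos[of "regular x"]] x by simp
  next
    fix M x y assume "M \<in> Hom FF x y"
    then have b: "bim M" "lalg M = x" "ralg M = y" "semisimple x" "semisimple y" "alg x" "alg y" by auto
    then have s: "sbim M" by auto
    note simps = b P(2-4)[OF s] Q(2-4)[OF s] ic[OF s] jc[OF s] t(2-5)[OF s] u(2-5)[OF s] inv[OF s]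
    show "(id2 FF (pf_arr P M) \<star>\<^bsub>FF\<^esub> inv2 BB (lunit BB (regular x))) \<bullet>\<^bsub>FF\<^esub> pt_arr (pt_Id FF P) M =
      pt_arr (pt_Comp FF FF P Q P ?\<beta> ?\<alpha>) M \<bullet>\<^bsub>FF\<^esub> (inv2 BB (lunit BB (regular y)) \<star>\<^bsub>FF\<^esub> id2 FF (pf_arr P M))"
      unfolding comp_simps pt_obj_icon_trans Alg2_fd_simps
      by (rule cell_eq_tensor[of _ _ "pf_arr P M" "regular y"]) (simp_all add: simps)
  qed
  show "invertible_modification FF FF Q Q (pt_Comp FF FF Q P Q ?\<alpha> ?\<beta>) (pt_Id FF Q) (\<lambda>A. lunit BB (regular A))"
  proof
    fix x assume "x \<in> Obj FF"
    then have x: "alg x" "semisimple x" by auto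
    show "lunit BB (regular x) \<in> Isos FF (pt_obj (pt_Comp FF FF Q P Q ?\<alpha> ?\<beta>) x) (pt_obj (pt_Id FF Q) x)"
      unfolding comp_simps pt_obj_icon_trans Q(1) using lunit_Isos[of "regular x"] x by simp
  next
    fix M x y assume "M \<in> Hom FF x y"
    then have b: "bim M" "lalg M = x" "ralg M = y" "semisimple x" "semisimple y" "alg x" "alg y" by auto
    then have s: "sbim M" by auto
    note simps = b P(2-4)[OF s] Q(2-4)[OF s] ic[OF s] jc[OF s] t(2-5)[OF s] u(2-5)[OF s] inv'[OF s]
    have act: "ract (pf_arr Q M) m (b \<otimes>\<^bsub>y\<^esub> b') = ract (pf_arr Q M) (ract (pf_arr Q M) m b) b'"
      if "m \<in> carrier (pf_arr Q M)" "b \<in> carrier y" "b' \<in> carrier y" for m b b'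
      using bim_assoc(2)[of "pf_arr Q M" m b b'] that by (simp add: simps)
    have lin: "bmap (\<psi> M) (ract (pf_arr P M) w b) = ract (pf_arr Q M) (bmap (\<psi> M) w) b"
      if "w \<in> carrier (pf_arr P M)" "b \<in> carrier y" for w b
      using that by (simp add: simps cell_linear)
    show "(id2 FF (pf_arr Q M) \<star>\<^bsub>FF\<^esub> lunit BB (regular x)) \<bullet>\<^bsub>FF\<^esub> pt_arr (pt_Comp FF FF Q P Q ?\<alpha> ?\<beta>) M =
      pt_arr (pt_Id FF Q) M \<bullet>\<^bsub>FF\<^esub> (lunit BB (regular y) \<star>\<^bsub>FF\<^esub> id2 FF (pf_arr Q M))"
      unfolding comp_simps pt_obj_icon_trans Alg2_fd_simps
      by (rule cell_eq_tensor_right[of _ _ "pf_arr Q M" "regular y" "regular y"]) (simp_all add: simps lin act)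
  qed
  fix x assume "x \<in> Obj FF"
  then have x: "alg x" "semisimple x" by auto
  show "lunit FF (pt_obj ?\<alpha> x) \<bullet>\<^bsub>FF\<^esub> (lunit BB (regular x) \<star>\<^bsub>FF\<^esub> id2 FF (pt_obj ?\<alpha> x))
        \<bullet>\<^bsub>FF\<^esub> inv2 FF (assoc FF (pt_obj ?\<alpha> x) (pt_obj ?\<beta> x) (pt_obj ?\<alpha> x))
        \<bullet>\<^bsub>FF\<^esub> (id2 FF (pt_obj ?\<alpha> x) \<star>\<^bsub>FF\<^esub> inv2 BB (lunit BB (regular x))) = runit FF (pt_obj ?\<alpha> x)"
    unfolding pt_obj_icon_trans Alg2_fd_simps
    by (rule cell_eq_tensor[of _ _ "regular x" "regular x"]) (use x in simp_all)
  show "runit FF (pt_obj ?\<beta> x) \<bullet>\<^bsub>FF\<^esub> (id2 FF (pt_obj ?\<beta> x) \<star>\<^bsub>FF\<^esub> lunit BB (regular x))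
        \<bullet>\<^bsub>FF\<^esub> assoc FF (pt_obj ?\<beta> x) (pt_obj ?\<alpha> x) (pt_obj ?\<beta> x)
        \<bullet>\<^bsub>FF\<^esub> (inv2 BB (lunit BB (regular x)) \<star>\<^bsub>FF\<^esub> id2 FF (pt_obj ?\<beta> x)) = lunit FF (pt_obj ?\<beta> x)"
    unfolding pt_obj_icon_trans Alg2_fd_simps
    by (rule cell_eq_tensor[of _ _ "regular x" "regular x"]) (use x in simp_all)
qed

end

section \<open>The weak duality involution\<close>

context morita
begin

abbreviation "DD \<equiv> pf_Comp FF (duality K) (pf_co FF (duality K))"

lemma DD_simps [simp]:
  "pf_obj DD A = A" "pf_arr DD M = dual (dual M)" "pf_cell DD \<sigma> = dual_map (dual_map \<sigma>)"
  "pf_comp DD N M = vcomp BB (inv2 FF (dual_comp_inv (dual M) (dual N))) (dual_map (inv2 FF (inv2 FF (dual_comp_inv M N))))"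
  "pf_unit DD A = vcomp BB (dual_unit (op A)) (dual_map (inv2 FF (dual_unit A)))"
  by (simp_all add: pf_Comp_def pf_co_def)

lemma Id_simps [simp]:
  "pf_obj (pf_Id FF) A = A" "pf_arr (pf_Id FF) M = M" "pf_cell (pf_Id FF) \<sigma> = \<sigma>"
  "pf_comp (pf_Id FF) N M = id2 BB (tensor M N)" "pf_unit (pf_Id FF) A = id2 BB (regular A)"
  by (simp_all add: pf_Id_def)

lemma dual_y_icon: "dual_y K = icon_trans (pf_Id FF) DD psi"
  by (simp add: dual_y_def icon_trans_def)

lemma fixes_objects_Id: "fixes_objects (pf_Id FF)"
  unfolding fixes_objects_def by simp

lemma fixes_objects_DD: "fixes_objects DD"
  unfolding fixes_objects_def
proof (intro conjI allI impI)
  fix \<sigma> assume \<sigma>: "cell \<sigma> \<and> sbim (bdom \<sigma>)"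
  then show "cell (pf_cell DD \<sigma>)" "bdom (pf_cell DD \<sigma>) = pf_arr DD (bdom \<sigma>)" "bcod (pf_cell DD \<sigma>) = pf_arr DD (bcod \<sigma>)"
    by auto
qed auto

lemma icon_psi: "icon (pf_Id FF) DD psi"
  unfolding icon_def
proof (intro conjI allI impI fixes_objects_Id fixes_objects_DD)
  fix M assume "sbim M"
  then show "psi M \<in> Isos BB (pf_arr (pf_Id FF) M) (pf_arr DD M)" using psi_Isos by simp
next
  fix \<sigma> assume "cell \<sigma> \<and> sbim (bdom \<sigma>)"
  moreover define M M' where "M = bdom \<sigma>" "M' = bcod \<sigma>"
  ultimately have c: "cell \<sigma>" "bdom \<sigma> = M" "bcod \<sigma> = M'" and b: "sbim M" by auto
  have b': "sbim M'" "lalg M' = lalg M" "ralg M' = ralg M" using b c cell_props[OF c(1)] by auto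
  have D: "bim (dual M)" "bim (dual M')" using b b' by auto
  show "vcomp BB (pf_cell DD \<sigma>) (psi (bdom \<sigma>)) = vcomp BB (psi (bcod \<sigma>)) (pf_cell (pf_Id FF) \<sigma>)"
  proof (rule cell_eqI)
    fix m assume m: "m \<in> carrier (bdom (vcomp BB (psi (bcod \<sigma>)) (pf_cell (pf_Id FF) \<sigma>)))"
    show "bmap (vcomp BB (pf_cell DD \<sigma>) (psi (bdom \<sigma>))) m = bmap (vcomp BB (psi (bcod \<sigma>)) (pf_cell (pf_Id FF) \<sigma>)) m"
      by (rule dual_ext[OF D(2)]) (use m b b' c D in auto)
  qed (use b b' c D in auto)
next
  fix M N assume "sbim M \<and> sbim N \<and> ralg M = lalg N"
  then have b: "bim M" "bim N" "lalg N = ralg M" "semisimple (lalg M)" "semisimple (ralg M)" "semisimple (ralg N)" by auto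
  let ?c = "dual_comp_inv (dual M) (dual N)"
  have iso: "?c \<in> Isos BB (tensor (dual (dual M)) (dual (dual N))) (dual (tensor (dual M) (dual N)))"
    by (rule dual_comp_inv_Isos) (use b in auto)
  have "vcomp BB (vcomp BB (inv2 BB ?c) (dual_map (dual_comp_inv M N))) (psi (tensor M N)) = tensor_map (psi M) (psi N)"
  proof (rule cell_eq_tensor[of _ _ M N])
    fix m n assume m: "m \<in> carrier M" "n \<in> carrier N"
    let ?p = "pure_tensor M N m n"
    \<comment> \<open>The inverse of \<open>?c\<close> is avoided by moving \<open>?c\<close> to the
      other side. Both functionals then send \<open>g \<otimes> h\<close> to
      \<open>h (g(m) n)\<close>: on one side as the value of \<open>psi N\<close> at
      \<open>n\<close> on \<open>g(m)\<close> acting on \<open>h\<close>, on the other as the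
      comparison functional of \<open>g \<otimes> h\<close> evaluated at
      \<open>m \<otimes> n\<close>.\<close>
    have "bmap ?c (pure_tensor (dual (dual M)) (dual (dual N)) (bmap (psi M) m) (bmap (psi N) n))
       = bmap (dual_map (dual_comp_inv M N)) (bmap (psi (tensor M N)) ?p)"
      by (rule dual_tensor_ext[of "dual M" "dual N"]) (use b m in \<open>auto intro!: dual_closed\<close>)
    then have "bmap (inv2 BB ?c) (bmap (dual_map (dual_comp_inv M N)) (bmap (psi (tensor M N)) ?p)) =
      pure_tensor (dual (dual M)) (dual (dual N)) (bmap (psi M) m) (bmap (psi N) n)"
      by (intro bmap_inv2[OF iso]) (use b m in auto)
    then show "bmap (vcomp BB (vcomp BB (inv2 BB ?c) (dual_map (dual_comp_inv M N))) (psi (tensor M N))) ?p = bmap (tensor_map (psi M) (psi N)) ?p"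
      using b m by simp
  qed (use b in auto)
  moreover have "vcomp BB (tensor_map (psi M) (psi N)) (id2 BB (tensor M N)) = tensor_map (psi M) (psi N)"
    by (rule Alg2.vcomp_id_right[of _ _ "tensor (dual (dual M)) (dual (dual N))"]) (use b in auto)
  ultimately show "vcomp BB (pf_comp DD N M) (psi (tensor M N)) = vcomp BB (tensor_map (psi M) (psi N)) (pf_comp (pf_Id FF) N M)"
    using b by simp
next
  fix A assume "alg A \<and> semisimple A"
  then have A: "alg A" "semisimple A" by auto
  \<comment> \<open>At \<open>a\<close> the left side is the functional \<open>dual_zeta A 1\<close>
    evaluated at \<open>a\<close>, that is \<open>1 a\<close>.\<close>
  show "vcomp BB (pf_unit DD A) (psi (regular A)) = pf_unit (pf_Id FF) A"
    by (rule cell_eqI) (use A dual_zeta_code[OF A(1)] in auto)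
qed

section \<open>The modification and its coherence condition\<close>

abbreviation "dual_y_co \<equiv> pt_post (co FF) FF (duality K) (pf_Id (co FF)) (pf_Comp (co FF) (pf_co FF (duality K)) (duality K)) (pt_co FF (dual_y K))"

lemma zeta_modification:
  "invertible_modification (co FF) FF (duality K) (pf_Comp FF DD (duality K)) (pt_pre (dual_y K) (duality K))
    dual_y_co dual_zeta"
proof (intro invertible_modification.intro; (unfold co_simps)?)
  \<comment> \<open>Three sources of inverses meet: the comparison cells are inverses by definition,
    \<open>pt_co\<close> inverts the component of \<open>dual_y\<close>, and \<open>pt_post\<close>
    inverts one comparison cell a second time.\<close>
  have post: "pt_obj dual_y_co x
      = dual (regular x)"
    "pt_arr dual_y_co M
      = vcomp BB (inv2 FF (dual_comp_inv (regular (lalg M)) (dual (dual M))))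
        (vcomp BB (dual_map (inv2 FF (pt_arr (dual_y K) M))) (inv2 FF (inv2 FF (dual_comp_inv M (regular (ralg M))))))" for x M
    by (simp_all add: pt_post_def pt_co_def dual_y_icon pf_Comp_def pf_co_def pf_Id_def)
  have pre: "pt_obj (pt_pre (dual_y K) (duality K)) x = regular (op x)"
    "pt_arr (pt_pre (dual_y K) (duality K)) M = pt_arr (dual_y K) (dual M)"
    for x :: "('k, 'u) module" and M :: "('k, 'u) bimodule"
    by (simp_all add: pt_pre_def dual_y_icon)
  have G: "pf_arr (pf_Comp FF DD (duality K)) M = dual (dual (dual M))" for M
    by (simp add: pf_Comp_def pf_co_def)
  {
    fix x assume "x \<in> Obj FF"
    then have x: "alg x" "semisimple x" by auto
    then show "dual_zeta x \<in> Isos FF (pt_obj (pt_pre (dual_y K) (duality K)) x)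
      (pt_obj dual_y_co x)"
      unfolding pre post using dual_unit_zeta_Isos(2) by simp
  next
    fix M x y assume "M \<in> Hom FF x y"
    then have b: "bim M" "lalg M = x" "ralg M = y" "semisimple x" "semisimple y" and a: "alg x" "alg y" by auto
    then have s: "sbim M" "sbim (dual M)" by auto
    note t = icon_trans_simps[OF icon_psi s(1), folded dual_y_icon, unfolded DD_simps Id_simps]
    note u = icon_trans_simps[OF icon_psi s(2), folded dual_y_icon, unfolded DD_simps Id_simps]
    let ?y = "pt_arr (dual_y K) M" and ?c = "dual_comp_inv M (regular y)" and ?c' = "dual_comp_inv (regular x) (dual (dual M))"
    have y_inv: "inv2 FF ?y = inv2 BB ?y"
      by (rule inv2_FF[OF t(1)]) (use b a in auto)
    note yi = inv2_Alg2[OF t(1)]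
    have iso: "?c' \<in> Isos BB (tensor (dual (regular x)) (dual (dual (dual M)))) (dual (tensor (regular x) (dual (dual M))))"
      by (rule dual_comp_inv_Isos) (use b a in auto)
    \<comment> \<open>Elements of the double dual are written as values of \<open>psi M\<close>,
      since only then is a preimage under \<open>?y\<close> at hand from which its inverse can be
      evaluated.\<close>
    have psi_surj: "\<exists>p\<in>carrier M. bmap (psi M) p = q" if "q \<in> carrier (dual (dual M))" for q
    proof -
      have "psi M \<in> Isos BB M (dual (dual M))" using psi_Isos b by simp
      then have "bmap (vcomp BB (psi M) (inv2 BB (psi M))) q = q" "bmap (inv2 BB (psi M)) q \<in> carrier M"
        using Alg2.inv2_right[of "psi M" M "dual (dual M)"] inv2_Alg2[of "psi M" M "dual (dual M)"] that by auto
      then show ?thesis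
        using inv2_Alg2[OF \<open>psi M \<in> Isos BB M (dual (dual M))\<close>] that by auto
    qed
    have "vcomp BB (tensor_map (dual_zeta x) (id2 BB (dual (dual (dual M))))) (pt_arr (dual_y K) (dual M)) =
      vcomp BB (vcomp BB (inv2 BB ?c') (vcomp BB (dual_map (inv2 BB ?y)) ?c)) (tensor_map (id2 BB (dual M)) (dual_zeta y))"
    proof (rule cell_eq_tensor[of _ _ "dual M" "regular (op y)"])
      fix g r assume g: "g \<in> carrier (dual M)" and "r \<in> carrier (regular (op y))"
      then have r: "r \<in> carrier y" by simp
      have gr: "ract (dual M) g r \<in> carrier (dual M)" using dual_closed(5)[OF b(1) g, of r] r b by simp
      \<comment> \<open>The left path ends in \<open>L\<close>, the right path in the inverse of
        \<open>?c'\<close> applied to \<open>R\<close>. It suffices that \<open>?c'\<close> sends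
        \<open>L\<close> to \<open>R\<close>, where only explicit maps are evaluated: at
        \<open>v \<otimes> q\<close> both functionals take the value \<open>r g(p)\<close>, with
        \<open>p\<close> representing \<open>v q\<close> in the double dual.\<close>
      define L where "L = pure_tensor (dual (regular x)) (dual (dual (dual M))) (bmap (dual_zeta x) \<one>\<^bsub>x\<^esub>) (bmap (psi (dual M)) (ract (dual M) g r))"
      define R where "R = bmap (dual_map (inv2 BB ?y)) (bmap ?c (pure_tensor (dual M) (dual (regular y)) g (bmap (dual_zeta y) r)))"
      have z: "bmap (dual_zeta x) \<one>\<^bsub>x\<^esub> \<in> carrier (dual (regular x))" "bmap (dual_zeta y) r \<in> carrier (dual (regular y))"
        using dual_zeta_code(1) a r by auto
      have L: "L \<in> carrier (tensor (dual (regular x)) (dual (dual (dual M))))"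
        unfolding L_def using gr z b a by simp
      have "bmap ?c' L = R"
      proof (rule dual_tensor_ext[of "regular x" "dual (dual M)"])
        fix v q assume v: "v \<in> carrier (regular x)" and q: "q \<in> carrier (dual (dual M))"
        have vq: "lact (dual (dual M)) v q \<in> carrier (dual (dual M))" using v q b a by simp
        \<comment> \<open>The action of \<open>v\<close> is absorbed into the choice of
          \<open>p\<close>, which matches the normal form
          \<open>v \<otimes> q = 1 \<otimes> v q\<close>.\<close>
        obtain p where p: "p \<in> carrier M" "bmap (psi M) p = lact (dual (dual M)) v q"
          using psi_surj[OF vq] by blast
        have "bmap (inv2 BB ?y) (pure_tensor (regular x) (dual (dual M)) v q) = pure_tensor M (regular y) p \<one>\<^bsub>y\<^esub>"
        proof (rule bmap_inv2[OF t(1)])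
          show "bmap ?y (pure_tensor M (regular y) p \<one>\<^bsub>y\<^esub>) = pure_tensor (regular x) (dual (dual M)) v q"
            using p v q b a pure_tensor_unit_left[of "dual (dual M)" x v q] by (simp add: t(5))
        qed (use p b a in auto)
        then have "dual_ev (tensor (regular x) (dual (dual M))) R (pure_tensor (regular x) (dual (dual M)) v q) =
          dual_ev (regular y) (bmap (dual_zeta y) r) (dual_ev M g p)"
          unfolding R_def using g z v q p b a yi t(2-4) by simp
        moreover have "dual_ev (tensor (regular x) (dual (dual M))) (bmap ?c' L) (pure_tensor (regular x) (dual (dual M)) v q) =
          dual_ev (dual M) (bmap (psi M) p) (ract (dual M) g r)"
          unfolding L_def using p(2) gr z v q vq b a by simp
        ultimately show "dual_ev (tensor (regular x) (dual (dual M))) (bmap ?c' L) (pure_tensor (regular x) (dual (dual M)) v q)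
          = dual_ev (tensor (regular x) (dual (dual M))) R (pure_tensor (regular x) (dual (dual M)) v q)"
          using p(1) g gr r b a dual_zeta_code(2) by simp
      qed (use L g z b a yi t(2-4) in \<open>auto simp: R_def\<close>)
      then have "bmap (inv2 BB ?c') R = L" by (rule bmap_inv2[OF iso L])
      then show "bmap (vcomp BB (tensor_map (dual_zeta x) (id2 BB (dual (dual (dual M))))) (pt_arr (dual_y K) (dual M))) (pure_tensor (dual M) (regular (op y)) g r)
        = bmap (vcomp BB (vcomp BB (inv2 BB ?c') (vcomp BB (dual_map (inv2 BB ?y)) ?c)) (tensor_map (id2 BB (dual M)) (dual_zeta y))) (pure_tensor (dual M) (regular (op y)) g r)"
        unfolding L_def R_def using g r gr z b a yi t(2-4) u(2-5) by simp
    qed (use b a yi t(2-4) u(2-4) in auto)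
    then show "(id2 FF (pf_arr (pf_Comp FF DD (duality K)) M) \<star>\<^bsub>FF\<^esub> dual_zeta x) \<bullet>\<^bsub>FF\<^esub> pt_arr (pt_pre (dual_y K) (duality K)) M
      = pt_arr dual_y_co M
        \<bullet>\<^bsub>FF\<^esub> (dual_zeta y \<star>\<^bsub>FF\<^esub> id2 FF (pf_arr (duality K) M))"
      unfolding pre post G y_inv using b a by simp
  }
qed

text \<open>On \<open>v \<otimes> w\<close> both sides reduce to
  \<open>1 \<otimes> (a \<mapsto> a v w)\<close>, with products in \<open>x\<close>: on the left
  because \<open>v\<close> moves across the tensor sign and acts on \<open>dual_zeta (op x)\<close>
  at \<open>w\<close>, on the right because \<open>psi\<close> at \<open>v w\<close> is evaluated at
  the functional \<open>dual_zeta x a\<close>. Associativity of the algebra identifies the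
  two.\<close>

lemma zeta_coherence:
  assumes x: "alg x" "semisimple x"
  shows "tensor_map (id2 BB (regular x)) (dual_zeta (op x)) =
    vcomp BB (tensor_map (id2 BB (regular x)) (dual_map (dual_zeta x))) (pt_arr (dual_y K) (regular x))"
proof -
  have s: "sbim (regular x)" using x by simp
  note t = icon_trans_simps[OF icon_psi s, folded dual_y_icon, unfolded DD_simps Id_simps]
  have R: "bim (regular (op x))" using x by simp
  show ?thesis
  proof (rule cell_eq_tensor[of _ _ "regular x" "regular x"])
    fix v w assume "v \<in> carrier (regular x)" "w \<in> carrier (regular x)"
    then have v: "v \<in> carrier x" "w \<in> carrier x" by auto
    have z: "bmap (dual_zeta (op x)) w \<in> carrier (dual (regular (op x)))" using dual_zeta_code(1)[of "op x" w] v x by simp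
    have "lact (dual (regular (op x))) v (bmap (dual_zeta (op x)) w) = bmap (dual_map (dual_zeta x)) (bmap (psi (regular x)) (v \<otimes>\<^bsub>x\<^esub> w))"
      by (rule dual_ext[OF R])
        (use v x z R dual_closed(4)[OF R z, of v] dual_zeta_code[of x] dual_zeta_code(2)[of "op x" w] in \<open>auto simp: alg_assoc\<close>)
    then show "bmap (tensor_map (id2 BB (regular x)) (dual_zeta (op x))) (pure_tensor (regular x) (regular x) v w) =
      bmap (vcomp BB (tensor_map (id2 BB (regular x)) (dual_map (dual_zeta x))) (pt_arr (dual_y K) (regular x))) (pure_tensor (regular x) (regular x) v w)"
      using v x z t(2-5) pure_tensor_unit_left[of "dual (regular (op x))" x v "bmap (dual_zeta (op x)) w"] by simp
  qed (use x t(2-4) in auto)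
qed

lemma weak_duality_involution_Alg2_fd:
  "weak_duality_involution FF (duality K) (dual_y K) (icon_trans DD (pf_Id FF) (\<lambda>M. inv2 BB (psi M)))
    (\<lambda>A. inv2 BB (lunit BB (regular A))) (\<lambda>A. lunit BB (regular A)) dual_zeta"
proof (rule weak_duality_involution.intro)
  show "bicategory FF" by (rule FF.bicategory_axioms)
  show "pseudofunctor (co FF) FF (duality K)" by (rule pseudofunctor_duality)
  show "pseudonatural_adjoint_equivalence FF FF (pf_Id FF) DD (dual_y K) (icon_trans DD (pf_Id FF) (\<lambda>M. inv2 BB (psi M)))
    (\<lambda>A. inv2 BB (lunit BB (regular A))) (\<lambda>A. lunit BB (regular A))"
    unfolding dual_y_icon by (rule icon_adjoint_equivalence[OF icon_psi])
  fix x assume "x \<in> Obj FF"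
  then show "dual_zeta (pf_obj (duality K) x) \<star>\<^bsub>FF\<^esub> id2 FF (pt_obj (dual_y K) x)
    = (pf_cell (duality K) (dual_zeta x) \<star>\<^bsub>FF\<^esub> id2 FF (pt_obj (dual_y K) x)) \<bullet>\<^bsub>FF\<^esub> pt_arr (dual_y K) (pt_obj (dual_y K) x)"
    using zeta_coherence by (simp add: dual_y_def)
qed (rule zeta_modification)

end

theorem theorem5p1:
  fixes K :: "'k ring" and emb :: "'k \<Rightarrow> 'u"
  assumes "algebraically_closed K"
    and "\<And>n::nat. n > 0 \<Longrightarrow> [n] \<cdot>\<^bsub>K\<^esub> \<one>\<^bsub>K\<^esub> \<noteq> \<zero>\<^bsub>K\<^esub>"
    and "inj_on emb (carrier K)"
  shows "\<exists>y' \<eta> \<epsilon>. weak_duality_involution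
    (Alg2_fd K :: (('k, 'u) module, ('k, 'u) bimodule, ('k, 'u) bimod_map) bicat)
    (duality K) (dual_y K) y' \<eta> \<epsilon> dual_zeta"
proof -
  interpret K: field K
    using assms(1) by (simp add: algebraically_closed_def)
  \<comment> \<open>In characteristic 0 the multiples of \<open>1\<close> are pairwise distinct, so
    the field is infinite, and \<open>emb\<close> makes the type of elements infinite too. This is
    what the codings of tensor products and of duals require.\<close>
  let ?f = "\<lambda>n::nat. [n] \<cdot>\<^bsub>K\<^esub> \<one>\<^bsub>K\<^esub>"
  have le: "m = n" if "m \<le> n" "?f m = ?f n" for m n
  proof (rule ccontr)
    assume "m \<noteq> n"
    have "?f (m + (n - m)) = ?f m \<oplus>\<^bsub>K\<^esub> ?f (n - m)"
      using K.add.nat_pow_mult[of "\<one>\<^bsub>K\<^esub>" m "n - m"] by simp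
    then have "?f m \<oplus>\<^bsub>K\<^esub> ?f (n - m) = ?f m" using that by simp
    then have "?f (n - m) = \<zero>\<^bsub>K\<^esub>" using K.add.r_cancel_one' K.add.nat_pow_closed by (metis K.add.l_cancel_one' K.one_closed)
    then show False using assms(2)[of "n - m"] that \<open>m \<noteq> n\<close> by simp
  qed
  have "inj ?f"
    by (rule injI) (metis le nat_le_linear)
  moreover have "range ?f \<subseteq> carrier K" by auto
  ultimately have "infinite (carrier K)"
    using infinite_iff_countable_subset by blast
  then have inf: "infinite (UNIV :: 'u set)"
    using assms(3) finite_imageD[of emb "carrier K"] finite_subset[of "emb ` carrier K" UNIV] by auto
  interpret morita K "TYPE('u)"
    by (intro morita.intro K.field_axioms inf)
  show ?thesis
    using weak_duality_involution_Alg2_fd by blast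
qed

end
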